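(* Suppose the triangulation $\mathcal{T}_h$ satisfies the mesh conditions (M1)–(M2) stated in the context. Let $$\Sigma_h=\{\tau\in H(\mathrm{div},\Omega;\mathbb{S}):\ \tau|_K\in P_3(K;\mathbb{S})\ \forall K\in\mathcal{T}_h,\ \tau\text{ is continuous at the vertices of }\mathcal{T}_h\},$$ $$V_h=\{v_h\in L^2(\Omega;\mathbb{R}^3):\ v_h|_K\in P_2(K;\mathbb{R}^3)\ \forall K\in\mathcal{T}_h\}.$$ Then the following discrete inf-sup condition holds: $$\inf_{v_h\in V_h}\sup_{\tau_h\in\Sigma_h}\frac{\int_{\Omega}\mathrm{div}\,\tau_h\cdot v_h\,\mathrm{d}x}{\|v_h\|_0\,\|\tau_h\|_{H(\mathrm{div})}}>0,$$ where the infimum and supremum are over nonzero functions.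
   Context: $\Omega\subset\mathbb{R}^3$ is a simply-connected bounded polyhedral domain and $\mathcal{T}_h$ is a (conforming) shape-regular triangulation of $\Omega$ into tetrahedra. $\mathbb{S}=\mathbb{R}^{3\times3}_{\mathrm{sym}}$; $H(\mathrm{div},\Omega;\mathbb{S})=\{\tau\in L^2(\Omega;\mathbb{S}):\mathrm{div}\,\tau\in L^2(\Omega;\mathbb{R}^3)\}$ with row-wise divergence and norm $\|\tau\|_{H(\mathrm{div})}^2=\|\tau\|_0^2+\|\mathrm{div}\,\tau\|_0^2$, where $\|\cdot\|_0$ is the $L^2(\Omega)$ norm. $P_k(K;X)$ is the space of $X$-valued polynomials of degree at most $k$. "Continuous at vertices" means that at each vertex $x$ the values $\tau|_K(x)$ agree for all $K\in\mathcal{T}_h$ containing $x$. Edge patch. For an edge $e$, the $m_e$ elements having $e$ as an edge are labelled $K_1,\dots,K_{m_e}$ and the faces containing $e$ are labelled $F_1,\dots,F_{m_e+1}$ so that $F_i,F_{i+1}\subset\partial K_i$; for an interior edge $F_{m_e+1}=F_1$ and indices are modulo $m_e$; for a boundary edge $F_1,F_{m_e+1}$ are boundary faces. $\theta_i$ is the dihedral angle (of $K_i$) between $F_i$ and $F_{i+1}$. An interior edge is singular if $m_e=4$ and $\theta_1+\theta_2=\theta_2+\theta_3=\pi$. Mesh conditions. There exists a constant $\kappa>0$ such that: (M1) for any edge $e$ of $\mathcal{T}_h$, $\kappa<\theta_j<\pi-\kappa$ for $1\le j\le m_e$; (M2) if an interior edge $e$ is not singular and $m_e$ is even, then $\theta_j+\theta_{j+1}<\pi-\kappa$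 for $1\le j\le m_e$. *)

theory Defs
  imports "HOL-Analysis.Analysis"
begin

section \<open>Domain and triangulation\<close>

text \<open>The representation as the interior of a finite union of polytopes excludes slit domains.\<close>

definition polyhedral_domain :: "(real^3) set \<Rightarrow> bool" where
  "polyhedral_domain \<Omega> \<longleftrightarrow> \<Omega> \<noteq> {} \<and> open \<Omega> \<and> connected \<Omega> \<and> bounded \<Omega> \<and>
     (\<exists>P. finite P \<and> (\<forall>p\<in>P. polytope p) \<and> \<Omega> = interior (\<Union>P))"

text \<open>Elements are closed tetrahedra; conformity is part of the library's \<open>triangulation\<close>.\<close>

definition tet_mesh :: "(real^3) set set \<Rightarrow> (real^3) set \<Rightarrow> bool" where
  "tet_mesh T \<Omega> \<longleftrightarrow> triangulation T \<and> (\<forall>K\<in>T. 3 simplex K) \<and> \<Union>T = closure \<Omega>"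

definition inball_diameter :: "(real^3) set \<Rightarrow> real" where
  "inball_diameter K = (SUP r\<in>{r. \<exists>x. cball x r \<subseteq> K}. 2 * r)"

definition shape_regular :: "real \<Rightarrow> (real^3) set set \<Rightarrow> bool" where
  "shape_regular \<sigma> T \<longleftrightarrow> (\<forall>K\<in>T. diameter K \<le> \<sigma> * inball_diameter K)"

definition mesh_vertices :: "(real^3) set set \<Rightarrow> (real^3) set" where
  "mesh_vertices T = {x. \<exists>K\<in>T. x extreme_point_of K}"

definition mesh_edges :: "(real^3) set set \<Rightarrow> (real^3) set set" where
  "mesh_edges T = {e. \<exists>K\<in>T. e edge_of K}"

definition mesh_faces :: "(real^3) set set \<Rightarrow> (real^3) set set" where
  "mesh_faces T = {F. \<exists>K\<in>T. F facet_of K}"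


section \<open>Edge patches and mesh conditions\<close>

definition edge_elements :: "(real^3) set set \<Rightarrow> (real^3) set \<Rightarrow> (real^3) set set" where
  "edge_elements T e = {K\<in>T. e edge_of K}"

definition edge_faces :: "(real^3) set set \<Rightarrow> (real^3) set \<Rightarrow> (real^3) set set" where
  "edge_faces T e = {F\<in>mesh_faces T. e \<subseteq> F}"

definition edge_number :: "(real^3) set set \<Rightarrow> (real^3) set \<Rightarrow> nat" where
  "edge_number T e = card (edge_elements T e)"

text \<open>An interior edge may have endpoints on the boundary.\<close>

definition interior_edge :: "(real^3) set \<Rightarrow> (real^3) set \<Rightarrow> bool" where
  "interior_edge \<Omega> e \<longleftrightarrow> \<not> e \<subseteq> frontier \<Omega>"

text \<open>
  \<open>Kl\<close> and \<open>Fl\<close> label the elements and faces around \<open>e\<close>, with indices starting at 1.  For an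
  interior edge, \<open>m + 1\<close> is identified with \<open>1\<close>; no other index beyond \<open>m\<close> is used.
\<close>

definition edge_patch_labelling ::
  "(real^3) set set \<Rightarrow> (real^3) set \<Rightarrow> (real^3) set \<Rightarrow>
     (nat \<Rightarrow> (real^3) set) \<Rightarrow> (nat \<Rightarrow> (real^3) set) \<Rightarrow> bool" where
  "edge_patch_labelling T \<Omega> e Kl Fl \<longleftrightarrow>
     (let m = edge_number T e in
        bij_betw Kl {1..m} (edge_elements T e) \<and>
        (\<forall>i\<in>{1..m}. Fl i facet_of Kl i \<and> Fl (i + 1) facet_of Kl i) \<and>
        (if interior_edge \<Omega> e
         then bij_betw Fl {1..m} (edge_faces T e) \<and> Fl (m + 1) = Fl 1 \<and> Kl (m + 1) = Kl 1
         else bij_betw Fl {1..m + 1} (edge_faces T e) \<and>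
              Fl 1 \<subseteq> frontier \<Omega> \<and> Fl (m + 1) \<subseteq> frontier \<Omega>))"

text \<open>
  The unit vector in the plane of \<open>F\<close> that is orthogonal to the edge \<open>e\<close> of \<open>F\<close> and points
  from \<open>e\<close> into \<open>F\<close>.
\<close>

definition conormal :: "(real^3) set \<Rightarrow> (real^3) set \<Rightarrow> real^3" where
  "conormal e F = (THE u. norm u = 1 \<and> u \<in> span {x - a | x a. x \<in> F \<and> a \<in> e} \<and>
     (\<forall>a\<in>e. \<forall>b\<in>e. u \<bullet> (b - a) = 0) \<and> (\<forall>a\<in>e. \<forall>x\<in>F. u \<bullet> (x - a) \<ge> 0))"

definition dihedral_angle :: "(real^3) set \<Rightarrow> (real^3) set \<Rightarrow> (real^3) set \<Rightarrow> real" where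
  "dihedral_angle e F G = arccos (conormal e F \<bullet> conormal e G)"

text \<open>
  The angle \<open>\<theta>\<^sub>i\<close>; for an interior edge with \<open>m\<close> elements, \<open>i\<close> is reduced modulo \<open>m\<close>
  to \<open>{1..m}\<close>, and for a boundary edge only \<open>i \<in> {1..m}\<close> is ever used.
\<close>

definition patch_angle ::
  "(real^3) set set \<Rightarrow> (real^3) set \<Rightarrow> (nat \<Rightarrow> (real^3) set) \<Rightarrow> nat \<Rightarrow> real" where
  "patch_angle T e Fl i =
     (let j = (i - 1) mod edge_number T e + 1 in dihedral_angle e (Fl j) (Fl (j + 1)))"

definition singular_edge ::
  "(real^3) set set \<Rightarrow> (real^3) set \<Rightarrow> (real^3) set \<Rightarrow> (nat \<Rightarrow> (real^3) set) \<Rightarrow> bool" where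
  "singular_edge T \<Omega> e Fl \<longleftrightarrow> interior_edge \<Omega> e \<and> edge_number T e = 4 \<and>
     patch_angle T e Fl 1 + patch_angle T e Fl 2 = pi \<and>
     patch_angle T e Fl 2 + patch_angle T e Fl 3 = pi"

definition mesh_condition_M1 ::
  "real \<Rightarrow> (real^3) set set \<Rightarrow> ((real^3) set \<Rightarrow> nat \<Rightarrow> (real^3) set) \<Rightarrow> bool" where
  "mesh_condition_M1 \<kappa> T Fl \<longleftrightarrow>
     (\<forall>e\<in>mesh_edges T. \<forall>j\<in>{1..edge_number T e}.
        \<kappa> < patch_angle T e (Fl e) j \<and> patch_angle T e (Fl e) j < pi - \<kappa>)"

definition mesh_condition_M2 ::
  "real \<Rightarrow> (real^3) set set \<Rightarrow> (real^3) set \<Rightarrow> ((real^3) set \<Rightarrow> nat \<Rightarrow> (real^3) set) \<Rightarrow> bool" where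
  "mesh_condition_M2 \<kappa> T \<Omega> Fl \<longleftrightarrow>
     (\<forall>e\<in>mesh_edges T. interior_edge \<Omega> e \<and> \<not> singular_edge T \<Omega> e (Fl e) \<and> even (edge_number T e) \<longrightarrow>
        (\<forall>j\<in>{1..edge_number T e}.
           patch_angle T e (Fl e) j + patch_angle T e (Fl e) (j + 1) < pi - \<kappa>))"


section \<open>Function spaces\<close>

text \<open>
  Elements of $L^2$ spaces are represented by functions on the whole space whose values outside
  \<open>\<Omega>\<close> are irrelevant; all conditions are invariant under modification on null sets.  The norm on
  matrices is the Frobenius norm.
\<close>

definition sym_matrices :: "(real^3^3) set" where
  "sym_matrices = {A. transpose A = A}"

definition L2_space :: "(real^3) set \<Rightarrow> 'a::euclidean_space set \<Rightarrow> (real^3 \<Rightarrow> 'a) set" where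
  "L2_space \<Omega> X = {f. f \<in> borel_measurable (lebesgue_on \<Omega>) \<and> (AE x in lebesgue_on \<Omega>. f x \<in> X) \<and>
     integrable (lebesgue_on \<Omega>) (\<lambda>x. (norm (f x))\<^sup>2)}"

definition L2_norm :: "(real^3) set \<Rightarrow> (real^3 \<Rightarrow> 'a::euclidean_space) \<Rightarrow> real" where
  "L2_norm \<Omega> f = sqrt (\<integral>x. (norm (f x))\<^sup>2 \<partial>lebesgue_on \<Omega>)"

definition nonzero_on :: "(real^3) set \<Rightarrow> (real^3 \<Rightarrow> 'a::euclidean_space) \<Rightarrow> bool" where
  "nonzero_on \<Omega> f \<longleftrightarrow> \<not> (AE x in lebesgue_on \<Omega>. f x = 0)"

definition partial_deriv :: "3 \<Rightarrow> (real^3 \<Rightarrow> real) \<Rightarrow> real^3 \<Rightarrow> real" where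
  "partial_deriv i \<phi> x = frechet_derivative \<phi> (at x) (axis i 1)"

definition gradient :: "(real^3 \<Rightarrow> real) \<Rightarrow> real^3 \<Rightarrow> real^3" where
  "gradient \<phi> x = (\<chi> i. partial_deriv i \<phi> x)"

fun Ck :: "nat \<Rightarrow> (real^3 \<Rightarrow> real) \<Rightarrow> bool" where
  "Ck 0 \<phi> = continuous_on UNIV \<phi>"
| "Ck (Suc k) \<phi> = (\<phi> differentiable_on UNIV \<and> (\<forall>i. Ck k (partial_deriv i \<phi>)))"

definition test_functions :: "(real^3) set \<Rightarrow> (real^3 \<Rightarrow> real) set" where
  "test_functions \<Omega> = {\<phi>. (\<forall>k. Ck k \<phi>) \<and>
     compact (closure {x. \<phi> x \<noteq> 0}) \<and> closure {x. \<phi> x \<noteq> 0} \<subseteq> \<Omega>}"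

text \<open>Row-wise weak divergence: the rows of a matrix \<open>A\<close> are \<open>A $ i\<close>.\<close>

definition has_weak_div ::
  "(real^3) set \<Rightarrow> (real^3 \<Rightarrow> real^3^3) \<Rightarrow> (real^3 \<Rightarrow> real^3) \<Rightarrow> bool" where
  "has_weak_div \<Omega> \<tau> g \<longleftrightarrow> (\<forall>\<phi>\<in>test_functions \<Omega>.
     (\<integral>x. \<tau> x *v gradient \<phi> x \<partial>lebesgue_on \<Omega>) = - (\<integral>x. \<phi> x *\<^sub>R g x \<partial>lebesgue_on \<Omega>))"

definition Hdiv :: "(real^3) set \<Rightarrow> (real^3^3) set \<Rightarrow> (real^3 \<Rightarrow> real^3^3) set" where
  "Hdiv \<Omega> X = {\<tau>\<in>L2_space \<Omega> X. \<exists>g\<in>L2_space \<Omega> UNIV. has_weak_div \<Omega> \<tau> g}"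

text \<open>A representative of the weak divergence, which is determined up to a null set.\<close>

definition weak_div :: "(real^3) set \<Rightarrow> (real^3 \<Rightarrow> real^3^3) \<Rightarrow> real^3 \<Rightarrow> real^3" where
  "weak_div \<Omega> \<tau> = (SOME g. g \<in> L2_space \<Omega> UNIV \<and> has_weak_div \<Omega> \<tau> g)"

definition Hdiv_norm :: "(real^3) set \<Rightarrow> (real^3 \<Rightarrow> real^3^3) \<Rightarrow> real" where
  "Hdiv_norm \<Omega> \<tau> = sqrt ((L2_norm \<Omega> \<tau>)\<^sup>2 + (L2_norm \<Omega> (weak_div \<Omega> \<tau>))\<^sup>2)"


section \<open>Finite element spaces\<close>

text \<open>\<open>X\<close>-valued polynomials of total degree at most \<open>k\<close>, for a linear subspace \<open>X\<close>.\<close>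

definition polys :: "nat \<Rightarrow> 'a::euclidean_space set \<Rightarrow> (real^3 \<Rightarrow> 'a) set" where
  "polys k X = {p. \<exists>c::(3 \<Rightarrow> nat) \<Rightarrow> 'a. (\<forall>\<alpha>. c \<alpha> \<in> X) \<and>
     (\<forall>x. p x = (\<Sum>\<alpha>\<in>{\<alpha>. (\<Sum>i\<in>UNIV. \<alpha> i) \<le> k}. (\<Prod>i\<in>UNIV. (x $ i) ^ \<alpha> i) *\<^sub>R c \<alpha>))}"

text \<open>
  \<open>p K\<close> is the polynomial that \<open>f\<close> equals on \<open>K\<close>.  It is uniquely determined because elements have
  nonempty interior, and it provides the values of \<open>f|\<^sub>K\<close> at boundary points of \<open>K\<close>.
\<close>

definition elementwise_poly ::
  "nat \<Rightarrow> 'a::euclidean_space set \<Rightarrow> (real^3) set set \<Rightarrow> (real^3 \<Rightarrow> 'a) \<Rightarrow>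
     ((real^3) set \<Rightarrow> real^3 \<Rightarrow> 'a) \<Rightarrow> bool" where
  "elementwise_poly k X T f p \<longleftrightarrow>
     (\<forall>K\<in>T. p K \<in> polys k X \<and> (AE x in lebesgue_on K. f x = p K x))"

definition Sigma_h :: "(real^3) set set \<Rightarrow> (real^3) set \<Rightarrow> (real^3 \<Rightarrow> real^3^3) set" where
  "Sigma_h T \<Omega> = {\<tau>\<in>Hdiv \<Omega> sym_matrices. \<exists>p. elementwise_poly 3 sym_matrices T \<tau> p \<and>
     (\<forall>x\<in>mesh_vertices T. \<forall>K\<in>T. \<forall>K'\<in>T. x \<in> K \<and> x \<in> K' \<longrightarrow> p K x = p K' x)}"

definition V_h :: "(real^3) set set \<Rightarrow> (real^3) set \<Rightarrow> (real^3 \<Rightarrow> real^3) set" where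
  "V_h T \<Omega> = {v\<in>L2_space \<Omega> UNIV. \<exists>p. elementwise_poly 2 UNIV T v p}"

end

theory Submission
  imports Defs "HOL-Computational_Algebra.Polynomial"
begin

text \<open>
  On a fixed mesh the inf-sup constant is positive as soon as no nonzero \<open>v \<in> V\<^sub>h\<close> is orthogonal to
  \<open>div \<Sigma>\<^sub>h\<close>.  Test such a \<open>v\<close> with fields \<open>\<tau>|\<^sub>K = w\<^sub>K S\<^sub>K\<close>, where \<open>w\<^sub>K\<close> is a product of barycentric coordinates vanishing
  at the vertices and \<open>S\<^sub>K\<close> is a constant symmetric matrix.  Edge bubbles on a single element force \<open>v|\<^sub>K\<close> to be a
  rigid motion.  By the divergence theorem only the jumps of \<open>v\<close> across faces then remain; face bubbles make them
  vanish at centroids, and patches around an edge kill their tangential part at the opposite vertices.  The normal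
  parts on the faces around an edge are tested with families \<open>A\<^sub>i\<close> of planar symmetric matrices with matching normal
  components.  Writing \<open>x\<close> and \<open>y\<close> for the normal and tangential components on the faces, these
  exist if and only if \<open>y\<^sub>i + y\<^sub>i\<^sub>+\<^sub>1 = (x\<^sub>i - x\<^sub>i\<^sub>+\<^sub>1) cot \<theta>\<^sub>i\<close>.  At boundary edges, edges of odd degree and singular edges \<open>x\<close> is
  arbitrary, so all jumps at the edge vanish; otherwise the only constraint is \<open>\<Sum> \<plusminus> (cot \<theta>\<^sub>i\<^sub>-\<^sub>1 + cot \<theta>\<^sub>i) x\<^sub>i = 0\<close> with
  nonzero coefficients by (M2), so one vanishing jump implies that all vanish.  An element with a nonvanishing
  jump thus has only such faces; a nonempty set of elements has a face belonging to exactly one of them, and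
  boundary faces are good, so there is no such element, and \<open>v\<close> vanishes by the same argument.
\<close>

text \<open>Factors that vanish at every vertex settle continuity there, and factors that agree on
  common faces reduce membership in H(div) to equality of the constant vectors \<open>S n\<close>. A
  jump is affine on a face, hence given by its three vertex values: the face bubble yields their
  sum; for barycentric coordinates \<lambda> the edge factors \<lambda>_a \<lambda>_b and
  \<lambda>_a \<lambda>_b (\<lambda>_a - \<lambda>_b) yield the value opposite to the edge and the
  difference at its ends. The cotangent relation is the symmetry of the planar matrix: for unit
  normals N, N' of the two faces of an element, N' . A N = N . A N' reads \<gamma> (x - x') =
  \<sigma> (y + y'), with \<gamma> and \<sigma> the cosine and sine of the turn from one face to the
  other. Given x, it determines y alternately, so one round about the edge multiplies the free value
  y_0 by (-1)^m: for odd m the loop always closes, for even m closing is one linear condition on x.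
  A separate obstacle is that \<open>weak_div\<close> is an arbitrary representative; its pairings
  are evaluated against piecewise polynomials, where smooth cutoffs determine them.\<close>

unbundle cross3_syntax

section \<open>Integrals over simplices\<close>

definition tri2 :: "(real \<times> real) set" where
  "tri2 = {p. 0 \<le> fst p \<and> 0 \<le> snd p \<and> fst p + snd p \<le> 1}"

definition tri_int :: "(real \<times> real \<Rightarrow> real) \<Rightarrow> real" where
  "tri_int h = (\<integral>p. indicator tri2 p *\<^sub>R h p \<partial>lborel)"

text \<open>Nested pairs instead of \<open>real^3\<close>: Fubini's theorem can then integrate the
  last coordinate first, over a segment above each point of \<open>tri2\<close>.\<close>

definition tri3 :: "((real \<times> real) \<times> real) set" where
  "tri3 = {q. fst q \<in> tri2 \<and> 0 \<le> snd q \<and> snd q \<le> 1 - fst (fst q) - snd (fst q)}"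

lemma compact_tri2: "compact tri2"
proof -
  have "closed tri2"
    unfolding tri2_def by (intro closed_Collect_conj closed_Collect_le continuous_intros)
  moreover have "tri2 \<subseteq> cbox (0,0) (1,1)"
    by (auto simp: tri2_def cbox_Pair_eq)
  ultimately show ?thesis
    by (meson bounded_cbox bounded_subset compact_eq_bounded_closed)
qed

lemma compact_tri3: "compact tri3"
proof -
  have "closed tri3"
    unfolding tri3_def tri2_def mem_Collect_eq by (intro closed_Collect_conj closed_Collect_le continuous_intros)
  moreover have "tri3 \<subseteq> cbox ((0,0),0) ((1,1),1)"
    by (auto simp: tri3_def tri2_def cbox_Pair_eq)
  ultimately show ?thesis
    by (meson bounded_cbox bounded_subset compact_eq_bounded_closed)
qed

lemma integrable_tri2: "continuous_on tri2 h \<Longrightarrow> integrable lborel (\<lambda>p. indicator tri2 p *\<^sub>R (h p :: real))"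
  by (rule borel_integrable_compact[OF compact_tri2])

lemma integrable_tri3: "continuous_on tri3 h \<Longrightarrow> integrable lborel (\<lambda>p. indicator tri3 p *\<^sub>R (h p :: real))"
  by (rule borel_integrable_compact[OF compact_tri3])

lemma tri_int_swap:
  assumes "continuous_on tri2 h"
  shows "tri_int (\<lambda>p. h (snd p, fst p)) = tri_int h"
proof -
  have m: "(\<lambda>p. indicator tri2 p *\<^sub>R h p) \<in> borel_measurable (lborel \<Otimes>\<^sub>M lborel)"
    using integrable_tri2[OF assms] unfolding lborel_prod by simp
  have "tri_int (\<lambda>p. h (snd p, fst p)) = (\<integral>(x,y). indicator tri2 (y,x) *\<^sub>R h (y,x) \<partial>(lborel \<Otimes>\<^sub>M lborel))"
    unfolding tri_int_def lborel_prod
    by (intro Bochner_Integration.integral_cong) (auto simp: tri2_def indicator_def)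
  also have "\<dots> = tri_int h"
    using lborel_pair.integral_product_swap[OF m] by (simp add: tri_int_def lborel_prod)
  finally show ?thesis .
qed

lemma tri_int_iterated:
  assumes "continuous_on tri2 h"
  shows "tri_int h = (\<integral>u. \<integral>v. indicator tri2 (u,v) *\<^sub>R h (u,v) \<partial>lborel \<partial>lborel)"
  unfolding tri_int_def
  using lborel_pair.integral_fst'[of "\<lambda>p. indicator tri2 p *\<^sub>R h p"] integrable_tri2[OF assms]
  by (simp add: lborel_prod)

text \<open>On each slice with fixed first coordinate u, the measure-preserving map v -> 1 - u - v
  sends the slice to itself. Together with \<open>tri_int_swap\<close> this generates all
  permutations of the three barycentric coordinates.\<close>

lemma tri_int_reflect:
  assumes "continuous_on tri2 h"
  shows "tri_int (\<lambda>p. h (fst p, 1 - fst p - snd p)) = tri_int h"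
proof -
  have c: "continuous_on tri2 (\<lambda>p. h (fst p, 1 - fst p - snd p))"
    by (rule continuous_on_compose2[OF assms]) (auto intro!: continuous_intros simp: tri2_def)
  have "(\<integral>v. indicator tri2 (u,v) *\<^sub>R h (u,v) \<partial>lborel)
      = (\<integral>v. indicator tri2 (u,v) *\<^sub>R h (u,1-u-v) \<partial>lborel)" for u
    by (subst lborel_integral_real_affine[where c="-1" and t="1-u"])
       (auto intro!: Bochner_Integration.integral_cong simp: indicator_def tri2_def algebra_simps)
  then show ?thesis
    unfolding tri_int_iterated[OF assms] tri_int_iterated[OF c] by simp
qed

text \<open>Fubini in the last coordinate and the fundamental theorem on each vertical segment; what
  remains is the slanted face minus the bottom face.\<close>

lemma tri3_FTC:
  fixes g g' :: "(real \<times> real) \<times> real \<Rightarrow> real"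
  assumes cont: "continuous_on UNIV g'"
    and deriv: "\<And>p w. ((\<lambda>w. g (p, w)) has_real_derivative g' (p, w)) (at w)"
  shows "(\<integral>q. indicator tri3 q *\<^sub>R g' q \<partial>lborel) =
         tri_int (\<lambda>p. g (p, 1 - fst p - snd p) - g (p, 0))"
proof -
  have i: "integrable (lborel \<Otimes>\<^sub>M lborel) (\<lambda>q. indicator tri3 q *\<^sub>R g' q)"
    unfolding lborel_prod using cont continuous_on_subset by (blast intro: integrable_tri3)
  have "(\<integral>w. indicator tri3 (p, w) *\<^sub>R g' (p,w) \<partial>lborel)
      = indicator tri2 p *\<^sub>R (g (p, 1 - fst p - snd p) - g (p, 0))" for p
  proof (cases "p \<in> tri2")
    case True
    have "(\<integral>w. indicator tri3 (p, w) *\<^sub>R g' (p,w) \<partial>lborel)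
        = (\<integral>w. indicator {0..1 - fst p - snd p} w *\<^sub>R g' (p,w) \<partial>lborel)"
      using True by (intro Bochner_Integration.integral_cong) (auto simp: tri3_def indicator_def)
    also have "\<dots> = g (p, 1 - fst p - snd p) - g (p, 0)"
    proof (rule integral_FTC_Icc)
      show "0 \<le> 1 - fst p - snd p" using True by (auto simp: tri2_def)
      show "((\<lambda>w. g (p, w)) has_vector_derivative g' (p, x)) (at x within {0..1 - fst p - snd p})" for x
        using deriv[of p x] by (auto simp: has_real_derivative_iff_has_vector_derivative intro: has_vector_derivative_at_within)
      show "continuous_on {0..1 - fst p - snd p} (\<lambda>w. g' (p, w))"
        by (rule continuous_on_compose2[OF cont]) (auto intro!: continuous_intros)
    qed
    finally show ?thesis using True by simp
  next
    case False
    then show ?thesis by (simp add: tri3_def indicator_def)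
  qed
  then show ?thesis
    unfolding tri_int_def lborel_pair.integral_fst'[OF i, symmetric, unfolded lborel_prod] by simp
qed

text \<open>The surface integral divided by twice the area of the triangle. The missing factor is
  carried by the cross product \<open>face_normal\<close>, which is not normalised.\<close>

definition face_int :: "real^3 \<Rightarrow> real^3 \<Rightarrow> real^3 \<Rightarrow> (real^3 \<Rightarrow> real) \<Rightarrow> real" where
  "face_int a b c f = tri_int (\<lambda>p. f ((1 - fst p - snd p) *\<^sub>R a + fst p *\<^sub>R b + snd p *\<^sub>R c))"

lemma face_int_swap_bc:
  assumes "continuous_on UNIV f"
  shows "face_int a c b f = face_int a b c f"
proof -
  let ?h = "\<lambda>p. f ((1 - fst p - snd p) *\<^sub>R a + fst p *\<^sub>R b + snd p *\<^sub>R c)"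
  have "continuous_on tri2 ?h"
    by (rule continuous_on_compose2[OF assms]) (auto intro!: continuous_intros)
  from tri_int_swap[OF this] show ?thesis
    unfolding face_int_def by (simp add: algebra_simps)
qed

lemma face_int_swap_ac:
  assumes "continuous_on UNIV f"
  shows "face_int c b a f = face_int a b c f"
proof -
  let ?h = "\<lambda>p. f ((1 - fst p - snd p) *\<^sub>R a + fst p *\<^sub>R b + snd p *\<^sub>R c)"
  have "continuous_on tri2 ?h"
    by (rule continuous_on_compose2[OF assms]) (auto intro!: continuous_intros)
  from tri_int_reflect[OF this] show ?thesis
    unfolding face_int_def by (simp add: algebra_simps)
qed

section \<open>Change of variables from the reference tetrahedron\<close>

definition vec3 :: "(real \<times> real) \<times> real \<Rightarrow> real^3" where
  "vec3 q = vector [fst (fst q), snd (fst q), snd q]"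

lemma vec3_nth [simp]: "vec3 q $ 1 = fst (fst q)" "vec3 q $ 2 = snd (fst q)" "vec3 q $ 3 = snd q"
  by (auto simp: vec3_def)

lemma continuous_on_vec3: "continuous_on S vec3"
  by (subst continuous_on_componentwise) (auto simp: Basis_vec_def inner_axis forall_3 intro!: continuous_intros)

lemma Basis_prod3: "(Basis :: ((real \<times> real) \<times> real) set) = {((1,0),0), ((0,1),0), ((0,0),1)}"
  by (auto simp: Basis_prod_def zero_prod_def)

lemma Basis_vec3: "(Basis :: (real^3) set) = {axis 1 1, axis 2 1, axis 3 1}"
  unfolding Basis_vec_def using exhaust_3 by auto metis

lemma axis_neq3: "axis 1 (1::real) \<noteq> axis (2::3) 1" "axis 1 (1::real) \<noteq> axis (3::3) 1" "axis 2 (1::real) \<noteq> axis (3::3) 1"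
  by (auto simp: axis_eq_axis)

lemma distr_vec3: "distr lborel borel vec3 = lborel"
proof (rule lborel_eqI[symmetric])
  fix l u :: "real^3" assume lu: "\<And>b. b \<in> Basis \<Longrightarrow> l \<bullet> b \<le> u \<bullet> b"
  have m: "vec3 \<in> borel_measurable borel"
    by (rule borel_measurable_continuous_onI[OF continuous_on_vec3])
  have "vec3 -` box l u = box ((l$1,l$2),l$3) ((u$1,u$2),u$3)"
    by (auto simp: box_def Basis_prod3 Basis_vec3 inner_axis)
  moreover have "l $ i \<le> u $ i" for i
    using lu[of "axis i 1"] by (auto simp: Basis_vec_def inner_axis)
  ultimately show "emeasure (distr lborel borel vec3) (box l u) = (\<Prod>b\<in>Basis. (u - l) \<bullet> b)"
    using m by (subst emeasure_distr) (auto simp: emeasure_lborel_box_eq Basis_prod3 Basis_vec3 inner_axis axis_neq3 zero_prod_def ac_simps)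
qed simp

lemma absolutely_integrable_continuous_compact:
  fixes f :: "'a::euclidean_space \<Rightarrow> 'b::euclidean_space"
  assumes "compact S" "continuous_on S f"
  shows "f absolutely_integrable_on S"
  using borel_integrable_compact[OF assms] integrable_completion[of "\<lambda>x. indicator S x *\<^sub>R f x" lborel]
  unfolding set_integrable_def by auto

definition tet_map :: "real^3 \<Rightarrow> real^3 \<Rightarrow> real^3 \<Rightarrow> real^3 \<Rightarrow> real^3 \<Rightarrow> real^3" where
  "tet_map a b c d x = a + (x$1 *\<^sub>R (b - a) + x$2 *\<^sub>R (c - a) + x$3 *\<^sub>R (d - a))"

definition tet_det :: "real^3 \<Rightarrow> real^3 \<Rightarrow> real^3 \<Rightarrow> real^3 \<Rightarrow> real" where
  "tet_det a b c d = ((b - a) \<times> (c - a)) \<bullet> (d - a)"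

lemma tet_linear: "linear (\<lambda>x::real^3. x$1 *\<^sub>R u + x$2 *\<^sub>R v + x$3 *\<^sub>R (w::real^3))"
  by (rule linearI) (auto simp: algebra_simps)

lemma det_tet_linear:
  "det (matrix (\<lambda>x::real^3. x$1 *\<^sub>R u + x$2 *\<^sub>R v + x$3 *\<^sub>R w)) = (u \<times> v) \<bullet> w"
  by (simp add: det_3 matrix_def axis_def cross3_simps)

lemma tet_map_inj:
  assumes "tet_det a b c d \<noteq> 0" shows "inj (tet_map a b c d)"
proof -
  let ?L = "\<lambda>x::real^3. x$1 *\<^sub>R (b - a) + x$2 *\<^sub>R (c - a) + x$3 *\<^sub>R (d - a)"
  have "inj ?L"
    using assms det_nz_iff_inj[OF tet_linear] by (simp add: tet_det_def det_tet_linear)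
  note L = this
  show ?thesis
  proof (rule injI)
    fix x y assume "tet_map a b c d x = tet_map a b c d y"
    then have "?L x = ?L y" by (simp add: tet_map_def)
    with L show "x = y" by (rule injD)
  qed
qed

lemma vec3_tri3: "vec3 ` tri3 = convex hull (insert 0 Basis)"
proof -
  have "x \<in> vec3 ` tri3 \<longleftrightarrow> 0 \<le> x$1 \<and> 0 \<le> x$2 \<and> 0 \<le> x$3 \<and> x$1 + x$2 + x$3 \<le> 1" (is "_ \<longleftrightarrow> ?R") for x
  proof
    assume ?R
    have "x = vec3 ((x$1,x$2),x$3)" by (simp add: vec_eq_iff forall_3)
    moreover have "((x$1,x$2),x$3) \<in> tri3" using \<open>?R\<close> by (auto simp: tri3_def tri2_def)
    ultimately show "x \<in> vec3 ` tri3" by blast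
  qed (auto simp: tri3_def tri2_def)
  then show ?thesis
    unfolding std_simplex by (intro set_eqI) (simp add: Basis_vec3 inner_axis axis_neq3 add.assoc)
qed

lemma tet_map_image: "tet_map a b c d ` vec3 ` tri3 = convex hull {a,b,c,d}"
proof -
  let ?L = "\<lambda>x::real^3. x$1 *\<^sub>R (b - a) + x$2 *\<^sub>R (c - a) + x$3 *\<^sub>R (d - a)"
  have "tet_map a b c d ` vec3 ` tri3 = (\<lambda>x. a + x) ` ?L ` (convex hull (insert 0 Basis))"
    unfolding vec3_tri3 by (auto simp: image_image tet_map_def)
  also have "\<dots> = convex hull ((\<lambda>x. a + x) ` ?L ` insert 0 Basis)"
    by (simp only: convex_hull_linear_image[OF tet_linear] convex_hull_translation)
  also have "(\<lambda>x. a + x) ` ?L ` insert 0 Basis = {a,b,c,d}"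
    by (auto simp: Basis_vec3 axis_def)
  finally show ?thesis .
qed

lemma integral_vec3:
  assumes "continuous_on UNIV f"
  shows "integral (vec3 ` tri3) f = (\<integral>q. indicator tri3 q *\<^sub>R (f (vec3 q)::real) \<partial>lborel)"
proof -
  have c: "compact (vec3 ` tri3)"
    by (intro compact_continuous_image compact_tri3 continuous_on_vec3)
  have i: "integrable lborel (\<lambda>x. indicator (vec3 ` tri3) x *\<^sub>R f x)"
    by (rule borel_integrable_compact[OF c continuous_on_subset[OF assms]]) simp
  have "inj vec3" by (auto simp: inj_def vec_eq_iff forall_3 intro!: prod_eqI)
  have "integral (vec3 ` tri3) f = integral UNIV (\<lambda>x. indicator (vec3 ` tri3) x *\<^sub>R f x)"
    by (subst integral_restrict_UNIV[symmetric])
       (auto intro!: Henstock_Kurzweil_Integration.integral_cong simp: indicator_def)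
  also have "\<dots> = (\<integral>x. indicator (vec3 ` tri3) x *\<^sub>R f x \<partial>distr lborel borel vec3)"
    using integral_lborel[OF i] by (simp add: distr_vec3)
  also have "\<dots> = (\<integral>q. indicator (vec3 ` tri3) (vec3 q) *\<^sub>R f (vec3 q) \<partial>lborel)"
    by (rule integral_distr)
       (use i in \<open>auto intro: borel_measurable_continuous_onI[OF continuous_on_vec3]\<close>)
  also have "\<dots> = (\<integral>q. indicator tri3 q *\<^sub>R f (vec3 q) \<partial>lborel)"
    using \<open>inj vec3\<close> by (intro Bochner_Integration.integral_cong) (auto simp: indicator_def inj_image_mem_iff)
  finally show ?thesis .
qed

lemma integral_tet:
  assumes f: "continuous_on UNIV f" and D: "tet_det a b c d \<noteq> 0"
  shows "integral (convex hull {a,b,c,d}) f =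
    \<bar>tet_det a b c d\<bar> * (\<integral>q. indicator tri3 q *\<^sub>R (f (tet_map a b c d (vec3 q))::real) \<partial>lborel)"
proof -
  let ?S = "vec3 ` tri3" let ?T = "tet_map a b c d"
  let ?L = "\<lambda>x::real^3. x$1 *\<^sub>R (b - a) + x$2 *\<^sub>R (c - a) + x$3 *\<^sub>R (d - a)"
  have c: "compact ?S"
    by (intro compact_continuous_image compact_tri3 continuous_on_vec3)
  have contT: "continuous_on A ?T" for A
    unfolding tet_map_def by (intro continuous_intros)
  \<comment> \<open>\<open>integral_change_of_variables\<close> speaks of integrands with values in
    \<open>real^'n\<close>, hence this copy of \<open>f\<close> in \<open>real^1\<close>.\<close>
  define F :: "real^3 \<Rightarrow> real^1" where "F x = vec (f x)" for x
  have contF: "continuous_on A F" for A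
    using continuous_on_subset[OF f, of A]
    by (subst continuous_on_componentwise) (auto simp: F_def Basis_vec_def inner_axis)
  have cK: "compact (?T ` ?S)"
    by (intro compact_continuous_image contT c)
  have absF: "F absolutely_integrable_on ?T ` ?S"
    by (rule absolutely_integrable_continuous_compact) (use cK contF in auto)
  have "integral (?T ` ?S) F = integral ?S (\<lambda>x. \<bar>det (matrix ?L)\<bar> *\<^sub>R F (?T x))"
  proof (rule integral_change_of_variables)
    show "?S \<in> sets lebesgue" using c by (simp add: lmeasurable_compact fmeasurableD)
    show "(?T has_derivative ?L) (at x within ?S)" for x
      using has_derivative_add[OF has_derivative_const linear_imp_has_derivative[OF tet_linear], of a]
      by (simp add: tet_map_def[abs_def])
    show "inj_on ?T ?S" using tet_map_inj[OF D] by (auto simp: inj_on_def inj_def)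
    show "F absolutely_integrable_on ?T ` ?S \<or>
      (\<lambda>x. \<bar>det (matrix ?L)\<bar> *\<^sub>R F (?T x)) absolutely_integrable_on ?S"
      using absF by simp
  qed
  then have "integral (?T ` ?S) F $ 1 = integral ?S (\<lambda>x. \<bar>tet_det a b c d\<bar> *\<^sub>R F (?T x)) $ 1"
    by (simp add: det_tet_linear tet_det_def)
  moreover have "integral (?T ` ?S) F $ 1 = integral (?T ` ?S) (\<lambda>x. F x $ 1)"
    using absF by (simp add: set_lebesgue_integral_eq_integral(1))
  moreover have "integral ?S (\<lambda>x. \<bar>tet_det a b c d\<bar> *\<^sub>R F (?T x)) $ 1 = integral ?S (\<lambda>x. (\<bar>tet_det a b c d\<bar> *\<^sub>R F (?T x)) $ 1)"
  proof (rule integral_component_eq_cart[symmetric])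
    have "continuous_on ?S (\<lambda>x. F (?T x))"
      by (rule continuous_on_compose2[OF contF[of UNIV] contT]) auto
    then have "continuous_on ?S (\<lambda>x. \<bar>tet_det a b c d\<bar> *\<^sub>R F (?T x))"
      by (intro continuous_on_scaleR continuous_on_const)
    then show "(\<lambda>x. \<bar>tet_det a b c d\<bar> *\<^sub>R F (?T x)) integrable_on ?S"
      by (rule set_lebesgue_integral_eq_integral(1)[OF absolutely_integrable_continuous_compact[OF c]])
  qed
  ultimately have "integral (?T ` ?S) f = integral ?S (\<lambda>x. \<bar>tet_det a b c d\<bar> * f (?T x))"
    by (simp add: F_def)
  also have "\<dots> = \<bar>tet_det a b c d\<bar> * integral ?S (\<lambda>x. f (?T x))" by simp
  also have "integral ?S (\<lambda>x. f (?T x)) = (\<integral>q. indicator tri3 q *\<^sub>R f (?T (vec3 q)) \<partial>lborel)"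
    by (intro integral_vec3 continuous_on_compose2[OF f contT]) auto
  finally show ?thesis unfolding tet_map_image .
qed

text \<open>In reference coordinates the direction \<open>d - a\<close> is the last coordinate
  direction, so by the chain rule the integrand is a derivative in that coordinate and
  \<open>tri3_FTC\<close> applies.\<close>

lemma integral_tet_FTC:
  assumes f: "\<And>x. (f has_derivative f' x) (at x)" and cont: "continuous_on UNIV (\<lambda>x. f' x (d - a))"
    and D: "tet_det a b c d \<noteq> 0"
  shows "integral (convex hull {a,b,c,d}) (\<lambda>x. f' x (d - a)) =
    \<bar>tet_det a b c d\<bar> * (face_int d b c f - face_int a b c f)"
proof -
  let ?T = "\<lambda>q. tet_map a b c d (vec3 q)"
  have contT: "continuous_on UNIV ?T"
    unfolding tet_map_def vec3_nth by (intro continuous_intros)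
  have cf: "continuous_on UNIV f"
    using f has_derivative_continuous by (metis continuous_at_imp_continuous_on)
  have "(\<integral>q. indicator tri3 q *\<^sub>R f' (?T q) (d - a) \<partial>lborel) =
      tri_int (\<lambda>p. f (?T (p, 1 - fst p - snd p)) - f (?T (p, 0)))"
  proof (rule tri3_FTC)
    show "continuous_on UNIV (\<lambda>q. f' (?T q) (d - a))"
      by (rule continuous_on_compose2[OF cont contT]) auto
    show "((\<lambda>w. f (?T (p, w))) has_real_derivative f' (?T (p, w)) (d - a)) (at w)" for p w
    proof -
      have "((\<lambda>w. ?T (p, w)) has_vector_derivative (d - a)) (at w)"
        unfolding tet_map_def vec3_nth by (auto intro!: derivative_eq_intros)
      from vector_derivative_diff_chain_within[OF this has_derivative_at_withinI[OF f]]
      show ?thesis by (simp add: o_def has_real_derivative_iff_has_vector_derivative)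
    qed
  qed
  also have "\<dots> = face_int d b c f - face_int a b c f"
  proof -
    have 1: "?T (p, 1 - fst p - snd p) = (1 - fst p - snd p) *\<^sub>R d + fst p *\<^sub>R b + snd p *\<^sub>R c"
      and 2: "?T (p, 0) = (1 - fst p - snd p) *\<^sub>R a + fst p *\<^sub>R b + snd p *\<^sub>R c" for p
      unfolding tet_map_def vec3_nth by (auto simp: algebra_simps)
    have i: "integrable lborel (\<lambda>p. indicator tri2 p *\<^sub>R f ((1 - fst p - snd p) *\<^sub>R e + fst p *\<^sub>R b + snd p *\<^sub>R c))" for e
      by (rule integrable_tri2, rule continuous_on_compose2[OF cf]) (auto intro!: continuous_intros)
    show ?thesis
      unfolding 1 2 face_int_def tri_int_def
      by (subst Bochner_Integration.integral_diff[symmetric, OF i i]) (simp add: algebra_simps)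
  qed
  finally show ?thesis
    by (simp only: integral_tet[OF cont D])
qed

section \<open>The divergence theorem on a tetrahedron\<close>

lemma tet_det_swap: "tet_det b a c d = - tet_det a b c d"
  by (simp_all add: tet_det_def cross3_simps)

lemma face_int_swap_ab:
  assumes "continuous_on UNIV f"
  shows "face_int b a c f = face_int a b c f"
  using face_int_swap_bc[OF assms, of c a b] face_int_swap_ac[OF assms] by simp

text \<open>Both sides are linear in \<open>h\<close>. The case of the three edges leaving
  \<open>a\<close> is \<open>integral_tet_FTC\<close>, and these edges form a basis.\<close>

lemma integral_tet_grad_ordered:
  assumes f: "\<And>x. (f has_derivative (\<lambda>h. g x \<bullet> h)) (at x)" and cont: "continuous_on UNIV g"
    and D: "tet_det a b c d > 0"
  shows "integral (convex hull {a,b,c,d}) (\<lambda>x. g x \<bullet> h) =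
    - ((((b - a) \<times> (c - a)) \<bullet> h) * face_int a b c f + (((d - a) \<times> (b - a)) \<bullet> h) * face_int a d b f
      + (((c - a) \<times> (d - a)) \<bullet> h) * face_int a c d f + (((d - b) \<times> (c - b)) \<bullet> h) * face_int b d c f)"
proof -
  have cf: "continuous_on UNIV f"
    using f has_derivative_continuous by (metis continuous_at_imp_continuous_on)
  have c: "continuous_on A (\<lambda>x. g x \<bullet> h)" for h A
    using continuous_on_subset[OF cont] by (intro continuous_intros) auto
  let ?D = "tet_det a b c d"
  have A: "integral (convex hull {a,b,c,d}) (\<lambda>x. g x \<bullet> (d - a)) = ?D * (face_int b d c f - face_int a b c f)"
    using integral_tet_FTC[OF f c, of a b c d] D face_int_swap_ab[OF cf, of d b c] by simp
  have B: "integral (convex hull {a,b,c,d}) (\<lambda>x. g x \<bullet> (b - a)) = ?D * (face_int b d c f - face_int a c d f)"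
  proof -
    have "{a,b,c,d} = {a,c,d,b}" by auto
    moreover have "tet_det a c d b = ?D" by (simp add: tet_det_def cross3_simps)
    ultimately show ?thesis
      using integral_tet_FTC[OF f c, of a c d b] D face_int_swap_bc[OF cf, of b c d] by simp
  qed
  have C: "integral (convex hull {a,b,c,d}) (\<lambda>x. g x \<bullet> (c - a)) = ?D * (face_int b d c f - face_int a d b f)"
  proof -
    have "{a,b,c,d} = {a,d,b,c}" by auto
    moreover have "tet_det a d b c = ?D" by (simp add: tet_det_def cross3_simps)
    ultimately show ?thesis
      using integral_tet_FTC[OF f c, of a d b c] D face_int_swap_bc[OF cf, of b c d]
        face_int_swap_ab[OF cf, of c b d] face_int_swap_ab[OF cf, of c d b] face_int_swap_ac[OF cf, of b d c] by simp
  qed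
  have i: "(\<lambda>x. g x \<bullet> h) integrable_on convex hull {a,b,c,d}" for h
    by (intro set_lebesgue_integral_eq_integral(1) absolutely_integrable_continuous_compact c
        compact_convex_hull finite_imp_compact) auto
  \<comment> \<open>Cramer's rule for \<open>h\<close> in the basis of the three edges at
    \<open>a\<close>.\<close>
  have "?D *\<^sub>R h = (h \<bullet> ((c - a) \<times> (d - a))) *\<^sub>R (b - a) + (h \<bullet> ((d - a) \<times> (b - a))) *\<^sub>R (c - a)
      + (h \<bullet> ((b - a) \<times> (c - a))) *\<^sub>R (d - a)"
    by (simp add: tet_det_def cross3_simps forall_3)
  moreover define p q r where "p = h \<bullet> ((c - a) \<times> (d - a))" "q = h \<bullet> ((d - a) \<times> (b - a))" "r = h \<bullet> ((b - a) \<times> (c - a))"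
  ultimately have h: "?D *\<^sub>R h = p *\<^sub>R (b - a) + q *\<^sub>R (c - a) + r *\<^sub>R (d - a)" by simp
  \<comment> \<open>The inward area vectors of the four faces add up to zero.\<close>
  have s: "((d - b) \<times> (c - b)) \<bullet> h = - (p + q + r)"
    unfolding p_q_r_def by (simp add: cross3_simps)
  have "?D * integral (convex hull {a,b,c,d}) (\<lambda>x. g x \<bullet> h) = integral (convex hull {a,b,c,d}) (\<lambda>x. g x \<bullet> (?D *\<^sub>R h))"
    by simp
  also have "\<dots> = integral (convex hull {a,b,c,d}) (\<lambda>x. p * (g x \<bullet> (b - a)) + q * (g x \<bullet> (c - a)) + r * (g x \<bullet> (d - a)))"
    unfolding h by (simp only: inner_add_right inner_scaleR_right)
  also have "\<dots> = p * integral (convex hull {a,b,c,d}) (\<lambda>x. g x \<bullet> (b - a)) + q * integral (convex hull {a,b,c,d}) (\<lambda>x. g x \<bullet> (c - a)) + r * integral (convex hull {a,b,c,d}) (\<lambda>x. g x \<bullet> (d - a))"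
  proof -
    have ii: "(\<lambda>x. k * (g x \<bullet> h)) integrable_on convex hull {a,b,c,d}" for k h
      using integrable_on_cmult_left[OF i, of k] by simp
    show ?thesis
      by (simp only: Henstock_Kurzweil_Integration.integral_add[OF integrable_add[OF ii ii] ii]
          Henstock_Kurzweil_Integration.integral_add[OF ii ii] integral_mult_right)
  qed
  also have "\<dots> = ?D * (p * (face_int b d c f - face_int a c d f) + q * (face_int b d c f - face_int a d b f) + r * (face_int b d c f - face_int a b c f))"
    unfolding A B C by (simp add: algebra_simps)
  finally have "integral (convex hull {a,b,c,d}) (\<lambda>x. g x \<bullet> h) = p * (face_int b d c f - face_int a c d f) + q * (face_int b d c f - face_int a d b f) + r * (face_int b d c f - face_int a b c f)"
    using D by simp
  then show ?thesis
    unfolding s unfolding p_q_r_def by (simp add: inner_commute algebra_simps)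
qed

text \<open>Faces are bare vertex sets. Fixing one order per face gives the elements that share it a
  common normal and a common parametrisation.\<close>

definition face_order :: "(real^3) set \<Rightarrow> (real^3) \<times> (real^3) \<times> (real^3)" where
  "face_order F = (SOME (a,b,c). F = {a,b,c} \<and> a \<noteq> b \<and> a \<noteq> c \<and> b \<noteq> c)"

definition face_base :: "(real^3) set \<Rightarrow> real^3" where
  "face_base F = fst (face_order F)"

definition face_normal :: "(real^3) set \<Rightarrow> real^3" where
  "face_normal F = (case face_order F of (a,b,c) \<Rightarrow> (b - a) \<times> (c - a))"

definition face_integral :: "(real^3) set \<Rightarrow> (real^3 \<Rightarrow> real) \<Rightarrow> real" where
  "face_integral F f = (case face_order F of (a,b,c) \<Rightarrow> face_int a b c f)"

definition faces :: "(real^3) set \<Rightarrow> (real^3) set set" where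
  "faces C = {F. F \<subseteq> C \<and> card F = 3}"

text \<open>\<open>the_elem (C - F)\<close> is the vertex opposite to \<open>F\<close>. The value is
  1 if \<open>face_normal F\<close> points into the tetrahedron and -1 if it points out of
  it.\<close>

definition side :: "(real^3) set \<Rightarrow> (real^3) set \<Rightarrow> real" where
  "side C F = sgn (face_normal F \<bullet> (the_elem (C - F) - face_base F))"

lemma face_order:
  assumes "card F = 3"
  obtains a b c where "face_order F = (a,b,c)" "F = {a,b,c}" "a \<noteq> b" "a \<noteq> c" "b \<noteq> c"
proof -
  obtain a b c where "F = {a,b,c} \<and> a \<noteq> b \<and> a \<noteq> c \<and> b \<noteq> c"
    using assms by (auto simp: card_3_iff)
  then have "case (a,b,c) of (a,b,c) \<Rightarrow> F = {a,b,c} \<and> a \<noteq> b \<and> a \<noteq> c \<and> b \<noteq> c" by simp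
  from someI[where P = "\<lambda>t. case t of (a,b,c) \<Rightarrow> F = {a,b,c} \<and> a \<noteq> b \<and> a \<noteq> c \<and> b \<noteq> c", OF this]
  have *: "case face_order F of (a,b,c) \<Rightarrow> F = {a,b,c} \<and> a \<noteq> b \<and> a \<noteq> c \<and> b \<noteq> c"
    unfolding face_order_def .
  obtain a' b' c' where "face_order F = (a',b',c')" by (cases "face_order F")
  with * that show ?thesis by simp
qed

lemma three_perm:
  assumes "{a,b,c} = {a',b',c'}" "a \<noteq> b" "a \<noteq> c" "b \<noteq> c" "a' \<noteq> b'" "a' \<noteq> c'" "b' \<noteq> c'"
  shows "(a',b',c') \<in> {(a,b,c),(a,c,b),(b,a,c),(b,c,a),(c,a,b),(c,b,a)}"
proof -
  have "a' \<in> {a,b,c}" "b' \<in> {a,b,c}" "c' \<in> {a,b,c}" using assms(1) by auto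
  then show ?thesis using assms(2-) by auto
qed

text \<open>The chosen order is one of six permutations of \<open>a\<close>, \<open>b\<close>,
  \<open>c\<close>, and transpositions leave \<open>face_int\<close> unchanged.\<close>

lemma face_integral_eq:
  assumes "a \<noteq> b" "a \<noteq> c" "b \<noteq> c" "continuous_on UNIV f"
  shows "face_integral {a,b,c} f = face_int a b c f"
proof -
  have "card {a,b,c} = 3" using assms by simp
  then obtain a' b' c' where o: "face_order {a,b,c} = (a',b',c')" "{a,b,c} = {a',b',c'}" "a' \<noteq> b'" "a' \<noteq> c'" "b' \<noteq> c'"
    by (rule face_order)
  from three_perm[OF o(2) assms(1-3) o(3-5)] show ?thesis
    unfolding face_integral_def o(1)
    using face_int_swap_bc[OF assms(4), of a b c] face_int_swap_ab[OF assms(4), of a b c] face_int_swap_ac[OF assms(4), of a b c]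
      face_int_swap_bc[OF assms(4), of b a c] face_int_swap_bc[OF assms(4), of c a b]
    by auto
qed

lemma face_normal_eq:
  assumes "a \<noteq> b" "a \<noteq> c" "b \<noteq> c"
  shows "face_normal {a,b,c} = (b - a) \<times> (c - a) \<or> face_normal {a,b,c} = - ((b - a) \<times> (c - a))"
proof -
  have "card {a,b,c} = 3" using assms by simp
  then obtain a' b' c' where o: "face_order {a,b,c} = (a',b',c')" "{a,b,c} = {a',b',c'}" "a' \<noteq> b'" "a' \<noteq> c'" "b' \<noteq> c'"
    by (rule face_order)
  have r: "(c - a) \<times> (b - a) = - ((b - a) \<times> (c - a))" "(a - b) \<times> (c - b) = - ((b - a) \<times> (c - a))"
     "(c - b) \<times> (a - b) = (b - a) \<times> (c - a)" "(a - c) \<times> (b - c) = (b - a) \<times> (c - a)" "(b - c) \<times> (a - c) = - ((b - a) \<times> (c - a))"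
    by (simp_all add: cross3_simps forall_3)
  from three_perm[OF o(2) assms(1-3) o(3-5)] show ?thesis
    unfolding face_normal_def o(1) using r by auto
qed

lemma face_base_in: "card F = 3 \<Longrightarrow> face_base F \<in> F"
  by (metis face_base_def face_order fst_conv insertI1)

lemma face_normal_orth:
  assumes "card F = 3" "p \<in> F" "q \<in> F"
  shows "face_normal F \<bullet> (p - q) = 0"
proof -
  obtain a b c where o: "face_order F = (a,b,c)" "F = {a,b,c}" "a \<noteq> b" "a \<noteq> c" "b \<noteq> c"
    using face_order[OF assms(1)] .
  have "face_normal F = (b - a) \<times> (c - a)" by (simp add: face_normal_def o(1))
  then show ?thesis using assms(2,3) unfolding o(2) by (auto simp: cross3_simps)
qed

lemma faces_Diff:
  assumes "card C = 4" shows "faces C = (\<lambda>v. C - {v}) ` C"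
proof (intro set_eqI iffI)
  fix F assume "F \<in> faces C"
  then have F: "F \<subseteq> C" "card F = 3" by (auto simp: faces_def)
  have fin: "finite C" using assms by (metis card.infinite zero_neq_numeral)
  have "card (C - F) = 1" using F assms fin by (simp add: card_Diff_subset finite_subset)
  then obtain v where "C - F = {v}" by (auto simp: card_1_singleton_iff)
  then have "v \<in> C" "F = C - {v}" using F by auto
  then show "F \<in> (\<lambda>v. C - {v}) ` C" by blast
next
  fix F assume "F \<in> (\<lambda>v. C - {v}) ` C"
  then show "F \<in> faces C" using assms by (auto simp: faces_def)
qed

lemma side_eq:
  assumes "card C = 4" "F \<subseteq> C" "card F = 3" "v \<in> C - F" "a \<in> F"
  shows "side C F = sgn (face_normal F \<bullet> (v - a))"
proof -
  have fin: "finite C" using assms by (metis card.infinite zero_neq_numeral)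
  have "card (C - F) = 1" using assms fin by (simp add: card_Diff_subset finite_subset)
  then have "C - F = {v}" using assms(4) by (metis card_1_singletonE singletonD)
  then have "the_elem (C - F) = v" by simp
  moreover have "face_normal F \<bullet> (v - face_base F) = face_normal F \<bullet> (v - a)"
    using face_normal_orth[OF assms(3) assms(5) face_base_in[OF assms(3)]] by (simp add: inner_diff_right)
  ultimately show ?thesis by (simp add: side_def)
qed

lemma card4_obtain:
  assumes "card C = 4"
  obtains a b c d where "C = {a,b,c,d}" "a \<noteq> b" "a \<noteq> c" "a \<noteq> d" "b \<noteq> c" "b \<noteq> d" "c \<noteq> d"
proof -
  from assms have "card C = Suc 3" by simp
  then obtain a F where "C = insert a F" "a \<notin> F" "card F = 3" by (metis card_Suc_eq)
  moreover then obtain b c d where "F = {b,c,d}" "b \<noteq> c" "b \<noteq> d" "c \<noteq> d" by (auto simp: card_3_iff)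
  ultimately show ?thesis using that by auto
qed

text \<open>A nonzero kernel vector of the matrix of edges supplies the weights of an affine
  dependence.\<close>

lemma tet_det_nonzero:
  assumes ind: "\<not> affine_dependent {a,b,c,d}" and dist: "a \<noteq> b" "a \<noteq> c" "a \<noteq> d" "b \<noteq> c" "b \<noteq> d" "c \<noteq> d"
  shows "tet_det a b c d \<noteq> 0"
proof
  assume 0: "tet_det a b c d = 0"
  let ?L = "\<lambda>x::real^3. x$1 *\<^sub>R (b - a) + x$2 *\<^sub>R (c - a) + x$3 *\<^sub>R (d - a)"
  have "\<not> inj ?L"
    using 0 det_nz_iff_inj[OF tet_linear[of "b - a" "c - a" "d - a"]] by (metis det_tet_linear tet_det_def)
  then obtain x where x: "?L x = 0" "x \<noteq> 0"
    using linear_injective_0[OF tet_linear[of "b - a" "c - a" "d - a"]] by blast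
  define u where "u = (\<lambda>y. if y = b then x$1 else if y = c then x$2 else if y = d then x$3 else - (x$1 + x$2 + x$3))"
  have "sum u {a,b,c,d} = 0" "(\<Sum>v\<in>{a,b,c,d}. u v *\<^sub>R v) = 0"
    using dist x(1) by (auto simp: u_def algebra_simps)
  moreover have "\<exists>v\<in>{a,b,c,d}. u v \<noteq> 0"
  proof (rule ccontr)
    assume "\<not> ?thesis"
    then have "x$1 = 0" "x$2 = 0" "x$3 = 0" using dist by (auto simp: u_def)
    then show False using x(2) by (simp add: vec_eq_iff forall_3)
  qed
  ultimately have "affine_dependent {a,b,c,d}"
    by (subst affine_dependent_explicit_finite) auto
  with ind show False by simp
qed

text \<open>The divergence theorem for the field \<open>f\<close> times the constant vector
  \<open>h\<close>. The minus sign comes from \<open>side C F\<close> times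
  \<open>face_normal F\<close> being the inward normal, with twice the area as length.\<close>

theorem integral_tet_grad:
  assumes f: "\<And>x. (f has_derivative (\<lambda>h. g x \<bullet> h)) (at x)" and cont: "continuous_on UNIV g"
    and C: "card C = 4" "\<not> affine_dependent C"
  shows "integral (convex hull C) (\<lambda>x. g x \<bullet> h) =
    - (\<Sum>F\<in>faces C. side C F * (face_normal F \<bullet> h) * face_integral F f)"
proof -
  have cf: "continuous_on UNIV f"
    using f has_derivative_continuous by (metis continuous_at_imp_continuous_on)
  obtain a b c d where C': "C = {a,b,c,d}" and dist: "a \<noteq> b" "a \<noteq> c" "a \<noteq> d" "b \<noteq> c" "b \<noteq> d" "c \<noteq> d"
    and D: "tet_det a b c d > 0"
  proof -
    obtain a b c d where C': "C = {a,b,c,d}" and dist: "a \<noteq> b" "a \<noteq> c" "a \<noteq> d" "b \<noteq> c" "b \<noteq> d" "c \<noteq> d"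
      by (rule card4_obtain[OF C(1)])
    have n: "tet_det a b c d \<noteq> 0" using tet_det_nonzero C(2) C' dist by metis
    show thesis
    proof (cases "tet_det a b c d > 0")
      case True then show ?thesis using that C' dist by blast
    next
      case False
      then have "tet_det b a c d > 0" using n tet_det_swap[of b a c d] by simp
      then show ?thesis using that[of b a c d] C' dist by blast
    qed
  qed
  have t: "side C F * (face_normal F \<bullet> h) * face_integral F f = (((q - p) \<times> (r - p)) \<bullet> h) * face_int p q r f"
    if "F = {p,q,r}" "p \<noteq> q" "p \<noteq> r" "q \<noteq> r" "v \<notin> F" "C = insert v F" "((q - p) \<times> (r - p)) \<bullet> (v - p) > 0" for F p q r v
  proof -
    have "side C F = sgn (face_normal F \<bullet> (v - p))"
      using that C(1) by (intro side_eq) auto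
    then have "side C F * (face_normal F \<bullet> h) = (((q - p) \<times> (r - p)) \<bullet> h)"
      using face_normal_eq[OF that(2-4)] that(7) unfolding that(1) by (auto simp: sgn_if)
    then show ?thesis using face_integral_eq[OF that(2-4) cf] that(1) by simp
  qed
  have det: "((b - a) \<times> (c - a)) \<bullet> (d - a) > 0" "((d - a) \<times> (b - a)) \<bullet> (c - a) > 0" "((c - a) \<times> (d - a)) \<bullet> (b - a) > 0"
    "((d - b) \<times> (c - b)) \<bullet> (a - b) > 0"
    using D by (simp_all add: tet_det_def cross3_simps)
  have fc: "faces C = {{a,b,c},{a,d,b},{a,c,d},{b,d,c}}"
    unfolding faces_Diff[OF C(1)] unfolding C' using dist by auto
  have ne: "{a,b,c} \<noteq> {a,d,b}" "{a,b,c} \<noteq> {a,c,d}" "{a,b,c} \<noteq> {b,d,c}" "{a,d,b} \<noteq> {a,c,d}" "{a,d,b} \<noteq> {b,d,c}" "{a,c,d} \<noteq> {b,d,c}"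
    using dist by auto
  show ?thesis
    unfolding fc
    using integral_tet_grad_ordered[OF f cont D, of h] ne
      t[of "{a,b,c}" a b c d] t[of "{a,d,b}" a d b c] t[of "{a,c,d}" a c d b] t[of "{b,d,c}" b d c a] dist det
    by (simp add: C' insert_commute)
qed

section \<open>Barycentric coordinates\<close>

definition bary_grad :: "(real^3) set \<Rightarrow> real^3 \<Rightarrow> real^3" where
  "bary_grad C v = (1 / (face_normal (C - {v}) \<bullet> (v - face_base (C - {v})))) *\<^sub>R face_normal (C - {v})"

text \<open>An explicit affine formula, so that continuity and polynomial degree are available for
  every \<open>C\<close>; only the values at the vertices rely on a nondegenerate
  tetrahedron.\<close>

definition bary :: "(real^3) set \<Rightarrow> real^3 \<Rightarrow> real^3 \<Rightarrow> real" where
  "bary C v x = bary_grad C v \<bullet> (x - face_base (C - {v}))"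

lemma bary_diff: "bary C v x - bary C v y = bary_grad C v \<bullet> (x - y)"
  by (simp add: bary_def inner_diff_right)

lemma continuous_on_bary [continuous_intros]: "continuous_on S (bary C v)"
  unfolding bary_def[abs_def] by (intro continuous_intros)

lemma bary_sum:
  assumes "sum t A = 1"
  shows "bary C v (\<Sum>w\<in>A. t w *\<^sub>R w) = (\<Sum>w\<in>A. t w * bary C v w)"
proof -
  have "(\<Sum>w\<in>A. t w * bary C v w) = bary_grad C v \<bullet> (\<Sum>w\<in>A. t w *\<^sub>R w) - (sum t A) * (bary_grad C v \<bullet> face_base (C - {v}))"
    unfolding bary_def by (simp add: inner_diff_right inner_sum_right right_diff_distrib sum_subtractf sum_distrib_right)
  then show ?thesis using assms by (simp add: bary_def inner_diff_right)
qed

lemma bary_comb2: "bary C v ((1 - t) *\<^sub>R x + t *\<^sub>R y) = (1 - t) * bary C v x + t * bary C v y"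
  by (simp add: bary_def inner_diff_right inner_add_right algebra_simps)

lemma bary_comb3: "bary C v ((1 - s - t) *\<^sub>R x + s *\<^sub>R y + t *\<^sub>R z) = (1 - s - t) * bary C v x + s * bary C v y + t * bary C v z"
  by (simp add: bary_def inner_diff_right inner_add_right algebra_simps)

locale tetrahedron =
  fixes C :: "(real^3) set"
  assumes card4: "card C = 4" and indep: "\<not> affine_dependent C"
begin

lemma fin: "finite C"
  using card4 by (metis card.infinite zero_neq_numeral)

lemma card_face: "v \<in> C \<Longrightarrow> card (C - {v}) = 3"
  using card4 by simp

lemma normal_nonzero:
  assumes "v \<in> C" "a \<in> C - {v}" shows "face_normal (C - {v}) \<bullet> (v - a) \<noteq> 0"
proof -
  obtain p q r where o: "face_order (C - {v}) = (p,q,r)" "C - {v} = {p,q,r}" "p \<noteq> q" "p \<noteq> r" "q \<noteq> r"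
    using face_order[OF card_face[OF assms(1)]] .
  have "C = {p,q,r,v}" "v \<notin> {p,q,r}" using o(2) assms(1) by auto
  then have "tet_det p q r v \<noteq> 0" using indep o(3-5) by (intro tet_det_nonzero) auto
  then have "face_normal (C - {v}) \<bullet> (v - p) \<noteq> 0"
    by (simp add: tet_det_def face_normal_def o(1))
  moreover have "face_normal (C - {v}) \<bullet> (p - a) = 0"
    using face_normal_orth[OF card_face[OF assms(1)]] assms(2) o(2) by auto
  ultimately show ?thesis by (simp add: inner_diff_right)
qed

lemma bary_self [simp]:
  assumes "v \<in> C" shows "bary C v v = 1"
  using normal_nonzero[OF assms face_base_in[OF card_face[OF assms]]]
  by (simp add: bary_def bary_grad_def)

lemma bary_other [simp]:
  assumes "v \<in> C" "w \<in> C" "w \<noteq> v" shows "bary C v w = 0"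
  using face_normal_orth[OF card_face[OF assms(1)], of w "face_base (C - {v})"] assms face_base_in[OF card_face[OF assms(1)]]
  by (simp add: bary_def bary_grad_def)

lemma bary_vertex: "v \<in> C \<Longrightarrow> w \<in> C \<Longrightarrow> bary C v w = (if v = w then 1 else 0)"
  by auto

lemma affine_zero:
  assumes "\<And>v. v \<in> C \<Longrightarrow> k + g \<bullet> v = 0"
  shows "g = 0" "k = 0"
proof -
  obtain a b c d where C': "C = {a,b,c,d}" and dist: "a \<noteq> b" "a \<noteq> c" "a \<noteq> d" "b \<noteq> c" "b \<noteq> d" "c \<noteq> d"
    by (rule card4_obtain[OF card4])
  have D: "tet_det a b c d \<noteq> 0" using tet_det_nonzero indep C' dist by metis
  have 0: "g \<bullet> (b - a) = 0" "g \<bullet> (c - a) = 0" "g \<bullet> (d - a) = 0"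
    using assms[of a] assms[of b] assms[of c] assms[of d] by (auto simp: C' inner_diff_right)
  \<comment> \<open>Up to the factor \<open>tet_det\<close>, these cross products are the basis dual
    to the three edges at \<open>a\<close>.\<close>
  have "tet_det a b c d *\<^sub>R g = (g \<bullet> (b - a)) *\<^sub>R ((c - a) \<times> (d - a)) + (g \<bullet> (c - a)) *\<^sub>R ((d - a) \<times> (b - a))
      + (g \<bullet> (d - a)) *\<^sub>R ((b - a) \<times> (c - a))"
    by (simp add: tet_det_def cross3_simps forall_3)
  then show "g = 0" using 0 D by simp
  then show "k = 0" using assms[of a] by (simp add: C')
qed

lemma affine_eq:
  assumes "\<And>v. v \<in> C \<Longrightarrow> k + g \<bullet> v = k' + g' \<bullet> v"
  shows "k + g \<bullet> x = k' + g' \<bullet> x"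
  using affine_zero[of "k - k'" "g - g'"] assms by (auto simp: inner_diff_left algebra_simps)

lemma sum_bary_weight: "(\<Sum>v\<in>C. bary C v x * f v) = (\<Sum>v\<in>C. f v * (- bary_grad C v \<bullet> face_base (C - {v}))) + (\<Sum>v\<in>C. f v *\<^sub>R bary_grad C v) \<bullet> x"
  by (simp add: bary_def inner_diff_right inner_sum_left sum_subtractf[symmetric] algebra_simps sum.distrib[symmetric])

lemma sum_bary: "(\<Sum>v\<in>C. bary C v x) = 1"
proof -
  let ?k = "(\<Sum>v\<in>C. 1 * (- bary_grad C v \<bullet> face_base (C - {v})))" and ?g = "(\<Sum>v\<in>C. 1 *\<^sub>R bary_grad C v)"
  have "?k + ?g \<bullet> x = 1 + 0 \<bullet> x"
  proof (rule affine_eq)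
    fix w assume "w \<in> C"
    have "(\<Sum>v\<in>C. bary C v w * 1) = 1"
      using \<open>w \<in> C\<close> fin by (simp add: bary_vertex)
    then show "?k + ?g \<bullet> w = 1 + 0 \<bullet> w" using sum_bary_weight[of w "\<lambda>_. 1"] by simp
  qed
  then show ?thesis using sum_bary_weight[of x "\<lambda>_. 1"] by simp
qed

lemma affine_interpolate: "k + g \<bullet> x = (\<Sum>v\<in>C. bary C v x * (k + g \<bullet> v))"
proof -
  let ?f = "\<lambda>v. k + g \<bullet> v"
  let ?k = "(\<Sum>v\<in>C. ?f v * (- bary_grad C v \<bullet> face_base (C - {v})))" and ?g = "(\<Sum>v\<in>C. ?f v *\<^sub>R bary_grad C v)"
  have "?k + ?g \<bullet> x = k + g \<bullet> x"
  proof (rule affine_eq)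
    fix w assume "w \<in> C"
    have "bary C v w * (k + g \<bullet> v) = (if v = w then k + g \<bullet> v else 0)" if "v \<in> C" for v
      using that \<open>w \<in> C\<close> by auto
    then have "(\<Sum>v\<in>C. bary C v w * ?f v) = ?f w"
      using \<open>w \<in> C\<close> fin by simp
    then show "?k + ?g \<bullet> w = k + g \<bullet> w" using sum_bary_weight[of w ?f] by simp
  qed
  then show ?thesis using sum_bary_weight[of x ?f] by simp
qed

lemma bary_repr: "(\<Sum>v\<in>C. bary C v x *\<^sub>R v) = x"
proof -
  define d where "d = (\<Sum>v\<in>C. bary C v x *\<^sub>R v) - x"
  \<comment> \<open>The linear form given by the defect \<open>d\<close> itself is interpolated at
    the vertices, which makes \<open>d\<close> orthogonal to itself.\<close>
  have "d \<bullet> d = d \<bullet> (\<Sum>v\<in>C. bary C v x *\<^sub>R v) - d \<bullet> x"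
    by (simp only: inner_diff_right[symmetric] d_def[symmetric])
  also have "\<dots> = 0"
    using affine_interpolate[of 0 d x] by (simp add: inner_sum_right)
  finally have "d = 0" by simp
  then show ?thesis by (simp add: d_def)
qed

lemma mem_tet: "x \<in> convex hull C \<longleftrightarrow> (\<forall>v\<in>C. 0 \<le> bary C v x)"
proof
  assume "x \<in> convex hull C"
  then obtain t where t: "\<forall>v\<in>C. 0 \<le> t v" "sum t C = 1" "(\<Sum>v\<in>C. t v *\<^sub>R v) = x"
    unfolding convex_hull_finite[OF fin] mem_Collect_eq by blast
  show "\<forall>v\<in>C. 0 \<le> bary C v x"
  proof
    fix v assume v: "v \<in> C"
    have "bary C v x = (\<Sum>w\<in>C. t w * bary C v w)"
      using bary_sum[OF t(2), of C v] t(3) by simp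
    also have "\<dots> = (\<Sum>w\<in>C. if v = w then t w else 0)"
      using v by (intro sum.cong) auto
    also have "\<dots> = t v" using v fin by simp
    finally show "0 \<le> bary C v x" using v t(1) by simp
  qed
next
  assume "\<forall>v\<in>C. 0 \<le> bary C v x"
  then show "x \<in> convex hull C"
    unfolding convex_hull_finite[OF fin] mem_Collect_eq
    by (intro exI[of _ "\<lambda>v. bary C v x"] conjI sum_bary bary_repr)
qed

lemma bary_on_face:
  assumes "F \<subseteq> C" "v \<in> C - F" "x \<in> convex hull F" shows "bary C v x = 0"
proof -
  have "finite F" using assms(1) fin finite_subset by blast
  then obtain t where t: "sum t F = 1" "(\<Sum>v\<in>F. t v *\<^sub>R v) = x"
    using assms(3) unfolding convex_hull_finite[OF \<open>finite F\<close>] mem_Collect_eq by blast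
  have "bary C v x = (\<Sum>w\<in>F. t w * bary C v w)"
    using bary_sum[OF t(1), of C v] t(2) by simp
  also have "\<dots> = 0"
    using assms by (intro sum.neutral ballI) (metis Diff_iff bary_other mult_zero_right subsetD)
  finally show ?thesis .
qed

lemma pos_interior:
  assumes "\<And>v. v \<in> C \<Longrightarrow> 0 < bary C v x" shows "x \<in> interior (convex hull C)"
proof (rule interiorI)
  let ?U = "\<Inter>v\<in>C. {x. 0 < bary C v x}"
  show "open ?U" by (intro open_INT fin ballI open_Collect_less continuous_intros)
  show "x \<in> ?U" using assms by auto
  show "?U \<subseteq> convex hull C" using mem_tet by (auto intro: less_imp_le)
qed

lemma centroid_interior: "(\<Sum>v\<in>C. (1/4) *\<^sub>R v) \<in> interior (convex hull C)"
proof (rule pos_interior)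
  fix v assume "v \<in> C"
  have "bary C v (\<Sum>v\<in>C. (1/4) *\<^sub>R v) = (\<Sum>w\<in>C. 1/4 * bary C v w)"
    by (rule bary_sum) (simp add: card4)
  also have "\<dots> = 1/4 * (\<Sum>w\<in>C. bary C v w)" by (simp only: sum_distrib_left)
  also have "(\<Sum>w\<in>C. bary C v w) = 1" using \<open>v \<in> C\<close> fin by (simp add: bary_vertex)
  finally show "0 < bary C v (\<Sum>v\<in>C. (1/4) *\<^sub>R v)" by simp
qed

lemma compact_tet: "compact (convex hull C)"
  using fin by (simp add: finite_imp_compact_convex_hull)

lemma negligible_frontier_tet: "negligible (frontier (convex hull C))"
  by (simp add: negligible_convex_frontier)

lemma measure_tet_pos: "measure lebesgue (convex hull C) > 0"
proof -
  have "\<not> negligible (interior (convex hull C))"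
    using centroid_interior by (metis empty_iff open_interior open_not_negligible)
  then have "\<not> negligible (convex hull C)"
    using interior_subset negligible_subset by blast
  then have "measure lebesgue (convex hull C) \<noteq> 0"
    using negligible_iff_measure0[OF lmeasurable_compact[OF compact_tet]] by blast
  then show ?thesis by (simp add: zero_less_measure_iff)
qed

lemma side_pm:
  assumes "F \<in> faces C" shows "side C F = 1 \<or> side C F = -1"
proof -
  obtain v where v: "v \<in> C" "F = C - {v}" using assms faces_Diff[OF card4] by auto
  note b = face_base_in[OF card_face[OF v(1)]]
  have "side C F = sgn (face_normal F \<bullet> (v - face_base F))"
    by (rule side_eq[OF card4]) (use v card_face[OF v(1)] b in auto)
  then show ?thesis using normal_nonzero[OF v(1) b] v(2) by (auto simp: sgn_if)
qed

text \<open>The frontier has measure zero and the tetrahedron is the closure of its interior, so the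
  vanishing extends to boundary points; it is at points of faces and edges that the result gets
  applied.\<close>

lemma bary_nonneg_zero_imp:
  assumes f: "continuous_on UNIV f" and nn: "\<And>x. x \<in> convex hull C \<Longrightarrow> 0 \<le> f x"
    and i: "integral (convex hull C) f = (0::real)" and x: "x \<in> convex hull C"
  shows "f x = 0"
proof -
  let ?S = "interior (convex hull C)"
  have ne: "?S \<noteq> {}" using centroid_interior by blast
  have cl: "closure ?S = convex hull C"
    using convex_closure_interior[OF convex_convex_hull ne] compact_tet by (simp add: closure_closed compact_imp_closed)
  have fi: "(f has_integral 0) (closure ?S)"
    unfolding cl using i set_lebesgue_integral_eq_integral(1)[OF absolutely_integrable_continuous_compact[OF compact_tet continuous_on_subset[OF f subset_UNIV]]]
    by (metis integrable_integral)
  have fr: "frontier (convex hull C) \<in> null_sets lborel"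
    using negligible_frontier_tet by (simp add: negligible_iff_null_sets null_sets_completion_iff)
  have un: "?S \<union> frontier (convex hull C) = convex hull C"
    using compact_imp_closed[OF compact_tet] by (auto simp: frontier_def closure_closed dest: interior_subset[THEN subsetD])
  show ?thesis
  proof (rule has_integral_0_closure_imp_0[of ?S f])
    show "continuous_on (closure ?S) f" using f continuous_on_subset by blast
    show "0 < emeasure lborel ?S"
      using ne open_not_negligible[of ?S] by (auto simp: negligible_iff_null_sets null_sets_completion_iff null_sets_def zero_less_iff_neq_zero)
    show "emeasure lborel ?S < \<infinity>"
      by (rule emeasure_bounded_finite) (meson bounded_interior compact_imp_bounded compact_tet)
    show "emeasure lborel (closure ?S) = emeasure lborel ?S"
      using emeasure_Un_null_set[OF _ fr, of ?S] unfolding un cl by simp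
  qed (use nn interior_subset fi x cl in auto)
qed

end

section \<open>Simplicial meshes\<close>

text \<open>Elements are represented by their vertex sets. Faces and edges then become finite sets,
  incidence becomes inclusion, and conformity becomes compatibility of \<open>convex hull\<close>
  with intersection.\<close>

locale simplicial_mesh =
  fixes M :: "(real^3) set set"
  assumes finM: "finite M" and card4M: "\<And>C. C \<in> M \<Longrightarrow> card C = 4"
    and indepM: "\<And>C. C \<in> M \<Longrightarrow> \<not> affine_dependent C"
    and conf: "\<And>C C'. C \<in> M \<Longrightarrow> C' \<in> M \<Longrightarrow> convex hull C \<inter> convex hull C' = convex hull (C \<inter> C')"
begin

lemma tet: "C \<in> M \<Longrightarrow> tetrahedron C"
  by (simp add: tetrahedron_def card4M indepM)

lemma two_elements_face:
  assumes "C \<in> M" "C' \<in> M" "C \<noteq> C'" "F \<in> faces C" "F \<in> faces C'"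
  obtains v v' where "C = insert v F" "C' = insert v' F" "v \<notin> F" "v' \<notin> F" "v \<noteq> v'" "C \<inter> C' = F" "v \<notin> C'" "v' \<notin> C"
proof -
  from assms obtain v where v: "v \<in> C" "F = C - {v}" using faces_Diff[OF card4M] by blast
  from assms obtain v' where v': "v' \<in> C'" "F = C' - {v'}" using faces_Diff[OF card4M] by blast
  have "C = insert v F" "C' = insert v' F" "v \<notin> F" "v' \<notin> F" using v v' by auto
  moreover from this assms(3) have "v \<noteq> v'" by auto
  ultimately show ?thesis using that by auto
qed

lemma side_opposite:
  assumes C: "C \<in> M" "C' \<in> M" "C \<noteq> C'" and F: "F \<in> faces C" "F \<in> faces C'"
  shows "side C' F = - side C F"
proof -
  interpret C: tetrahedron C using tet C by blast
  interpret C': tetrahedron C' using tet C by blast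
  obtain v v' where v: "C = insert v F" "C' = insert v' F" "v \<notin> F" "v' \<notin> F" "v \<noteq> v'" "C \<inter> C' = F" "v \<notin> C'" "v' \<notin> C"
    using two_elements_face[OF C F] .
  have c3: "card F = 3" and finF: "finite F" using F C.fin v(1) by (auto simp: faces_def)
  have CvF: "C - {v} = F" "C' - {v'} = F" using v by auto
  have neg: "bary C v v' < 0"
  proof (rule ccontr)
    assume "\<not> ?thesis"
    then have nn: "bary C v v' \<ge> 0" by simp
    \<comment> \<open>Otherwise a point slightly moved from the centroid of the face towards the vertex \<open>v'\<close>
      would belong to both elements, but not to their common face.\<close>
    define B where "B = (\<Sum>w\<in>C. \<bar>bary C w v'\<bar>)"
    have B: "\<bar>bary C w v'\<bar> \<le> B" if "w \<in> C" for w
      unfolding B_def using that C.fin by (intro member_le_sum) auto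
    then have B0: "B \<ge> 0" using v(1) by (metis abs_ge_zero insertI1 order_trans)
    \<comment> \<open>At the centroid \<open>m\<close> the coordinates belonging to \<open>F\<close>
      are 1/3, at \<open>v'\<close> they are at least \<open>- B\<close>. This \<open>e\<close>
      solves \<open>(1 - e) / 3 = e * B\<close>, so the coordinates of \<open>x\<close> stay
      nonnegative.\<close>
    define e where "e = 1 / (1 + 3 * B)"
    have e: "0 < e" "e \<le> 1" "e * (1 + 3 * B) = 1" using B0 by (auto simp: e_def)
    define m where "m = (\<Sum>w\<in>F. (1/3) *\<^sub>R w)"
    have m: "bary D u m = (\<Sum>w\<in>F. 1/3 * bary D u w)" for D u
      unfolding m_def by (rule bary_sum) (simp add: c3)
    have mF: "m \<in> convex hull F"
      unfolding m_def by (rule convex_sum[OF finF convex_convex_hull]) (auto simp: c3 hull_inc)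
    define x where "x = (1 - e) *\<^sub>R m + e *\<^sub>R v'"
    have "x \<in> convex hull C"
      unfolding C.mem_tet
    proof
      fix w assume w: "w \<in> C"
      show "0 \<le> bary C w x"
      proof (cases "w = v")
        case True
        have "bary C v m = 0" using C.bary_on_face[of F v m] v mF by auto
        then show ?thesis using True nn e by (simp add: x_def bary_comb2)
      next
        case False
        then have wF: "w \<in> F" using w v(1) by auto
        have "(\<Sum>u\<in>F. 1/3 * bary C w u) = (\<Sum>u\<in>F. if u = w then 1/3 else 0)"
        proof (intro sum.cong refl)
          fix u assume "u \<in> F"
          then have "u \<in> C" using v(1) by simp
          then show "1/3 * bary C w u = (if u = w then 1/3 else 0)" by (simp add: C.bary_vertex[OF w])
        qed
        then have "bary C w m = 1/3" using m wF finF by simp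
        then have "bary C w x = (1 - e) / 3 + e * bary C w v'" by (simp add: x_def bary_comb2)
        moreover have "e * bary C w v' \<ge> - (e * B)"
        proof -
          have "e * (- bary C w v') \<le> e * B" using B[OF w] e(1) by (intro mult_left_mono) auto
          then show ?thesis by simp
        qed
        moreover have "(1 - e) / 3 = e * B" using e(3) by (simp add: algebra_simps)
        ultimately show ?thesis by simp
      qed
    qed
    moreover have "x \<in> convex hull C'"
      unfolding x_def
    proof (rule convexD[OF convex_convex_hull])
      show "m \<in> convex hull C'" using mF hull_mono[of F C'] v(2) by blast
      show "v' \<in> convex hull C'" using v(2) by (simp add: hull_inc)
    qed (use e in auto)
    ultimately have "x \<in> convex hull F" using conf[OF C(1,2)] v(6) by blast
    then have "bary C' v' x = 0" "bary C' v' m = 0" using C'.bary_on_face[of F v'] v mF by auto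
    moreover have "bary C' v' v' = 1" using v(2) by (intro C'.bary_self) simp
    ultimately show False using e by (simp add: x_def bary_comb2)
  qed
  have b: "face_base F \<in> F" using face_base_in[OF c3] .
  have "face_normal F \<bullet> (v - face_base F) \<noteq> 0"
    using C.normal_nonzero[of v "face_base F"] v CvF b by auto
  moreover have "bary C v v' = (face_normal F \<bullet> (v' - face_base F)) / (face_normal F \<bullet> (v - face_base F))"
    by (simp add: bary_def bary_grad_def CvF)
  moreover have "side C F = sgn (face_normal F \<bullet> (v - face_base F))"
    using v b c3 by (intro side_eq C.card4) auto
  moreover have "side C' F = sgn (face_normal F \<bullet> (v' - face_base F))"
    using v b c3 by (intro side_eq C'.card4) auto
  ultimately show ?thesis
    using neg by (auto simp: sgn_if divide_less_0_iff)
qed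

lemma side_pmM: "C \<in> M \<Longrightarrow> F \<in> faces C \<Longrightarrow> side C F = 1 \<or> side C F = - 1"
  using tetrahedron.side_pm tet by blast

text \<open>Three elements at one face would have pairwise opposite values of \<open>side\<close>,
  but only the two values 1 and -1 exist.\<close>

lemma two_elements:
  assumes "C \<in> M" "C' \<in> M" "C \<noteq> C'" "F \<in> faces C" "F \<in> faces C'"
  shows "{D\<in>M. F \<in> faces D} = {C, C'}"
proof -
  have "D = C \<or> D = C'" if "D \<in> M" "F \<in> faces D" for D
  proof (rule ccontr)
    assume "\<not> ?thesis"
    then have "side D F = - side C F" "side D F = - side C' F" "side C' F = - side C F"
      using side_opposite assms that by metis+
    then show False using side_pmM[OF assms(1,4)] by auto
  qed
  then show ?thesis using assms by auto
qed

definition all_faces :: "(real^3) set set" where "all_faces = (\<Union>C\<in>M. faces C)"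

lemma finite_faces: "C \<in> M \<Longrightarrow> finite (faces C)"
  using faces_Diff[OF card4M] tetrahedron.fin[OF tet] by simp

lemma finite_all_faces: "finite all_faces"
  unfolding all_faces_def using finM finite_faces by blast

lemma sum_faces_swap:
  fixes h :: "(real^3) set \<Rightarrow> (real^3) set \<Rightarrow> real"
  assumes "B \<subseteq> M"
  shows "(\<Sum>C\<in>B. \<Sum>F\<in>faces C. h C F) = (\<Sum>F\<in>all_faces. \<Sum>C\<in>{C\<in>B. F \<in> faces C}. h C F)"
proof -
  have "finite B" using assms finM finite_subset by blast
  have "(\<Sum>C\<in>B. \<Sum>F\<in>faces C. h C F) = (\<Sum>C\<in>B. \<Sum>F\<in>{F\<in>all_faces. F \<in> faces C}. h C F)"
    using assms by (intro sum.cong refl) (auto simp: all_faces_def)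
  also have "\<dots> = (\<Sum>F\<in>all_faces. \<Sum>C\<in>{C\<in>B. F \<in> faces C}. h C F)"
    by (rule sum.swap_restrict[OF \<open>finite B\<close> finite_all_faces])
  finally show ?thesis .
qed

text \<open>If no face of the elements of \<open>B\<close> were exposed, the divergence theorem for a coordinate
  function would give volume zero.\<close>

lemma no_exposed_face_imp_empty:
  assumes B: "B \<subseteq> M" and ex: "\<And>C F. C \<in> B \<Longrightarrow> F \<in> faces C \<Longrightarrow> \<exists>C'\<in>B. C' \<noteq> C \<and> F \<in> faces C'"
  shows "B = {}"
proof (rule ccontr)
  assume "B \<noteq> {}"
  let ?e = "axis 1 1 :: real^3"
  let ?f = "\<lambda>x::real^3. ?e \<bullet> x"
  have "integral (convex hull C) (\<lambda>x. ?e \<bullet> ?e) = - (\<Sum>F\<in>faces C. side C F * (face_normal F \<bullet> ?e) * face_integral F ?f)"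
    if "C \<in> B" for C
    using that B by (intro integral_tet_grad) (auto intro!: derivative_eq_intros card4M simp: indepM)
  then have "(\<Sum>C\<in>B. integral (convex hull C) (\<lambda>x. ?e \<bullet> ?e))
      = - (\<Sum>C\<in>B. \<Sum>F\<in>faces C. side C F * (face_normal F \<bullet> ?e) * face_integral F ?f)"
    by (simp add: sum_negf)
  also have "\<dots> = - (\<Sum>F\<in>all_faces. \<Sum>C\<in>{C\<in>B. F \<in> faces C}. side C F * (face_normal F \<bullet> ?e) * face_integral F ?f)"
    by (simp only: sum_faces_swap[OF B])
  also have "\<dots> = 0"
  proof -
    \<comment> \<open>Either no element of \<open>B\<close> has the face, or exactly two have it,
      with opposite \<open>side\<close>.\<close>
    have "(\<Sum>C\<in>{C\<in>B. F \<in> faces C}. side C F * k) = 0" for F k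
    proof (cases "{C\<in>B. F \<in> faces C} = {}")
      case False
      then obtain C where C: "C \<in> B" "F \<in> faces C" by blast
      then obtain C' where C': "C' \<in> B" "C' \<noteq> C" "F \<in> faces C'" using ex by blast
      have "{C\<in>B. F \<in> faces C} = {C, C'}"
        using two_elements[of C C' F] C C' B by blast
      moreover have "side C' F = - side C F" using side_opposite[of C C' F] C C' B by blast
      ultimately show ?thesis using C' by (simp add: sum.insert)
    qed (simp only: sum.empty)
    then show ?thesis by (simp add: mult.assoc)
  qed
  finally have "(\<Sum>C\<in>B. integral (convex hull C) (\<lambda>x. ?e \<bullet> ?e)) = 0" .
  moreover have "integral (convex hull C) (\<lambda>x. ?e \<bullet> ?e) > 0" if "C \<in> B" for C
  proof -
    interpret tetrahedron C using tet that B by blast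
    show ?thesis
      using measure_tet_pos lmeasure_integral[OF lmeasurable_compact[OF compact_tet]] by (simp add: inner_axis)
  qed
  moreover have "finite B" using B finM finite_subset by blast
  ultimately show False using \<open>B \<noteq> {}\<close> sum_pos by (metis (no_types, lifting) less_irrefl)
qed

end

section \<open>Smooth functions\<close>

definition smooth :: "(real^3 \<Rightarrow> real) \<Rightarrow> bool" where
  "smooth f \<longleftrightarrow> (\<forall>k. Ck k f)"

lemma partial_deriv_eq:
  assumes "(f has_derivative f') (at x)" shows "partial_deriv i f x = f' (axis i 1)"
  unfolding partial_deriv_def using frechet_derivative_at[OF assms] by simp

lemma Ck_SucD: "Ck (Suc k) f \<Longrightarrow> Ck k f"
proof (induction k arbitrary: f)
  case 0 then show ?case by (simp add: differentiable_imp_continuous_on)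
next
  case (Suc k)
  then show ?case by (metis Ck.simps(2))
qed

lemma Ck_differentiable: "Ck (Suc k) f \<Longrightarrow> (f has_derivative frechet_derivative f (at x)) (at x)"
  by (simp add: differentiable_on_def frechet_derivative_works)

lemma partial_deriv_add:
  assumes "Ck (Suc k) f" "Ck (Suc l) g"
  shows "partial_deriv i (\<lambda>x. f x + g x) = (\<lambda>x. partial_deriv i f x + partial_deriv i g x)"
  using partial_deriv_eq[OF has_derivative_add[OF Ck_differentiable[OF assms(1)] Ck_differentiable[OF assms(2)]]]
  by (auto simp: partial_deriv_def)

lemma partial_deriv_mult:
  assumes "Ck (Suc k) f" "Ck (Suc l) g"
  shows "partial_deriv i (\<lambda>x. f x * g x) = (\<lambda>x. f x * partial_deriv i g x + partial_deriv i f x * g x)"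
  using partial_deriv_eq[OF has_derivative_mult[OF Ck_differentiable[OF assms(1)] Ck_differentiable[OF assms(2)]]]
  by (auto simp: partial_deriv_def)

lemma Ck_add: "Ck k f \<Longrightarrow> Ck k g \<Longrightarrow> Ck k (\<lambda>x. f x + g x)"
proof (induction k arbitrary: f g)
  case 0 then show ?case by (simp add: continuous_on_add)
next
  case (Suc k)
  show ?case using Suc.prems Suc.IH partial_deriv_add[OF Suc.prems]
    by (auto intro: differentiable_on_add)
qed

lemma Ck_mult: "Ck k f \<Longrightarrow> Ck k g \<Longrightarrow> Ck k (\<lambda>x. f x * g x)"
proof (induction k arbitrary: f g)
  case 0 then show ?case by (simp add: continuous_on_mult)
next
  case (Suc k)
  have "Ck k (\<lambda>x. f x * partial_deriv i g x + partial_deriv i f x * g x)" for i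
    using Suc.prems Ck_SucD by (intro Ck_add Suc.IH) auto
  then show ?case using Suc.prems partial_deriv_mult[OF Suc.prems]
    by (auto intro: differentiable_on_mult)
qed

lemma Ck_const: "Ck k (\<lambda>x. c)"
proof (induction k arbitrary: c)
  case (Suc k)
  have "partial_deriv i (\<lambda>x. c) = (\<lambda>x. 0)" for i
    using partial_deriv_eq[OF has_derivative_const] by auto
  then show ?case using Suc by simp
qed simp

lemma smooth_const: "smooth (\<lambda>x. c)" by (simp add: smooth_def Ck_const)
lemma smooth_add: "smooth f \<Longrightarrow> smooth g \<Longrightarrow> smooth (\<lambda>x. f x + g x)" by (simp add: smooth_def Ck_add)
lemma smooth_mult: "smooth f \<Longrightarrow> smooth g \<Longrightarrow> smooth (\<lambda>x. f x * g x)" by (simp add: smooth_def Ck_mult)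

lemma smooth_prod: "finite A \<Longrightarrow> (\<And>a. a \<in> A \<Longrightarrow> smooth (f a)) \<Longrightarrow> smooth (\<lambda>x. \<Prod>a\<in>A. f a x)"
proof (induction A rule: finite_induct)
  case empty show ?case using smooth_const[of 1] by simp
next
  case (insert a A)
  then show ?case using smooth_mult[of "f a" "\<lambda>x. \<Prod>a\<in>A. f a x"] by simp
qed

lemma smooth_sum: "finite A \<Longrightarrow> (\<And>a. a \<in> A \<Longrightarrow> smooth (f a)) \<Longrightarrow> smooth (\<lambda>x. \<Sum>a\<in>A. f a x)"
proof (induction A rule: finite_induct)
  case empty show ?case using smooth_const[of 0] by simp
next
  case (insert a A)
  then show ?case using smooth_add[of "f a" "\<lambda>x. \<Sum>a\<in>A. f a x"] by simp
qed

lemma smooth_power: "smooth f \<Longrightarrow> smooth (\<lambda>x. f x ^ n)"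
proof (induction n)
  case 0 show ?case using smooth_const[of 1] by simp
next
  case (Suc n)
  then show ?case using smooth_mult[of f "\<lambda>x. f x ^ n"] by simp
qed

text \<open>Differentiating once passes from \<open>h n\<close> to \<open>h (Suc n)\<close>, so the
  induction on \<open>k\<close> has to run over all members of a sequence of successive derivatives
  at once.\<close>

lemma Ck_compose_affine:
  assumes "\<And>n t. (h n has_real_derivative h (Suc n) t) (at t)"
  shows "Ck k (\<lambda>x. h n (c + g \<bullet> x))"
proof (induction k arbitrary: n)
  case 0
  have "continuous_on UNIV (h n)"
    by (rule DERIV_continuous_on) (rule assms)
  then show ?case by (auto intro!: continuous_on_compose2[of UNIV "h n"] continuous_intros)
next
  case (Suc k)
  have d: "((\<lambda>x. h n (c + g \<bullet> x)) has_derivative (\<lambda>v. h (Suc n) (c + g \<bullet> x) * (g \<bullet> v))) (at x)" for x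
    by (rule has_derivative_eq_rhs[OF DERIV_compose_FDERIV[OF assms]])
       (auto intro!: derivative_eq_intros)
  have "partial_deriv i (\<lambda>x. h n (c + g \<bullet> x)) = (\<lambda>x. h (Suc n) (c + g \<bullet> x) * (g $ i))" for i
    using partial_deriv_eq[OF d] by (auto simp: inner_axis)
  moreover have "Ck k (\<lambda>x. h (Suc n) (c + g \<bullet> x) * (g $ i))" for i
    by (intro Ck_mult Ck_const Suc.IH)
  ultimately show ?case using d by (auto simp: differentiable_on_def differentiable_def)
qed

lemma smooth_affine: "smooth (\<lambda>x. c + g \<bullet> x)"
proof -
  let ?h = "\<lambda>n t::real. if n = 0 then t else if n = Suc 0 then 1 else 0"
  have "((?h n) has_real_derivative ?h (Suc n) t) (at t)" for n t
    by (cases "n = 0") (auto intro!: derivative_eq_intros)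
  from Ck_compose_affine[of ?h _ 0, OF this] show ?thesis by (simp add: smooth_def)
qed

lemma smooth_coord: "smooth (\<lambda>x. x $ i)"
  using smooth_affine[of 0 "axis i 1"] by (simp add: inner_axis inner_commute)

lemma smooth_gradient:
  assumes "smooth f"
  shows "(f has_derivative (\<lambda>h. gradient f x \<bullet> h)) (at x)" and "continuous_on UNIV (gradient f)"
proof -
  have c: "Ck (Suc 0) f" using assms by (simp add: smooth_def)
  note d = Ck_differentiable[OF c, of x]
  have "frechet_derivative f (at x) h = gradient f x \<bullet> h" for h
  proof -
    interpret linear "frechet_derivative f (at x)" using has_derivative_linear[OF d] .
    have "h = (\<Sum>i\<in>UNIV. h $ i *\<^sub>R axis i 1)"
      by (simp add: vec_eq_iff axis_def if_distrib cong: if_cong)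
    then have "frechet_derivative f (at x) h = (\<Sum>i\<in>UNIV. h $ i *\<^sub>R frechet_derivative f (at x) (axis i 1))"
      by (metis (no_types, lifting) scale sum sum.cong)
    then show ?thesis by (simp add: gradient_def partial_deriv_def inner_vec_def mult.commute)
  qed
  then show "(f has_derivative (\<lambda>h. gradient f x \<bullet> h)) (at x)" using d by presburger
  have "continuous_on UNIV (partial_deriv i f)" for i using c by simp
  then show "continuous_on UNIV (gradient f)"
    unfolding gradient_def[abs_def] by (subst continuous_on_componentwise) (auto simp: Basis_vec_def inner_axis)
qed

text \<open>The functions P(1/t) exp(-1/t), extended by zero to t \<le> 0, form a class closed under
  differentiation. This makes exp(-1/t) smooth across 0 without computing its derivatives one by
  one.\<close>

definition exp_poly :: "real poly \<Rightarrow> real \<Rightarrow> real" where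
  "exp_poly P t = (if t > 0 then poly P (1/t) * exp (- 1/t) else 0)"

lemma power_le_exp: "0 \<le> s \<Longrightarrow> s ^ m \<le> fact m * exp (s::real)"
proof -
  assume "0 \<le> s"
  have "(\<Sum>n\<in>{m}. s ^ n /\<^sub>R fact n) \<le> exp s"
    unfolding exp_def using \<open>0 \<le> s\<close> by (intro sum_le_suminf summable_exp_generic) auto
  then show ?thesis by (simp add: field_simps)
qed

lemma poly_exp_bound: "\<exists>K. \<forall>s>0. \<bar>poly P s\<bar> * s ^ m * exp (- s) \<le> (K::real)"
proof (induction P arbitrary: m)
  case 0
  then show ?case by auto
next
  case (pCons a P)
  obtain K where K: "\<forall>s>0. \<bar>poly P s\<bar> * s ^ Suc m * exp (- s) \<le> K" using pCons.IH by blast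
  have "\<bar>poly (pCons a P) s\<bar> * s ^ m * exp (- s) \<le> \<bar>a\<bar> * fact m + K" if "s > 0" for s
  proof -
    have "s ^ m * exp (- s) \<le> fact m"
      using power_le_exp[of s m] that by (simp add: exp_minus field_simps)
    then have "\<bar>a\<bar> * (s ^ m * exp (- s)) \<le> \<bar>a\<bar> * fact m" by (intro mult_left_mono) auto
    moreover have "\<bar>poly P s\<bar> * s ^ Suc m * exp (- s) \<le> K" using K that by blast
    moreover have "\<bar>poly (pCons a P) s\<bar> * (s ^ m * exp (- s)) \<le> (\<bar>a\<bar> + s * \<bar>poly P s\<bar>) * (s ^ m * exp (- s))"
      using that by (intro mult_right_mono) (auto simp: abs_mult intro: order_trans[OF abs_triangle_ineq])
    ultimately show ?thesis by (simp add: algebra_simps)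
  qed
  then show ?case by blast
qed

text \<open>With s = 1/t, the derivative of P(s) exp(-s) in t is s^2 (P(s) - P'(s)) exp(-s), and
  \<open>[:0,0,1:]\<close> is the polynomial s^2.\<close>

lemma exp_poly_deriv:
  "(exp_poly P has_real_derivative exp_poly ([:0,0,1:] * (P - pderiv P)) t) (at t)"
proof -
  consider "t > 0" | "t < 0" | "t = 0" by linarith
  then show ?thesis
  proof cases
    case 1
    have "((\<lambda>t. poly P (1/t) * exp (- 1/t)) has_real_derivative exp_poly ([:0,0,1:] * (P - pderiv P)) t) (at t)"
      using 1 by (auto intro!: derivative_eq_intros DERIV_chain'[OF _ poly_DERIV] simp: exp_poly_def field_simps power2_eq_square)
    then show ?thesis
      by (rule has_field_derivative_transform_within_open[where S = "{0<..}"]) (use 1 in \<open>auto simp: exp_poly_def\<close>)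
  next
    case 2
    have "((\<lambda>t. 0) has_real_derivative 0) (at t)" by simp
    then have "(exp_poly P has_real_derivative 0) (at t)"
      by (rule has_field_derivative_transform_within_open[where S = "{..<0}"]) (use 2 in \<open>auto simp: exp_poly_def\<close>)
    then show ?thesis using 2 by (simp add: exp_poly_def)
  next
    case 3
    \<comment> \<open>The difference quotient at 0 is P(s) s exp(-s) with s = 1/h. A bound on P(s)
      s^2 exp(-s) therefore makes it at most K times h.\<close>
    obtain K where K: "\<And>s. s > 0 \<Longrightarrow> \<bar>poly P s\<bar> * s ^ 2 * exp (- s) \<le> K"
      using poly_exp_bound[of P 2] by blast
    have K0: "K \<ge> 0" using K[of 1] by (smt (verit) exp_ge_zero mult_nonneg_nonneg zero_le_power2 abs_ge_zero)
    have b: "norm (exp_poly P h / h) \<le> K * \<bar>h\<bar>" for h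
    proof (cases "h > 0")
      case True
      then show ?thesis using K[of "1/h"] by (simp add: exp_poly_def abs_mult field_simps power2_eq_square)
    qed (use K0 in \<open>simp add: exp_poly_def mult_nonneg_nonpos\<close>)
    have "((\<lambda>h. exp_poly P h / h) \<longlongrightarrow> 0) (at 0)"
      by (rule Lim_null_comparison[where g = "\<lambda>h. K * \<bar>h\<bar>"]) (use b in \<open>auto intro!: tendsto_eq_intros\<close>)
    then show ?thesis unfolding 3 DERIV_def by (simp add: exp_poly_def)
  qed
qed

text \<open>\<open>bump 0\<close> is exp(-1/t) for positive t and 0 otherwise; \<open>bump n\<close>
  is its n-th derivative.\<close>

definition bump :: "nat \<Rightarrow> real \<Rightarrow> real" where
  "bump n = exp_poly (((\<lambda>P. [:0,0,1:] * (P - pderiv P)) ^^ n) 1)"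

lemma bump_deriv: "(bump n has_real_derivative bump (Suc n) t) (at t)"
  unfolding bump_def using exp_poly_deriv by (simp only: funpow.simps o_def)

lemma bump_0: "bump 0 t = (if t > 0 then exp (- 1/t) else 0)"
  by (simp add: bump_def exp_poly_def)

lemma bump_0_bounds: "0 \<le> bump 0 t" "bump 0 t \<le> 1"
  by (auto simp: bump_0)

lemma bump_0_limit:
  assumes "s > 0" shows "(\<lambda>n. bump 0 (real n * s - 1)) \<longlonglongrightarrow> 1"
proof -
  have "filterlim (\<lambda>n. - 1 + s * real n) at_top sequentially"
    using assms by (intro filterlim_tendsto_add_at_top[OF tendsto_const]
        filterlim_tendsto_pos_mult_at_top[OF tendsto_const] filterlim_real_sequentially)
  then have lim: "filterlim (\<lambda>n. real n * s - 1) at_top sequentially" by (simp add: mult.commute)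
  have "(\<lambda>n. exp (- 1 / (real n * s - 1))) \<longlonglongrightarrow> exp 0"
    by (intro tendsto_exp tendsto_divide_0[OF tendsto_const] filterlim_at_top_imp_at_infinity lim)
  then have "(\<lambda>n. exp (- 1 / (real n * s - 1))) \<longlonglongrightarrow> 1" by simp
  moreover have "\<forall>\<^sub>F n in sequentially. exp (- 1 / (real n * s - 1)) = bump 0 (real n * s - 1)"
    using filterlim_at_top_dense[THEN iffD1, OF lim, rule_format, of 0]
    by eventually_elim (simp add: bump_0)
  ultimately show ?thesis by (rule Lim_transform_eventually)
qed

section \<open>Polynomials\<close>

abbreviation monomial :: "(3 \<Rightarrow> nat) \<Rightarrow> real^3 \<Rightarrow> real" where
  "monomial \<alpha> x \<equiv> (\<Prod>i\<in>UNIV. (x $ i) ^ \<alpha> i)"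

abbreviation exponents :: "nat \<Rightarrow> (3 \<Rightarrow> nat) set" where
  "exponents k \<equiv> {\<alpha>. (\<Sum>i\<in>UNIV. \<alpha> i) \<le> k}"

lemma finite_exponents [simp]: "finite (exponents k)"
proof (rule finite_subset)
  show "exponents k \<subseteq> PiE UNIV (\<lambda>_. {..k})"
  proof
    fix \<alpha> :: "3 \<Rightarrow> nat" assume "\<alpha> \<in> exponents k"
    then have "\<alpha> i \<le> k" for i
      using member_le_sum[of i UNIV \<alpha>] by (auto intro: order_trans)
    then show "\<alpha> \<in> PiE UNIV (\<lambda>_. {..k})" by auto
  qed
  show "finite (PiE (UNIV::3 set) (\<lambda>_. {..k}))" by (intro finite_PiE) auto
qed

lemma polysI:
  assumes "\<And>\<alpha>. c \<alpha> \<in> X" "\<And>x. p x = (\<Sum>\<alpha>\<in>exponents k. monomial \<alpha> x *\<^sub>R c \<alpha>)"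
  shows "p \<in> polys k X"
  using assms unfolding polys_def by blast

lemma polysE:
  assumes "p \<in> polys k X"
  obtains c where "\<And>\<alpha>. c \<alpha> \<in> X" "\<And>x. p x = (\<Sum>\<alpha>\<in>exponents k. monomial \<alpha> x *\<^sub>R c \<alpha>)"
  using assms unfolding polys_def by blast

lemma polys_monomial:
  assumes "subspace X" "a \<in> X" "\<alpha> \<in> exponents k"
  shows "(\<lambda>x. monomial \<alpha> x *\<^sub>R a) \<in> polys k X"
proof (rule polysI)
  show "(if \<beta> = \<alpha> then a else 0) \<in> X" for \<beta>
    using assms by (simp add: subspace_0)
  show "monomial \<alpha> x *\<^sub>R a = (\<Sum>\<beta>\<in>exponents k. monomial \<beta> x *\<^sub>R (if \<beta> = \<alpha> then a else 0))" for x
  proof -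
    have "(\<Sum>\<beta>\<in>exponents k. monomial \<beta> x *\<^sub>R (if \<beta> = \<alpha> then a else 0))
        = (\<Sum>\<beta>\<in>exponents k. if \<beta> = \<alpha> then monomial \<alpha> x *\<^sub>R a else 0)"
      by (intro sum.cong) auto
    then show ?thesis using assms(3) by (simp del: mem_Collect_eq)
  qed
qed

lemma polys_add:
  assumes "subspace X" "p \<in> polys k X" "q \<in> polys k X"
  shows "(\<lambda>x. p x + q x) \<in> polys k X"
proof -
  obtain c where c: "\<And>\<alpha>. c \<alpha> \<in> X" "\<And>x. p x = (\<Sum>\<alpha>\<in>exponents k. monomial \<alpha> x *\<^sub>R c \<alpha>)"
    using polysE[OF assms(2)] by blast
  obtain d where d: "\<And>\<alpha>. d \<alpha> \<in> X" "\<And>x. q x = (\<Sum>\<alpha>\<in>exponents k. monomial \<alpha> x *\<^sub>R d \<alpha>)"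
    using polysE[OF assms(3)] by blast
  show ?thesis
  proof (rule polysI)
    show "c \<alpha> + d \<alpha> \<in> X" for \<alpha> using assms(1) c d by (simp add: subspace_add)
    show "p x + q x = (\<Sum>\<alpha>\<in>exponents k. monomial \<alpha> x *\<^sub>R (c \<alpha> + d \<alpha>))" for x
      unfolding c(2) d(2) by (simp only: scaleR_add_right sum.distrib)
  qed
qed

lemma polys_const:
  assumes "subspace X" "a \<in> X" shows "(\<lambda>x. a) \<in> polys k X"
  using polys_monomial[OF assms, of "\<lambda>_. 0" k] by simp

lemma polys_sum:
  assumes "subspace X" "finite A" "\<And>a. a \<in> A \<Longrightarrow> p a \<in> polys k X"
  shows "(\<lambda>x. \<Sum>a\<in>A. p a x) \<in> polys k X"
  using assms(2,3)
proof (induction A rule: finite_induct)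
  case empty
  then show ?case using polys_const[OF assms(1) subspace_0[OF assms(1)]] by simp
next
  case (insert a A)
  then show ?case using polys_add[OF assms(1), of "p a" k "\<lambda>x. \<Sum>a\<in>A. p a x"] by simp
qed

lemma polys_mult:
  assumes X: "subspace X" and p: "p \<in> polys j (UNIV :: real set)" and q: "q \<in> polys k X"
  shows "(\<lambda>x. p x *\<^sub>R q x) \<in> polys (j + k) X"
proof -
  obtain c where c: "\<And>x. p x = (\<Sum>\<alpha>\<in>exponents j. monomial \<alpha> x *\<^sub>R c \<alpha>)"
    using polysE[OF p] by blast
  obtain d where d: "\<And>\<alpha>. d \<alpha> \<in> X" "\<And>x. q x = (\<Sum>\<alpha>\<in>exponents k. monomial \<alpha> x *\<^sub>R d \<alpha>)"
    using polysE[OF q] by blast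
  have eq: "p x *\<^sub>R q x = (\<Sum>\<alpha>\<in>exponents j. \<Sum>\<beta>\<in>exponents k. monomial (\<lambda>i. \<alpha> i + \<beta> i) x *\<^sub>R (c \<alpha> *\<^sub>R d \<beta>))" for x
    unfolding c d(2) scaleR_sum_left unfolding scaleR_sum_right
    by (intro sum.cong refl) (simp add: power_add prod.distrib mult_ac)
  show ?thesis unfolding eq
  proof (intro polys_sum X finite_exponents)
    fix \<alpha> \<beta> :: "3 \<Rightarrow> nat" assume "\<alpha> \<in> exponents j" "\<beta> \<in> exponents k"
    then show "(\<lambda>x. monomial (\<lambda>i. \<alpha> i + \<beta> i) x *\<^sub>R (c \<alpha> *\<^sub>R d \<beta>)) \<in> polys (j + k) X"
      using d(1) by (intro polys_monomial X) (auto simp: sum.distrib subspace_scale[OF X])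
  qed
qed

lemma polys_coord: "(\<lambda>x. x $ i) \<in> polys 1 (UNIV :: real set)"
proof -
  let ?a = "\<lambda>j. if j = i then 1 else (0::nat)"
  have "monomial ?a x = x $ i" for x
  proof -
    have "monomial ?a x = (\<Prod>j\<in>UNIV. if j = i then x $ i else 1)"
      by (intro prod.cong) auto
    then show ?thesis by simp
  qed
  then show ?thesis using polys_monomial[of UNIV "1::real" ?a 1] by simp
qed

lemma polys_affine: "(\<lambda>x. c + g \<bullet> x) \<in> polys 1 (UNIV :: real set)"
proof -
  have "(\<lambda>x. (g $ i) *\<^sub>R (x $ i)) \<in> polys (0 + 1) (UNIV::real set)" for i
    by (intro polys_mult[OF subspace_UNIV] polys_coord polys_const[OF subspace_UNIV UNIV_I])
  then have "(\<lambda>x. c + (\<Sum>i\<in>UNIV. (g $ i) *\<^sub>R (x $ i))) \<in> polys 1 (UNIV::real set)"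
    by (intro polys_add[OF subspace_UNIV] polys_sum[OF subspace_UNIV finite] polys_const[OF subspace_UNIV UNIV_I]) simp
  moreover have "(\<lambda>x. c + (\<Sum>i\<in>UNIV. (g $ i) *\<^sub>R (x $ i))) = (\<lambda>x. c + g \<bullet> x)"
    by (simp add: inner_vec_def)
  ultimately show ?thesis by simp
qed

lemma polys_smooth:
  assumes "p \<in> polys k (UNIV :: real set)" shows "smooth p"
proof -
  obtain c where c: "\<And>x. p x = (\<Sum>\<alpha>\<in>exponents k. monomial \<alpha> x *\<^sub>R c \<alpha>)"
    by (rule polysE[OF assms]) blast
  have "smooth (\<lambda>x. \<Sum>\<alpha>\<in>exponents k. monomial \<alpha> x * c \<alpha>)"
    by (rule smooth_sum[OF finite_exponents], rule smooth_mult[OF _ smooth_const], rule smooth_prod[OF finite],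
        rule smooth_power[OF smooth_coord])
  moreover have "p = (\<lambda>x. \<Sum>\<alpha>\<in>exponents k. monomial \<alpha> x * c \<alpha>)"
    by (rule ext) (simp add: c)
  ultimately show ?thesis by metis
qed

lemma polys_nth:
  assumes "q \<in> polys k (UNIV :: (real^'n) set)" shows "(\<lambda>x. q x $ i) \<in> polys k (UNIV :: real set)"
proof -
  obtain c where c: "\<And>x. q x = (\<Sum>\<alpha>\<in>exponents k. monomial \<alpha> x *\<^sub>R c \<alpha>)"
    by (rule polysE[OF assms]) blast
  show ?thesis by (rule polysI[where c = "\<lambda>\<alpha>. c \<alpha> $ i"]) (auto simp: c)
qed

text \<open>The property is closed under sums and scalar multiples, so the ten monomials of degree
  at most 2 suffice. A symmetric \<open>B\<close> is requested so that the gradient is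
  \<open>l + 2 *\<^sub>R (B *v x)\<close>.\<close>

lemma polys_quadratic:
  assumes "p \<in> polys 2 (UNIV :: real set)"
  shows "\<exists>k l B. transpose B = B \<and> (\<forall>x. p x = k + l \<bullet> x + x \<bullet> (B *v x))"
proof -
  define Q where "Q p \<longleftrightarrow> (\<exists>k l B. transpose B = B \<and> (\<forall>x. p x = k + l \<bullet> x + x \<bullet> (B *v x)))" for p :: "real^3 \<Rightarrow> real"
  have Q_add: "Q (\<lambda>x. p x + q x)" if pq: "Q p" "Q q" for p q
  proof -
    obtain k l B where 1: "transpose B = B" "\<And>x. p x = k + l \<bullet> x + x \<bullet> (B *v x)" using pq(1) unfolding Q_def by blast
    obtain k' l' B' where 2: "transpose B' = B'" "\<And>x. q x = k' + l' \<bullet> x + x \<bullet> (B' *v x)" using pq(2) unfolding Q_def by blast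
    have "transpose (B + B') = B + B'" using 1(1) 2(1) by (simp add: transpose_def vec_eq_iff)
    moreover have "\<forall>x. p x + q x = (k + k') + (l + l') \<bullet> x + x \<bullet> ((B + B') *v x)"
      using 1 2 by (simp add: inner_add_left inner_add_right matrix_vector_mult_add_rdistrib)
    ultimately show ?thesis unfolding Q_def by blast
  qed
  have Q_mult: "Q (\<lambda>x. p x * c)" if p: "Q p" for p c
  proof -
    obtain k l B where 1: "transpose B = B" "\<And>x. p x = k + l \<bullet> x + x \<bullet> (B *v x)" using p unfolding Q_def by blast
    have "transpose (c *\<^sub>R B) = c *\<^sub>R B" using 1(1) by (simp add: transpose_def vec_eq_iff)
    moreover have "\<forall>x. p x * c = (c * k) + (c *\<^sub>R l) \<bullet> x + x \<bullet> ((c *\<^sub>R B) *v x)"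
      using 1(2) by (simp add: scaleR_matrix_vector_assoc[symmetric] algebra_simps)
    ultimately show ?thesis unfolding Q_def by blast
  qed
  have t0: "transpose 0 = (0 :: real^3^3)" by (simp add: transpose_def vec_eq_iff)
  have Q_const: "Q (\<lambda>x. c)" for c
    unfolding Q_def by (rule exI[of _ c], rule exI[of _ 0], rule exI[of _ 0]) (simp add: t0)
  have Q_coord: "Q (\<lambda>x. x $ i)" for i
    unfolding Q_def by (rule exI[of _ 0], rule exI[of _ "axis i 1"], rule exI[of _ 0]) (simp add: t0 inner_axis inner_commute)
  have Q_coord2: "Q (\<lambda>x. x $ i * x $ j)" for i j
  proof -
    define B :: "real^3^3" where "B = (\<chi> r s. (if r = i \<and> s = j then 1/2 else 0) + (if r = j \<and> s = i then 1/2 else 0))"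
    have "transpose B = B" by (simp add: B_def transpose_def vec_eq_iff add.commute conj_commute)
    moreover have "\<forall>x. x $ i * x $ j = 0 + 0 \<bullet> x + x \<bullet> (B *v x)"
    proof
      fix x :: "real^3"
      have "(B *v x) $ r = (if r = i then x $ j / 2 else 0) + (if r = j then x $ i / 2 else 0)" for r
        unfolding matrix_vector_mult_def B_def
        by (simp add: distrib_right sum.distrib if_distrib[of "\<lambda>z. z * _"] cong: if_cong)
      then have "x \<bullet> (B *v x) = (\<Sum>r\<in>UNIV. (if r = i then x $ r * x $ j / 2 else 0)) + (\<Sum>r\<in>UNIV. (if r = j then x $ r * x $ i / 2 else 0))"
        unfolding inner_vec_def sum.distrib[symmetric] by (intro sum.cong) (auto simp: field_simps)
      then show "x $ i * x $ j = 0 + 0 \<bullet> x + x \<bullet> (B *v x)" by simp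
    qed
    ultimately show ?thesis unfolding Q_def by blast
  qed
  have Q_sum: "Q (\<lambda>x. \<Sum>a\<in>A. f a x)" if "finite A" "\<And>a. a \<in> A \<Longrightarrow> Q (f a)" for A :: "(3 \<Rightarrow> nat) set" and f
    using that
  proof (induction A rule: finite_induct)
    case empty then show ?case using Q_const[of 0] by simp
  next
    case (insert a A) then show ?case using Q_add[of "f a" "\<lambda>x. \<Sum>a\<in>A. f a x"] by simp
  qed
  have Q_mono: "Q (monomial \<alpha>)" if "\<alpha> \<in> exponents 2" for \<alpha>
  proof -
    have s: "\<alpha> 1 + \<alpha> 2 + \<alpha> 3 \<le> 2" using that by (simp add: sum_3)
    have m: "monomial \<alpha> = (\<lambda>x. x$1 ^ \<alpha> 1 * x$2 ^ \<alpha> 2 * x$3 ^ \<alpha> 3)"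
      unfolding UNIV_3 by (rule ext) (simp add: mult.assoc)
    have "(a,b,d) \<in> {(0,0,0),(1,0,0),(0,1,0),(0,0,1),(2,0,0),(0,2,0),(0,0,2),(1,1,0),(1,0,1),(0,1,1)}"
      if "a + b + d \<le> 2" for a b d :: nat
    proof -
      have "a \<le> 2" "b \<le> 2 - a" "d \<le> 2 - a - b" using that by auto
      moreover from this have "a = 0 \<or> a = 1 \<or> a = 2" "b = 0 \<or> b = 1 \<or> b = 2" "d = 0 \<or> d = 1 \<or> d = 2" by linarith+
      ultimately show ?thesis by (elim disjE) simp_all
    qed
    from this[OF s] show ?thesis
      unfolding m by (elim insertE emptyE Pair_inject) (simp_all add: Q_const Q_coord Q_coord2 power2_eq_square)
  qed
  obtain c where c: "\<And>x. p x = (\<Sum>\<alpha>\<in>exponents 2. monomial \<alpha> x *\<^sub>R c \<alpha>)"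
    using polysE[OF assms] by blast
  have "Q (\<lambda>x. \<Sum>\<alpha>\<in>exponents 2. monomial \<alpha> x * c \<alpha>)"
    by (intro Q_sum Q_mult Q_mono) auto
  moreover have "p = (\<lambda>x. \<Sum>\<alpha>\<in>exponents 2. monomial \<alpha> x * c \<alpha>)"
    by (rule ext) (simp add: c)
  ultimately have "Q p" by metis
  then show ?thesis unfolding Q_def .
qed

lemma subspace_sym_matrices: "subspace sym_matrices"
  by (rule subspaceI) (auto simp: sym_matrices_def transpose_def vec_eq_iff)

section \<open>Weak divergences of piecewise polynomials\<close>

text \<open>Given by strict inequalities for the coordinates, because \<open>cutoff\<close> is a
  product over exactly these conditions.\<close>

definition open_tet :: "(real^3) set \<Rightarrow> (real^3) set" where
  "open_tet C = {x. \<forall>v\<in>C. 0 < bary C v x}"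

text \<open>Nonzero only where every coordinate exceeds 1/n, hence compactly supported inside the
  open tetrahedron, and convergent to its indicator as n grows.\<close>

definition cutoff :: "(real^3) set \<Rightarrow> nat \<Rightarrow> real^3 \<Rightarrow> real" where
  "cutoff C n x = (\<Prod>v\<in>C. bump 0 (real n * bary C v x - 1))"

context tetrahedron
begin

lemma open_tet_interior: "open_tet C \<subseteq> interior (convex hull C)"
  using pos_interior by (auto simp: open_tet_def)

lemma open_open_tet: "open (open_tet C)"
proof -
  have "open_tet C = (\<Inter>v\<in>C. {x. 0 < bary C v x})" by (auto simp: open_tet_def)
  then show ?thesis by (simp add: fin open_INT open_Collect_less continuous_on_bary)
qed

lemma bary_grad_nonzero:
  assumes "v \<in> C" shows "bary_grad C v \<noteq> 0"
proof
  assume "bary_grad C v = 0"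
  then have "bary C v v = 0" by (simp add: bary_def)
  then show False using assms by simp
qed

lemma negligible_tet_diff: "negligible (convex hull C - open_tet C)"
proof (rule negligible_subset)
  show "convex hull C - open_tet C \<subseteq> (\<Union>v\<in>C. {x. bary_grad C v \<bullet> x = bary_grad C v \<bullet> face_base (C - {v})})"
    using mem_tet by (force simp: open_tet_def bary_def inner_diff_right)
  show "negligible (\<Union>v\<in>C. {x. bary_grad C v \<bullet> x = bary_grad C v \<bullet> face_base (C - {v})})"
    using fin bary_grad_nonzero by (intro negligible_Union) (auto intro: negligible_hyperplane)
qed

lemma smooth_cutoff: "smooth (cutoff C n)"
proof -
  have "smooth (\<lambda>x. bump 0 (real n * bary C v x - 1))" for v
  proof -
    have "smooth (\<lambda>x. bump 0 ((- real n * (bary_grad C v \<bullet> face_base (C - {v})) - 1) + (real n *\<^sub>R bary_grad C v) \<bullet> x))"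
      unfolding smooth_def using Ck_compose_affine[of bump, OF bump_deriv] by blast
    then show ?thesis by (simp add: bary_def inner_diff_right algebra_simps)
  qed
  from smooth_prod[OF fin this] show ?thesis unfolding cutoff_def[abs_def] .
qed

lemma cutoff_bounds: "0 \<le> cutoff C n x" "cutoff C n x \<le> 1"
  unfolding cutoff_def using bump_0_bounds by (auto intro: prod_nonneg prod_le_1)

lemma cutoff_support: "closure {x. cutoff C n x \<noteq> 0} \<subseteq> open_tet C"
proof -
  let ?S = "{x. \<forall>v\<in>C. 1 \<le> real n * bary C v x}"
  have eq: "?S = (\<Inter>v\<in>C. {x. 1 \<le> real n * bary C v x})" by blast
  have "closed ?S" unfolding eq
    by (intro closed_INT ballI closed_Collect_le continuous_on_const continuous_on_mult_left continuous_on_bary)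
  moreover have "{x. cutoff C n x \<noteq> 0} \<subseteq> ?S"
  proof (intro subsetI CollectI ballI)
    fix x v assume x: "x \<in> {x. cutoff C n x \<noteq> 0}" and v: "v \<in> C"
    have "bump 0 (real n * bary C v x - 1) \<noteq> 0"
    proof
      assume "bump 0 (real n * bary C v x - 1) = 0"
      then have "cutoff C n x = 0"
        unfolding cutoff_def by (intro prod_zero[OF fin] bexI[OF _ v])
      then show False using x by simp
    qed
    then show "1 \<le> real n * bary C v x" by (simp add: bump_0 split: if_splits)
  qed
  ultimately have "closure {x. cutoff C n x \<noteq> 0} \<subseteq> ?S" by (rule closure_minimal[rotated])
  moreover have "?S \<subseteq> open_tet C"
  proof
    fix x assume x: "x \<in> ?S"
    have "0 < bary C v x" if "v \<in> C" for v
    proof (rule ccontr)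
      assume "\<not> ?thesis"
      then have "real n * bary C v x \<le> 0" by (simp add: mult_nonneg_nonpos)
      then show False using x that by fastforce
    qed
    then show "x \<in> open_tet C" by (simp add: open_tet_def)
  qed
  ultimately show ?thesis by blast
qed

lemma cutoff_limit: "(\<lambda>n. cutoff C n x) \<longlonglongrightarrow> indicator (open_tet C) x"
proof (cases "x \<in> open_tet C")
  case True
  then have "(\<lambda>n. cutoff C n x) \<longlonglongrightarrow> (\<Prod>v\<in>C. 1)"
    unfolding cutoff_def by (intro tendsto_prod bump_0_limit) (auto simp: open_tet_def)
  then show ?thesis using True by simp
next
  case False
  then have "cutoff C n x = 0" for n
    using cutoff_support[of n] closure_subset[of "{x. cutoff C n x \<noteq> 0}"] by blast
  then show ?thesis using False by simp
qed

lemma cutoff_test_function: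
  assumes "open_tet C \<subseteq> \<Omega>" "smooth p"
  shows "(\<lambda>x. p x * cutoff C n x) \<in> test_functions \<Omega>"
proof -
  have s: "closure {x. p x * cutoff C n x \<noteq> 0} \<subseteq> closure {x. cutoff C n x \<noteq> 0}"
    by (rule closure_mono) auto
  have "bounded (open_tet C)"
    by (rule bounded_subset[OF compact_imp_bounded[OF compact_tet]]) (use open_tet_interior interior_subset in blast)
  then have "bounded (closure {x. p x * cutoff C n x \<noteq> 0})"
    by (rule bounded_subset) (use s cutoff_support in blast)
  then have "compact (closure {x. p x * cutoff C n x \<noteq> 0})" by (simp add: compact_eq_bounded_closed)
  then show ?thesis
    using smooth_mult[OF assms(2) smooth_cutoff, of n] s cutoff_support[of n] assms(1)
    unfolding test_functions_def smooth_def by blast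
qed

lemma lebesgue_on_tet:
  fixes f :: "real^3 \<Rightarrow> 'b::euclidean_space"
  assumes "open \<Omega>" "open_tet C \<subseteq> \<Omega>" "continuous_on UNIV f"
  shows "integrable (lebesgue_on \<Omega>) (\<lambda>x. indicator (open_tet C) x *\<^sub>R f x)"
    and "(\<integral>x. indicator (open_tet C) x *\<^sub>R f x \<partial>lebesgue_on \<Omega>) = integral (convex hull C) f"
proof -
  have \<Omega>: "\<Omega> \<inter> space lebesgue \<in> sets lebesgue" using assms(1) by (simp add: borel_open)
  have a: "f absolutely_integrable_on convex hull C"
    by (rule absolutely_integrable_continuous_compact[OF compact_tet continuous_on_subset[OF assms(3) subset_UNIV]])
  have "f absolutely_integrable_on open_tet C"
    by (rule set_integrable_subset[OF a])
       (use open_open_tet open_tet_interior interior_subset in \<open>auto simp: borel_open\<close>)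
  then have i: "integrable lebesgue (\<lambda>x. indicator (open_tet C) x *\<^sub>R f x)" by (simp add: set_integrable_def)
  have e: "indicator \<Omega> x *\<^sub>R (indicator (open_tet C) x *\<^sub>R f x) = indicator (open_tet C) x *\<^sub>R f x" for x
    using assms(2) by (auto simp: indicator_def)
  show "integrable (lebesgue_on \<Omega>) (\<lambda>x. indicator (open_tet C) x *\<^sub>R f x)"
    using i by (subst integrable_restrict_space[OF \<Omega>]) (simp only: set_integrable_def e)
  have n: "convex hull C - open_tet C \<in> null_sets lebesgue"
    using negligible_tet_diff negligible_iff_null_sets by blast
  have "(\<integral>x. indicator (open_tet C) x *\<^sub>R f x \<partial>lebesgue_on \<Omega>) = (\<integral>x. indicator (open_tet C) x *\<^sub>R f x \<partial>lebesgue)"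
    by (subst integral_restrict_space[OF \<Omega>]) (simp only: e)
  also have "\<dots> = (\<integral>x. indicator (convex hull C) x *\<^sub>R f x \<partial>lebesgue)"
  proof (rule integral_cong_AE)
    show "AE x in lebesgue. indicator (open_tet C) x *\<^sub>R f x = indicator (convex hull C) x *\<^sub>R f x"
      by (rule AE_I'[OF n]) (use open_tet_interior interior_subset in \<open>auto simp: indicator_def split: if_splits\<close>)
  qed (use i a in \<open>auto simp: set_integrable_def\<close>)
  also have "\<dots> = integral (convex hull C) f"
    using set_lebesgue_integral_eq_integral(2)[OF a] by (simp add: set_lebesgue_integral_def)
  finally show "(\<integral>x. indicator (open_tet C) x *\<^sub>R f x \<partial>lebesgue_on \<Omega>) = integral (convex hull C) f" .
qed

end

lemma face_integral_cong:
  assumes "card F = 3" "\<And>x. x \<in> convex hull F \<Longrightarrow> f x = g x"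
  shows "face_integral F f = face_integral F g"
proof -
  obtain a b c where o: "face_order F = (a,b,c)" "F = {a,b,c}" using face_order[OF assms(1)] by metis
  have "f ((1 - fst p - snd p) *\<^sub>R a + fst p *\<^sub>R b + snd p *\<^sub>R c) = g ((1 - fst p - snd p) *\<^sub>R a + fst p *\<^sub>R b + snd p *\<^sub>R c)"
    if "p \<in> tri2" for p
  proof (rule assms(2))
    show "(1 - fst p - snd p) *\<^sub>R a + fst p *\<^sub>R b + snd p *\<^sub>R c \<in> convex hull F"
      unfolding o(2) convex_hull_3 mem_Collect_eq
      by (intro exI[of _ "1 - fst p - snd p"] exI[of _ "fst p"] exI[of _ "snd p"])
         (use that in \<open>auto simp: tri2_def\<close>)
  qed
  then show ?thesis
    unfolding face_integral_def o(1) face_int_def tri_int_def split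
    by (intro Bochner_Integration.integral_cong) (auto simp: indicator_def)
qed

lemma face_integral_mult_left: "face_integral F (\<lambda>x. k * f x) = k * face_integral F f"
proof (cases "face_order F")
  case (fields a b c)
  show ?thesis
    unfolding face_integral_def fields face_int_def tri_int_def split
    by (subst integral_mult_right_zero[symmetric]) (simp add: mult_ac)
qed

lemma integrable_L2:
  fixes f :: "real^3 \<Rightarrow> 'a::euclidean_space"
  assumes "f \<in> L2_space \<Omega> X" "open \<Omega>" "bounded \<Omega>" shows "integrable (lebesgue_on \<Omega>) f"
proof -
  have "\<Omega> \<in> lmeasurable" using assms(2,3) by (simp add: lmeasurable_open)
  then interpret finite_measure "lebesgue_on \<Omega>" by (rule finite_measure_lebesgue_on)
  have "integrable (lebesgue_on \<Omega>) (\<lambda>x. 1 + (norm (f x))\<^sup>2)"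
    using assms(1) by (intro Bochner_Integration.integrable_add) (auto simp: L2_space_def)
  then show ?thesis
  proof (rule Bochner_Integration.integrable_bound)
    show "f \<in> borel_measurable (lebesgue_on \<Omega>)" using assms(1) by (simp add: L2_space_def)
    have "norm (f x) \<le> 1 + (norm (f x))\<^sup>2" for x
      using sum_power2_ge_zero[of "norm (f x) - 1" 0] by (simp add: power2_diff) (smt (verit) norm_ge_zero)
    then show "AE x in lebesgue_on \<Omega>. norm (f x) \<le> norm (1 + (norm (f x))\<^sup>2)"
      by (intro AE_I2) (smt (verit) real_norm_def zero_le_power2)
  qed
qed

text \<open>The last assumption says that a face of a single element is a boundary face. For actual
  triangulations it is derived in \<open>exposed_face_outside\<close>.\<close>

locale mesh_domain = simplicial_mesh +
  fixes \<Omega> :: "(real^3) set"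
  assumes open_domain: "open \<Omega>" and bounded_domain: "bounded \<Omega>"
    and tet_subset: "\<And>C. C \<in> M \<Longrightarrow> interior (convex hull C) \<subseteq> \<Omega>"
    and covered: "\<Omega> \<subseteq> (\<Union>C\<in>M. convex hull C)"
    and exposed: "\<And>C F. C \<in> M \<Longrightarrow> F \<in> faces C \<Longrightarrow> (\<And>C'. C' \<in> M \<Longrightarrow> F \<in> faces C' \<Longrightarrow> C' = C) \<Longrightarrow> convex hull F \<inter> \<Omega> = {}"
begin

lemma open_tet_subset: "C \<in> M \<Longrightarrow> open_tet C \<subseteq> \<Omega>"
  using tetrahedron.open_tet_interior[OF tet] tet_subset by blast

lemma open_tet_disjoint:
  assumes "C \<in> M" "C' \<in> M" "x \<in> open_tet C" "x \<in> convex hull C'" shows "C = C'"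
proof (rule ccontr)
  assume "C \<noteq> C'"
  interpret C: tetrahedron C using tet assms by blast
  interpret C': tetrahedron C' using tet assms by blast
  have "\<not> C \<subseteq> C'" using \<open>C \<noteq> C'\<close> card_subset_eq[OF C'.fin] C.card4 C'.card4 by metis
  then obtain v where v: "v \<in> C" "v \<notin> C'" by blast
  have "x \<in> convex hull (C \<inter> C')"
    using conf[OF assms(1,2)] assms(3,4) C.open_tet_interior interior_subset by blast
  then have "bary C v x = 0" using v by (intro C.bary_on_face) auto
  then show False using assms(3) v by (auto simp: open_tet_def)
qed

text \<open>On the faces the value is 0 rather than the value of one chosen side; the union of the
  faces is a null set.\<close>

definition piecewise :: "((real^3) set \<Rightarrow> real^3 \<Rightarrow> 'b::euclidean_space) \<Rightarrow> real^3 \<Rightarrow> 'b" where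
  "piecewise h x = (\<Sum>C\<in>M. indicator (open_tet C) x *\<^sub>R h C x)"

lemma piecewise_eq:
  assumes "C \<in> M" "x \<in> open_tet C" shows "piecewise h x = h C x"
proof -
  have "indicator (open_tet C') x *\<^sub>R h C' x = (if C' = C then h C x else 0)" if "C' \<in> M" for C'
    using open_tet_disjoint[OF assms(1) that assms(2)] assms(2) tetrahedron.open_tet_interior[OF tet[OF that]] interior_subset
    by (auto simp: indicator_def)
  then show ?thesis unfolding piecewise_def using finM assms(1) by simp
qed

lemma piecewise_0: "(\<And>C. C \<in> M \<Longrightarrow> x \<notin> open_tet C) \<Longrightarrow> piecewise h x = 0"
  unfolding piecewise_def by (intro sum.neutral) auto

lemma AE_in_tet: "AE x in lebesgue_on \<Omega>. \<exists>C\<in>M. x \<in> open_tet C"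
proof -
  let ?N = "\<Union>C\<in>M. convex hull C - open_tet C"
  have "negligible ?N"
    using finM tetrahedron.negligible_tet_diff[OF tet] by (intro negligible_Union) auto
  then have "AE x in lebesgue. x \<notin> ?N"
    using negligible_iff_null_sets AE_not_in by blast
  then have "AE x in lebesgue. x \<in> \<Omega> \<longrightarrow> (\<exists>C\<in>M. x \<in> open_tet C)"
    by (rule eventually_mono) (use covered in blast)
  then show ?thesis
    by (subst AE_restrict_space_iff) (use open_domain in \<open>auto simp: borel_open\<close>)
qed

lemma piecewise_integral:
  assumes "\<And>C. C \<in> M \<Longrightarrow> continuous_on UNIV (h C)"
  shows "integrable (lebesgue_on \<Omega>) (piecewise h)"
    and "(\<integral>x. piecewise h x \<partial>lebesgue_on \<Omega>) = (\<Sum>C\<in>M. integral (convex hull C) (h C))"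
proof -
  note * = tetrahedron.lebesgue_on_tet[OF tet open_domain open_tet_subset assms]
  show "integrable (lebesgue_on \<Omega>) (piecewise h)"
    unfolding piecewise_def[abs_def] using * by (intro Bochner_Integration.integrable_sum) auto
  show "(\<integral>x. piecewise h x \<partial>lebesgue_on \<Omega>) = (\<Sum>C\<in>M. integral (convex hull C) (h C))"
    unfolding piecewise_def[abs_def] using * by (subst Bochner_Integration.integral_sum) auto
qed

lemma piecewise_cases:
  obtains C where "C \<in> M" "x \<in> open_tet C" | "\<And>C. C \<in> M \<Longrightarrow> x \<notin> open_tet C"
  by blast

lemma piecewise_L2:
  assumes "\<And>C. C \<in> M \<Longrightarrow> continuous_on UNIV (h C)" "\<And>C x. C \<in> M \<Longrightarrow> h C x \<in> X"
  shows "piecewise h \<in> L2_space \<Omega> X"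
proof -
  have "(norm (piecewise h x))\<^sup>2 = piecewise (\<lambda>C x. (norm (h C x))\<^sup>2) x" for x
    by (cases rule: piecewise_cases[of x]) (simp_all add: piecewise_eq piecewise_0)
  then have "(\<lambda>x. (norm (piecewise h x))\<^sup>2) = piecewise (\<lambda>C x. (norm (h C x))\<^sup>2)" by auto
  moreover have "integrable (lebesgue_on \<Omega>) (piecewise (\<lambda>C x. (norm (h C x))\<^sup>2))"
    by (intro piecewise_integral continuous_intros assms)
  moreover have "AE x in lebesgue_on \<Omega>. piecewise h x \<in> X"
    using AE_in_tet by (rule eventually_mono) (auto simp: piecewise_eq assms)
  moreover have "piecewise h \<in> borel_measurable (lebesgue_on \<Omega>)"
    by (rule borel_measurable_integrable[OF piecewise_integral(1)[OF assms(1)]])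
  ultimately show ?thesis by (simp add: L2_space_def)
qed

text \<open>The weak divergence need not be known to be unique: polynomials times cut-off functions are
  test functions, and dominated convergence turns them into piecewise polynomials.\<close>

lemma weak_div_unique_tested:
  assumes g: "g1 \<in> L2_space \<Omega> UNIV" "g2 \<in> L2_space \<Omega> UNIV"
    and w: "has_weak_div \<Omega> \<tau> g1" "has_weak_div \<Omega> \<tau> g2"
    and p: "\<And>C i. C \<in> M \<Longrightarrow> smooth (\<lambda>x. p C x $ i)"
  shows "(\<integral>x. g1 x \<bullet> piecewise p x \<partial>lebesgue_on \<Omega>) = (\<integral>x. g2 x \<bullet> piecewise p x \<partial>lebesgue_on \<Omega>)"
    and "g \<in> L2_space \<Omega> UNIV \<Longrightarrow> integrable (lebesgue_on \<Omega>) (\<lambda>x. g x \<bullet> piecewise p x)"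
proof -
  have main: "integrable (lebesgue_on \<Omega>) (\<lambda>x. (q x * indicator (open_tet C) x) * d x $ i)
     \<and> (\<lambda>n. \<integral>x. (q x * cutoff C n x) * d x $ i \<partial>lebesgue_on \<Omega>) \<longlonglongrightarrow> (\<integral>x. (q x * indicator (open_tet C) x) * d x $ i \<partial>lebesgue_on \<Omega>)
     \<and> (\<forall>n. integrable (lebesgue_on \<Omega>) (\<lambda>x. (q x * cutoff C n x) *\<^sub>R d x))"
    if C: "C \<in> M" and q: "smooth q" and d: "d \<in> L2_space \<Omega> UNIV" for C q d i
  proof -
    interpret C: tetrahedron C using tet C by blast
    have di: "integrable (lebesgue_on \<Omega>) d" using integrable_L2[OF d open_domain bounded_domain] .
    have dm: "(\<lambda>x. d x) \<in> borel_measurable (lebesgue_on \<Omega>)" by (rule borel_measurable_integrable[OF di])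
    then have dim: "(\<lambda>x. d x $ i) \<in> borel_measurable (lebesgue_on \<Omega>)"
      using borel_measurable_inner[OF dm, of "\<lambda>_. axis i 1"] by (simp add: inner_axis)
    have cq: "continuous_on UNIV q" using q smooth_def Ck.simps(1) by blast
    have cc: "continuous_on UNIV (cutoff C n)" for n using C.smooth_cutoff smooth_def Ck.simps(1) by blast
    have qm: "q \<in> borel_measurable (lebesgue_on \<Omega>)"
      using borel_measurable_continuous_onI[OF cq] by (simp add: borel_measurable_if_lebesgue_on measurable_completion measurable_restrict_space1)
    have cm: "cutoff C n \<in> borel_measurable (lebesgue_on \<Omega>)" for n
      using borel_measurable_continuous_onI[OF cc] by (simp add: measurable_completion measurable_restrict_space1)
    have om: "(indicator (open_tet C) :: _ \<Rightarrow> real) \<in> borel_measurable (lebesgue_on \<Omega>)"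
    proof -
      have "(indicator (open_tet C) :: _ \<Rightarrow> real) \<in> borel_measurable borel"
        using C.open_open_tet by (simp add: borel_open)
      then show ?thesis by (simp add: measurable_completion measurable_restrict_space1)
    qed
    obtain B where B: "\<And>x. x \<in> convex hull C \<Longrightarrow> \<bar>q x\<bar> \<le> B"
      using compact_imp_bounded[OF compact_continuous_image[OF continuous_on_subset[OF cq subset_UNIV] C.compact_tet]]
      by (auto simp: bounded_iff)
    have oC: "x \<in> convex hull C" if "x \<in> open_tet C" for x
      using that C.open_tet_interior interior_subset by blast
    have B0: "B \<ge> 0" using B[of "\<Sum>v\<in>C. (1/4) *\<^sub>R v"] C.centroid_interior interior_subset by fastforce
    have c0: "cutoff C n x = 0" if "x \<notin> open_tet C" for n x
      using C.cutoff_support[of n] closure_subset[of "{x. cutoff C n x \<noteq> 0}"] that by blast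
    have bc: "\<bar>q x * cutoff C n x\<bar> \<le> B" for n x
    proof (cases "x \<in> open_tet C")
      case True
      then have "\<bar>q x\<bar> * \<bar>cutoff C n x\<bar> \<le> B * 1"
        using B[OF oC] C.cutoff_bounds[of n x] B0 by (intro mult_mono) auto
      then show ?thesis by (simp add: abs_mult)
    qed (use c0 B0 in simp)
    have bi: "\<bar>q x * indicator (open_tet C) x\<bar> \<le> B" for x
      using B[OF oC] B0 by (cases "x \<in> open_tet C") auto
    have dn: "integrable (lebesgue_on \<Omega>) (\<lambda>x. B * norm (d x))" using di by simp
    have 1: "\<bar>a * d x $ i\<bar> \<le> B * norm (d x)" if "\<bar>a\<bar> \<le> B" for a x
      using that mult_mono[of "\<bar>a\<bar>" B "\<bar>d x $ i\<bar>" "norm (d x)"] component_le_norm_cart[of "d x" i] B0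
      by (simp add: abs_mult)
    have "integrable (lebesgue_on \<Omega>) (\<lambda>x. (q x * indicator (open_tet C) x) * d x $ i)"
      by (rule Bochner_Integration.integrable_bound[OF dn])
         (use 1[OF bi] in \<open>auto intro!: borel_measurable_times qm om dim AE_I2 intro: order_trans[OF _ abs_ge_self]\<close>)
    moreover have "(\<lambda>n. \<integral>x. (q x * cutoff C n x) * d x $ i \<partial>lebesgue_on \<Omega>) \<longlonglongrightarrow> (\<integral>x. (q x * indicator (open_tet C) x) * d x $ i \<partial>lebesgue_on \<Omega>)"
    proof (rule integral_dominated_convergence[OF _ _ dn])
      show "AE x in lebesgue_on \<Omega>. (\<lambda>n. (q x * cutoff C n x) * d x $ i) \<longlonglongrightarrow> (q x * indicator (open_tet C) x) * d x $ i"
        by (intro AE_I2 tendsto_intros C.cutoff_limit)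
      show "AE x in lebesgue_on \<Omega>. norm ((q x * cutoff C n x) * d x $ i) \<le> B * norm (d x)" for n
        using 1[OF bc] by (intro AE_I2) simp
    qed (intro borel_measurable_times qm om dim cm)+
    moreover have "integrable (lebesgue_on \<Omega>) (\<lambda>x. (q x * cutoff C n x) *\<^sub>R d x)" for n
    proof (rule Bochner_Integration.integrable_bound[OF dn])
      show "(\<lambda>x. (q x * cutoff C n x) *\<^sub>R d x) \<in> borel_measurable (lebesgue_on \<Omega>)"
        by (intro borel_measurable_scaleR borel_measurable_times qm cm dm)
      show "AE x in lebesgue_on \<Omega>. norm ((q x * cutoff C n x) *\<^sub>R d x) \<le> norm (B * norm (d x))"
        using bc B0 by (intro AE_I2) (auto simp: abs_mult[symmetric] intro!: mult_right_mono)
    qed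
    ultimately show ?thesis by blast
  qed
  have expand: "d x \<bullet> piecewise p x = (\<Sum>C\<in>M. \<Sum>i\<in>UNIV. (p C x $ i * indicator (open_tet C) x) * d x $ i)" for d x
    unfolding piecewise_def inner_sum_right by (simp add: inner_vec_def sum_distrib_left mult_ac)
  have i1: "integrable (lebesgue_on \<Omega>) (\<lambda>x. d x \<bullet> piecewise p x)"
    and e1: "(\<integral>x. d x \<bullet> piecewise p x \<partial>lebesgue_on \<Omega>)
      = (\<Sum>C\<in>M. \<Sum>i\<in>UNIV. \<integral>x. (p C x $ i * indicator (open_tet C) x) * d x $ i \<partial>lebesgue_on \<Omega>)"
    if d: "d \<in> L2_space \<Omega> UNIV" for d
    unfolding expand using main[OF _ p d]
    by (auto simp: Bochner_Integration.integral_sum Bochner_Integration.integrable_sum)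
  show "integrable (lebesgue_on \<Omega>) (\<lambda>x. g x \<bullet> piecewise p x)" if "g \<in> L2_space \<Omega> UNIV"
    using i1 that .
  have "(\<integral>x. (p C x $ i * indicator (open_tet C) x) * g1 x $ i \<partial>lebesgue_on \<Omega>)
     = (\<integral>x. (p C x $ i * indicator (open_tet C) x) * g2 x $ i \<partial>lebesgue_on \<Omega>)" if C: "C \<in> M" for C i
  \<comment> \<open>Both integrals are limits of the same sequence: the cut-off polynomials are test
    functions, on which \<open>g1\<close> and \<open>g2\<close> have equal integrals by the
    definition of the weak divergence.\<close>
  proof (rule LIMSEQ_unique[OF main[OF C p[OF C] g(1), THEN conjunct2, THEN conjunct1]])
    note m = main[OF C p[OF C, of i] g(1)] main[OF C p[OF C, of i] g(2)]
    have eqs: "(\<integral>x. (p C x $ i * cutoff C n x) * g2 x $ i \<partial>lebesgue_on \<Omega>) = (\<integral>x. (p C x $ i * cutoff C n x) * g1 x $ i \<partial>lebesgue_on \<Omega>)" for n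
    proof -
      have t: "(\<lambda>x. p C x $ i * cutoff C n x) \<in> test_functions \<Omega>"
        using tetrahedron.cutoff_test_function[OF tet[OF C] open_tet_subset[OF C] p[OF C]] .
      have eq: "(\<integral>x. (p C x $ i * cutoff C n x) *\<^sub>R g1 x \<partial>lebesgue_on \<Omega>) = (\<integral>x. (p C x $ i * cutoff C n x) *\<^sub>R g2 x \<partial>lebesgue_on \<Omega>)"
      proof -
        have "- (\<integral>x. (p C x $ i * cutoff C n x) *\<^sub>R g1 x \<partial>lebesgue_on \<Omega>) = - (\<integral>x. (p C x $ i * cutoff C n x) *\<^sub>R g2 x \<partial>lebesgue_on \<Omega>)"
          using w(1)[unfolded has_weak_div_def, rule_format, OF t] w(2)[unfolded has_weak_div_def, rule_format, OF t]
          by (rule trans[OF sym])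
        then show ?thesis by (simp only: neg_equal_iff_equal)
      qed
      have comp: "(\<integral>x. (p C x $ i * cutoff C n x) * d x $ i \<partial>lebesgue_on \<Omega>)
          = (\<integral>x. (p C x $ i * cutoff C n x) *\<^sub>R d x \<partial>lebesgue_on \<Omega>) \<bullet> axis i 1"
        if "integrable (lebesgue_on \<Omega>) (\<lambda>x. (p C x $ i * cutoff C n x) *\<^sub>R d x)" for d
        by (subst integral_inner_left[symmetric], rule that) (simp only: inner_axis inner_real_def mult_1_right vector_scaleR_component real_scaleR_def)
      show ?thesis
        by (simp only: eq comp[OF m(1)[THEN conjunct2, THEN conjunct2, THEN spec]] comp[OF m(2)[THEN conjunct2, THEN conjunct2, THEN spec]])
    qed
    show "(\<lambda>n. \<integral>x. (p C x $ i * cutoff C n x) * g1 x $ i \<partial>lebesgue_on \<Omega>) \<longlonglongrightarrow> (\<integral>x. (p C x $ i * indicator (open_tet C) x) * g2 x $ i \<partial>lebesgue_on \<Omega>)"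
      using main[OF C p[OF C, of i] g(2), of i, THEN conjunct2, THEN conjunct1] by (simp only: eqs)
  qed
  then show "(\<integral>x. g1 x \<bullet> piecewise p x \<partial>lebesgue_on \<Omega>) = (\<integral>x. g2 x \<bullet> piecewise p x \<partial>lebesgue_on \<Omega>)"
    unfolding e1[OF g(1)] e1[OF g(2)] by simp
qed

end

lemma symmetric_dot: "transpose S = S \<Longrightarrow> x \<bullet> (S *v y) = (S *v x) \<bullet> (y :: real^3)"
  by (metis dot_lmul_matrix transpose_matrix_vector)

lemma integral_inner_const:
  fixes f :: "real^3 \<Rightarrow> real^3"
  assumes "compact S" "continuous_on S f"
  shows "integral S f \<bullet> u = integral S (\<lambda>x. f x \<bullet> u)"
  using integral_linear[OF set_lebesgue_integral_eq_integral(1)[OF absolutely_integrable_continuous_compact[OF assms]]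
      bounded_linear_inner_left[of u]]
  by (simp add: o_def)

lemma smooth_continuous: "smooth f \<Longrightarrow> continuous_on UNIV f"
  unfolding smooth_def using Ck.simps(1) by metis

lemma continuous_on_matrix_vector [continuous_intros]:
  fixes A :: "real^'n^'m"
  assumes "continuous_on S f" shows "continuous_on S (\<lambda>x. A *v f x)"
  by (rule continuous_on_compose2[OF matrix_vector_mult_linear_continuous_on[of UNIV] assms]) simp

context simplicial_mesh
begin

lemma vertex_in_tet:
  assumes "C0 \<in> M" "x \<in> C0" "C \<in> M" "x \<in> convex hull C" shows "x \<in> C"
proof (rule ccontr)
  assume "x \<notin> C"
  interpret C0: tetrahedron C0 using tet assms by blast
  have "x \<in> convex hull C0" using assms(2) by (simp add: hull_inc)
  then have "x \<in> convex hull (C0 \<inter> C)" using conf[OF assms(1,3)] assms(4) by blast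
  then have "bary C0 x x = 0" using \<open>x \<notin> C\<close> assms(2) by (intro C0.bary_on_face) auto
  then show False using assms(2) by simp
qed

abbreviation elements :: "(real^3) set set" where "elements \<equiv> (\<lambda>C. convex hull C) ` M"

text \<open>The inverse of \<open>convex hull\<close> on elements and on their faces, needed to
  return from closed sets to vertex sets.\<close>

definition vertex_set :: "(real^3) set \<Rightarrow> (real^3) set" where
  "vertex_set K = {x. x extreme_point_of K}"

lemma vertex_set_hull: "C \<in> M \<Longrightarrow> vertex_set (convex hull C) = C"
  using extreme_point_of_convex_hull_affine_independent[OF indepM] by (auto simp: vertex_set_def)

lemma mesh_vertices_elements: "mesh_vertices elements = \<Union>M"
  using extreme_point_of_convex_hull_affine_independent[OF indepM] by (auto simp: mesh_vertices_def)

end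

section \<open>Test fields \<open>w S\<close> and their weak divergence\<close>

context mesh_domain
begin

text \<open>At a shared face the two contributions have equal normal components and opposite
  \<open>side\<close>, so they cancel; at an exposed face the test function vanishes.\<close>

lemma face_sum_zero:
  assumes S: "\<And>C. C \<in> M \<Longrightarrow> transpose (S C) = S C"
    and compat: "\<And>C C' F x. C \<in> M \<Longrightarrow> C' \<in> M \<Longrightarrow> C \<noteq> C' \<Longrightarrow> F \<in> faces C \<Longrightarrow> F \<in> faces C' \<Longrightarrow> x \<in> convex hull F \<Longrightarrow>
      w C x *\<^sub>R (S C *v face_normal F) = w C' x *\<^sub>R (S C' *v face_normal F)"
    and \<phi>: "\<And>x. x \<notin> \<Omega> \<Longrightarrow> \<phi> x = 0"
  shows "(\<Sum>C\<in>M. \<Sum>F\<in>faces C. side C F * (face_normal F \<bullet> (S C *v u)) * face_integral F (\<lambda>x. w C x * \<phi> x)) = 0"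
proof -
  define h where "h C F = face_integral F (\<lambda>x. ((w C x *\<^sub>R (S C *v face_normal F)) \<bullet> u) * \<phi> x)" for C F
  have h: "side C F * (face_normal F \<bullet> (S C *v u)) * face_integral F (\<lambda>x. w C x * \<phi> x) = side C F * h C F" if "C \<in> M" for C F
    unfolding h_def symmetric_dot[OF S[OF that]] mult.assoc face_integral_mult_left[symmetric] by (simp add: mult_ac)
  have "(\<Sum>C\<in>{C\<in>M. F \<in> faces C}. side C F * h C F) = 0" for F
  proof (cases "{C\<in>M. F \<in> faces C} = {}")
    case False
    then obtain C where C: "C \<in> M" "F \<in> faces C" by blast
    then have c3: "card F = 3" by (simp add: faces_def)
    show ?thesis
    proof (cases "\<exists>C'\<in>M. C' \<noteq> C \<and> F \<in> faces C'")
      case True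
      then obtain C' where C': "C' \<in> M" "C' \<noteq> C" "F \<in> faces C'" by blast
      have "h C F = h C' F"
        unfolding h_def using compat[OF C(1) C'(1) C'(2)[symmetric] C(2) C'(3)] by (intro face_integral_cong[OF c3]) simp
      moreover have "side C' F = - side C F" using side_opposite C C' by metis
      ultimately show ?thesis
        using two_elements[OF C(1) C'(1) C'(2)[symmetric] C(2) C'(3)] C'(2) by simp
    next
      case False
      then have "convex hull F \<inter> \<Omega> = {}" using exposed[OF C] by blast
      then have "h C F = face_integral F (\<lambda>x. 0 * 0)"
        unfolding h_def using \<phi> by (intro face_integral_cong[OF c3]) auto
      then have "h C F = 0" unfolding face_integral_mult_left by simp
      moreover have "{C\<in>M. F \<in> faces C} = {C}" using False C by blast
      ultimately show ?thesis by simp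
    qed
  qed (simp only: sum.empty)
  then show ?thesis by (simp add: h sum_faces_swap[OF subset_refl])
qed

context
  fixes w :: "(real^3) set \<Rightarrow> real^3 \<Rightarrow> real" and S :: "(real^3) set \<Rightarrow> real^3^3"
  assumes w: "\<And>C. C \<in> M \<Longrightarrow> w C \<in> polys 3 UNIV"
    and S: "\<And>C. C \<in> M \<Longrightarrow> transpose (S C) = S C"
    and w_vertex: "\<And>C x. C \<in> M \<Longrightarrow> x \<in> C \<Longrightarrow> w C x = 0"
    and compat: "\<And>C C' F x. C \<in> M \<Longrightarrow> C' \<in> M \<Longrightarrow> C \<noteq> C' \<Longrightarrow> F \<in> faces C \<Longrightarrow> F \<in> faces C' \<Longrightarrow> x \<in> convex hull F \<Longrightarrow>
      w C x *\<^sub>R (S C *v face_normal F) = w C' x *\<^sub>R (S C' *v face_normal F)"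
begin

abbreviation "field \<equiv> piecewise (\<lambda>C x. w C x *\<^sub>R S C)"
abbreviation "field_div \<equiv> piecewise (\<lambda>C x. S C *v gradient (w C) x)"

lemma w_smooth: "C \<in> M \<Longrightarrow> smooth (w C)"
  using w polys_smooth by blast

lemma cont_w: "C \<in> M \<Longrightarrow> continuous_on A (w C)" "C \<in> M \<Longrightarrow> continuous_on A (gradient (w C))"
  using smooth_continuous[OF w_smooth] smooth_gradient(2)[OF w_smooth] continuous_on_subset by blast+

text \<open>Since \<open>S C\<close> is constant on the element, the row-wise divergence of
  \<open>w S\<close> is \<open>S\<close> applied to the gradient of \<open>w\<close>. Integration by
  parts on each element leaves face terms, which \<open>face_sum_zero\<close> cancels.\<close>

lemma field_has_weak_div: "has_weak_div \<Omega> field field_div"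
  unfolding has_weak_div_def
proof
  fix \<phi> assume "\<phi> \<in> test_functions \<Omega>"
  then have sm: "smooth \<phi>" and supp: "closure {x. \<phi> x \<noteq> 0} \<subseteq> \<Omega>" by (auto simp: test_functions_def smooth_def)
  have \<phi>0: "\<phi> x = 0" if "x \<notin> \<Omega>" for x using that supp closure_subset[of "{x. \<phi> x \<noteq> 0}"] by blast
  have c\<phi>: "continuous_on A \<phi>" "continuous_on A (gradient \<phi>)" for A
    using smooth_continuous[OF sm] smooth_gradient(2)[OF sm] continuous_on_subset by blast+
  let ?L = "\<lambda>C x. w C x *\<^sub>R (S C *v gradient \<phi> x)" and ?R = "\<lambda>C x. \<phi> x *\<^sub>R (S C *v gradient (w C) x)"
  have cL: "continuous_on A (?L C)" and cR: "continuous_on A (?R C)" if "C \<in> M" for C A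
    using that by (intro continuous_intros cont_w c\<phi>; simp)+
  have "(\<lambda>x. field x *v gradient \<phi> x) = piecewise ?L"
  proof
    fix x show "field x *v gradient \<phi> x = piecewise ?L x"
      by (cases rule: piecewise_cases[of x]) (simp_all add: piecewise_eq piecewise_0 scaleR_matrix_vector_assoc)
  qed
  moreover have "(\<lambda>x. \<phi> x *\<^sub>R field_div x) = piecewise ?R"
  proof
    fix x show "\<phi> x *\<^sub>R field_div x = piecewise ?R x"
      by (cases rule: piecewise_cases[of x]) (simp_all add: piecewise_eq piecewise_0)
  qed
  moreover have "(\<Sum>C\<in>M. integral (convex hull C) (?L C)) + (\<Sum>C\<in>M. integral (convex hull C) (?R C)) = 0" (is "?I = 0")
  proof -
    have "?I \<bullet> u = 0" for u
    proof -
      have "integral (convex hull C) (?L C) \<bullet> u + integral (convex hull C) (?R C) \<bullet> u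
        = - (\<Sum>F\<in>faces C. side C F * (face_normal F \<bullet> (S C *v u)) * face_integral F (\<lambda>x. w C x * \<phi> x))" if C: "C \<in> M" for C
      proof -
        interpret C: tetrahedron C using tet C by blast
        \<comment> \<open>The gradient of the product of \<open>w C\<close> and \<phi>. Testing with
          a constant vector \<open>u\<close> and moving the symmetric \<open>S C\<close> onto it
          leaves a scalar integration by parts.\<close>
        let ?g = "\<lambda>x. w C x *\<^sub>R gradient \<phi> x + \<phi> x *\<^sub>R gradient (w C) x"
        have "integral (convex hull C) (?L C) \<bullet> u + integral (convex hull C) (?R C) \<bullet> u
          = (integral (convex hull C) (?L C) + integral (convex hull C) (?R C)) \<bullet> u" by (simp add: inner_add_left)
        also have "integral (convex hull C) (?L C) + integral (convex hull C) (?R C) = integral (convex hull C) (\<lambda>x. ?L C x + ?R C x)"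
          by (rule Henstock_Kurzweil_Integration.integral_add[symmetric];
              intro set_lebesgue_integral_eq_integral(1) absolutely_integrable_continuous_compact C.compact_tet cL cR C)
        also have "\<dots> \<bullet> u = integral (convex hull C) (\<lambda>x. (?L C x + ?R C x) \<bullet> u)"
          by (intro integral_inner_const C.compact_tet continuous_on_add cL cR C)
        also have "(\<lambda>x. (?L C x + ?R C x) \<bullet> u) = (\<lambda>x. ?g x \<bullet> (S C *v u))"
          by (rule ext) (simp only: symmetric_dot[OF S[OF C]] inner_add_left matrix_vector_right_distrib matrix_vector_mult_scaleR inner_scaleR_left)
        also have "integral (convex hull C) (\<lambda>x. ?g x \<bullet> (S C *v u)) = - (\<Sum>F\<in>faces C. side C F * (face_normal F \<bullet> (S C *v u)) * face_integral F (\<lambda>x. w C x * \<phi> x))"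
        proof (rule integral_tet_grad[OF _ _ C.card4 C.indep])
          show "((\<lambda>x. w C x * \<phi> x) has_derivative (\<lambda>h. ?g x \<bullet> h)) (at x)" for x
            by (rule has_derivative_eq_rhs[OF has_derivative_mult[OF smooth_gradient(1)[OF w_smooth[OF C]] smooth_gradient(1)[OF sm]]])
               (simp add: inner_add_left fun_eq_iff)
          show "continuous_on UNIV ?g"
            by (intro continuous_intros cont_w c\<phi> C)
        qed
        finally show ?thesis .
      qed
      then have "?I \<bullet> u = - (\<Sum>C\<in>M. \<Sum>F\<in>faces C. side C F * (face_normal F \<bullet> (S C *v u)) * face_integral F (\<lambda>x. w C x * \<phi> x))"
        by (simp add: inner_add_left inner_sum_left sum.distrib[symmetric] sum_negf)
      also have "\<dots> = 0" unfolding neg_equal_0_iff_equal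
        by (rule face_sum_zero[where S = S and w = w and \<phi> = \<phi>, OF S compat \<phi>0])
      finally show ?thesis .
    qed
    then show ?thesis using inner_eq_zero_iff by blast
  qed
  ultimately show "(\<integral>x. field x *v gradient \<phi> x \<partial>lebesgue_on \<Omega>) = - (\<integral>x. \<phi> x *\<^sub>R field_div x \<partial>lebesgue_on \<Omega>)"
    using piecewise_integral(2)[of ?L, OF cL] piecewise_integral(2)[of ?R, OF cR]
    by (simp add: eq_neg_iff_add_eq_0)
qed

lemma field_sym: "C \<in> M \<Longrightarrow> w C x *\<^sub>R S C \<in> sym_matrices"
  using S by (simp add: sym_matrices_def transpose_def vec_eq_iff)

lemma field_Hdiv: "field \<in> Hdiv \<Omega> sym_matrices" and field_div_L2: "field_div \<in> L2_space \<Omega> UNIV"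
proof -
  show "field_div \<in> L2_space \<Omega> UNIV"
    by (intro piecewise_L2 continuous_intros cont_w) auto
  moreover have "field \<in> L2_space \<Omega> sym_matrices"
    by (intro piecewise_L2 continuous_intros cont_w field_sym)
  ultimately show "field \<in> Hdiv \<Omega> sym_matrices"
    using field_has_weak_div by (auto simp: Hdiv_def)
qed

lemma field_Sigma_h: "field \<in> Sigma_h elements \<Omega>"
proof -
  define p where "p K x = w (vertex_set K) x *\<^sub>R S (vertex_set K)" for K x
  have "elementwise_poly 3 sym_matrices elements field p"
    unfolding elementwise_poly_def
  proof
    fix K assume "K \<in> elements"
    then obtain C where C: "C \<in> M" "K = convex hull C" by blast
    interpret C: tetrahedron C using tet C by blast
    have pK: "p K = (\<lambda>x. w C x *\<^sub>R S C)" using vertex_set_hull[OF C(1)] C(2) by (simp add: p_def fun_eq_iff)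
    have "p K \<in> polys (3 + 0) sym_matrices"
      unfolding pK using S[OF C(1)]
      by (intro polys_mult w C polys_const subspace_sym_matrices) (simp add: sym_matrices_def)
    moreover have "AE x in lebesgue_on K. field x = p K x"
    proof -
      have "AE x in lebesgue. x \<notin> convex hull C - open_tet C"
        using C.negligible_tet_diff negligible_iff_null_sets AE_not_in by blast
      then have "AE x in lebesgue. x \<in> convex hull C \<longrightarrow> field x = p K x"
        by (rule eventually_mono) (auto simp: pK piecewise_eq[OF C(1)])
      then show ?thesis
        unfolding C(2) by (subst AE_restrict_space_iff) (use C.compact_tet in \<open>auto simp: lmeasurable_compact fmeasurableD\<close>)
    qed
    ultimately show "p K \<in> polys 3 sym_matrices \<and> (AE x in lebesgue_on K. field x = p K x)" by simp
  qed
  \<comment> \<open>A mesh vertex lying in an element is one of its own vertices, where the factor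
    is 0. Thus the values of all elements at a vertex agree.\<close>
  moreover have "p K x = 0" if "x \<in> mesh_vertices elements" "K \<in> elements" "x \<in> K" for K x
  proof -
    from that(2) obtain C where C: "C \<in> M" "K = convex hull C" by blast
    then have "x \<in> C" using vertex_in_tet that unfolding mesh_vertices_elements by blast
    then show ?thesis using w_vertex C vertex_set_hull[OF C(1)] by (simp add: p_def)
  qed
  ultimately show ?thesis
    unfolding Sigma_h_def using field_Hdiv by (auto intro!: exI[of _ p])
qed

text \<open>\<open>weak_div\<close> is some representative chosen by \<open>SOME\<close>. Under the
  integral against a piecewise polynomial it may be exchanged for the explicit
  \<open>field_div\<close>.\<close>

lemma weak_div_field:
  assumes p: "\<And>C i. C \<in> M \<Longrightarrow> smooth (\<lambda>x. p C x $ i)" and v: "v \<in> borel_measurable (lebesgue_on \<Omega>)" "AE x in lebesgue_on \<Omega>. v x = piecewise p x"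
  shows "(\<integral>x. weak_div \<Omega> field x \<bullet> v x \<partial>lebesgue_on \<Omega>)
    = (\<Sum>C\<in>M. integral (convex hull C) (\<lambda>x. (S C *v gradient (w C) x) \<bullet> p C x))"
proof -
  have "\<exists>g. g \<in> L2_space \<Omega> UNIV \<and> has_weak_div \<Omega> field g"
    using field_has_weak_div field_div_L2 by blast
  from someI_ex[OF this] have d: "weak_div \<Omega> field \<in> L2_space \<Omega> UNIV" "has_weak_div \<Omega> field (weak_div \<Omega> field)"
    unfolding weak_div_def by auto
  have cp: "continuous_on UNIV (p C)" if "C \<in> M" for C
    using smooth_continuous[OF p[OF that]]
    by (subst continuous_on_componentwise) (auto simp: Basis_vec_def inner_axis)
  have dm: "weak_div \<Omega> field \<in> borel_measurable (lebesgue_on \<Omega>)" using d(1) by (simp add: L2_space_def)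
  have "(\<integral>x. weak_div \<Omega> field x \<bullet> v x \<partial>lebesgue_on \<Omega>) = (\<integral>x. weak_div \<Omega> field x \<bullet> piecewise p x \<partial>lebesgue_on \<Omega>)"
    by (rule integral_cong_AE) (use v(2) in \<open>auto intro!: borel_measurable_inner dm v(1) borel_measurable_integrable[OF piecewise_integral(1)] cp elim: eventually_mono\<close>)
  also have "\<dots> = (\<integral>x. field_div x \<bullet> piecewise p x \<partial>lebesgue_on \<Omega>)"
    by (rule weak_div_unique_tested(1)[OF d(1) field_div_L2 d(2) field_has_weak_div p])
  also have "(\<lambda>x. field_div x \<bullet> piecewise p x) = piecewise (\<lambda>C x. (S C *v gradient (w C) x) \<bullet> p C x)"
  proof
    fix x show "field_div x \<bullet> piecewise p x = piecewise (\<lambda>C x. (S C *v gradient (w C) x) \<bullet> p C x) x"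
      by (cases rule: piecewise_cases[of x]) (simp_all add: piecewise_eq piecewise_0)
  qed
  also have "(\<integral>x. piecewise (\<lambda>C x. (S C *v gradient (w C) x) \<bullet> p C x) x \<partial>lebesgue_on \<Omega>)
      = (\<Sum>C\<in>M. integral (convex hull C) (\<lambda>x. (S C *v gradient (w C) x) \<bullet> p C x))"
    by (rule piecewise_integral(2)) (intro continuous_intros cont_w cp)
  finally show ?thesis .
qed

end

end

section \<open>Moments on faces and edges\<close>

text \<open>The integrand is a function of all three barycentric coordinates, so that the symmetries
  of the triangle act by permuting arguments.\<close>

definition bary_int :: "(real \<Rightarrow> real \<Rightarrow> real \<Rightarrow> real) \<Rightarrow> real" where
  "bary_int m = tri_int (\<lambda>p. m (1 - fst p - snd p) (fst p) (snd p))"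

definition cont3 :: "(real \<Rightarrow> real \<Rightarrow> real \<Rightarrow> real) \<Rightarrow> bool" where
  "cont3 m \<longleftrightarrow> continuous_on UNIV (\<lambda>(q::real \<times> real \<times> real). m (fst q) (fst (snd q)) (snd (snd q)))"

lemma cont3_tri2:
  assumes "cont3 m" shows "continuous_on tri2 (\<lambda>p. m (1 - fst p - snd p) (fst p) (snd p))"
  using continuous_on_compose2[OF assms[unfolded cont3_def], of tri2 "\<lambda>p. (1 - fst p - snd p, fst p, snd p)"]
  by (simp add: continuous_on_Pair continuous_on_diff continuous_on_fst continuous_on_snd continuous_on_id)

lemma bary_int_swap_bc: "cont3 m \<Longrightarrow> bary_int (\<lambda>x y z. m x z y) = bary_int m"
  using tri_int_swap[OF cont3_tri2] by (simp add: bary_int_def diff_diff_eq add.commute)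

lemma bary_int_swap_ac: "cont3 m \<Longrightarrow> bary_int (\<lambda>x y z. m z y x) = bary_int m"
  using tri_int_reflect[OF cont3_tri2] by (simp add: bary_int_def)

lemma bary_int_add:
  assumes "cont3 m" "cont3 m'"
  shows "bary_int (\<lambda>x y z. m x y z + m' x y z) = bary_int m + bary_int m'"
  using Bochner_Integration.integral_add[OF integrable_tri2[OF cont3_tri2[OF assms(1)]] integrable_tri2[OF cont3_tri2[OF assms(2)]]]
  unfolding bary_int_def tri_int_def by (simp add: distrib_left)

lemma bary_int_cmult: "bary_int (\<lambda>x y z. k * m x y z) = k * bary_int m"
  unfolding bary_int_def tri_int_def
  by (subst integral_mult_right_zero[symmetric]) (simp add: mult_ac)

text \<open>Strict positivity is asked only on a small box. There \<open>y\<close> and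
  \<open>z\<close> lie below 1/5 and hence the first coordinate above 3/5, so weights such as (x -
  z)^2 are positive on it although they vanish elsewhere.\<close>

lemma bary_int_pos:
  assumes c: "cont3 m" and nn: "\<And>x y z. 0 \<le> x \<Longrightarrow> 0 \<le> y \<Longrightarrow> 0 \<le> z \<Longrightarrow> 0 \<le> m x y z"
    and pos: "\<And>y z. 1/10 < y \<Longrightarrow> y < 1/5 \<Longrightarrow> 1/10 < z \<Longrightarrow> z < 1/5 \<Longrightarrow> 0 < m (1 - y - z) y z"
  shows "bary_int m > 0"
proof (rule ccontr)
  assume neg: "\<not> bary_int m > 0"
  let ?h = "\<lambda>p. indicator tri2 p *\<^sub>R m (1 - fst p - snd p) (fst p) (snd p)"
  have nn': "0 \<le> ?h p" for p using nn by (auto simp: indicator_def tri2_def)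
  have i: "integrable lborel ?h" by (rule integrable_tri2[OF cont3_tri2[OF c]])
  have "(\<integral>p. ?h p \<partial>lborel) \<ge> 0" using nn' by (intro Bochner_Integration.integral_nonneg)
  then have "(\<integral>p. ?h p \<partial>lborel) = 0"
    using neg by (simp add: bary_int_def tri_int_def)
  then have ae: "AE p in lborel. ?h p = 0"
    using integral_nonneg_eq_0_iff_AE[OF i] nn' by auto
  let ?B = "box (1/10,1/10) (1/5,1/5) :: (real \<times> real) set"
  have "AE p in lborel. p \<notin> ?B"
    using ae
  proof (rule eventually_mono)
    fix p assume h: "?h p = 0"
    show "p \<notin> ?B"
    proof
      assume "p \<in> ?B"
      then have p: "1/10 < fst p" "fst p < 1/5" "1/10 < snd p" "snd p < 1/5"
        by (auto simp: box_def Basis_prod_def inner_prod_def)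
      then have "p \<in> tri2" by (auto simp: tri2_def)
      then show False using h pos[OF p] by simp
    qed
  qed
  then have "?B \<in> null_sets lborel"
    by (subst AE_iff_null_sets) auto
  then have "emeasure lborel ?B = 0" by (simp add: null_sets_def)
  then show False by (simp add: emeasure_lborel_box_eq Basis_prod_def)
qed

lemmas cont3_intros = continuous_on_mult continuous_on_diff continuous_on_add continuous_on_power continuous_on_fst continuous_on_snd continuous_on_id continuous_on_const

text \<open>The face bubble is symmetric in the three coordinates. An affine function is therefore
  tested through the plain sum of its vertex values.\<close>

lemma moments_face:
  obtains k where "k > 0" "bary_int (\<lambda>x y z. x * y * z * x) = k" "bary_int (\<lambda>x y z. x * y * z * y) = k" "bary_int (\<lambda>x y z. x * y * z * z) = k"
proof -
  have c: "cont3 (\<lambda>x y z. x * y * z * x)" "cont3 (\<lambda>x y z. x * y * z * y)" unfolding cont3_def by (intro cont3_intros)+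
  have "bary_int (\<lambda>x y z. x * y * z * z) = bary_int (\<lambda>x y z. x * y * z * x)"
    using bary_int_swap_ac[OF c(1)] by (simp add: mult_ac)
  moreover have "bary_int (\<lambda>x y z. x * y * z * z) = bary_int (\<lambda>x y z. x * y * z * y)"
    using bary_int_swap_bc[OF c(2)] by (simp add: mult_ac)
  moreover have "bary_int (\<lambda>x y z. x * y * z * x) > 0"
    by (rule bary_int_pos[OF c(1)]) auto
  ultimately show ?thesis using that by metis
qed

text \<open>Equality of the first two moments is symmetry. For the inequality, the positive function
  y (x - z)^2 expands to y x^2 + y z^2 - 2 x y z, whose integral is 2 s - 2 u.\<close>

lemma moments_edge:
  obtains s u where "s \<noteq> u" "bary_int (\<lambda>x y z. x * y * x) = s" "bary_int (\<lambda>x y z. x * y * y) = s" "bary_int (\<lambda>x y z. x * y * z) = u"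
proof -
  have c: "cont3 (\<lambda>x y z. x * y * x)" "cont3 (\<lambda>x y z. x * y * y)" "cont3 (\<lambda>x y z. x * y * z)" "cont3 (\<lambda>x y z. x * z * x)" "cont3 (\<lambda>x y z. z * y * z)"
     "cont3 (\<lambda>x y z. y * x * y)" "cont3 (\<lambda>x y z. y * (x - z)^2)" "cont3 (\<lambda>x y z. -2 * (x * y * z))" "cont3 (\<lambda>x y z. x * y * x + z * y * z)"
    unfolding cont3_def by (intro cont3_intros)+
  have 1: "bary_int (\<lambda>x y z. z * y * z) = bary_int (\<lambda>x y z. x * y * x)"
    using bary_int_swap_ac[OF c(1)] by simp
  have 2: "bary_int (\<lambda>x y z. y * z * y) = bary_int (\<lambda>x y z. x * y * y)"
  proof -
    have "bary_int (\<lambda>x y z. y * z * y) = bary_int (\<lambda>x y z. z * y * z)" using bary_int_swap_bc[OF c(5)] by simp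
    also have "\<dots> = bary_int (\<lambda>x y z. x * y * x)" by (rule 1)
    also have "\<dots> = bary_int (\<lambda>x y z. x * z * x)" using bary_int_swap_bc[OF c(1)] by simp
    also have "\<dots> = bary_int (\<lambda>x y z. z * x * z)" using bary_int_swap_ac[OF c(4)] by (simp add: mult_ac)
    also have "\<dots> = bary_int (\<lambda>x y z. y * x * y)" using bary_int_swap_bc[OF c(6)] by simp
    finally show ?thesis by (simp add: mult_ac)
  qed
  have 3: "bary_int (\<lambda>x y z. x * y * y) = bary_int (\<lambda>x y z. x * y * x)"
  proof -
    have "bary_int (\<lambda>x y z. x * y * x) = bary_int (\<lambda>x y z. z * y * z)" using 1 by simp
    also have "\<dots> = bary_int (\<lambda>x y z. y * z * y)" using bary_int_swap_bc[OF c(5)] by simp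
    finally show ?thesis using 2 by simp
  qed
  have "0 < bary_int (\<lambda>x y z. y * (x - z)^2)"
    by (rule bary_int_pos[OF c(7)]) (auto intro!: mult_pos_pos)
  also have "(\<lambda>x y z. y * (x - z)^2) = (\<lambda>x y z::real. (x * y * x + z * y * z) + (- 2 * (x * y * z)))"
    by (intro ext) algebra
  also have "bary_int \<dots> = bary_int (\<lambda>x y z. x * y * x + z * y * z) + bary_int (\<lambda>x y z. - 2 * (x * y * z))"
    by (rule bary_int_add[OF c(9) c(8)])
  also have "\<dots> = 2 * bary_int (\<lambda>x y z. x * y * x) - 2 * bary_int (\<lambda>x y z. x * y * z)"
    unfolding bary_int_add[OF c(1) c(5)] bary_int_cmult 1 by simp
  finally have "bary_int (\<lambda>x y z. x * y * x) \<noteq> bary_int (\<lambda>x y z. x * y * z)" by linarith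
  then show ?thesis by (rule that[OF _ refl 3 refl])
qed

text \<open>The weight changes sign when x and y are exchanged: this kills the moment against z and
  makes the other two opposite. Their difference is the integral of x y (x - y)^2, which is
  positive.\<close>

lemma moments_edge_diff:
  obtains g where "g \<noteq> 0" "bary_int (\<lambda>x y z. x * y * (x - y) * x) = g" "bary_int (\<lambda>x y z. x * y * (x - y) * y) = - g" "bary_int (\<lambda>x y z. x * y * (x - y) * z) = 0"
proof -
  have c: "cont3 (\<lambda>x y z. x * y * (x - y) * x)" "cont3 (\<lambda>x y z. x * z * (x - z) * x)" "cont3 (\<lambda>x y z. z * x * (z - x) * z)"
    "cont3 (\<lambda>x y z. y * x * (y - x) * y)" "cont3 (\<lambda>x y z. x * y * (x - y) * y)" "cont3 (\<lambda>x y z. x * y * (x - y)^2)" "cont3 (\<lambda>x y z. - 1 * (x * y * (x - y) * y))"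
    "cont3 (\<lambda>x y z. x * y * (x - y) * z)" "cont3 (\<lambda>x y z. x * z * (x - z) * y)" "cont3 (\<lambda>x y z. z * x * (z - x) * y)"
    unfolding cont3_def by (intro cont3_intros)+
  have "bary_int (\<lambda>x y z. x * y * (x - y) * x) = bary_int (\<lambda>x y z. x * z * (x - z) * x)" using bary_int_swap_bc[OF c(1)] by simp
  also have "\<dots> = bary_int (\<lambda>x y z. z * x * (z - x) * z)" using bary_int_swap_ac[OF c(2)] by simp
  also have "\<dots> = bary_int (\<lambda>x y z. y * x * (y - x) * y)" using bary_int_swap_bc[OF c(3)] by simp
  also have "\<dots> = bary_int (\<lambda>x y z. - 1 * (x * y * (x - y) * y))" by (intro arg_cong[of _ _ bary_int] ext) algebra
  finally have 1: "bary_int (\<lambda>x y z. x * y * (x - y) * y) = - bary_int (\<lambda>x y z. x * y * (x - y) * x)"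
    unfolding bary_int_cmult by simp
  have "bary_int (\<lambda>x y z. x * y * (x - y) * z) = bary_int (\<lambda>x y z. x * z * (x - z) * y)" using bary_int_swap_bc[OF c(8)] by simp
  also have "\<dots> = bary_int (\<lambda>x y z. z * x * (z - x) * y)" using bary_int_swap_ac[OF c(9)] by simp
  also have "\<dots> = bary_int (\<lambda>x y z. y * x * (y - x) * z)" using bary_int_swap_bc[OF c(10)] by simp
  also have "\<dots> = bary_int (\<lambda>x y z. - 1 * (x * y * (x - y) * z))" by (intro arg_cong[of _ _ bary_int] ext) algebra
  finally have 2: "bary_int (\<lambda>x y z. x * y * (x - y) * z) = 0" unfolding bary_int_cmult by simp
  have "0 < bary_int (\<lambda>x y z. x * y * (x - y)^2)"
    by (rule bary_int_pos[OF c(6)]) (auto intro!: mult_pos_pos)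
  also have "(\<lambda>x y z. x * y * (x - y)^2) = (\<lambda>x y z. x * y * (x - y) * (x::real) + - 1 * (x * y * (x - y) * y))"
    by (intro ext) algebra
  also have "bary_int \<dots> = 2 * bary_int (\<lambda>x y z. x * y * (x - y) * x)"
    unfolding bary_int_add[OF c(1) c(7)] bary_int_cmult 1 by simp
  finally have "bary_int (\<lambda>x y z. x * y * (x - y) * x) \<noteq> 0" by linarith
  then show ?thesis by (rule that[OF _ refl 1 2])
qed

lemma face_int_add:
  assumes "continuous_on UNIV f" "continuous_on UNIV g"
  shows "face_int a b c (\<lambda>x. f x + g x) = face_int a b c f + face_int a b c g"
proof -
  have i: "integrable lborel (\<lambda>p. indicator tri2 p *\<^sub>R h ((1 - fst p - snd p) *\<^sub>R a + fst p *\<^sub>R b + snd p *\<^sub>R c))" if "continuous_on UNIV h" for h :: "real^3 \<Rightarrow> real"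
    by (rule integrable_tri2, rule continuous_on_compose2[OF that]) (auto intro!: continuous_intros)
  show ?thesis
    using Bochner_Integration.integral_add[OF i[OF assms(1)] i[OF assms(2)]]
    unfolding face_int_def tri_int_def by (simp add: distrib_left)
qed

lemma face_integral_add:
  assumes "continuous_on UNIV f" "continuous_on UNIV g"
  shows "face_integral F (\<lambda>x. f x + g x) = face_integral F f + face_integral F g"
  unfolding face_integral_def using face_int_add[OF assms] by (simp split: prod.split)

lemma face_integral_0: "face_integral F (\<lambda>x. 0) = 0"
  using face_integral_mult_left[of F 0 "\<lambda>x. 0"] by simp

lemma face_integral_sum:
  assumes "finite A" "\<And>a. a \<in> A \<Longrightarrow> continuous_on UNIV (f a)"
  shows "face_integral F (\<lambda>x. \<Sum>a\<in>A. f a x) = (\<Sum>a\<in>A. face_integral F (f a))"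
  using assms
proof (induction A rule: finite_induct)
  case empty then show ?case by (simp add: face_integral_0)
next
  case (insert a A)
  then show ?case using face_integral_add[of "f a" "\<lambda>x. \<Sum>a\<in>A. f a x" F] by (simp add: continuous_on_sum)
qed

text \<open>On the face an affine function is the average of its vertex values with the barycentric
  coordinates as weights, so only three moments of \<open>m\<close> enter.\<close>

lemma (in tetrahedron) face_integral_bary:
  assumes F: "{a,b,c} \<in> faces C" "a \<noteq> b" "a \<noteq> c" "b \<noteq> c" and m: "cont3 m"
    and m3: "cont3 (\<lambda>x y z. m x y z * x)" "cont3 (\<lambda>x y z. m x y z * y)" "cont3 (\<lambda>x y z. m x y z * z)"
  shows "face_integral {a,b,c} (\<lambda>x. m (bary C a x) (bary C b x) (bary C c x) * (k + g \<bullet> x))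
    = bary_int (\<lambda>x y z. m x y z * x) * (k + g \<bullet> a) + bary_int (\<lambda>x y z. m x y z * y) * (k + g \<bullet> b) + bary_int (\<lambda>x y z. m x y z * z) * (k + g \<bullet> c)"
proof -
  let ?A = "k + g \<bullet> a" and ?B = "k + g \<bullet> b" and ?C = "k + g \<bullet> c"
  have abc: "a \<in> C" "b \<in> C" "c \<in> C" using F by (auto simp: faces_def)
  let ?f = "\<lambda>x. m (bary C a x) (bary C b x) (bary C c x) * (k + g \<bullet> x)"
  have "continuous_on UNIV ?f"
  proof (intro continuous_on_mult)
    show "continuous_on UNIV (\<lambda>x. m (bary C a x) (bary C b x) (bary C c x))"
      using continuous_on_compose2[OF m[unfolded cont3_def], of UNIV "\<lambda>x. (bary C a x, bary C b x, bary C c x)"]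
      by (simp add: continuous_on_Pair continuous_on_bary)
  qed (intro continuous_intros)
  then have "face_integral {a,b,c} ?f = face_int a b c ?f" by (rule face_integral_eq[OF F(2-4)])
  also have "\<dots> = bary_int (\<lambda>x y z. m x y z * (x * ?A + y * ?B + z * ?C))"
    unfolding face_int_def bary_int_def
  proof (intro arg_cong[of _ _ tri_int] ext)
    fix p :: "real \<times> real"
    let ?x = "(1 - fst p - snd p) *\<^sub>R a + fst p *\<^sub>R b + snd p *\<^sub>R c"
    have "bary C a ?x = 1 - fst p - snd p" "bary C b ?x = fst p" "bary C c ?x = snd p"
      unfolding bary_comb3 using abc F(2-4) by (simp_all add: bary_vertex)
    moreover have "k + g \<bullet> ?x = (1 - fst p - snd p) * ?A + fst p * ?B + snd p * ?C"
      by (simp add: inner_add_right algebra_simps)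
    ultimately show "m (bary C a ?x) (bary C b ?x) (bary C c ?x) * (k + g \<bullet> ?x)
        = m (1 - fst p - snd p) (fst p) (snd p) * ((1 - fst p - snd p) * ?A + fst p * ?B + snd p * ?C)"
      by (simp only:)
  qed
  also have "\<dots> = bary_int (\<lambda>x y z. (?A * (m x y z * x) + ?B * (m x y z * y)) + ?C * (m x y z * z))"
    by (simp add: algebra_simps)
  also have "\<dots> = ?A * bary_int (\<lambda>x y z. m x y z * x) + ?B * bary_int (\<lambda>x y z. m x y z * y) + ?C * bary_int (\<lambda>x y z. m x y z * z)"
  proof -
    have "cont3 (\<lambda>x y z. ?A * (m x y z * x))" "cont3 (\<lambda>x y z. ?B * (m x y z * y))" "cont3 (\<lambda>x y z. ?C * (m x y z * z))"
      "cont3 (\<lambda>x y z. ?A * (m x y z * x) + ?B * (m x y z * y))"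
      unfolding cont3_def by (intro continuous_on_add continuous_on_mult_left m3[unfolded cont3_def])+
    then show ?thesis by (simp only: bary_int_add bary_int_cmult)
  qed
  finally show ?thesis by (simp only: mult.commute)
qed

section \<open>Rigid motions and their jumps\<close>

lemma bary_polys: "bary C v \<in> polys 1 UNIV"
proof -
  have "bary C v = (\<lambda>x. - (bary_grad C v \<bullet> face_base (C - {v})) + bary_grad C v \<bullet> x)"
    by (rule ext) (simp add: bary_def inner_diff_right)
  then show ?thesis using polys_affine[of "- (bary_grad C v \<bullet> face_base (C - {v}))" "bary_grad C v"] by (simp only:)
qed

lemma polys_mult_real: "p \<in> polys j (UNIV::real set) \<Longrightarrow> q \<in> polys k UNIV \<Longrightarrow> (\<lambda>x. p x * q x) \<in> polys (j + k) (UNIV::real set)"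
  using polys_mult[OF subspace_UNIV, of p j q k] by simp

lemma bary_prod_polys:
  assumes "f \<in> polys 1 (UNIV::real set)" shows "(\<lambda>x. bary C a x * bary C b x * f x) \<in> polys 3 UNIV"
  using polys_mult_real[OF polys_mult_real[OF bary_polys bary_polys] assms] by (simp add: eval_nat_numeral)

lemma quadratic_derivative:
  assumes "transpose B = (B::real^3^3)"
  shows "((\<lambda>x. k + l \<bullet> x + x \<bullet> (B *v x)) has_derivative (\<lambda>h. (l + 2 *\<^sub>R (B *v x)) \<bullet> h)) (at x)"
proof -
  have b: "((\<lambda>x. B *v x) has_derivative (\<lambda>h. B *v h)) (at x)"
    by (rule linear_imp_has_derivative) simp
  have "((\<lambda>x. k + l \<bullet> x + x \<bullet> (B *v x)) has_derivative (\<lambda>h. l \<bullet> h + (x \<bullet> (B *v h) + h \<bullet> (B *v x)))) (at x)"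
    by (rule has_derivative_eq_rhs, rule has_derivative_add[OF has_derivative_add[OF has_derivative_const
          has_derivative_inner_right[OF has_derivative_ident]] has_derivative_inner[OF has_derivative_ident b]]) simp
  moreover have "l \<bullet> h + (x \<bullet> (B *v h) + h \<bullet> (B *v x)) = (l + 2 *\<^sub>R (B *v x)) \<bullet> h" for h
    using symmetric_dot[OF assms, of x h] by (simp add: inner_add_left inner_add_right inner_commute)
  ultimately show ?thesis by simp
qed

section \<open>Quadratics and rigid motions on one element\<close>

context tetrahedron
begin

lemma orth_edges_zero:
  assumes "a \<in> C" "\<And>v. v \<in> C \<Longrightarrow> g \<bullet> (v - a) = 0" shows "g = 0"
  by (rule affine_zero(1)[of "- (g \<bullet> a)"]) (use assms(2) in \<open>simp add: inner_diff_right\<close>)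

text \<open>Polarisation: \<open>v - w\<close> is the difference of \<open>v - a\<close> and
  \<open>w - a\<close>, so the symmetrised bilinear form vanishes on all pairs of edges at
  \<open>a\<close>, which span the space.\<close>

lemma edge_quadratic_zero:
  fixes A :: "real^3^3"
  assumes "\<And>v w. v \<in> C \<Longrightarrow> w \<in> C \<Longrightarrow> (v - w) \<bullet> (A *v (v - w)) = 0"
  shows "transpose A = - A"
proof -
  obtain a where a: "a \<in> C" using card4 by fastforce
  let ?N = "A + transpose A"
  have N: "s \<bullet> (?N *v t) = s \<bullet> (A *v t) + t \<bullet> (A *v s)" for s t
    by (simp add: matrix_vector_mult_add_rdistrib inner_add_right)
       (metis dot_lmul_matrix inner_commute transpose_matrix_vector)
  have 0: "(v - a) \<bullet> (?N *v (w - a)) = 0" if v: "v \<in> C" and w: "w \<in> C" for v w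
  proof -
    have "(v - a) - (w - a) = v - w" by simp
    then have "((v - a) - (w - a)) \<bullet> (A *v ((v - a) - (w - a))) = 0" using assms[OF v w] by simp
    then show ?thesis
      unfolding N using assms[OF v a] assms[OF w a]
      by (simp add: matrix_vector_mult_diff_distrib inner_diff_left inner_diff_right algebra_simps)
  qed
  have 1: "?N *v (w - a) = 0" if "w \<in> C" for w
    by (rule orth_edges_zero[OF a]) (use 0[OF _ that] in \<open>simp add: inner_commute\<close>)
  have "?N $ i = 0" for i
  proof (rule orth_edges_zero[OF a])
    fix w assume "w \<in> C"
    then have "(?N *v (w - a)) $ i = 0" using 1 by simp
    then show "?N $ i \<bullet> (w - a) = 0" by (simp only: matrix_vector_mul_component)
  qed
  then have "?N = 0" by (simp add: vec_eq_iff)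
  then show ?thesis by (metis add_eq_0_iff)
qed

text \<open>The trace of \<open>S ** W\<close> vanishes for symmetric \<open>S\<close> and skew
  \<open>W\<close>. Hence for a rigid motion p the integrand is the full divergence of w S p, and
  only face terms survive.\<close>

lemma rigid_divergence:
  assumes W: "transpose W = - W" and S: "transpose S = (S::real^3^3)" and w: "smooth w"
  shows "integral (convex hull C) (\<lambda>x. (S *v gradient w x) \<bullet> (k + W *v x))
    = - (\<Sum>F\<in>faces C. side C F * face_integral F (\<lambda>x. w x * ((S *v face_normal F) \<bullet> (k + W *v x))))"
proof -
  let ?p = "\<lambda>x. k + W *v x"
  let ?g = "\<lambda>i x. (S *v ?p x) $ i *\<^sub>R gradient w x + w x *\<^sub>R ((S ** W) $ i)"
  have cp: "continuous_on A ?p" for A by (intro continuous_intros)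
  have cw: "continuous_on A w" "continuous_on A (gradient w)" for A
    using smooth_continuous[OF w] smooth_gradient(2)[OF w] continuous_on_subset by blast+
  have cSp: "continuous_on A (\<lambda>x. (S *v ?p x) $ i)" for A i
    using continuous_on_inner[OF continuous_on_matrix_vector[OF cp[of A], of S] continuous_on_const[of _ "axis i 1"]]
    by (simp add: inner_axis)
  have cg: "continuous_on A (?g i)" for A i
    by (intro continuous_on_add continuous_on_scaleR cSp cw continuous_on_const)
  have dp: "((\<lambda>x. (S *v ?p x) $ i) has_derivative (\<lambda>h. (S ** W) $ i \<bullet> h)) (at x)" for i x
  proof -
    have "(S *v ?p x) $ i = (S *v k) $ i + (S ** W) $ i \<bullet> x" for x
      by (simp add: matrix_vector_right_distrib matrix_vector_mul_assoc matrix_vector_mul_component)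
    then show ?thesis by (auto intro!: derivative_eq_intros)
  qed
  have d: "((\<lambda>x. w x * (S *v ?p x) $ i) has_derivative (\<lambda>h. ?g i x \<bullet> h)) (at x)" for i x
    by (rule has_derivative_eq_rhs[OF has_derivative_mult[OF smooth_gradient(1)[OF w] dp]]) (simp add: inner_add_left fun_eq_iff algebra_simps)
  have I: "integral (convex hull C) (\<lambda>x. ?g i x \<bullet> axis i 1)
      = - (\<Sum>F\<in>faces C. side C F * (face_normal F \<bullet> axis i 1) * face_integral F (\<lambda>x. w x * (S *v ?p x) $ i))" for i
    by (rule integral_tet_grad[OF d cg card4 indep])
  have tr: "(\<Sum>i\<in>UNIV. (S ** W) $ i $ i) = 0"
  proof -
    have s: "S $ i $ j = S $ j $ i" for i j
    proof -
      have "transpose S $ i $ j = S $ i $ j" by (simp only: S)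
      then show ?thesis by (simp add: transpose_def)
    qed
    have w: "W $ j $ i = - W $ i $ j" for i j
    proof -
      have "transpose W $ i $ j = (- W) $ i $ j" by (simp only: W)
      then show ?thesis by (simp add: transpose_def)
    qed
    show ?thesis
      using s[of 2 1] s[of 3 1] s[of 3 2] w[of 1 1] w[of 2 2] w[of 3 3] w[of 1 2] w[of 1 3] w[of 2 3]
      by (simp add: sum_3 matrix_matrix_mult_def)
  qed
  have "(S *v gradient w x) \<bullet> ?p x = (\<Sum>i\<in>UNIV. ?g i x \<bullet> axis i 1)" for x
  proof -
    have "(\<Sum>i\<in>UNIV. ?g i x \<bullet> axis i 1) = (\<Sum>i\<in>UNIV. (S *v ?p x) $ i * gradient w x $ i) + w x * (\<Sum>i\<in>UNIV. (S ** W) $ i $ i)"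
      by (simp add: inner_axis sum.distrib sum_distrib_left)
    also have "\<dots> = (S *v ?p x) \<bullet> gradient w x" unfolding tr by (simp add: inner_vec_def)
    also have "\<dots> = (S *v gradient w x) \<bullet> ?p x" using symmetric_dot[OF S, of "gradient w x" "?p x"] by (simp only: inner_commute)
    finally show ?thesis by simp
  qed
  then have "integral (convex hull C) (\<lambda>x. (S *v gradient w x) \<bullet> ?p x) = integral (convex hull C) (\<lambda>x. \<Sum>i\<in>UNIV. ?g i x \<bullet> axis i 1)"
    by (simp only:)
  also have "\<dots> = (\<Sum>i\<in>UNIV. integral (convex hull C) (\<lambda>x. ?g i x \<bullet> axis i 1))"
    by (rule Henstock_Kurzweil_Integration.integral_sum[OF finite])
       (intro set_lebesgue_integral_eq_integral(1) absolutely_integrable_continuous_compact compact_tet continuous_on_inner cg continuous_on_const)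
  also have "\<dots> = - (\<Sum>i\<in>UNIV. \<Sum>F\<in>faces C. side C F * (face_normal F \<bullet> axis i 1) * face_integral F (\<lambda>x. w x * (S *v ?p x) $ i))"
    unfolding I sum_negf ..
  also have "(\<Sum>i\<in>UNIV. \<Sum>F\<in>faces C. side C F * (face_normal F \<bullet> axis i 1) * face_integral F (\<lambda>x. w x * (S *v ?p x) $ i))
      = (\<Sum>F\<in>faces C. \<Sum>i\<in>UNIV. side C F * (face_normal F \<bullet> axis i 1) * face_integral F (\<lambda>x. w x * (S *v ?p x) $ i))"
    by (rule sum.swap)
  also have "\<dots> = (\<Sum>F\<in>faces C. side C F * face_integral F (\<lambda>x. w x * ((S *v face_normal F) \<bullet> ?p x)))"
  proof (rule sum.cong[OF refl])
    fix F
    have "(\<Sum>i\<in>UNIV. side C F * (face_normal F \<bullet> axis i 1) * face_integral F (\<lambda>x. w x * (S *v ?p x) $ i))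
      = side C F * (\<Sum>i\<in>UNIV. face_integral F (\<lambda>x. face_normal F $ i * (w x * (S *v ?p x) $ i)))"
      unfolding face_integral_mult_left by (simp add: sum_distrib_left inner_axis mult.assoc)
    also have "(\<Sum>i\<in>UNIV. face_integral F (\<lambda>x. face_normal F $ i * (w x * (S *v ?p x) $ i)))
      = face_integral F (\<lambda>x. \<Sum>i\<in>UNIV. face_normal F $ i * (w x * (S *v ?p x) $ i))"
      by (rule face_integral_sum[symmetric, OF finite]) (intro continuous_on_mult continuous_on_const cw cSp)
    also have "(\<lambda>x. \<Sum>i\<in>UNIV. face_normal F $ i * (w x * (S *v ?p x) $ i)) = (\<lambda>x. w x * ((S *v face_normal F) \<bullet> ?p x))"
    proof
      fix x
      have "(\<Sum>i\<in>UNIV. face_normal F $ i * (w x * (S *v ?p x) $ i)) = w x * (face_normal F \<bullet> (S *v ?p x))"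
        by (simp add: inner_vec_def sum_distrib_left mult_ac)
      then show "(\<Sum>i\<in>UNIV. face_normal F $ i * (w x * (S *v ?p x) $ i)) = w x * ((S *v face_normal F) \<bullet> ?p x)"
        by (simp only: symmetric_dot[OF S])
    qed
    finally show "(\<Sum>i\<in>UNIV. side C F * (face_normal F \<bullet> axis i 1) * face_integral F (\<lambda>x. w x * (S *v ?p x) $ i))
      = side C F * face_integral F (\<lambda>x. w x * ((S *v face_normal F) \<bullet> ?p x))" .
  qed
  finally show ?thesis .
qed

text \<open>Integrating by parts along \<open>a - b\<close> produces no face term: faces containing
  both points are parallel to this direction, and on the other faces the edge bubble vanishes. With
  \<open>q\<close> chosen as the derivative of \<open>f\<close> along \<open>a - b\<close>, the
  bubble times q^2 has integral zero.\<close>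

lemma edge_bubble_zero:
  assumes ab: "a \<in> C" "b \<in> C" "a \<noteq> b" and B: "transpose B = (B::real^3^3)"
    and f: "\<And>x. f x = k + l \<bullet> x + x \<bullet> (B *v x)"
    and orth: "\<And>q. q \<in> polys 1 UNIV \<Longrightarrow>
      integral (convex hull C) (\<lambda>x. (gradient (\<lambda>x. bary C a x * bary C b x * q x) x \<bullet> (a - b)) * f x) = 0"
  shows "l \<bullet> (a - b) = 0" "B *v (a - b) = 0"
proof -
  define t where "t = a - b"
  \<comment> \<open>The derivative of \<open>f\<close> in direction \<open>t\<close>; it is affine
    because \<open>f\<close> is quadratic.\<close>
  define q where "q = (\<lambda>x. l \<bullet> t + (2 *\<^sub>R (B *v t)) \<bullet> x)"
  have q: "q \<in> polys 1 UNIV" unfolding q_def by (rule polys_affine)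
  have qt: "(l + 2 *\<^sub>R (B *v x)) \<bullet> t = q x" for x
    using symmetric_dot[OF B, of x t] by (simp add: q_def inner_add_left inner_add_right inner_commute)
  define w where "w = (\<lambda>x. bary C a x * bary C b x * q x)"
  have sw: "smooth w" unfolding w_def by (rule polys_smooth[OF bary_prod_polys[OF q]])
  have cw: "continuous_on A w" "continuous_on A (gradient w)" for A
    using smooth_continuous[OF sw] smooth_gradient(2)[OF sw] continuous_on_subset by blast+
  have ff: "f = (\<lambda>x. k + l \<bullet> x + x \<bullet> (B *v x))" using f by blast
  have cf: "continuous_on A f" for A unfolding ff by (intro continuous_intros)
  have cq: "continuous_on A q" for A unfolding q_def by (intro continuous_intros)
  let ?g = "\<lambda>x. w x *\<^sub>R (l + 2 *\<^sub>R (B *v x)) + f x *\<^sub>R gradient w x"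
  have "integral (convex hull C) (\<lambda>x. ?g x \<bullet> t) = - (\<Sum>F\<in>faces C. side C F * (face_normal F \<bullet> t) * face_integral F (\<lambda>x. w x * f x))"
  proof (rule integral_tet_grad[OF _ _ card4 indep])
    show "((\<lambda>x. w x * f x) has_derivative (\<lambda>h. ?g x \<bullet> h)) (at x)" for x
      unfolding ff
      by (rule has_derivative_eq_rhs[OF has_derivative_mult[OF smooth_gradient(1)[OF sw] quadratic_derivative[OF B]]])
         (simp add: inner_add_left fun_eq_iff algebra_simps)
    show "continuous_on UNIV ?g"
      by (intro continuous_on_add continuous_on_scaleR cw cf continuous_intros)
  qed
  also have "\<dots> = 0"
  proof -
    have "(face_normal F \<bullet> t) * face_integral F (\<lambda>x. w x * f x) = 0" if F: "F \<in> faces C" for F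
    proof (cases "a \<in> F \<and> b \<in> F")
      case True
      then show ?thesis using face_normal_orth[of F a b] F by (simp add: t_def faces_def)
    next
      case False
      have "face_integral F (\<lambda>x. w x * f x) = face_integral F (\<lambda>x. 0)"
      proof (rule face_integral_cong)
        show "card F = 3" using F by (simp add: faces_def)
        fix x assume "x \<in> convex hull F"
        then have "bary C a x = 0 \<or> bary C b x = 0" using bary_on_face[of F] False F ab by (auto simp: faces_def)
        then show "w x * f x = 0" by (auto simp: w_def)
      qed
      then show ?thesis by (simp add: face_integral_0)
    qed
    then show ?thesis
      unfolding neg_equal_0_iff_equal by (intro sum.neutral ballI) (simp only: mult.assoc mult_zero_right)
  qed
  finally have "integral (convex hull C) (\<lambda>x. ?g x \<bullet> t) = 0" .
  moreover have "?g x \<bullet> t = w x * q x + (gradient w x \<bullet> t) * f x" for x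
    unfolding inner_add_left[of "w x *\<^sub>R _"] inner_scaleR_left[of "w x"] inner_scaleR_left[of "f x"] qt by (simp only: mult.commute)
  moreover have "integral (convex hull C) (\<lambda>x. w x * q x + (gradient w x \<bullet> t) * f x)
      = integral (convex hull C) (\<lambda>x. w x * q x) + integral (convex hull C) (\<lambda>x. (gradient w x \<bullet> t) * f x)"
    by (rule Henstock_Kurzweil_Integration.integral_add;
        intro set_lebesgue_integral_eq_integral(1) absolutely_integrable_continuous_compact compact_tet continuous_on_mult continuous_on_inner cw cf cq continuous_on_const)
  moreover have "integral (convex hull C) (\<lambda>x. (gradient w x \<bullet> t) * f x) = 0"
    unfolding w_def t_def by (rule orth[OF q])
  ultimately have i0: "integral (convex hull C) (\<lambda>x. w x * q x) = 0" by simp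
  have z: "w x * q x = 0" if "x \<in> convex hull C" for x
  proof (rule bary_nonneg_zero_imp[OF _ _ i0 that])
    show "continuous_on UNIV (\<lambda>x. w x * q x)" by (intro continuous_on_mult cw cq)
    fix x assume "x \<in> convex hull C"
    then have "0 \<le> bary C a x * bary C b x" using mem_tet ab by simp
    then have "0 \<le> (bary C a x * bary C b x) * (q x * q x)" by simp
    then show "0 \<le> w x * q x" by (simp add: w_def mult.assoc)
  qed
  \<comment> \<open>The point with weight 1/3 at each of \<open>y\<close>, \<open>a\<close>,
    \<open>b\<close> has positive bubble even if \<open>y\<close> is \<open>a\<close> or
    \<open>b\<close>. These two cases give \<open>q a = q b = 0\<close>, and then all vertices
    follow.\<close>
  have q3: "q y + q a + q b = 0" if y: "y \<in> C" for y
  proof -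
    let ?x = "(1 - 1/3 - 1/3) *\<^sub>R y + (1/3) *\<^sub>R a + (1/3) *\<^sub>R b"
    have b: "bary C v ?x = (1 - 1/3 - 1/3) * bary C v y + 1/3 * bary C v a + 1/3 * bary C v b" for v
      by (rule bary_comb3)
    have "?x \<in> convex hull C" unfolding mem_tet b using ab y by (auto simp: bary_vertex)
    then have "w ?x * q ?x = 0" by (rule z)
    moreover have "bary C a ?x > 0" "bary C b ?x > 0" unfolding b using ab y by (auto simp: bary_vertex)
    ultimately have "q ?x = 0" by (auto simp: w_def)
    then show ?thesis by (simp add: q_def inner_add_right)
  qed
  have "q a = 0" "q b = 0" using q3[OF ab(1)] q3[OF ab(2)] by auto
  then have "q y = 0" if "y \<in> C" for y using q3[OF that] by simp
  then have "2 *\<^sub>R (B *v t) = 0" "l \<bullet> t = 0" using affine_zero[of "l \<bullet> t" "2 *\<^sub>R (B *v t)"] by (auto simp: q_def)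
  then show "l \<bullet> (a - b) = 0" "B *v (a - b) = 0" by (auto simp: t_def)
qed

end

lemma outer_mult: "(\<chi> i j. (s::real^3) $ i * t $ j) *v (y::real^3) = (t \<bullet> y) *\<^sub>R s"
  by (simp add: vec_eq_iff matrix_vector_mult_def inner_vec_def sum_distrib_left mult_ac)

lemma matrix_vector_uminus: "(- A) *v (x::real^3) = - ((A::real^3^3) *v x)"
  by (simp add: matrix_vector_mult_def vec_eq_iff sum_negf)

text \<open>The symmetrised product of \<open>u\<close> and \<open>n\<close>, divided by
  \<open>n \<bullet> n\<close>, maps \<open>n\<close> to \<open>u\<close> plus a multiple of
  \<open>n\<close>; the last term of \<open>S\<close> removes that multiple.\<close>

lemma symmetric_with_image:
  assumes "n \<noteq> (0::real^3)"
  obtains S :: "real^3^3" where "transpose S = S" "S *v n = u"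
proof -
  define S :: "real^3^3" where "S = (1 / (n \<bullet> n)) *\<^sub>R ((\<chi> i j. u $ i * n $ j) + (\<chi> i j. n $ i * u $ j))
     - ((u \<bullet> n) / (n \<bullet> n)^2) *\<^sub>R (\<chi> i j. n $ i * n $ j)"
  have "transpose S = S" by (simp add: S_def transpose_def vec_eq_iff mult_ac)
  moreover have "S *v n = u"
  proof -
    have "S *v n = (1 / (n \<bullet> n)) *\<^sub>R ((n \<bullet> n) *\<^sub>R u + (u \<bullet> n) *\<^sub>R n) - ((u \<bullet> n) / (n \<bullet> n)^2) *\<^sub>R ((n \<bullet> n) *\<^sub>R n)"
      by (simp only: S_def matrix_vector_mult_diff_rdistrib scaleR_matrix_vector_assoc[symmetric] matrix_vector_mult_add_rdistrib outer_mult)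
    also have "\<dots> = u" using assms by (simp add: scaleR_add_right power2_eq_square)
    finally show ?thesis .
  qed
  ultimately show ?thesis using that by blast
qed

text \<open>\<open>edge_quadratic_zero\<close> makes the linear part skew. The second-order
  coefficients \<open>B i $ m $ j\<close> become antisymmetric in i and j while staying symmetric in
  m and j; alternating the two rules carries an entry to its own negative.\<close>

lemma rigid_of_edges:
  fixes l :: "3 \<Rightarrow> real^3" and B :: "3 \<Rightarrow> real^3^3"
  assumes C: "tetrahedron C" and B: "\<And>i. transpose (B i) = B i"
    and l0: "\<And>v w. v \<in> C \<Longrightarrow> w \<in> C \<Longrightarrow> (\<Sum>i\<in>UNIV. (v - w) $ i *\<^sub>R l i) \<bullet> (v - w) = 0"
    and B0: "\<And>v w. v \<in> C \<Longrightarrow> w \<in> C \<Longrightarrow> (\<Sum>i\<in>UNIV. (v - w) $ i *\<^sub>R B i) *v (v - w) = 0"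
  shows "B i = 0" and "transpose (\<chi> i. l i) = - (\<chi> i. l i)"
proof -
  interpret tetrahedron C by (rule C)
  have "(v - w) \<bullet> ((\<chi> i. l i) *v (v - w)) = 0" if "v \<in> C" "w \<in> C" for v w
    using l0[OF that] by (simp add: inner_vec_def[of "v - w"] matrix_vector_mul_component inner_sum_left)
  then show "transpose (\<chi> i. l i) = - (\<chi> i. l i)" by (rule edge_quadratic_zero)
  have 1: "B i $ m $ j = - B j $ m $ i" for i j m
  proof -
    let ?A = "(\<chi> i j. B i $ m $ j) :: real^3^3"
    have "(v - w) \<bullet> (?A *v (v - w)) = 0" if "v \<in> C" "w \<in> C" for v w
    proof -
      have "((\<Sum>i\<in>UNIV. (v - w) $ i *\<^sub>R B i) *v (v - w)) $ m = (v - w) \<bullet> (?A *v (v - w))"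
        by (simp add: matrix_vector_mult_def inner_vec_def sum_3 algebra_simps)
      then show ?thesis using B0[OF that] by simp
    qed
    then have "transpose ?A = - ?A" by (rule edge_quadratic_zero)
    then have "transpose ?A $ j $ i = (- ?A) $ j $ i" by simp
    then show ?thesis by (simp add: transpose_def)
  qed
  have 2: "B i $ m $ j = B i $ j $ m" for i j m
  proof -
    have "transpose (B i) $ j $ m = B i $ j $ m" by (simp only: B)
    then show ?thesis by (simp add: transpose_def)
  qed
  have "B i $ m $ j = 0" for i j m
    using 1[of i m j] 2[of j m i] 1[of j i m] 2[of m i j] 1[of m j i] 2[of i j m] by linarith
  then show "B i = 0" by (simp add: vec_eq_iff)
qed

text \<open>Coordinates on a common face depend on the face alone. Scalar factors built from them
  therefore agree across it.\<close>

lemma (in simplicial_mesh) bary_agree: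
  assumes C: "C \<in> M" "C' \<in> M" and F: "F \<subseteq> C" "F \<subseteq> C'" and v: "v \<in> F" and x: "x \<in> convex hull F"
  shows "bary C v x = bary C' v x"
proof -
  have fF: "finite F" using F(1) tetrahedron.fin[OF tet[OF C(1)]] finite_subset by blast
  then obtain t where t: "sum t F = 1" "(\<Sum>v\<in>F. t v *\<^sub>R v) = x"
    using x unfolding convex_hull_finite[OF fF] mem_Collect_eq by blast
  have "bary D v x = t v" if D: "D \<in> M" "F \<subseteq> D" for D
  proof -
    have "bary D v x = (\<Sum>w\<in>F. t w * bary D v w)" using bary_sum[OF t(1), of D v] t(2) by simp
    also have "\<dots> = (\<Sum>w\<in>F. if w = v then t w else 0)"
    proof (intro sum.cong refl)
      fix w assume "w \<in> F"
      then have "w \<in> D" "v \<in> D" using D v by auto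
      then show "t w * bary D v w = (if w = v then t w else 0)"
        by (simp add: tetrahedron.bary_vertex[OF tet[OF D(1)]])
    qed
    also have "\<dots> = t v" using fF v by simp
    finally show ?thesis .
  qed
  then show ?thesis using C F by simp
qed

section \<open>Orthogonality to the divergence and its consequence on each element\<close>

context mesh_domain
begin

text \<open>Bundles the assumptions under which the field \<open>w S\<close> was shown to lie in
  \<open>Sigma_h\<close> above.\<close>

definition admissible :: "((real^3) set \<Rightarrow> real^3 \<Rightarrow> real) \<Rightarrow> ((real^3) set \<Rightarrow> real^3^3) \<Rightarrow> bool" where
  "admissible w S \<longleftrightarrow> (\<forall>C\<in>M. w C \<in> polys 3 UNIV \<and> transpose (S C) = S C \<and> (\<forall>x\<in>C. w C x = 0)) \<and>
    (\<forall>C\<in>M. \<forall>C'\<in>M. \<forall>F x. C \<noteq> C' \<longrightarrow> F \<in> faces C \<longrightarrow> F \<in> faces C' \<longrightarrow> x \<in> convex hull F \<longrightarrow>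
      w C x *\<^sub>R (S C *v face_normal F) = w C' x *\<^sub>R (S C' *v face_normal F))"

text \<open>Only the special fields are tested, and through integrals over elements, so that the
  argument about jumps involves no weak derivatives.\<close>

definition orthogonal_to_div :: "((real^3) set \<Rightarrow> real^3 \<Rightarrow> real^3) \<Rightarrow> bool" where
  "orthogonal_to_div p \<longleftrightarrow> (\<forall>w S. admissible w S \<longrightarrow>
     (\<Sum>C\<in>M. integral (convex hull C) (\<lambda>x. (S C *v gradient (w C) x) \<bullet> p C x)) = 0)"

text \<open>If the normal component vanishes on the boundary of \<open>C\<close>, extension by zero
  to all other elements is admissible.\<close>

lemma orthogonal_single:
  assumes orth: "orthogonal_to_div p" and C: "C \<in> M" and w: "w \<in> polys 3 UNIV" and S: "transpose S = S"
    and v: "\<And>x. x \<in> C \<Longrightarrow> w x = 0"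
    and F: "\<And>F x. F \<in> faces C \<Longrightarrow> x \<in> convex hull F \<Longrightarrow> w x *\<^sub>R (S *v face_normal F) = 0"
  shows "integral (convex hull C) (\<lambda>x. (S *v gradient w x) \<bullet> p C x) = 0"
proof -
  let ?w = "\<lambda>D. if D = C then w else (\<lambda>_. 0)" and ?S = "\<lambda>D. if D = C then S else 0"
  have t0: "transpose (0::real^3^3) = 0" by (simp add: transpose_def vec_eq_iff)
  have "admissible ?w ?S"
    unfolding admissible_def using w S v F polys_const[OF subspace_UNIV UNIV_I, of 0 3] by (auto simp: t0)
  then have "(\<Sum>D\<in>M. integral (convex hull D) (\<lambda>x. (?S D *v gradient (?w D) x) \<bullet> p D x)) = 0"
    using orth unfolding orthogonal_to_div_def by blast
  also have "(\<Sum>D\<in>M. integral (convex hull D) (\<lambda>x. (?S D *v gradient (?w D) x) \<bullet> p D x))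
      = (\<Sum>D\<in>M. if D = C then integral (convex hull C) (\<lambda>x. (S *v gradient w x) \<bullet> p C x) else 0)"
    by (intro sum.cong) auto
  finally show ?thesis using C finM by simp
qed

lemma orthogonal_rigid:
  assumes orth: "orthogonal_to_div p" and p: "p C \<in> polys 2 UNIV" and C: "C \<in> M"
  obtains k W where "transpose W = - W" "p C = (\<lambda>x. k + W *v x)"
proof -
  interpret tetrahedron C using tet C .
  have "\<forall>i. \<exists>k l B. transpose B = B \<and> (\<forall>x. p C x $ i = k + l \<bullet> x + x \<bullet> (B *v x))"
    using polys_quadratic[OF polys_nth[OF p]] by blast
  then obtain k l B where B: "\<And>i. transpose (B i) = B i" and pi: "\<And>i x. p C x $ i = k i + l i \<bullet> x + x \<bullet> (B i *v x)"
    by metis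
  have edge: "(\<Sum>i\<in>UNIV. (a - b) $ i *\<^sub>R l i) \<bullet> (a - b) = 0 \<and> (\<Sum>i\<in>UNIV. (a - b) $ i *\<^sub>R B i) *v (a - b) = 0"
    if ab: "a \<in> C" "b \<in> C" for a b
  proof (cases "a = b")
    case False
    let ?t = "a - b"
    \<comment> \<open>The dyad of the edge vector maps a normal to a multiple of its product with
      the edge. This is zero on faces containing the edge, while the bubble is zero on the
      others.\<close>
    let ?S = "(\<chi> i j. ?t $ i * ?t $ j) :: real^3^3"
    have tB: "transpose (\<Sum>i\<in>UNIV. ?t $ i *\<^sub>R B i) = (\<Sum>i\<in>UNIV. ?t $ i *\<^sub>R B i)"
    proof -
      have "B i $ r $ s = B i $ s $ r" for i r s
      proof -
        have "transpose (B i) $ s $ r = B i $ s $ r" by (simp only: B)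
        then show ?thesis by (simp add: transpose_def)
      qed
      then show ?thesis by (simp add: vec_eq_iff transpose_def sum_component)
    qed
    have f: "?t \<bullet> p C x = (\<Sum>i\<in>UNIV. ?t $ i * k i) + (\<Sum>i\<in>UNIV. ?t $ i *\<^sub>R l i) \<bullet> x + x \<bullet> ((\<Sum>i\<in>UNIV. ?t $ i *\<^sub>R B i) *v x)" for x
      unfolding inner_vec_def[of ?t] pi
      by (simp add: sum_3 inner_add_left matrix_vector_mult_add_rdistrib scaleR_matrix_vector_assoc[symmetric] inner_add_right algebra_simps)
    have "integral (convex hull C) (\<lambda>x. (gradient (\<lambda>x. bary C a x * bary C b x * q x) x \<bullet> ?t) * (?t \<bullet> p C x)) = 0"
      if q: "q \<in> polys 1 UNIV" for q
    proof -
      let ?w = "\<lambda>x. bary C a x * bary C b x * q x"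
      have "integral (convex hull C) (\<lambda>x. (?S *v gradient ?w x) \<bullet> p C x) = 0"
      proof (rule orthogonal_single[OF orth C bary_prod_polys[OF q]])
        show "transpose ?S = ?S" by (simp add: transpose_def vec_eq_iff mult.commute)
        show "?w x = 0" if "x \<in> C" for x using that ab False by (auto simp: bary_vertex)
        fix F x assume F: "F \<in> faces C" and x: "x \<in> convex hull F"
        show "?w x *\<^sub>R (?S *v face_normal F) = 0"
        proof (cases "a \<in> F \<and> b \<in> F")
          case True
          then have "?t \<bullet> face_normal F = 0"
            using face_normal_orth[of F a b] F by (simp add: faces_def inner_commute)
          then show ?thesis unfolding outer_mult by simp
        next
          case False
          then have "bary C a x = 0 \<or> bary C b x = 0" using bary_on_face[of F _ x] F ab x by (auto simp: faces_def)
          then show ?thesis by auto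
        qed
      qed
      then show ?thesis unfolding outer_mult by (simp add: inner_commute)
    qed
    from edge_bubble_zero[OF ab False tB f this] show ?thesis by blast
  qed simp
  have "B i = 0" for i by (rule rigid_of_edges(1)[OF tet[OF C], where B = B and l = l]) (use edge B in blast)+
  moreover have "transpose (\<chi> i. l i) = - (\<chi> i. l i)" by (rule rigid_of_edges(2)[OF tet[OF C], where B = B and l = l]) (use edge B in blast)+
  moreover have "p C = (\<lambda>x. (\<chi> i. k i) + (\<chi> i. l i) *v x)" if "\<And>i. B i = 0"
    by (rule ext) (simp add: vec_eq_iff pi that matrix_vector_mul_component)
  ultimately show ?thesis using that by blast
qed

end

section \<open>Jumps of a piecewise rigid motion\<close>

locale rigid_mesh = mesh_domain +
  fixes k :: "(real^3) set \<Rightarrow> real^3" and W :: "(real^3) set \<Rightarrow> real^3^3"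
  assumes skew: "\<And>C. C \<in> M \<Longrightarrow> transpose (W C) = - W C"
    and orth: "orthogonal_to_div (\<lambda>C x. k C + W C *v x)"
begin

abbreviation rig :: "(real^3) set \<Rightarrow> real^3 \<Rightarrow> real^3" where "rig C x \<equiv> k C + W C *v x"

text \<open>On a face of a single element this is, up to sign, the motion itself. A vanishing jump
  there acts as a boundary condition.\<close>

definition jump :: "(real^3) set \<Rightarrow> real^3 \<Rightarrow> real^3" where
  "jump F x = (\<Sum>C\<in>{C\<in>M. F \<in> faces C}. side C F *\<^sub>R rig C x)"

text \<open>A skew matrix gives (x - y) . W (x - y) = 0: a rigid motion has the same component along
  the segment at both ends, and so has a combination of rigid motions.\<close>

lemma jump_rigid: "(x - y) \<bullet> (jump F x - jump F y) = 0"
proof -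
  have rigid: "(x - y) \<bullet> (rig C x - rig C y) = 0" if "C \<in> M" for C
  proof -
    have "(x - y) \<bullet> (W C *v (x - y)) = (transpose (W C) *v (x - y)) \<bullet> (x - y)"
      by (metis dot_lmul_matrix transpose_matrix_vector)
    also have "\<dots> = - ((W C *v (x - y)) \<bullet> (x - y))"
      unfolding skew[OF that] by (simp add: matrix_vector_uminus)
    finally have "(x - y) \<bullet> (W C *v (x - y)) = 0" by (simp add: inner_commute)
    then show ?thesis by (simp add: matrix_vector_mult_diff_distrib)
  qed
  have "(x - y) \<bullet> (jump F x - jump F y) = (\<Sum>C\<in>{C\<in>M. F \<in> faces C}. side C F * ((x - y) \<bullet> (rig C x - rig C y)))"
    unfolding jump_def sum_subtractf[symmetric] scaleR_right_diff_distrib[symmetric] inner_sum_right inner_scaleR_right ..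
  also have "\<dots> = 0"
  proof (intro sum.neutral ballI)
    fix C assume "C \<in> {C\<in>M. F \<in> faces C}"
    then have "C \<in> M" by simp
    then show "side C F * ((x - y) \<bullet> (rig C x - rig C y)) = 0" by (simp only: rigid mult_zero_right)
  qed
  finally show ?thesis .
qed

text \<open>\<open>rigid_divergence\<close> leaves face terms only. Collected by face, they turn
  into jumps as soon as the factor and the vector \<open>S n\<close> are common to both
  elements.\<close>

lemma face_form:
  assumes "admissible w S"
  shows "(\<Sum>F\<in>all_faces. \<Sum>C\<in>{C\<in>M. F \<in> faces C}. side C F * face_integral F (\<lambda>x. w C x * ((S C *v face_normal F) \<bullet> rig C x))) = 0"
proof -
  have eq: "integral (convex hull C) (\<lambda>x. (S C *v gradient (w C) x) \<bullet> rig C x)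
    = - (\<Sum>F\<in>faces C. side C F * face_integral F (\<lambda>x. w C x * ((S C *v face_normal F) \<bullet> rig C x)))" if C: "C \<in> M" for C
  proof -
    have "transpose (S C) = S C" "w C \<in> polys 3 UNIV" using assms C unfolding admissible_def by blast+
    then show ?thesis by (rule tetrahedron.rigid_divergence[OF tet[OF C] skew[OF C] _ polys_smooth])
  qed
  have "(\<Sum>C\<in>M. integral (convex hull C) (\<lambda>x. (S C *v gradient (w C) x) \<bullet> rig C x)) = 0"
    using orth assms unfolding orthogonal_to_div_def by blast
  moreover have "(\<Sum>C\<in>M. integral (convex hull C) (\<lambda>x. (S C *v gradient (w C) x) \<bullet> rig C x))
    = - (\<Sum>C\<in>M. \<Sum>F\<in>faces C. side C F * face_integral F (\<lambda>x. w C x * ((S C *v face_normal F) \<bullet> rig C x)))"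
    unfolding sum_negf[symmetric] by (rule sum.cong[OF refl]) (simp only: eq sum_negf)
  ultimately have "(\<Sum>C\<in>M. \<Sum>F\<in>faces C. side C F * face_integral F (\<lambda>x. w C x * ((S C *v face_normal F) \<bullet> rig C x))) = 0"
    by linarith
  then show ?thesis by (simp only: sum_faces_swap[OF subset_refl])
qed

text \<open>Test fields of the form \<open>w S\<close> whose scalar factor is the same polynomial \<open>m\<close> of the barycentric
  coordinates of a face or an edge, so that only their normal components enter.\<close>

lemma face_moment:
  assumes F: "F = {a,b,c}" "a \<noteq> b" "a \<noteq> c" "b \<noteq> c" and C: "C \<in> M" "F \<in> faces C"
    and m: "cont3 m" "cont3 (\<lambda>x y z. m x y z * x)" "cont3 (\<lambda>x y z. m x y z * y)" "cont3 (\<lambda>x y z. m x y z * z)"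
  shows "face_integral F (\<lambda>x. m (bary C a x) (bary C b x) (bary C c x) * (P \<bullet> rig C x))
    = P \<bullet> (bary_int (\<lambda>x y z. m x y z * x) *\<^sub>R rig C a + bary_int (\<lambda>x y z. m x y z * y) *\<^sub>R rig C b + bary_int (\<lambda>x y z. m x y z * z) *\<^sub>R rig C c)"
proof -
  interpret tetrahedron C using tet C(1) .
  have e: "P \<bullet> rig C x = P \<bullet> k C + (transpose (W C) *v P) \<bullet> x" for x
    by (simp add: inner_add_right) (metis dot_lmul_matrix transpose_matrix_vector)
  have "face_integral F (\<lambda>x. m (bary C a x) (bary C b x) (bary C c x) * (P \<bullet> rig C x))
    = bary_int (\<lambda>x y z. m x y z * x) * (P \<bullet> rig C a) + bary_int (\<lambda>x y z. m x y z * y) * (P \<bullet> rig C b) + bary_int (\<lambda>x y z. m x y z * z) * (P \<bullet> rig C c)"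
    unfolding F(1) e by (rule face_integral_bary[OF C(2)[unfolded F(1)] F(2-4) m])
  then show ?thesis by (simp only: inner_add_right[of P "_ *\<^sub>R _"] inner_add_right[of P "_ *\<^sub>R _ + _ *\<^sub>R _"] inner_scaleR_right)
qed

text \<open>The jump is affine, so the sum is three times its value at the centroid. The face bubble
  with one symmetric \<open>S\<close> on both elements reaches every prescribed vector
  \<open>S n = u\<close>, and its moments at the three vertices are equal.\<close>

lemma jump_centroid:
  assumes F: "F = {a,b,c}" "a \<noteq> b" "a \<noteq> c" "b \<noteq> c" "F \<in> all_faces"
  shows "jump F a + jump F b + jump F c = 0"
proof -
  let ?w = "\<lambda>C. if F \<in> faces C then (\<lambda>x. bary C a x * bary C b x * bary C c x) else (\<lambda>_. 0)"
  obtain C0 where C0: "C0 \<in> M" "F \<in> faces C0" using F(5) unfolding all_faces_def by blast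
  have n0: "face_normal F \<noteq> 0"
  proof -
    obtain v where v: "v \<in> C0" "F = C0 - {v}" using C0(2) unfolding faces_Diff[OF card4M[OF C0(1)]] by blast
    have "a \<in> C0 - {v}" using F(1) v(2) by blast
    from tetrahedron.normal_nonzero[OF tet[OF C0(1)] v(1) this] show ?thesis unfolding v(2)[symmetric] by fastforce
  qed
  have "u \<bullet> (jump F a + jump F b + jump F c) = 0" for u
  proof -
    obtain S :: "real^3^3" where S: "transpose S = S" "S *v face_normal F = u" using symmetric_with_image[OF n0] .
    \<comment> \<open>Any other face of these elements misses one of \<open>a\<close>,
      \<open>b\<close>, \<open>c\<close>, so only \<open>F\<close> contributes although
      \<open>S\<close> is the same everywhere.\<close>
    have zero: "?w C x = 0" if "C \<in> M" "F' \<in> faces C" "F' \<noteq> F" "x \<in> convex hull F'" for C F' x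
    proof (cases "F \<in> faces C")
      case True
      interpret tetrahedron C using tet that(1) .
      have "\<not> F \<subseteq> F'"
        using that(2,3) True card_subset_eq[of F' F] finite_subset[OF _ fin, of F'] by (auto simp: faces_def)
      then have "(a \<in> C - F' \<or> b \<in> C - F' \<or> c \<in> C - F')" using F(1) True by (auto simp: faces_def)
      then show ?thesis using bary_on_face[of F' _ x] that(2,4) True by (auto simp: faces_def)
    qed simp
    have "admissible ?w (\<lambda>_. S)"
      unfolding admissible_def
    proof (intro conjI ballI allI impI)
      fix C assume C: "C \<in> M"
      show "?w C \<in> polys 3 UNIV"
        using bary_prod_polys[OF bary_polys] polys_const[OF subspace_UNIV UNIV_I, of 0 3] by auto
      fix x assume "x \<in> C"
      then show "?w C x = 0"
        using tetrahedron.bary_vertex[OF tet[OF C]] F by (auto simp: faces_def)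
    next
      fix C C' F' x assume H: "C \<in> M" "C' \<in> M" "C \<noteq> C'" "F' \<in> faces C" "F' \<in> faces C'" "x \<in> convex hull F'"
      show "?w C x *\<^sub>R (S *v face_normal F') = ?w C' x *\<^sub>R (S *v face_normal F')"
      proof (cases "F' = F")
        case True
        have sub: "F \<subseteq> C" "F \<subseteq> C'" "x \<in> convex hull F" using H True by (auto simp: faces_def)
        have "bary C v x = bary C' v x" if "v \<in> F" for v by (rule bary_agree[OF H(1,2) sub(1,2) that sub(3)])
        then show ?thesis using True H F(1) by simp
      next
        case False
        then show ?thesis using zero H by simp
      qed
    qed (rule S(1))
    from face_form[OF this]
    have "0 = (\<Sum>F'\<in>all_faces. \<Sum>C\<in>{C\<in>M. F' \<in> faces C}. side C F' * face_integral F' (\<lambda>x. ?w C x * ((S *v face_normal F') \<bullet> rig C x)))"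
      by simp
    also have "\<dots> = (\<Sum>F'\<in>all_faces. if F' = F then \<Sum>C\<in>{C\<in>M. F \<in> faces C}. side C F * face_integral F (\<lambda>x. ?w C x * (u \<bullet> rig C x)) else 0)"
    proof (intro sum.cong refl)
      fix F' assume F': "F' \<in> all_faces"
      show "(\<Sum>C\<in>{C\<in>M. F' \<in> faces C}. side C F' * face_integral F' (\<lambda>x. ?w C x * ((S *v face_normal F') \<bullet> rig C x)))
        = (if F' = F then \<Sum>C\<in>{C\<in>M. F \<in> faces C}. side C F * face_integral F (\<lambda>x. ?w C x * (u \<bullet> rig C x)) else 0)"
      proof (cases "F' = F")
        case True then show ?thesis using S(2) by simp
      next
        case False
        have "face_integral F' (\<lambda>x. ?w C x * ((S *v face_normal F') \<bullet> rig C x)) = face_integral F' (\<lambda>x. 0)" if "C \<in> M" "F' \<in> faces C" for C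
          by (rule face_integral_cong) (use zero[OF that False] that in \<open>auto simp: faces_def\<close>)
        then show ?thesis using False by (auto simp: face_integral_0 intro!: sum.neutral)
      qed
    qed
    also have "\<dots> = (\<Sum>C\<in>{C\<in>M. F \<in> faces C}. side C F * face_integral F (\<lambda>x. ?w C x * (u \<bullet> rig C x)))"
      using F(5) finite_all_faces by simp
    finally have s0: "(\<Sum>C\<in>{C\<in>M. F \<in> faces C}. side C F * face_integral F (\<lambda>x. ?w C x * (u \<bullet> rig C x))) = 0" by simp
    obtain \<kappa> where \<kappa>: "\<kappa> > 0" "bary_int (\<lambda>x y z. x * y * z * x) = \<kappa>" "bary_int (\<lambda>x y z. x * y * z * y) = \<kappa>" "bary_int (\<lambda>x y z. x * y * z * z) = \<kappa>"
      using moments_face .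
    have c3: "cont3 (\<lambda>x y z. x * y * z)" "cont3 (\<lambda>x y z. x * y * z * x)" "cont3 (\<lambda>x y z. x * y * z * y)" "cont3 (\<lambda>x y z. x * y * z * z)"
      unfolding cont3_def by (intro cont3_intros)+
    have "side C F * face_integral F (\<lambda>x. ?w C x * (u \<bullet> rig C x)) = \<kappa> * (u \<bullet> (side C F *\<^sub>R rig C a + side C F *\<^sub>R rig C b + side C F *\<^sub>R rig C c))"
      if "C \<in> M" "F \<in> faces C" for C
    proof -
      have "face_integral F (\<lambda>x. ?w C x * (u \<bullet> rig C x)) = u \<bullet> (\<kappa> *\<^sub>R rig C a + \<kappa> *\<^sub>R rig C b + \<kappa> *\<^sub>R rig C c)"
        using face_moment[OF F(1-4) that c3, of u] that(2) unfolding \<kappa>(2-4) by simp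
      then show ?thesis by (simp add: inner_add_right algebra_simps)
    qed
    then have "\<kappa> * (u \<bullet> (jump F a + jump F b + jump F c)) = 0"
      using s0 unfolding jump_def sum.distrib[symmetric] inner_sum_right sum_distrib_left by simp
    then show ?thesis using \<kappa>(1) by simp
  qed
  from this[of "jump F a + jump F b + jump F c"] show ?thesis by simp
qed

abbreviation edge_fan :: "real^3 \<Rightarrow> real^3 \<Rightarrow> (real^3) set set" where
  "edge_fan a b \<equiv> {F\<in>all_faces. a \<in> F \<and> b \<in> F}"

definition apex :: "real^3 \<Rightarrow> real^3 \<Rightarrow> (real^3) set \<Rightarrow> real^3" where
  "apex a b F = the_elem (F - {a,b})"

lemma fan_face:
  assumes "a \<noteq> b" "F \<in> edge_fan a b"
  shows "F = {a, b, apex a b F}" "a \<noteq> apex a b F" "b \<noteq> apex a b F"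
proof -
  have c3: "card F = 3" and ab: "a \<in> F" "b \<in> F" using assms by (auto simp: all_faces_def faces_def)
  then have "finite F" by (metis card.infinite zero_neq_numeral)
  then have "card (F - {a,b}) = 1" using c3 ab assms(1) by (simp add: card_Diff_subset)
  then obtain c where "F - {a,b} = {c}" by (rule card_1_singletonE)
  then show "F = {a, b, apex a b F}" "a \<noteq> apex a b F" "b \<noteq> apex a b F" using ab unfolding apex_def by auto
qed

text \<open>The factor vanishes at the vertices and on every face that does not contain the edge, so
  it may be extended by zero and only the fan contributes. On a face of the fan both elements see
  the same factor and the same vector \<open>P F\<close>.\<close>

lemma edge_moments:
  fixes \<alpha> \<beta> :: real
  defines "m \<equiv> \<lambda>x y z::real. x * y * (\<alpha> + \<beta> * (x - y))"
  assumes ab: "a \<noteq> b"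
    and S: "\<And>C. C \<in> M \<Longrightarrow> a \<in> C \<Longrightarrow> b \<in> C \<Longrightarrow> transpose (S C) = S C"
    and P: "\<And>C F. C \<in> M \<Longrightarrow> F \<in> faces C \<Longrightarrow> a \<in> F \<Longrightarrow> b \<in> F \<Longrightarrow> S C *v face_normal F = P F"
  shows "(\<Sum>F\<in>edge_fan a b. P F \<bullet> (bary_int (\<lambda>x y z. m x y z * x) *\<^sub>R jump F a + bary_int (\<lambda>x y z. m x y z * y) *\<^sub>R jump F b
     + bary_int (\<lambda>x y z. m x y z * z) *\<^sub>R jump F (apex a b F))) = 0"
proof -
  define r where "r C x = \<alpha> + \<beta> * (bary C a x - bary C b x)" for C x
  let ?w = "\<lambda>C. if a \<in> C \<and> b \<in> C then (\<lambda>x. bary C a x * bary C b x * r C x) else (\<lambda>_. 0)"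
  let ?S = "\<lambda>C. if a \<in> C \<and> b \<in> C then S C else 0"
  have t0: "transpose (0::real^3^3) = 0" by (simp add: transpose_def vec_eq_iff)
  have r: "r C \<in> polys 1 UNIV" for C
  proof -
    have "r C = (\<lambda>x. (\<alpha> - \<beta> * (bary_grad C a \<bullet> face_base (C - {a})) + \<beta> * (bary_grad C b \<bullet> face_base (C - {b}))) + (\<beta> *\<^sub>R (bary_grad C a - bary_grad C b)) \<bullet> x)"
      by (rule ext) (simp add: r_def bary_def inner_diff_right inner_diff_left algebra_simps)
    then show ?thesis using polys_affine by (simp only:)
  qed
  have zero: "?w C x = 0" if "C \<in> M" "F \<in> faces C" "\<not> (a \<in> F \<and> b \<in> F)" "x \<in> convex hull F" for C F x
  proof (cases "a \<in> C \<and> b \<in> C")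
    case True
    interpret tetrahedron C using tet that(1) .
    have "bary C a x = 0 \<or> bary C b x = 0"
      using bary_on_face[of F _ x] that(2-4) True by (auto simp: faces_def)
    then show ?thesis using True by auto
  qed auto
  have "admissible ?w ?S"
    unfolding admissible_def
  proof (intro conjI ballI allI impI)
    fix C assume C: "C \<in> M"
    show "?w C \<in> polys 3 UNIV"
      using bary_prod_polys[OF r] polys_const[OF subspace_UNIV UNIV_I, of 0 3] by auto
    show "transpose (?S C) = ?S C" using S[OF C] t0 by auto
    fix x assume "x \<in> C"
    then show "?w C x = 0"
      using tetrahedron.bary_vertex[OF tet[OF C]] ab by auto
  next
    fix C C' F x assume H: "C \<in> M" "C' \<in> M" "C \<noteq> C'" "F \<in> faces C" "F \<in> faces C'" "x \<in> convex hull F"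
    show "?w C x *\<^sub>R (?S C *v face_normal F) = ?w C' x *\<^sub>R (?S C' *v face_normal F)"
    proof (cases "a \<in> F \<and> b \<in> F")
      case True
      have sub: "F \<subseteq> C" "F \<subseteq> C'" using H by (auto simp: faces_def)
      have "bary C v x = bary C' v x" if "v \<in> F" for v by (rule bary_agree[OF H(1,2) sub that H(6)])
      moreover have "a \<in> C" "b \<in> C" "a \<in> C'" "b \<in> C'" using True sub by auto
      ultimately show ?thesis using P[OF H(1,4)] P[OF H(2,5)] True by (simp add: r_def)
    next
      case False
      then show ?thesis using zero[OF H(1,4) False H(6)] zero[OF H(2,5) False H(6)] by (simp only: scaleR_zero_left)
    qed
  qed
  from face_form[OF this]
  have "0 = (\<Sum>F\<in>all_faces. \<Sum>C\<in>{C\<in>M. F \<in> faces C}. side C F * face_integral F (\<lambda>x. ?w C x * ((?S C *v face_normal F) \<bullet> rig C x)))"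
    by simp
  also have "\<dots> = (\<Sum>F\<in>all_faces. if a \<in> F \<and> b \<in> F then P F \<bullet> (bary_int (\<lambda>x y z. m x y z * x) *\<^sub>R jump F a + bary_int (\<lambda>x y z. m x y z * y) *\<^sub>R jump F b
     + bary_int (\<lambda>x y z. m x y z * z) *\<^sub>R jump F (apex a b F)) else 0)"
  proof (intro sum.cong refl)
    fix F assume F: "F \<in> all_faces"
    show "(\<Sum>C\<in>{C\<in>M. F \<in> faces C}. side C F * face_integral F (\<lambda>x. ?w C x * ((?S C *v face_normal F) \<bullet> rig C x)))
      = (if a \<in> F \<and> b \<in> F then P F \<bullet> (bary_int (\<lambda>x y z. m x y z * x) *\<^sub>R jump F a + bary_int (\<lambda>x y z. m x y z * y) *\<^sub>R jump F b
     + bary_int (\<lambda>x y z. m x y z * z) *\<^sub>R jump F (apex a b F)) else 0)"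
    proof (cases "a \<in> F \<and> b \<in> F")
      case True
      then have Fe: "F \<in> edge_fan a b" using F by simp
      have c3: "cont3 m" "cont3 (\<lambda>x y z. m x y z * x)" "cont3 (\<lambda>x y z. m x y z * y)" "cont3 (\<lambda>x y z. m x y z * z)"
        unfolding cont3_def m_def by (intro cont3_intros)+
      let ?Q = "\<lambda>C. bary_int (\<lambda>x y z. m x y z * x) *\<^sub>R rig C a + bary_int (\<lambda>x y z. m x y z * y) *\<^sub>R rig C b
     + bary_int (\<lambda>x y z. m x y z * z) *\<^sub>R rig C (apex a b F)"
      have "side C F * face_integral F (\<lambda>x. ?w C x * ((?S C *v face_normal F) \<bullet> rig C x)) = side C F * (P F \<bullet> ?Q C)"
        if C: "C \<in> M" "F \<in> faces C" for C
      proof -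
        have "a \<in> C" "b \<in> C" using True C by (auto simp: faces_def)
        then have "face_integral F (\<lambda>x. ?w C x * ((?S C *v face_normal F) \<bullet> rig C x))
          = face_integral F (\<lambda>x. m (bary C a x) (bary C b x) (bary C (apex a b F) x) * (P F \<bullet> rig C x))"
          using P[OF C] True by (simp add: m_def r_def)
        also have "\<dots> = P F \<bullet> ?Q C"
          by (rule face_moment[OF fan_face(1)[OF ab Fe] ab fan_face(2,3)[OF ab Fe] C c3])
        finally show ?thesis by simp
      qed
      then have "(\<Sum>C\<in>{C\<in>M. F \<in> faces C}. side C F * face_integral F (\<lambda>x. ?w C x * ((?S C *v face_normal F) \<bullet> rig C x)))
        = (\<Sum>C\<in>{C\<in>M. F \<in> faces C}. side C F * (P F \<bullet> ?Q C))"
        by (intro sum.cong) auto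
      also have "\<dots> = P F \<bullet> (\<Sum>C\<in>{C\<in>M. F \<in> faces C}. side C F *\<^sub>R ?Q C)"
        by (simp only: inner_sum_right inner_scaleR_right)
      also have "(\<Sum>C\<in>{C\<in>M. F \<in> faces C}. side C F *\<^sub>R ?Q C) = bary_int (\<lambda>x y z. m x y z * x) *\<^sub>R jump F a + bary_int (\<lambda>x y z. m x y z * y) *\<^sub>R jump F b
     + bary_int (\<lambda>x y z. m x y z * z) *\<^sub>R jump F (apex a b F)"
        unfolding jump_def scaleR_sum_right sum.distrib[symmetric]
        by (intro sum.cong refl) (simp only: scaleR_add_right[of "side _ F"] scaleR_left_commute[of "side _ F"])
      finally show ?thesis using True by (simp only: simp_thms if_True)
    next
      case False
      have "face_integral F (\<lambda>x. ?w C x * ((?S C *v face_normal F) \<bullet> rig C x)) = face_integral F (\<lambda>x. 0)" if "C \<in> M" "F \<in> faces C" for C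
        by (rule face_integral_cong) (use zero[OF that False] that in \<open>auto simp: faces_def\<close>)
      then show ?thesis using False by (auto simp: face_integral_0 intro!: sum.neutral)
    qed
  qed
  also have "\<dots> = (\<Sum>F\<in>edge_fan a b. P F \<bullet> (bary_int (\<lambda>x y z. m x y z * x) *\<^sub>R jump F a + bary_int (\<lambda>x y z. m x y z * y) *\<^sub>R jump F b
     + bary_int (\<lambda>x y z. m x y z * z) *\<^sub>R jump F (apex a b F)))"
    by (rule sum.inter_filter[symmetric, OF finite_all_faces])
  finally show ?thesis by simp
qed

text \<open>The factor with \<beta> = 1 is sensitive exactly to the difference of the jumps at
  \<open>a\<close> and \<open>b\<close>. The factor with \<alpha> = 1 isolates the apex once the
  centroid relation has removed the other two values.\<close>

lemma edge_test:
  assumes ab: "a \<noteq> b"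
    and S: "\<And>C. C \<in> M \<Longrightarrow> a \<in> C \<Longrightarrow> b \<in> C \<Longrightarrow> transpose (S C) = S C"
    and P: "\<And>C F. C \<in> M \<Longrightarrow> F \<in> faces C \<Longrightarrow> a \<in> F \<Longrightarrow> b \<in> F \<Longrightarrow> S C *v face_normal F = P F"
  shows "(\<Sum>F\<in>edge_fan a b. P F \<bullet> (jump F a - jump F b)) = 0"
    and "(\<Sum>F\<in>edge_fan a b. P F \<bullet> jump F (apex a b F)) = 0"
proof -
  obtain g where g: "g \<noteq> 0" "bary_int (\<lambda>x y z. x * y * (x - y) * x) = g" "bary_int (\<lambda>x y z. x * y * (x - y) * y) = - g" "bary_int (\<lambda>x y z. x * y * (x - y) * z) = 0"
    by (rule moments_edge_diff)
  obtain s u where su: "s \<noteq> u" "bary_int (\<lambda>x y z. x * y * x) = s" "bary_int (\<lambda>x y z. x * y * y) = s" "bary_int (\<lambda>x y z. x * y * z) = u"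
    by (rule moments_edge)
  have "0 = (\<Sum>F\<in>edge_fan a b. g * (P F \<bullet> (jump F a - jump F b)))"
  proof -
    have "(\<Sum>F\<in>edge_fan a b. P F \<bullet> (g *\<^sub>R jump F a + (- g) *\<^sub>R jump F b + 0 *\<^sub>R jump F (apex a b F))) = 0"
      using edge_moments[where \<alpha> = 0 and \<beta> = 1 and S = S and P = P, OF ab S P] by (simp only: add_0 mult_1 g)
    then show ?thesis by (simp add: inner_diff_right inner_add_right right_diff_distrib)
  qed
  then show "(\<Sum>F\<in>edge_fan a b. P F \<bullet> (jump F a - jump F b)) = 0"
    using g(1) by (simp add: sum_distrib_left[symmetric])
  \<comment> \<open>By the centroid relation the jumps at \<open>a\<close> and \<open>b\<close> sum
    to minus the jump at the apex. Here \<open>s \<noteq> u\<close> keeps the remaining coefficient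
    nonzero.\<close>
  have J: "s *\<^sub>R jump F a + s *\<^sub>R jump F b + u *\<^sub>R jump F (apex a b F) = (u - s) *\<^sub>R jump F (apex a b F)" if "F \<in> edge_fan a b" for F
  proof -
    have "jump F a + jump F b + jump F (apex a b F) = 0"
      using jump_centroid[OF fan_face(1)[OF ab that] ab fan_face(2,3)[OF ab that]] that by simp
    then have "s *\<^sub>R (jump F a + jump F b + jump F (apex a b F)) = 0" by simp
    then show ?thesis by (simp add: algebra_simps)
  qed
  have "0 = (\<Sum>F\<in>edge_fan a b. P F \<bullet> (s *\<^sub>R jump F a + s *\<^sub>R jump F b + u *\<^sub>R jump F (apex a b F)))"
    using edge_moments[where \<alpha> = 1 and \<beta> = 0 and S = S and P = P, OF ab S P] by (simp only: mult_zero_left add_0_right mult_1_right su)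
  also have "\<dots> = (\<Sum>F\<in>edge_fan a b. (u - s) * (P F \<bullet> jump F (apex a b F)))"
    by (intro sum.cong refl) (simp only: J inner_scaleR_right)
  finally show "(\<Sum>F\<in>edge_fan a b. P F \<bullet> jump F (apex a b F)) = 0"
    using su(1) by (simp add: sum_distrib_left[symmetric])
qed

end

section \<open>Edge patches\<close>

lemma parallel_cross:
  fixes x u v :: "real^3"
  assumes "x \<bullet> u = 0" "x \<bullet> v = 0"
  shows "((u \<times> v) \<bullet> (u \<times> v)) *\<^sub>R x = (x \<bullet> (u \<times> v)) *\<^sub>R (u \<times> v)"
proof -
  have "(u \<times> v) \<times> ((u \<times> v) \<times> x) = ((u \<times> v) \<bullet> x) *\<^sub>R (u \<times> v) - ((u \<times> v) \<bullet> (u \<times> v)) *\<^sub>R x"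
    by (rule Lagrange)
  moreover have "(u \<times> v) \<times> x = 0"
  proof -
    have "x \<times> (u \<times> v) = (x \<bullet> v) *\<^sub>R u - (x \<bullet> u) *\<^sub>R v" by (rule Lagrange)
    then show ?thesis using assms cross_skew[of "u \<times> v" x] by simp
  qed
  ultimately show ?thesis by (simp add: inner_commute)
qed

section \<open>The alternating linear system around an edge\<close>

lemma alternating_solution:
  fixes r :: "nat \<Rightarrow> real"
  defines "y \<equiv> \<lambda>\<eta> k. (-1) ^ k * (\<eta> + (\<Sum>i<k. (-1) ^ Suc i * r i))"
  shows "y \<eta> k + y \<eta> (Suc k) = r k" "y \<eta> 0 = \<eta>"
proof -
  have "(-1::real) ^ k * (-1) ^ k = 1" by (simp add: power_mult_distrib[symmetric])
  then have "(-1::real) ^ k * ((-1) ^ k * r k) = r k" by (simp add: mult.assoc[symmetric])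
  then show "y \<eta> k + y \<eta> (Suc k) = r k" by (simp add: y_def algebra_simps)
qed (simp add: y_def)

text \<open>There are m equations for the m + 1 unknowns y, so \<open>y 0\<close> is free and every
  x is allowed, in particular unit vectors.\<close>

lemma open_chain_zero:
  fixes D \<rho> :: "nat \<Rightarrow> real"
  assumes H: "\<And>x y. (\<And>i. i < m \<Longrightarrow> y i + y (Suc i) = (x i - x (Suc i)) * \<rho> i) \<Longrightarrow> (\<Sum>j\<le>m. D j * x j) = 0"
    and j: "j \<le> m"
  shows "D j = 0"
proof -
  let ?x = "\<lambda>i. if i = j then 1 else (0::real)"
  have "(\<Sum>i\<le>m. D i * ?x i) = 0"
    by (rule H, rule alternating_solution(1)[where \<eta> = 0])
  moreover have "(\<Sum>i\<le>m. D i * ?x i) = (\<Sum>i\<le>m. if i = j then D i else 0)" by (intro sum.cong) auto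
  ultimately show ?thesis using j by simp
qed

definition cyclic_pred :: "nat \<Rightarrow> nat \<Rightarrow> nat" where
  "cyclic_pred m j = (if j = 0 then m - 1 else j - 1)"

text \<open>Solving forward from \<open>y 0 = \<eta>\<close> gives
  \<open>y m = (-1) ^ m * (\<eta> + L x)\<close>. Odd m closes with a suitable \<eta>; even m closes
  iff \<open>L x = 0\<close>. The coefficient of \<open>L\<close> at j is, up to sign, the sum of
  \<rho> at j and at its predecessor, and D is a multiple of \<open>L\<close>: it vanishes where
  \<open>L\<close> does, and a single zero elsewhere makes all of it vanish.\<close>

lemma cyclic_zero:
  fixes D \<rho> :: "nat \<Rightarrow> real"
  assumes H: "\<And>x y. x m = x 0 \<Longrightarrow> y m = y 0 \<Longrightarrow> (\<And>i. i < m \<Longrightarrow> y i + y (Suc i) = (x i - x (Suc i)) * \<rho> i) \<Longrightarrow> (\<Sum>j<m. D j * x j) = 0"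
    and m: "m > 0"
  shows "odd m \<Longrightarrow> j < m \<Longrightarrow> D j = 0"
    and "even m \<Longrightarrow> j < m \<Longrightarrow> \<rho> (cyclic_pred m j) + \<rho> j = 0 \<Longrightarrow> D j = 0"
    and "even m \<Longrightarrow> j < m \<Longrightarrow> \<rho> (cyclic_pred m j) + \<rho> j \<noteq> 0 \<Longrightarrow> D j = 0 \<Longrightarrow> i < m \<Longrightarrow> D i = 0"
proof -
  define L where "L x = (\<Sum>i<m. (-1) ^ Suc i * ((x i - x (Suc i)) * \<rho> i))" for x :: "nat \<Rightarrow> real"
  have solve: "(\<Sum>j<m. D j * x j) = 0" if x: "x m = x 0" and o: "odd m \<or> L x = 0" for x
  proof (rule H[OF x])
    \<comment> \<open>For odd m the closing condition reads \<eta> = - (\<eta> + L x).\<close>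
    let ?\<eta> = "if odd m then - L x / 2 else 0"
    let ?y = "\<lambda>k. (-1) ^ k * (?\<eta> + (\<Sum>i<k. (-1) ^ Suc i * ((x i - x (Suc i)) * \<rho> i)))"
    show "?y i + ?y (Suc i) = (x i - x (Suc i)) * \<rho> i" for i by (rule alternating_solution(1))
    have "?y m = (-1) ^ m * (?\<eta> + L x)" by (simp add: L_def)
    then show "?y m = ?y 0" using o by (cases "odd m") auto
  qed
  \<comment> \<open>Unit vectors on the cycle: index \<open>m\<close> repeats index 0, so the vector
    for \<open>j = 0\<close> is 1 at both.\<close>
  define e where "e j i = (if i = j \<or> (i = m \<and> j = 0) then 1 else (0::real))" for j i
  have e: "e j m = e j 0" if "j < m" for j using that m by (auto simp: e_def)
  have De: "(\<Sum>i<m. D i * e j i) = D j" if "j < m" for j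
  proof -
    have "(\<Sum>i<m. D i * e j i) = (\<Sum>i<m. if i = j then D i else 0)" by (intro sum.cong) (auto simp: e_def)
    then show ?thesis using that by simp
  qed
  show "D j = 0" if "odd m" "j < m" for j
    using solve[where x = "e j", OF e[OF that(2)]] De[OF that(2)] that(1) by simp
  have Le: "L (e j) = (-1) ^ Suc j * (\<rho> (cyclic_pred m j) + \<rho> j)" if "even m" "j < m" for j
  proof -
    let ?p = "cyclic_pred m j"
    have p: "?p < m" using that m by (auto simp: cyclic_pred_def)
    have "L (e j) = (\<Sum>i<m. (if i = j then (-1) ^ Suc i * \<rho> i else 0) - (if i = ?p then (-1) ^ Suc i * \<rho> i else 0))"
      unfolding L_def
    proof (intro sum.cong refl)
      fix i assume "i \<in> {..<m}"
      then have "e j i = (if i = j then 1 else 0)" "e j (Suc i) = (if i = ?p then 1 else 0)"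
        using that m by (auto simp: e_def cyclic_pred_def)
      then show "(-1) ^ Suc i * ((e j i - e j (Suc i)) * \<rho> i) = (if i = j then (-1) ^ Suc i * \<rho> i else 0) - (if i = ?p then (-1) ^ Suc i * \<rho> i else 0)"
        by simp
    qed
    also have "\<dots> = (-1) ^ Suc j * \<rho> j - (-1) ^ Suc ?p * \<rho> ?p"
      using that p by (simp add: sum_subtractf)
    also have "(-1::real) ^ Suc ?p = - ((-1) ^ Suc j)"
    proof (cases j)
      case 0
      then show ?thesis using that m by (simp add: cyclic_pred_def)
    qed (simp add: cyclic_pred_def)
    finally show ?thesis by (simp add: algebra_simps)
  qed
  show "D j = 0" if "even m" "j < m" "\<rho> (cyclic_pred m j) + \<rho> j = 0" for j
    using solve[where x = "e j", OF e[OF that(2)]] De[OF that(2)] Le[OF that(1,2)] that(3) by simp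
  show "D i = 0" if ev: "even m" and j: "j < m" "\<rho> (cyclic_pred m j) + \<rho> j \<noteq> 0" "D j = 0" and i: "i < m" for i j
  proof -
    have nz: "L (e j) \<noteq> 0" using Le[OF ev j(1)] j(2) by simp
    \<comment> \<open>Chosen so that \<open>e i - c * e j\<close> lies in the kernel of
      \<open>L\<close> and is an allowed test vector.\<close>
    define c where "c = L (e i) / L (e j)"
    let ?x = "\<lambda>n. e i n - c * e j n"
    have "L ?x = L (e i) - c * L (e j)"
      unfolding L_def sum_distrib_left sum_subtractf[symmetric] by (intro sum.cong refl) (simp add: algebra_simps)
    then have "L ?x = 0" using nz by (simp add: c_def)
    moreover have "?x m = ?x 0" using e[OF i] e[OF j(1)] by simp
    ultimately have "(\<Sum>n<m. D n * ?x n) = 0" using solve[where x = ?x] by simp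
    moreover have "(\<Sum>n<m. D n * ?x n) = (\<Sum>n<m. D n * e i n) - c * (\<Sum>n<m. D n * e j n)"
      by (simp add: sum_distrib_left sum_subtractf algebra_simps)
    ultimately show ?thesis using De[OF i] De[OF j(1)] j(3) by simp
  qed
qed

context rigid_mesh
begin

text \<open>With \<open>t\<close> along the edge, t . n = 0 on every face of the fan, so the
  symmetrised product of \<open>t\<close> and \<open>s\<close> maps n to (s . n) t. In an element
  with face \<open>F\<close>, let \<open>s\<close> point from \<open>a\<close> to the vertex
  opposite to \<open>F\<close>: it lies in the other face at the edge, hence s . n = 0 there, and it
  is scaled to s . n = 1 on \<open>F\<close>. Thus \<open>F\<close> alone is tested, in direction
  \<open>t\<close>.\<close>

lemma jump_apex_tangential:
  assumes ab: "a \<noteq> b" and F: "F \<in> edge_fan a b"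
  shows "(a - b) \<bullet> jump F (apex a b F) = 0"
proof -
  define t where "t = a - b"
  define s where "s C = (1 / (face_normal F \<bullet> (the_elem (C - F) - a))) *\<^sub>R (the_elem (C - F) - a)" for C
  define S :: "(real^3) set \<Rightarrow> real^3^3" where
    "S C = (if F \<in> faces C then (\<chi> i j. t $ i * s C $ j) + (\<chi> i j. s C $ i * t $ j) else 0)" for C
  have t0: "transpose (0::real^3^3) = 0" by (simp add: transpose_def vec_eq_iff)
  have S: "transpose (S C) = S C" for C
    using t0 by (auto simp: S_def transpose_def vec_eq_iff mult_ac)
  have P: "S C *v face_normal F' = (if F' = F then t else 0)"
    if C: "C \<in> M" and F': "F' \<in> faces C" "a \<in> F'" "b \<in> F'" for C F'
  proof (cases "F \<in> faces C")
    case True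
    interpret tetrahedron C using tet[OF C] .
    obtain c where c: "c \<in> C" "F = C - {c}" using True unfolding faces_Diff[OF card4] by blast
    then have "C - F = {c}" by blast
    then have te: "the_elem (C - F) = c" by simp
    have aF: "a \<in> C - {c}" using F c(2) by blast
    have nz: "face_normal F \<bullet> (c - a) \<noteq> 0" using normal_nonzero[OF c(1) aF] c(2) by simp
    have tn: "t \<bullet> face_normal F' = 0"
      using face_normal_orth[of F' a b] F' by (simp add: faces_def t_def inner_commute)
    have Sn: "S C *v face_normal F' = (s C \<bullet> face_normal F') *\<^sub>R t"
      using True tn by (simp add: S_def matrix_vector_mult_add_rdistrib outer_mult)
    show ?thesis
    proof (cases "F' = F")
      case True
      then show ?thesis using Sn nz by (simp add: s_def te inner_commute)
    next
      case False
      have "\<not> F' \<subseteq> F"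
        using False F'(1) True card_subset_eq[of F F'] finite_subset[OF _ fin, of F] by (auto simp: faces_def)
      then have "c \<in> F'" using F'(1) c(2) unfolding faces_def by blast
      then have "face_normal F' \<bullet> (c - a) = 0" using face_normal_orth[of F' c a] F' by (simp add: faces_def)
      then show ?thesis using Sn False by (simp add: s_def te inner_commute)
    qed
  next
    case False
    then show ?thesis using F'(1) by (auto simp: S_def)
  qed
  have "(\<Sum>F'\<in>edge_fan a b. (if F' = F then t else 0) \<bullet> jump F' (apex a b F')) = 0"
    by (rule edge_test(2)[OF ab S P])
  moreover have "(\<Sum>F'\<in>edge_fan a b. (if F' = F then t else 0) \<bullet> jump F' (apex a b F')) = (\<Sum>F'\<in>edge_fan a b. if F' = F then t \<bullet> jump F (apex a b F) else 0)"
    by (intro sum.cong) auto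
  moreover have "\<dots> = t \<bullet> jump F (apex a b F)" using F finite_all_faces by simp
  ultimately show ?thesis by (simp add: t_def)
qed

text \<open>The apex drops out by \<open>jump_apex_tangential\<close>. For the components along
  \<open>x - y\<close> at the two ends, the centroid relation gives sum zero and
  \<open>jump_rigid\<close> gives equality, so both vanish.\<close>

lemma jump_normal:
  assumes F: "F \<in> all_faces" and v: "v \<in> F" and xy: "x \<in> F" "y \<in> F"
  shows "(x - y) \<bullet> jump F v = 0"
proof (cases "x = y")
  case False
  have c3: "card F = 3" using F by (auto simp: all_faces_def faces_def)
  have Fe: "F \<in> edge_fan x y" using F xy by simp
  let ?z = "apex x y F"
  note f = fan_face[OF False Fe]
  have t: "(x - y) \<bullet> jump F ?z = 0" by (rule jump_apex_tangential[OF False Fe])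
  have "(x - y) \<bullet> (jump F x + jump F y + jump F ?z) = 0"
    using jump_centroid[OF f(1) False f(2,3) F] by simp
  then have 1: "(x - y) \<bullet> jump F x + (x - y) \<bullet> jump F y = 0" using t by (simp add: inner_add_right)
  have 2: "(x - y) \<bullet> jump F x - (x - y) \<bullet> jump F y = 0"
    using jump_rigid[of x y F] by (simp only: inner_diff_right)
  have "(x - y) \<bullet> jump F x = 0" "(x - y) \<bullet> jump F y = 0" using 1 2 by linarith+
  moreover have "v = x \<or> v = y \<or> v = ?z" using v f(1) by auto
  ultimately show ?thesis using t by auto
qed simp

end

section \<open>Rotations in the plane orthogonal to an edge\<close>

locale edge_frame =
  fixes t :: "real^3"
  assumes unit_t: "norm t = 1"
begin

definition unit_normal_to :: "real^3 \<Rightarrow> bool" where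
  "unit_normal_to s \<longleftrightarrow> norm s = 1 \<and> s \<bullet> t = 0"

lemma frame:
  assumes "unit_normal_to s"
  shows "s \<bullet> s = 1" "(t \<times> s) \<bullet> (t \<times> s) = 1" "s \<bullet> (t \<times> s) = 0" "t \<bullet> (t \<times> s) = 0"
proof -
  have s: "norm s = 1" "s \<bullet> t = 0" using assms by (auto simp: unit_normal_to_def)
  show "s \<bullet> s = 1" using s(1) by (simp add: dot_square_norm)
  show "(t \<times> s) \<bullet> (t \<times> s) = 1"
    using norm_cross_dot[of t s] s unit_t by (simp add: inner_commute[of t s] dot_square_norm)
qed (simp_all add: dot_cross_self)

lemma expand:
  assumes s: "unit_normal_to s" and x: "x \<bullet> t = 0"
  shows "x = (x \<bullet> s) *\<^sub>R s + (x \<bullet> (t \<times> s)) *\<^sub>R (t \<times> s)"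
proof -
  let ?N = "t \<times> s"
  define z where "z = x - ((x \<bullet> s) *\<^sub>R s + (x \<bullet> ?N) *\<^sub>R ?N)"
  note f = frame[OF s]
  have st: "s \<bullet> t = 0" using s by (simp add: unit_normal_to_def)
  have "z \<bullet> t = 0" "z \<bullet> s = 0" "z \<bullet> ?N = 0"
    unfolding z_def using f st x by (simp_all add: inner_diff_left inner_add_left inner_diff_right inner_add_right inner_commute)
  then have "z = 0" using parallel_cross[of z t s] f(2) by simp
  then show ?thesis by (simp add: z_def)
qed

lemma normal_multiple:
  assumes s: "unit_normal_to s" and x: "x \<bullet> t = 0" "x \<bullet> s = 0"
  shows "x = (x \<bullet> (t \<times> s)) *\<^sub>R (t \<times> s)"
  using expand[OF s x(1)] x(2) by simp

text \<open>In the plane orthogonal to \<open>t\<close>, the vectors \<open>s\<close> and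
  \<open>t \<times> s\<close> form an orthonormal basis, and \<gamma>, \<sigma> are the cosine and
  sine of the rotation taking \<open>s\<close> to \<open>s'\<close>.\<close>

lemma rotate:
  assumes s: "unit_normal_to s" "unit_normal_to s'"
  defines "\<gamma> \<equiv> s \<bullet> s'" and "\<sigma> \<equiv> (t \<times> s) \<bullet> s'"
  shows "s' = \<gamma> *\<^sub>R s + \<sigma> *\<^sub>R (t \<times> s)" "t \<times> s' = \<gamma> *\<^sub>R (t \<times> s) - \<sigma> *\<^sub>R s" "\<gamma>\<^sup>2 + \<sigma>\<^sup>2 = 1"
    "s = \<gamma> *\<^sub>R s' - \<sigma> *\<^sub>R (t \<times> s')" "(t \<times> s') \<bullet> s = - \<sigma>"
proof -
  note f = frame[OF s(1)] frame[OF s(2)]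
  have st: "s \<bullet> t = 0" "s' \<bullet> t = 0" using s by (auto simp: unit_normal_to_def)
  show e: "s' = \<gamma> *\<^sub>R s + \<sigma> *\<^sub>R (t \<times> s)"
    using expand[OF s(1) st(2)] by (simp add: \<gamma>_def \<sigma>_def inner_commute)
  have tt: "t \<times> (t \<times> s) = - s"
    using Lagrange[of t t s] st unit_t by (simp add: inner_commute dot_square_norm)
  have "t \<times> s' = t \<times> (\<gamma> *\<^sub>R s + \<sigma> *\<^sub>R (t \<times> s))" using e by simp
  also have "\<dots> = \<gamma> *\<^sub>R (t \<times> s) - \<sigma> *\<^sub>R s" by (simp add: cross_add_right cross_mult_right tt)
  finally show n: "t \<times> s' = \<gamma> *\<^sub>R (t \<times> s) - \<sigma> *\<^sub>R s" .
  have "1 = s' \<bullet> (\<gamma> *\<^sub>R s + \<sigma> *\<^sub>R (t \<times> s))" using f(5) e by simp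
  also have "\<dots> = \<gamma> * \<gamma> + \<sigma> * \<sigma>" by (simp add: inner_add_right \<gamma>_def \<sigma>_def inner_commute)
  finally show g: "\<gamma>\<^sup>2 + \<sigma>\<^sup>2 = 1" by (simp add: power2_eq_square)
  have "\<gamma> *\<^sub>R s' - \<sigma> *\<^sub>R (t \<times> s') = \<gamma> *\<^sub>R (\<gamma> *\<^sub>R s + \<sigma> *\<^sub>R (t \<times> s)) - \<sigma> *\<^sub>R (\<gamma> *\<^sub>R (t \<times> s) - \<sigma> *\<^sub>R s)"
    using e n by simp
  also have "\<dots> = (\<gamma>\<^sup>2 + \<sigma>\<^sup>2) *\<^sub>R s" by (simp add: algebra_simps power2_eq_square)
  finally show "s = \<gamma> *\<^sub>R s' - \<sigma> *\<^sub>R (t \<times> s')" using g by simp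
  have "(\<gamma> *\<^sub>R (t \<times> s) - \<sigma> *\<^sub>R s) \<bullet> s = - \<sigma>"
    using f by (simp add: inner_diff_left inner_diff_right inner_commute)
  then show "(t \<times> s') \<bullet> s = - \<sigma>" using n by simp
qed

text \<open>The hypothesis on \<open>y + y'\<close> is the symmetry condition that the product of A
  N with N' equals that of A N' with N, where N and N' are the two normals; as these are
  independent, it is also sufficient.\<close>

lemma planar_matrix:
  assumes s: "unit_normal_to s" "unit_normal_to s'"
  defines "\<gamma> \<equiv> s \<bullet> s'" and "\<sigma> \<equiv> (t \<times> s) \<bullet> s'"
  assumes nz: "\<sigma> \<noteq> 0" and y: "y + y' = (x - x') * (\<gamma> / \<sigma>)"
  obtains A :: "real^3^3" where "transpose A = A" "A *v (t \<times> s) = x *\<^sub>R (t \<times> s) + y *\<^sub>R s"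
    "A *v (t \<times> s') = x' *\<^sub>R (t \<times> s') + y' *\<^sub>R s'"
proof -
  let ?o = "\<lambda>p q. (\<chi> i j. p $ i * q $ j) :: real^3^3"
  note r = rotate[OF s, folded \<gamma>_def \<sigma>_def] and f = frame[OF s(1)] frame[OF s(2)]
  \<comment> \<open>\<open>s\<close> is orthogonal to its own normal and \<open>s'\<close> to its
    own, so the two dyads fix the normal parts \<open>x\<close> and \<open>x'\<close> separately.
    Then \<delta> is what makes the tangential part of the first image equal to
    \<open>y\<close>.\<close>
  define \<delta> where "\<delta> = y / \<sigma> - x * \<gamma> / \<sigma>\<^sup>2"
  define A where "A = (x / \<sigma>\<^sup>2) *\<^sub>R ?o s' s' + (x' / \<sigma>\<^sup>2) *\<^sub>R ?o s s + \<delta> *\<^sub>R (?o s s' + ?o s' s)"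
  have Av: "A *v v = (x / \<sigma>\<^sup>2 * (s' \<bullet> v)) *\<^sub>R s' + (x' / \<sigma>\<^sup>2 * (s \<bullet> v)) *\<^sub>R s + (\<delta> * (s' \<bullet> v)) *\<^sub>R s + (\<delta> * (s \<bullet> v)) *\<^sub>R s'" for v
    by (simp add: A_def matrix_vector_mult_add_rdistrib scaleR_matrix_vector_assoc[symmetric] outer_mult scaleR_add_right)
  have sv: "s' \<bullet> (t \<times> s) = \<sigma>" "s \<bullet> (t \<times> s) = 0" "s' \<bullet> (t \<times> s') = 0" "s \<bullet> (t \<times> s') = - \<sigma>"
    using f r(5) by (simp_all add: \<sigma>_def inner_commute)
  have "A *v (t \<times> s) = (x / \<sigma>) *\<^sub>R s' + (\<delta> * \<sigma>) *\<^sub>R s"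
    unfolding Av sv using nz by (simp add: power2_eq_square)
  also have "\<dots> = (x / \<sigma>) *\<^sub>R (\<gamma> *\<^sub>R s + \<sigma> *\<^sub>R (t \<times> s)) + (\<delta> * \<sigma>) *\<^sub>R s" using r(1) by simp
  also have "\<dots> = x *\<^sub>R (t \<times> s) + (x * \<gamma> / \<sigma> + \<delta> * \<sigma>) *\<^sub>R s"
    using nz by (simp add: algebra_simps)
  also have "x * \<gamma> / \<sigma> + \<delta> * \<sigma> = y" using nz by (simp add: \<delta>_def field_simps power2_eq_square)
  finally have 1: "A *v (t \<times> s) = x *\<^sub>R (t \<times> s) + y *\<^sub>R s" .
  have "A *v (t \<times> s') = - ((x' / \<sigma>) *\<^sub>R s) - (\<delta> * \<sigma>) *\<^sub>R s'"
    unfolding Av sv using nz by (simp add: power2_eq_square)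
  also have "\<dots> = - ((x' / \<sigma>) *\<^sub>R (\<gamma> *\<^sub>R s' - \<sigma> *\<^sub>R (t \<times> s'))) - (\<delta> * \<sigma>) *\<^sub>R s'" using r(4) by simp
  also have "\<dots> = x' *\<^sub>R (t \<times> s') + (- (x' * \<gamma> / \<sigma>) - \<delta> * \<sigma>) *\<^sub>R s'"
    using nz by (simp add: algebra_simps)
  also have "- (x' * \<gamma> / \<sigma>) - \<delta> * \<sigma> = y'"
  proof -
    have "\<delta> * \<sigma> = y - x * \<gamma> / \<sigma>" using nz by (simp add: \<delta>_def field_simps power2_eq_square)
    moreover have "y' = (x - x') * (\<gamma> / \<sigma>) - y" using y by simp
    ultimately show ?thesis by (simp add: algebra_simps diff_divide_distrib)
  qed
  finally have 2: "A *v (t \<times> s') = x' *\<^sub>R (t \<times> s') + y' *\<^sub>R s'" .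
  have "transpose A = A" by (simp add: A_def transpose_def vec_eq_iff mult_ac)
  then show ?thesis using that 1 2 by blast
qed

end

section \<open>The patch of elements around an edge\<close>

context rigid_mesh
begin

definition good :: "(real^3) set \<Rightarrow> bool" where
  "good F \<longleftrightarrow> (\<forall>v\<in>F. jump F v = 0)"

end

text \<open>Covers interior and boundary edges alike: \<open>F m\<close> is \<open>F 0\<close> in
  the first case and a further face in the second. Indices start at 0, and \<open>s f\<close> is the
  conormal pointing from the edge into the face \<open>f\<close>.\<close>

locale edge_patch = rigid_mesh +
  fixes a b :: "real^3" and m :: nat and K F :: "nat \<Rightarrow> (real^3) set" and s :: "(real^3) set \<Rightarrow> real^3"
  assumes ab: "a \<noteq> b" and m_pos: "m > 0"
    and K: "\<And>i. i < m \<Longrightarrow> K i \<in> M"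
    and K_all: "\<And>C. C \<in> M \<Longrightarrow> a \<in> C \<Longrightarrow> b \<in> C \<Longrightarrow> \<exists>i<m. C = K i"
    and K_inj: "inj_on K {..<m}"
    and F: "\<And>i. i < m \<Longrightarrow> F i \<in> faces (K i)" "\<And>i. i < m \<Longrightarrow> F (Suc i) \<in> faces (K i)" "\<And>i. i < m \<Longrightarrow> F i \<noteq> F (Suc i)"
    and F_ab: "\<And>i. i \<le> m \<Longrightarrow> a \<in> F i" "\<And>i. i \<le> m \<Longrightarrow> b \<in> F i"
    and s: "\<And>f. f \<in> edge_fan a b \<Longrightarrow> norm (s f) = 1 \<and> s f \<bullet> (b - a) = 0 \<and> (\<exists>\<alpha>>0. \<exists>\<beta>. apex a b f - a = \<alpha> *\<^sub>R s f + \<beta> *\<^sub>R (b - a))"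
begin

definition t :: "real^3" where "t = (1 / norm (b - a)) *\<^sub>R (b - a)"

sublocale edge_frame t
  by unfold_locales (use ab in \<open>simp add: t_def\<close>)

text \<open>A unit normal of the face, oriented by the sense of rotation about the edge.
  \<open>\<nu> f\<close> is the signed length of \<open>face_normal f\<close> with respect to
  it.\<close>

abbreviation N :: "(real^3) set \<Rightarrow> real^3" where "N f \<equiv> t \<times> s f"
abbreviation \<nu> :: "(real^3) set \<Rightarrow> real" where "\<nu> f \<equiv> face_normal f \<bullet> N f"
text \<open>Cosine, and below sine, of the turn from \<open>F i\<close> to the next face, so that
  \<open>\<rho> i\<close> is a signed cotangent.\<close>

definition \<gamma> :: "nat \<Rightarrow> real" where "\<gamma> i = s (F i) \<bullet> s (F (Suc i))"
definition \<sigma> :: "nat \<Rightarrow> real" where "\<sigma> i = N (F i) \<bullet> s (F (Suc i))"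
abbreviation \<rho> :: "nat \<Rightarrow> real" where "\<rho> i \<equiv> \<gamma> i / \<sigma> i"

lemma F_fan: "i \<le> m \<Longrightarrow> F i \<in> edge_fan a b"
proof -
  assume i: "i \<le> m"
  then have "\<exists>C\<in>M. F i \<in> faces C"
    using F(1)[of i] F(2)[of "i - 1"] K[of i] K[of "i - 1"] m_pos by (cases "i = m") auto
  then show ?thesis using F_ab[OF i] by (auto simp: all_faces_def)
qed

lemma s_normal: "f \<in> edge_fan a b \<Longrightarrow> unit_normal_to (s f)"
  unfolding unit_normal_to_def using s[of f] by (simp add: t_def)

lemma apex_expand:
  assumes "f \<in> edge_fan a b"
  obtains \<alpha> \<beta> where "\<alpha> > 0" "apex a b f - a = \<alpha> *\<^sub>R s f + \<beta> *\<^sub>R (b - a)"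
  using s[OF assms] by blast

lemma in_plane:
  assumes f: "f \<in> edge_fan a b" and x: "x \<bullet> (b - a) = 0" "x \<bullet> (apex a b f - a) = 0"
  shows "x = (x \<bullet> N f) *\<^sub>R N f"
proof (rule normal_multiple[OF s_normal[OF f]])
  obtain \<alpha> \<beta> where \<alpha>: "\<alpha> > 0" "apex a b f - a = \<alpha> *\<^sub>R s f + \<beta> *\<^sub>R (b - a)" by (rule apex_expand[OF f])
  show "x \<bullet> t = 0" using x(1) by (simp add: t_def)
  have "\<alpha> * (x \<bullet> s f) = 0" using x unfolding \<alpha>(2) by (simp add: inner_add_right)
  then show "x \<bullet> s f = 0" using \<alpha>(1) by simp
qed

lemma fan_cases: "f \<in> edge_fan a b \<Longrightarrow> v \<in> f \<Longrightarrow> v = a \<or> v = b \<or> v = apex a b f"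
  by (subst (asm) fan_face(1)[OF ab, of f]) (assumption, simp)

lemma fan3:
  assumes f: "f \<in> edge_fan a b" shows "card f = 3 \<and> a \<in> f \<and> b \<in> f \<and> apex a b f \<in> f"
proof -
  have "card f = 3" "a \<in> f" "b \<in> f" using f by (auto simp: all_faces_def faces_def)
  moreover have "apex a b f \<in> f" by (subst (2) fan_face(1)[OF ab f]) simp
  ultimately show ?thesis by blast
qed

lemma fan_eqI:
  assumes "f \<in> edge_fan a b" "g \<in> edge_fan a b" "apex a b f = apex a b g" shows "f = g"
proof -
  have "f = {a, b, apex a b g}" using fan_face(1)[OF ab assms(1)] unfolding assms(3) .
  also have "\<dots> = g" by (rule fan_face(1)[OF ab assms(2), symmetric])
  finally show ?thesis .
qed

lemma normal_eq:
  assumes f: "f \<in> edge_fan a b" shows "face_normal f = \<nu> f *\<^sub>R N f"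
  by (rule in_plane[OF f]) (use fan3[OF f] face_normal_orth in blast)+

lemma nu_nonzero: "f \<in> edge_fan a b \<Longrightarrow> \<nu> f \<noteq> 0"
proof -
  assume f: "f \<in> edge_fan a b"
  then obtain C where C: "C \<in> M" "f \<in> faces C" by (auto simp: all_faces_def)
  obtain v where v: "v \<in> C" "f = C - {v}" using C(2) unfolding faces_Diff[OF card4M[OF C(1)]] by blast
  have "a \<in> C - {v}" using f v(2) by blast
  then have "face_normal f \<noteq> 0" using tetrahedron.normal_nonzero[OF tet[OF C(1)] v(1), of a] v(2) by auto
  then show "\<nu> f \<noteq> 0" using normal_eq[OF f] by auto
qed

lemma jump_eq:
  assumes f: "f \<in> edge_fan a b" and v: "v \<in> f" shows "jump f v = (jump f v \<bullet> N f) *\<^sub>R N f"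
proof (rule in_plane[OF f])
  have "f \<in> all_faces" using f by blast
  note n = jump_normal[OF this v]
  show "jump f v \<bullet> (b - a) = 0" using n[of b a] fan3[OF f] by (metis inner_commute)
  show "jump f v \<bullet> (apex a b f - a) = 0" using n[of "apex a b f" a] fan3[OF f] by (metis inner_commute)
qed

text \<open>By \<open>jump_normal\<close> only normal components are left. The value at the apex,
  the difference at \<open>a\<close> and \<open>b\<close>, and the centroid relation determine all
  three vertex values.\<close>

lemma goodI:
  assumes f: "f \<in> edge_fan a b" and 1: "\<nu> f * ((jump f a - jump f b) \<bullet> N f) = 0" and 2: "\<nu> f * (jump f (apex a b f) \<bullet> N f) = 0"
  shows "good f"
proof -
  note v = fan3[OF f] and n = nu_nonzero[OF f]
  have 3: "jump f (apex a b f) = 0" using jump_eq[OF f, of "apex a b f"] 2 n v by simp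
  have "jump f a - jump f b = ((jump f a - jump f b) \<bullet> N f) *\<^sub>R N f"
    using jump_eq[OF f, of a] jump_eq[OF f, of b] v by (metis inner_diff_left scaleR_left_diff_distrib)
  then have 4: "jump f a = jump f b" using 1 n by simp
  have "jump f a + jump f b + jump f (apex a b f) = 0"
    using jump_centroid[OF fan_face(1)[OF ab f] ab fan_face(2,3)[OF ab f]] f by simp
  then have "2 *\<^sub>R jump f a = 0" using 3 4 by (simp add: scaleR_2)
  then have "jump f a = 0" "jump f b = 0" using 4 by simp_all
  then show ?thesis using 3 fan_cases[OF f] unfolding good_def by metis
qed

text \<open>Stated for an unordered pair, so that it serves the element as seen from either of its
  two faces at the edge.\<close>

lemma opposite_vertex:
  assumes "i < m" and "{f, g} = {F i, F (Suc i)}" "f \<noteq> g"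
  shows "apex a b g \<in> K i - f" "f \<in> faces (K i)" "g \<in> faces (K i)"
proof -
  have fg: "f \<in> edge_fan a b" "g \<in> edge_fan a b" using assms F_fan[of i] F_fan[of "Suc i"] by (auto simp: doubleton_eq_iff)
  show *: "f \<in> faces (K i)" "g \<in> faces (K i)" using assms F[of i] by (auto simp: doubleton_eq_iff)
  have "apex a b g \<notin> f"
  proof
    assume "apex a b g \<in> f"
    then have sub: "g \<subseteq> f" using fan_cases[OF fg(2)] fan3[OF fg(1)] by blast
    have c: "card g = card f" "card f = 3" using fan3[OF fg(1)] fan3[OF fg(2)] by simp_all
    then have "finite f" by (metis card.infinite zero_neq_numeral)
    then show False using card_subset_eq[OF _ sub c(1)] assms(3) by simp
  qed
  moreover have "apex a b g \<in> K i" using *(2) fan3[OF fg(2)] by (auto simp: faces_def)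
  ultimately show "apex a b g \<in> K i - f" by simp
qed

text \<open>Within \<open>K i\<close> the vertex opposite to \<open>f\<close> is the apex of
  \<open>g\<close>, whose offset from \<open>a\<close> is a positive multiple of \<open>s g\<close>
  plus a multiple of the edge, and the normal of \<open>f\<close> does not see the latter.\<close>

lemma side_apex:
  assumes i: "i < m" and fg: "{f, g} = {F i, F (Suc i)}" "f \<noteq> g"
  shows "side (K i) f = sgn (\<nu> f * (N f \<bullet> s g))" "N f \<bullet> s g \<noteq> 0"
proof -
  note o = opposite_vertex[OF assms]
  have e: "f \<in> edge_fan a b" "g \<in> edge_fan a b" using fg F_fan[of i] F_fan[of "Suc i"] i by (auto simp: doubleton_eq_iff)
  obtain \<alpha> \<beta> where \<alpha>: "\<alpha> > 0" "apex a b g - a = \<alpha> *\<^sub>R s g + \<beta> *\<^sub>R (b - a)" by (rule apex_expand[OF e(2)])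
  have "face_normal f \<bullet> (b - a) = 0" using face_normal_orth fan3[OF e(1)] by blast
  then have "face_normal f \<bullet> (apex a b g - a) = \<alpha> * (face_normal f \<bullet> s g)" unfolding \<alpha>(2) by (simp add: inner_add_right)
  also have "face_normal f \<bullet> s g = \<nu> f * (N f \<bullet> s g)" by (subst normal_eq[OF e(1)]) simp
  finally have q: "face_normal f \<bullet> (apex a b g - a) = \<alpha> * (\<nu> f * (N f \<bullet> s g))" .
  have "side (K i) f = sgn (face_normal f \<bullet> (apex a b g - a))"
    by (rule side_eq[OF card4M[OF K[OF i]]]) (use o fan3[OF e(1)] in \<open>auto simp: faces_def\<close>)
  then show s: "side (K i) f = sgn (\<nu> f * (N f \<bullet> s g))" using q \<alpha>(1) by (simp add: sgn_mult)
  show "N f \<bullet> s g \<noteq> 0" using side_pmM[OF K[OF i] o(2)] s by auto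
qed

lemma sigma_nonzero: "i < m \<Longrightarrow> \<sigma> i \<noteq> 0"
  using side_apex(2)[of i "F i" "F (Suc i)"] F(3) by (simp add: \<sigma>_def)

text \<open>Neighbouring elements lie on opposite sides of their common face, so the conormals turn around
  the edge in a constant direction.\<close>

lemma sigma_sign:
  assumes "i < m" shows "sgn (\<sigma> i) = sgn (\<sigma> 0)"
  using assms
proof (induction i)
  case (Suc i)
  let ?f = "F (Suc i)"
  have i: "i < m" using Suc by simp
  have fan: "F i \<in> edge_fan a b" "?f \<in> edge_fan a b" using F_fan[of i] F_fan[of "Suc i"] i by auto
  have "K i \<noteq> K (Suc i)" using K_inj Suc.prems by (metis i inj_on_def lessThan_iff n_not_Suc_n)
  then have "side (K (Suc i)) ?f = - side (K i) ?f"
    using side_opposite[OF K[OF i] K[OF Suc.prems]] F(2)[OF i] F(1)[OF Suc.prems] by blast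
  moreover have "side (K (Suc i)) ?f = sgn (\<nu> ?f) * sgn (\<sigma> (Suc i))"
    using side_apex(1)[OF Suc.prems refl F(3)[OF Suc.prems]] by (simp add: \<sigma>_def sgn_mult)
  moreover have "side (K i) ?f = sgn (\<nu> ?f) * sgn (N ?f \<bullet> s (F i))"
    using side_apex(1)[OF i _ F(3)[OF i, symmetric]] by (simp add: insert_commute sgn_mult)
  moreover have "N ?f \<bullet> s (F i) = - \<sigma> i"
    using rotate(5)[OF s_normal[OF fan(1)] s_normal[OF fan(2)]] by (simp add: \<sigma>_def)
  ultimately have "sgn (\<nu> ?f) * sgn (\<sigma> (Suc i)) = sgn (\<nu> ?f) * sgn (\<sigma> i)"
    by (simp add: sgn_minus)
  then have "sgn (\<sigma> (Suc i)) = sgn (\<sigma> i)" using nu_nonzero[OF fan(2)] by (simp add: sgn_zero_iff)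
  then show ?case using Suc.IH i by simp
qed simp

text \<open>Each element gets the matrix of \<open>planar_matrix\<close> for the values of
  \<open>X\<close> and \<open>Y\<close> on its two faces. These values belong to the faces, so
  neighbours produce the same vector there. A jump is parallel to the normal, so pairing with it
  picks out \<open>X\<close> only.\<close>

lemma planar_family:
  assumes xy: "\<And>i. i < m \<Longrightarrow> Y (F i) + Y (F (Suc i)) = (X (F i) - X (F (Suc i))) * \<rho> i"
  shows "(\<Sum>f\<in>edge_fan a b. \<nu> f * ((jump f a - jump f b) \<bullet> N f) * X f) = 0"
    and "(\<Sum>f\<in>edge_fan a b. \<nu> f * (jump f (apex a b f) \<bullet> N f) * X f) = 0"
proof -
  have "\<exists>A::real^3^3. transpose A = A \<and> A *v N (F i) = X (F i) *\<^sub>R N (F i) + Y (F i) *\<^sub>R s (F i)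
      \<and> A *v N (F (Suc i)) = X (F (Suc i)) *\<^sub>R N (F (Suc i)) + Y (F (Suc i)) *\<^sub>R s (F (Suc i))" if i: "i < m" for i
  proof -
    have u: "unit_normal_to (s (F i))" "unit_normal_to (s (F (Suc i)))" using s_normal F_fan i by auto
    from planar_matrix[OF u sigma_nonzero[OF i, unfolded \<sigma>_def] xy[OF i, unfolded \<sigma>_def \<gamma>_def]]
    show ?thesis by metis
  qed
  then obtain A :: "nat \<Rightarrow> real^3^3" where A: "\<And>i. i < m \<Longrightarrow> transpose (A i) = A i"
      "\<And>i. i < m \<Longrightarrow> A i *v N (F i) = X (F i) *\<^sub>R N (F i) + Y (F i) *\<^sub>R s (F i)"
      "\<And>i. i < m \<Longrightarrow> A i *v N (F (Suc i)) = X (F (Suc i)) *\<^sub>R N (F (Suc i)) + Y (F (Suc i)) *\<^sub>R s (F (Suc i))"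
    by metis
  define S where "S C = A (the_inv_into {..<m} K C)" for C
  have SK: "S (K i) = A i" if "i < m" for i
    unfolding S_def using the_inv_into_f_f[OF K_inj] that by simp
  define P where "P f = \<nu> f *\<^sub>R (X f *\<^sub>R N f + Y f *\<^sub>R s f)" for f
  have S: "transpose (S C) = S C" if C: "C \<in> M" "a \<in> C" "b \<in> C" for C
    using K_all[OF C] SK A(1) by auto
  have P: "S C *v face_normal f = P f" if C: "C \<in> M" "f \<in> faces C" "a \<in> f" "b \<in> f" for C f
  proof -
    have "a \<in> C" "b \<in> C" using C by (auto simp: faces_def)
    then obtain i where i: "i < m" "C = K i" using K_all C(1) by blast
    have f: "f \<in> edge_fan a b" using C by (auto simp: all_faces_def)
    \<comment> \<open>A third face of the element at this edge would require a fifth vertex.\<close>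
    have "f = F i \<or> f = F (Suc i)"
    proof (rule ccontr)
      assume n: "\<not> ?thesis"
      note o = opposite_vertex[OF i(1) refl F(3)[OF i(1)]]
      have e: "F i \<in> edge_fan a b" "F (Suc i) \<in> edge_fan a b" using F_fan[of i] F_fan[of "Suc i"] i(1) by auto
      have ne: "apex a b f \<noteq> apex a b (F i)" "apex a b f \<noteq> apex a b (F (Suc i))" "apex a b (F i) \<noteq> apex a b (F (Suc i))"
        using n F(3)[OF i(1)] fan_eqI[OF f e(1)] fan_eqI[OF f e(2)] fan_eqI[OF e] by blast+
      have "{a, b, apex a b (F i), apex a b (F (Suc i)), apex a b f} \<subseteq> K i"
        using o C(2) i(2) fan3[OF f] fan3[OF e(1)] fan3[OF e(2)] unfolding faces_def by auto
      moreover have "card {a, b, apex a b (F i), apex a b (F (Suc i)), apex a b f} = 5"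
        using ne ab fan_face(2,3)[OF ab f] fan_face(2,3)[OF ab e(1)] fan_face(2,3)[OF ab e(2)] by simp
      ultimately have "5 \<le> card (K i)" using tetrahedron.fin[OF tet[OF K[OF i(1)]]] by (metis card_mono)
      then show False using card4M[OF K[OF i(1)]] by simp
    qed
    then have "S C *v N f = X f *\<^sub>R N f + Y f *\<^sub>R s f"
      using A(2,3)[OF i(1)] SK[OF i(1)] i(2) by auto
    moreover have "S C *v face_normal f = \<nu> f *\<^sub>R (S C *v N f)"
      by (subst normal_eq[OF f]) (simp add: matrix_vector_mult_scaleR)
    ultimately show ?thesis by (simp add: P_def)
  qed
  have dot: "P f \<bullet> j = \<nu> f * (j \<bullet> N f) * X f" if f: "f \<in> edge_fan a b" and j: "j = (j \<bullet> N f) *\<^sub>R N f" for f j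
  proof -
    note r = frame[OF s_normal[OF f]]
    have "P f \<bullet> j = (j \<bullet> N f) * (P f \<bullet> N f)" by (subst j) simp
    also have "P f \<bullet> N f = \<nu> f * X f" using r by (simp add: P_def inner_add_left)
    finally show ?thesis by simp
  qed
  have "(\<Sum>f\<in>edge_fan a b. P f \<bullet> (jump f a - jump f b)) = 0" by (rule edge_test(1)[OF ab S P])
  moreover have "P f \<bullet> (jump f a - jump f b) = \<nu> f * ((jump f a - jump f b) \<bullet> N f) * X f" if f: "f \<in> edge_fan a b" for f
  proof (rule dot[OF f])
    show "jump f a - jump f b = ((jump f a - jump f b) \<bullet> N f) *\<^sub>R N f"
      using jump_eq[OF f, of a] jump_eq[OF f, of b] fan3[OF f] by (metis inner_diff_left scaleR_left_diff_distrib)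
  qed
  ultimately show "(\<Sum>f\<in>edge_fan a b. \<nu> f * ((jump f a - jump f b) \<bullet> N f) * X f) = 0"
    by (metis (no_types, lifting) sum.cong)
  have "(\<Sum>f\<in>edge_fan a b. P f \<bullet> jump f (apex a b f)) = 0" by (rule edge_test(2)[OF ab S P])
  moreover have "P f \<bullet> jump f (apex a b f) = \<nu> f * (jump f (apex a b f) \<bullet> N f) * X f" if f: "f \<in> edge_fan a b" for f
    by (rule dot[OF f jump_eq[OF f]]) (use fan3[OF f] in simp)
  ultimately show "(\<Sum>f\<in>edge_fan a b. \<nu> f * (jump f (apex a b f) \<bullet> N f) * X f) = 0"
    by (metis (no_types, lifting) sum.cong)
qed

end

context edge_patch
begin

abbreviation \<theta> :: "nat \<Rightarrow> real" where "\<theta> i \<equiv> arccos (\<gamma> i)"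

text \<open>\<open>arccos\<close> forgets the sense of rotation; by \<open>sigma_sign\<close> a
  single sign restores it for the whole patch.\<close>

lemma angle:
  assumes i: "i < m"
  shows "cos (\<theta> i) = \<gamma> i" "\<sigma> i = sgn (\<sigma> 0) * sin (\<theta> i)" "0 < sin (\<theta> i)" "0 < \<theta> i"
proof -
  have u: "unit_normal_to (s (F i))" "unit_normal_to (s (F (Suc i)))" using s_normal F_fan i by auto
  have 1: "(\<gamma> i)\<^sup>2 + (\<sigma> i)\<^sup>2 = 1" using rotate(3)[OF u] by (simp add: \<gamma>_def \<sigma>_def)
  then have "(\<gamma> i)\<^sup>2 \<le> 1\<^sup>2" by (smt (verit) zero_le_power2 one_power2)
  then have g: "\<bar>\<gamma> i\<bar> \<le> 1" by (simp only: abs_le_square_iff[of "\<gamma> i" 1, symmetric] abs_one)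
  then show "cos (\<theta> i) = \<gamma> i" by (intro cos_arccos) auto
  have "sin (\<theta> i) = sqrt (1 - (\<gamma> i)\<^sup>2)" using g by (intro sin_arccos) auto
  also have "1 - (\<gamma> i)\<^sup>2 = (\<sigma> i)\<^sup>2" using 1 by linarith
  finally have sn: "sin (\<theta> i) = \<bar>\<sigma> i\<bar>" by simp
  show "\<sigma> i = sgn (\<sigma> 0) * sin (\<theta> i)"
    unfolding sn sigma_sign[OF i, symmetric] by (simp add: sgn_mult_abs)
  show p: "0 < sin (\<theta> i)" unfolding sn using sigma_nonzero[OF i] by simp
  have "0 \<le> \<theta> i" using g by (intro arccos_lbound) auto
  then show "0 < \<theta> i" using p by (cases "\<theta> i = 0") auto
qed

text \<open>\<open>\<rho>\<close> is the cotangent of the dihedral angle up to a common sign. In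
  this form the sum is visibly nonzero whenever the two angles add up to less than
  \<open>pi\<close>.\<close>

lemma cot_sum:
  assumes "i < m" "j < m"
  shows "\<rho> i + \<rho> j = sgn (\<sigma> 0) * sin (\<theta> i + \<theta> j) / (sin (\<theta> i) * sin (\<theta> j))"
proof -
  define \<epsilon> where "\<epsilon> = sgn (\<sigma> 0)"
  have e: "\<epsilon> = 1 \<or> \<epsilon> = -1" using sigma_nonzero[OF m_pos] by (auto simp: \<epsilon>_def sgn_if)
  have q: "\<rho> k = \<epsilon> * (cos (\<theta> k) / sin (\<theta> k))" if "k < m" for k
    unfolding angle(2)[OF that, folded \<epsilon>_def] using e by (auto simp: angle(1)[OF that])
  have "\<rho> i + \<rho> j = \<epsilon> * (cos (\<theta> i) / sin (\<theta> i) + cos (\<theta> j) / sin (\<theta> j))"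
    unfolding q[OF assms(1)] q[OF assms(2)] by (simp only: distrib_left)
  also have "cos (\<theta> i) / sin (\<theta> i) + cos (\<theta> j) / sin (\<theta> j) = sin (\<theta> i + \<theta> j) / (sin (\<theta> i) * sin (\<theta> j))"
    using angle(3)[OF assms(1)] angle(3)[OF assms(2)] by (simp add: sin_add field_simps)
  finally show ?thesis by (simp add: \<epsilon>_def)
qed

text \<open>The faces of a boundary edge form an open chain without repetition, where
  \<open>X\<close> can be prescribed freely.\<close>

lemma boundary_good:
  assumes fan: "edge_fan a b = F ` {..m}" and inj: "inj_on F {..m}" and f: "f \<in> edge_fan a b"
  shows "good f"
proof -
  have zero: "\<delta> f = 0" if H: "\<And>X Y. (\<And>i. i < m \<Longrightarrow> Y (F i) + Y (F (Suc i)) = (X (F i) - X (F (Suc i))) * \<rho> i) \<Longrightarrow>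
      (\<Sum>f\<in>edge_fan a b. \<delta> f * X f) = 0" for \<delta> :: "_ \<Rightarrow> real"
  proof -
    have chain: "(\<Sum>j\<le>m. \<delta> (F j) * x j) = 0" if xy: "\<And>i. i < m \<Longrightarrow> y i + y (Suc i) = (x i - x (Suc i)) * \<rho> i" for x y :: "nat \<Rightarrow> real"
    proof -
      have inv: "the_inv_into {..m} F (F i) = i" if "i \<le> m" for i
        using the_inv_into_f_f[OF inj, of i] that by simp
      have "(\<Sum>f\<in>edge_fan a b. \<delta> f * x (the_inv_into {..m} F f)) = 0"
        by (rule H[of "\<lambda>f. y (the_inv_into {..m} F f)" "\<lambda>f. x (the_inv_into {..m} F f)"]) (use xy inv in simp)
      then show ?thesis unfolding fan sum.reindex[OF inj] using inv by simp
    qed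
    obtain j where j: "j \<le> m" "f = F j" using f unfolding fan by blast
    show ?thesis
      unfolding j(2)
    proof (rule open_chain_zero[where D = "\<lambda>j. \<delta> (F j)" and \<rho> = \<rho> and m = m])
      show "(\<Sum>j\<le>m. \<delta> (F j) * x j) = 0" if "\<And>i. i < m \<Longrightarrow> y i + y (Suc i) = (x i - x (Suc i)) * \<rho> i" for x y :: "nat \<Rightarrow> real"
        using that by (rule chain)
    qed (rule j(1))
  qed
  show ?thesis
  proof (rule goodI[OF f])
    show "\<nu> f * ((jump f a - jump f b) \<bullet> N f) = 0"
      by (rule zero[of "\<lambda>f. \<nu> f * ((jump f a - jump f b) \<bullet> N f)"], rule planar_family(1))
    show "\<nu> f * (jump f (apex a b f) \<bullet> N f) = 0"
      by (rule zero[of "\<lambda>f. \<nu> f * (jump f (apex a b f) \<bullet> N f)"], rule planar_family(2))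
  qed
qed

text \<open>\<open>cyclic_zero\<close> by cases: for odd m and for a singular edge every coefficient
  vanishes outright. Otherwise \<open>cot_sum\<close> makes the constraint nonzero at the face
  \<open>f0\<close>, whose known zero then spreads to the others.\<close>

lemma interior_good:
  assumes fan: "edge_fan a b = F ` {..<m}" and inj: "inj_on F {..<m}" and closed: "F m = F 0"
    and angles: "even m \<Longrightarrow> (\<forall>i<m. \<theta> (cyclic_pred m i) + \<theta> i < pi) \<or> (m = 4 \<and> \<theta> 0 + \<theta> 1 = pi \<and> \<theta> 1 + \<theta> 2 = pi)"
    and f0: "f0 \<in> edge_fan a b" "good f0" and f: "f \<in> edge_fan a b"
  shows "good f"
proof -
  have pred: "cyclic_pred m i < m" if "i < m" for i using that by (auto simp: cyclic_pred_def)
  \<comment> \<open>Two consecutive turns with supplementary angles make a half turn, so faces two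
    steps apart have opposite conormals. Since \<open>F 4 = F 0\<close>, this also fixes the fourth
    angle, and \<rho> alternates in sign around the edge.\<close>
  have singular: "\<forall>i<m. \<rho> (cyclic_pred m i) + \<rho> i = 0" if sing: "m = 4" "\<theta> 0 + \<theta> 1 = pi" "\<theta> 1 + \<theta> 2 = pi"
  proof -
    have lt: "0 < m" "1 < m" "2 < m" "3 < m" using sing by auto
    have fanF: "F i \<in> edge_fan a b" if "i \<le> 4" for i using F_fan[of i] that sing(1) by simp
    note u = s_normal[OF fanF]
    have "\<theta> 1 = pi - \<theta> 0" "\<theta> 2 = pi - \<theta> 1" using sing by auto
    then have c: "cos (\<theta> 1) = - cos (\<theta> 0)" "cos (\<theta> 2) = - cos (\<theta> 1)" "sin (\<theta> 1) = sin (\<theta> 0)" "sin (\<theta> 2) = sin (\<theta> 1)"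
      by (metis cos_pi_minus, metis cos_pi_minus, metis sin_pi_minus, metis sin_pi_minus)
    then have gs: "\<gamma> 1 = - \<gamma> 0" "\<gamma> 2 = - \<gamma> 1" "\<sigma> 1 = \<sigma> 0" "\<sigma> 2 = \<sigma> 1"
      using angle(1)[OF lt(1)] angle(1)[OF lt(2)] angle(1)[OF lt(3)] angle(2)[OF lt(1)] angle(2)[OF lt(2)] angle(2)[OF lt(3)] by metis+
    have turn: "s (F (Suc (Suc i))) = - s (F i)" if "i \<le> 2" "\<gamma> (Suc i) = - \<gamma> i" "\<sigma> (Suc i) = \<sigma> i" for i
    proof -
      have "s (F (Suc (Suc i))) = \<gamma> (Suc i) *\<^sub>R s (F (Suc i)) + \<sigma> (Suc i) *\<^sub>R N (F (Suc i))"
        using rotate(1)[OF u u, of "Suc i" "Suc (Suc i)"] that(1) by (simp add: \<gamma>_def \<sigma>_def)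
      moreover have "s (F i) = \<gamma> i *\<^sub>R s (F (Suc i)) - \<sigma> i *\<^sub>R N (F (Suc i))"
        using rotate(4)[OF u u, of i "Suc i"] that(1) by (simp add: \<gamma>_def \<sigma>_def)
      ultimately show ?thesis using that by simp
    qed
    have s2: "s (F 2) = - s (F 0)" using turn[of 0] gs by (simp add: numeral_2_eq_2)
    have s3: "s (F 3) = - s (F 1)" using turn[of 1] gs by (simp add: numeral_3_eq_3 numeral_2_eq_2)
    have s4: "s (F 4) = s (F 0)" using closed sing(1) by simp
    have "\<gamma> 3 = - \<gamma> 0" "\<sigma> 3 = \<sigma> 0"
    proof -
      have e: "\<gamma> 3 = s (F 3) \<bullet> s (F 4)" "\<sigma> 3 = N (F 3) \<bullet> s (F 4)" "\<gamma> 0 = s (F 0) \<bullet> s (F 1)"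
        by (simp_all add: \<gamma>_def \<sigma>_def eval_nat_numeral)
      show "\<gamma> 3 = - \<gamma> 0" unfolding e s3 s4 by (simp add: inner_commute)
      have "N (F 1) \<bullet> s (F 0) = - \<sigma> 0" using rotate(5)[OF u u, of 0 1] by (simp add: \<sigma>_def)
      then show "\<sigma> 3 = \<sigma> 0" unfolding e s3 s4 by simp
    qed
    then have r: "\<rho> 1 = - \<rho> 0" "\<rho> 2 = \<rho> 0" "\<rho> 3 = - \<rho> 0" using gs by simp_all
    show ?thesis
    proof (intro allI impI)
      fix i assume "i < m"
      then consider "i = 0" | "i = 1" | "i = 2" | "i = 3" using sing(1) by linarith
      then show "\<rho> (cyclic_pred m i) + \<rho> i = 0" using r sing(1) by cases (simp_all add: cyclic_pred_def)
    qed
  qed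
  \<comment> \<open>Kept general in \<delta> because it is applied twice: to the differences of the
    jumps at the ends of the edge and to the jumps at the apices.\<close>
  have zero: "\<delta> f = 0" if H: "\<And>X Y. (\<And>i. i < m \<Longrightarrow> Y (F i) + Y (F (Suc i)) = (X (F i) - X (F (Suc i))) * \<rho> i) \<Longrightarrow>
      (\<Sum>f\<in>edge_fan a b. \<delta> f * X f) = 0" and \<delta>0: "\<delta> f0 = 0" for \<delta> :: "_ \<Rightarrow> real"
  proof -
    have chain: "(\<Sum>j<m. \<delta> (F j) * x j) = 0"
      if x: "x m = x 0" and y: "y m = y 0" and xy: "\<And>i. i < m \<Longrightarrow> y i + y (Suc i) = (x i - x (Suc i)) * \<rho> i" for x y :: "nat \<Rightarrow> real"
    proof -
      let ?inv = "the_inv_into {..<m} F"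
      have inv: "?inv (F i) = i" if "i < m" for i
        using the_inv_into_f_f[OF inj, of i] that by simp
      have xi: "x (?inv (F i)) = x i" "y (?inv (F i)) = y i" if "i \<le> m" for i
        using inv[of i] inv[of 0] m_pos that closed x y by (cases "i = m"; simp)+
      have "(\<Sum>f\<in>edge_fan a b. \<delta> f * x (?inv f)) = 0"
        by (rule H[of "\<lambda>f. y (?inv f)" "\<lambda>f. x (?inv f)"]) (use xy xi in simp)
      then show ?thesis unfolding fan sum.reindex[OF inj] using inv by simp
    qed
    obtain i where i: "i < m" "f = F i" using f unfolding fan by blast
    obtain j where j: "j < m" "f0 = F j" using f0 unfolding fan by blast
    have z1: "\<delta> (F i) = 0" if "odd m"
    proof (rule cyclic_zero(1)[where D = "\<lambda>j. \<delta> (F j)" and \<rho> = \<rho> and m = m])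
      show "(\<Sum>j<m. \<delta> (F j) * x j) = 0" if "x m = x 0" "y m = y 0" "\<And>i. i < m \<Longrightarrow> y i + y (Suc i) = (x i - x (Suc i)) * \<rho> i" for x y :: "nat \<Rightarrow> real"
        using that by (rule chain)
    qed (use m_pos i(1) that in blast)+
    have z2: "\<delta> (F i) = 0" if "even m" "\<rho> (cyclic_pred m i) + \<rho> i = 0"
    proof (rule cyclic_zero(2)[where D = "\<lambda>j. \<delta> (F j)" and \<rho> = \<rho> and m = m])
      show "(\<Sum>j<m. \<delta> (F j) * x j) = 0" if "x m = x 0" "y m = y 0" "\<And>i. i < m \<Longrightarrow> y i + y (Suc i) = (x i - x (Suc i)) * \<rho> i" for x y :: "nat \<Rightarrow> real"
        using that by (rule chain)
    qed (use m_pos i(1) that in blast)+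
    have z3: "\<delta> (F i) = 0" if "even m" "\<rho> (cyclic_pred m j) + \<rho> j \<noteq> 0"
    proof (rule cyclic_zero(3)[where D = "\<lambda>j. \<delta> (F j)" and \<rho> = \<rho> and m = m and j = j])
      show "(\<Sum>j<m. \<delta> (F j) * x j) = 0" if "x m = x 0" "y m = y 0" "\<And>i. i < m \<Longrightarrow> y i + y (Suc i) = (x i - x (Suc i)) * \<rho> i" for x y :: "nat \<Rightarrow> real"
        using that by (rule chain)
      show "\<delta> (F j) = 0" using \<delta>0 j(2) by simp
    qed (use m_pos i(1) j(1) that in blast)+
    show ?thesis
    proof (cases "odd m")
      case True
      then show ?thesis using z1 i(2) by simp
    next
      case False
      then have ev: "even m" by simp
      from angles[OF ev] show ?thesis
      proof
        assume "m = 4 \<and> \<theta> 0 + \<theta> 1 = pi \<and> \<theta> 1 + \<theta> 2 = pi"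
        then have "\<rho> (cyclic_pred m i) + \<rho> i = 0" using singular i(1) by blast
        then show ?thesis using z2[OF ev] i(2) by simp
      next
        assume lt: "\<forall>i<m. \<theta> (cyclic_pred m i) + \<theta> i < pi"
        have "sin (\<theta> (cyclic_pred m j) + \<theta> j) > 0"
          using lt j(1) angle(4)[OF j(1)] angle(4)[OF pred[OF j(1)]] by (intro sin_gt_zero) auto
        then have "\<rho> (cyclic_pred m j) + \<rho> j \<noteq> 0"
          unfolding cot_sum[OF pred[OF j(1)] j(1)]
          using angle(3)[OF j(1)] angle(3)[OF pred[OF j(1)]] sigma_nonzero[OF m_pos] by (simp add: sgn_zero_iff)
        then show ?thesis using z3[OF ev] i(2) by simp
      qed
    qed
  qed
  have j0: "jump f0 a = 0" "jump f0 b = 0" "jump f0 (apex a b f0) = 0"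
    using f0(2) fan3[OF f0(1)] unfolding good_def by blast+
  show ?thesis
  proof (rule goodI[OF f])
    show "\<nu> f * ((jump f a - jump f b) \<bullet> N f) = 0"
      by (rule zero[of "\<lambda>f. \<nu> f * ((jump f a - jump f b) \<bullet> N f)"], rule planar_family(1)) (assumption, simp add: j0)
    show "\<nu> f * (jump f (apex a b f) \<bullet> N f) = 0"
      by (rule zero[of "\<lambda>f. \<nu> f * (jump f (apex a b f) \<bullet> N f)"], rule planar_family(2)) (assumption, simp add: j0)
  qed
qed

end

section \<open>From single edges to the whole mesh\<close>

context rigid_mesh
begin

text \<open>\<open>W C\<close> kills the directions of the face. For the remaining vertex d,
  skewness makes the image of \<open>d - a\<close> orthogonal to all edges at \<open>a\<close>,
  hence zero; so the motion vanishes at four vertices.\<close>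

lemma rigid_zero:
  assumes C: "C \<in> M" and F: "F \<in> faces C" and z: "\<And>v. v \<in> F \<Longrightarrow> rig C v = 0"
  shows "rig C x = 0"
proof -
  interpret tetrahedron C using tet[OF C] .
  obtain d where d: "d \<in> C" "F = C - {d}" using F unfolding faces_Diff[OF card4] by blast
  have c3: "card F = 3" using F by (simp add: faces_def)
  then obtain a where a: "a \<in> F" by fastforce
  have skewd: "p \<bullet> (W C *v q) = - (q \<bullet> (W C *v p))" for p q
  proof -
    have "p \<bullet> (W C *v q) = (transpose (W C) *v p) \<bullet> q" by (metis dot_lmul_matrix transpose_matrix_vector)
    then show ?thesis unfolding skew[OF C] matrix_vector_uminus by (simp add: inner_commute)
  qed
  have Wv: "W C *v (v - a) = 0" if "v \<in> F" for v
    using z[OF that] z[OF a] unfolding matrix_vector_mult_diff_distrib by (metis add_left_cancel diff_self)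
  have "W C *v (d - a) = 0"
  proof (rule orth_edges_zero)
    show "a \<in> C" using a d by blast
    fix v assume v: "v \<in> C"
    show "(W C *v (d - a)) \<bullet> (v - a) = 0"
    proof (cases "v = d")
      case True
      then show ?thesis using skewd[of "d - a" "d - a"] by (simp add: inner_commute)
    next
      case False
      then have "v \<in> F" using v d by blast
      then show ?thesis using skewd[of "v - a" "d - a"] Wv by (simp add: inner_commute)
    qed
  qed
  then have "rig C d = 0" using z[OF a] unfolding matrix_vector_mult_diff_distrib by simp
  then have all: "rig C v = 0" if "v \<in> C" for v using z that d by (cases "v = d") auto
  have "W C $ i = 0" "k C $ i = 0" for i
  proof -
    have "k C $ i + W C $ i \<bullet> v = 0" if "v \<in> C" for v
    proof -
      have "rig C v $ i = 0" using all[OF that] by simp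
      then show ?thesis by (simp add: matrix_vector_mul_component)
    qed
    from affine_zero[OF this] show "W C $ i = 0" "k C $ i = 0" by auto
  qed
  then have "rig C x $ i = 0" for i
    by (simp only: vector_add_component matrix_vector_mul_component inner_zero_left add_0_right)
  then show ?thesis by (simp only: vec_eq_iff zero_index simp_thms)
qed

text \<open>An element with a bad face has only bad faces, so none of them is exposed.\<close>

lemma all_zero:
  assumes edge: "\<And>a b F G. a \<noteq> b \<Longrightarrow> F \<in> edge_fan a b \<Longrightarrow> G \<in> edge_fan a b \<Longrightarrow> good F \<Longrightarrow> good G"
    and ex: "\<And>C F. C \<in> M \<Longrightarrow> F \<in> faces C \<Longrightarrow> (\<And>C'. C' \<in> M \<Longrightarrow> F \<in> faces C' \<Longrightarrow> C' = C) \<Longrightarrow> good F"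
    and C: "C \<in> M"
  shows "rig C x = 0"
proof -
  have "{C\<in>M. \<exists>F\<in>faces C. \<not> good F} = {}"
  proof (rule no_exposed_face_imp_empty)
    fix C F assume C: "C \<in> {C\<in>M. \<exists>F\<in>faces C. \<not> good F}" and F: "F \<in> faces C"
    then obtain G where G: "C \<in> M" "G \<in> faces C" "\<not> good G" by blast
    \<comment> \<open>Any two faces of a tetrahedron share an edge, along which goodness of
      \<open>F\<close> would pass on to \<open>G\<close>.\<close>
    have "\<not> good F"
    proof (cases "F = G")
      case False
      obtain u v where uv: "u \<in> C" "F = C - {u}" "v \<in> C" "G = C - {v}"
        using F G(2) unfolding faces_Diff[OF card4M[OF G(1)]] by blast
      then have "u \<noteq> v" using False by blast
      obtain a b where "C - {u,v} = {a,b}" "a \<noteq> b"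
      proof -
        have "card (C - {u,v}) = 2" using card4M[OF G(1)] uv \<open>u \<noteq> v\<close> by (simp add: card_Diff_subset)
        then show ?thesis using that by (auto simp: card_2_iff)
      qed
      moreover have "F \<in> all_faces" "G \<in> all_faces" using F G by (auto simp: all_faces_def)
      ultimately have "F \<in> edge_fan a b" "G \<in> edge_fan a b" "a \<noteq> b" using uv by auto
      then show ?thesis using edge G(3) by blast
    qed (use G in simp)
    then obtain C' where "C' \<in> M" "F \<in> faces C'" "C' \<noteq> C" using ex[OF G(1) F] by blast
    then show "\<exists>C'\<in>{C\<in>M. \<exists>F\<in>faces C. \<not> good F}. C' \<noteq> C \<and> F \<in> faces C'" using \<open>\<not> good F\<close> by blast
  qed blast
  then have good: "good F" if "C \<in> M" "F \<in> faces C" for C F using that by blast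
  \<comment> \<open>With all jumps zero, a motion vanishes on an exposed face and agrees with its
    neighbour on a shared one. Nonzero motions would again fill a set of elements without exposed
    faces.\<close>
  have "{C\<in>M. \<exists>x. rig C x \<noteq> 0} = {}"
  proof (rule no_exposed_face_imp_empty)
    fix C F assume "C \<in> {C\<in>M. \<exists>x. rig C x \<noteq> 0}" and F: "F \<in> faces C"
    then obtain x where C: "C \<in> M" "rig C x \<noteq> 0" by blast
    have J: "jump F v = 0" if "v \<in> F" for v using good[OF C(1) F] that by (simp add: good_def)
    have s: "side C F \<noteq> 0" using side_pmM[OF C(1) F] by auto
    have "\<exists>C'\<in>M. C' \<noteq> C \<and> F \<in> faces C'"
    proof (rule ccontr)
      assume "\<not> ?thesis"
      then have "{C\<in>M. F \<in> faces C} = {C}" using C F by blast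
      then have "rig C v = 0" if "v \<in> F" for v using J[OF that] s by (simp add: jump_def)
      then show False using rigid_zero[OF C(1) F] C(2) by blast
    qed
    then obtain C' where C': "C' \<in> M" "C' \<noteq> C" "F \<in> faces C'" by blast
    have eq: "{C\<in>M. F \<in> faces C} = {C, C'}" using two_elements[OF C(1) C'(1) _ F C'(3)] C'(2) by blast
    have s': "side C' F = - side C F" using side_opposite[OF C(1) C'(1) _ F C'(3)] C'(2) by blast
    have same: "rig C v = rig C' v" if "v \<in> F" for v
    proof -
      have "jump F v = side C F *\<^sub>R rig C v + side C' F *\<^sub>R rig C' v"
        unfolding jump_def eq using C'(2) by simp
      also have "\<dots> = side C F *\<^sub>R (rig C v - rig C' v)" unfolding s' by (simp add: algebra_simps)
      finally show ?thesis using J[OF that] s by simp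
    qed
    have "\<exists>x. rig C' x \<noteq> 0"
    proof (rule ccontr)
      assume "\<not> ?thesis"
      then have "rig C v = 0" if "v \<in> F" for v using same[OF that] by simp
      then show False using rigid_zero[OF C(1) F] C(2) by blast
    qed
    then show "\<exists>C'\<in>{C\<in>M. \<exists>x. rig C x \<noteq> 0}. C' \<noteq> C \<and> F \<in> faces C'" using C' by blast
  qed blast
  then show ?thesis using C by blast
qed

end

section \<open>From injectivity to the inf-sup constant\<close>

text \<open>Gaussian elimination over the index set: a quadratic quantity that vanishes on the common
  kernel of a family of functionals is controlled by finitely many of them.\<close>

lemma functional_bound:
  fixes L :: "('i \<Rightarrow> real) set" and Q :: "('i \<Rightarrow> real) \<Rightarrow> real"
  assumes "finite I"
    and "\<And>c. 0 \<le> Q c" and "\<And>c d. Q (\<lambda>i. c i + d i) \<le> 2 * (Q c + Q d)" and "\<And>a c. Q (\<lambda>i. a * c i) = a\<^sup>2 * Q c"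
    and "\<And>c d. (\<And>i. i \<in> I \<Longrightarrow> c i = d i) \<Longrightarrow> Q c = Q d"
    and "\<And>c. (\<And>l. l \<in> L \<Longrightarrow> (\<Sum>i\<in>I. l i * c i) = 0) \<Longrightarrow> Q c = 0"
  shows "\<exists>L' B. finite L' \<and> L' \<subseteq> L \<and> 0 \<le> B \<and> (\<forall>c. Q c \<le> B * (\<Sum>l\<in>L'. (\<Sum>i\<in>I. l i * c i)\<^sup>2))"
  using assms
proof (induction I arbitrary: L Q rule: finite_induct)
  case empty
  have "Q c = 0" for c using empty(5) by simp
  then show ?case by (intro exI[of _ "{}"] exI[of _ 0]) simp
next
  case (insert n I)
  note pos = insert.prems(1) and add = insert.prems(2) and scale = insert.prems(3) and cong = insert.prems(4) and ker = insert.prems(5)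
  let ?e = "\<lambda>i. if i = n then 1 else (0::real)"
  have sumI: "(\<Sum>i\<in>insert n I. l i * c i) = l n * c n + (\<Sum>i\<in>I. l i * c i)" for l c :: "'i \<Rightarrow> real"
    using insert.hyps by simp
  have sumU: "(\<Sum>i\<in>I. l i * (if i = n then z else c i)) = (\<Sum>i\<in>I. l i * c i)" for l c :: "'i \<Rightarrow> real" and z
    using insert.hyps by (intro sum.cong) auto
  have split: "Q c \<le> 2 * (Q (\<lambda>i. if i = n then z else c i) + (c n - z)\<^sup>2 * Q ?e)" for c z
  proof -
    have "Q c = Q (\<lambda>i. (if i = n then z else c i) + (c n - z) * ?e i)" by (rule cong) auto
    also have "\<dots> \<le> 2 * (Q (\<lambda>i. if i = n then z else c i) + Q (\<lambda>i. (c n - z) * ?e i))" by (rule add)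
    finally show ?thesis by (simp only: scale)
  qed
  show ?case
  proof (cases "\<forall>l\<in>L. l n = 0")
    \<comment> \<open>No functional sees the coordinate \<open>n\<close>. The unit vector
      \<open>?e\<close> then lies in the common kernel and costs nothing, so the coordinate may be
      set to 0.\<close>
    case True
    let ?z = "\<lambda>c i. if i = n then 0 else c i :: real"
    have e0: "Q ?e = 0"
    proof (rule ker)
      fix l assume "l \<in> L"
      moreover have "(\<Sum>i\<in>I. l i * ?e i) = 0" using insert.hyps by (intro sum.neutral) auto
      ultimately show "(\<Sum>i\<in>insert n I. l i * ?e i) = 0" using True by (simp add: sumI)
    qed
    have "\<exists>L' B. finite L' \<and> L' \<subseteq> L \<and> 0 \<le> B \<and> (\<forall>c. Q (?z c) \<le> B * (\<Sum>l\<in>L'. (\<Sum>i\<in>I. l i * c i)\<^sup>2))"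
    proof (rule insert.IH[of "\<lambda>c. Q (?z c)"])
      show "Q (?z (\<lambda>i. c i + d i)) \<le> 2 * (Q (?z c) + Q (?z d))" for c d
        using add[of "?z c" "?z d"] cong[of "?z (\<lambda>i. c i + d i)" "\<lambda>i. ?z c i + ?z d i"] by auto
      show "Q (?z (\<lambda>i. a * c i)) = a\<^sup>2 * Q (?z c)" for a c
        using scale[of a "?z c"] cong[of "?z (\<lambda>i. a * c i)" "\<lambda>i. a * ?z c i"] by auto
      show "Q (?z c) = Q (?z d)" if "\<And>i. i \<in> I \<Longrightarrow> c i = d i" for c d
        using that by (intro cong) auto
      show "Q (?z c) = 0" if "\<And>l. l \<in> L \<Longrightarrow> (\<Sum>i\<in>I. l i * c i) = 0" for c
        by (rule ker) (use that in \<open>simp add: sumI sumU\<close>)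
    qed (rule pos)
    then obtain L' B where L': "finite L'" "L' \<subseteq> L" "0 \<le> B" and b: "\<And>c. Q (?z c) \<le> B * (\<Sum>l\<in>L'. (\<Sum>i\<in>I. l i * c i)\<^sup>2)" by blast
    have "Q c \<le> (2 * B) * (\<Sum>l\<in>L'. (\<Sum>i\<in>insert n I. l i * c i)\<^sup>2)" for c
    proof -
      have "(\<Sum>l\<in>L'. (\<Sum>i\<in>insert n I. l i * c i)\<^sup>2) = (\<Sum>l\<in>L'. (\<Sum>i\<in>I. l i * c i)\<^sup>2)"
      proof (intro sum.cong refl)
        fix l assume "l \<in> L'"
        then have "l n = 0" using True L'(2) by blast
        then show "(\<Sum>i\<in>insert n I. l i * c i)\<^sup>2 = (\<Sum>i\<in>I. l i * c i)\<^sup>2" by (simp only: sumI mult_zero_left add_0)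
      qed
      then show ?thesis using split[of c 0] b[of c] e0 by simp
    qed
    then show ?thesis using L' by (intro exI[of _ L'] exI[of _ "2 * B"]) auto
  next
    case False
    then obtain l0 where l0: "l0 \<in> L" "l0 n \<noteq> 0" by blast
    \<comment> \<open>The value of coordinate \<open>n\<close> for which \<open>l0\<close> vanishes.
      Accordingly \<open>r l\<close> is \<open>l\<close> after elimination of \<open>n\<close> with
      pivot \<open>l0\<close>.\<close>
    define z where "z c = - (\<Sum>i\<in>I. l0 i * c i) / l0 n" for c
    let ?x = "\<lambda>c i. if i = n then z c else c i"
    define r where "r l i = l i - l n / l0 n * l0 i" for l i
    have r: "(\<Sum>i\<in>I. r l i * c i) = (\<Sum>i\<in>I. l i * c i) - l n / l0 n * (\<Sum>i\<in>I. l0 i * c i)" for l c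
      unfolding r_def by (simp add: left_diff_distrib sum_subtractf sum_distrib_left mult.assoc)
    have rx: "(\<Sum>i\<in>insert n I. l i * ?x c i) = (\<Sum>i\<in>I. r l i * c i)" for l c
      unfolding sumI sumU r by (simp add: z_def)
    have z_add: "z (\<lambda>i. c i + d i) = z c + z d" for c d
      by (simp add: z_def distrib_left sum.distrib diff_divide_distrib)
    have z_scale: "z (\<lambda>i. a * c i) = a * z c" for a c
      by (simp add: z_def sum_distrib_left mult.left_commute)
    have "\<exists>L' B. finite L' \<and> L' \<subseteq> r ` L \<and> 0 \<le> B \<and> (\<forall>c. Q (?x c) \<le> B * (\<Sum>l\<in>L'. (\<Sum>i\<in>I. l i * c i)\<^sup>2))"
    proof (rule insert.IH[of "\<lambda>c. Q (?x c)"])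
      show "Q (?x (\<lambda>i. c i + d i)) \<le> 2 * (Q (?x c) + Q (?x d))" for c d
        using add[of "?x c" "?x d"] cong[of "?x (\<lambda>i. c i + d i)" "\<lambda>i. ?x c i + ?x d i"] by (auto simp: z_add)
      show "Q (?x (\<lambda>i. a * c i)) = a\<^sup>2 * Q (?x c)" for a c
        using scale[of a "?x c"] cong[of "?x (\<lambda>i. a * c i)" "\<lambda>i. a * ?x c i"] by (auto simp: z_scale)
      show "Q (?x c) = Q (?x d)" if "\<And>i. i \<in> I \<Longrightarrow> c i = d i" for c d
      proof -
        have "z c = z d" using that by (simp add: z_def)
        then show ?thesis using that by (intro cong) auto
      qed
      show "Q (?x c) = 0" if "\<And>l. l \<in> r ` L \<Longrightarrow> (\<Sum>i\<in>I. l i * c i) = 0" for c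
        by (rule ker) (use that in \<open>simp only: rx imageI\<close>)
    qed (rule pos)
    then obtain L1 B where L1: "finite L1" "L1 \<subseteq> r ` L" "0 \<le> B" and b: "\<And>c. Q (?x c) \<le> B * (\<Sum>l\<in>L1. (\<Sum>i\<in>I. l i * c i)\<^sup>2)" by blast
    obtain L2 where L2: "L2 \<subseteq> L" "finite L2" "L1 = r ` L2" using finite_subset_image[OF L1(1,2)] by blast
    let ?S = "\<lambda>l c. (\<Sum>i\<in>insert n I. l i * c i)"
    let ?T = "\<lambda>c. \<Sum>l\<in>insert l0 L2. (?S l c)\<^sup>2"
    \<comment> \<open>The outer 2 comes from \<open>split\<close>; the term
      \<open>2 + 2 * ...\<close> from (u - v)^2 \<le> 2 u^2 + 2 v^2 applied to the reduced
      functionals; the last summand pays for moving coordinate \<open>n\<close> to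
      \<open>z c\<close>.\<close>
    define B' where "B' = 2 * (B * (2 + 2 * (\<Sum>l\<in>L2. (l n / l0 n)\<^sup>2)) + Q ?e / (l0 n)\<^sup>2)"
    have "Q c \<le> B' * ?T c" for c
    proof -
      have T1: "(?S l0 c)\<^sup>2 \<le> ?T c" using L2(2) by (intro member_le_sum) auto
      have T2: "(\<Sum>l\<in>L2. (?S l c)\<^sup>2) \<le> ?T c" using L2(2) by (intro sum_mono2) auto
      have cz: "c n - z c = ?S l0 c / l0 n" using l0(2) by (simp add: sumI z_def field_simps)
      have rl: "(\<Sum>i\<in>I. r l i * c i)\<^sup>2 \<le> 2 * (?S l c)\<^sup>2 + 2 * ((l n / l0 n)\<^sup>2 * (?S l0 c)\<^sup>2)" for l
      proof -
        have e: "(\<Sum>i\<in>I. r l i * c i) = ?S l c - l n / l0 n * ?S l0 c"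
          unfolding r sumI using l0(2) by (simp add: field_simps)
        have "(u - v)\<^sup>2 \<le> 2 * u\<^sup>2 + 2 * v\<^sup>2" for u v :: real
          using zero_le_power2[of "u + v"] by (simp add: power2_sum power2_diff)
        then show ?thesis unfolding e power_mult_distrib[symmetric] .
      qed
      have "(\<Sum>l\<in>L1. (\<Sum>i\<in>I. l i * c i)\<^sup>2) \<le> (\<Sum>l\<in>L2. (\<Sum>i\<in>I. r l i * c i)\<^sup>2)"
        unfolding L2(3) by (rule sum_image_le[OF L2(2), unfolded o_def]) simp
      also have "\<dots> \<le> (\<Sum>l\<in>L2. 2 * (?S l c)\<^sup>2 + 2 * ((l n / l0 n)\<^sup>2 * (?S l0 c)\<^sup>2))" by (intro sum_mono rl)
      also have "\<dots> = 2 * (\<Sum>l\<in>L2. (?S l c)\<^sup>2) + 2 * (\<Sum>l\<in>L2. (l n / l0 n)\<^sup>2) * (?S l0 c)\<^sup>2"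
        by (simp only: sum.distrib sum_distrib_left sum_distrib_right mult.assoc)
      also have "\<dots> \<le> 2 * ?T c + 2 * (\<Sum>l\<in>L2. (l n / l0 n)\<^sup>2) * ?T c"
        using T1 T2 by (intro add_mono mult_left_mono) (auto intro: sum_nonneg)
      also have "\<dots> = (2 + 2 * (\<Sum>l\<in>L2. (l n / l0 n)\<^sup>2)) * ?T c" by (simp only: distrib_right)
      finally have A: "Q (?x c) \<le> B * ((2 + 2 * (\<Sum>l\<in>L2. (l n / l0 n)\<^sup>2)) * ?T c)"
        using b[of c] L1(3) by (meson mult_left_mono order_trans)
      have E: "(c n - z c)\<^sup>2 * Q ?e \<le> Q ?e / (l0 n)\<^sup>2 * ?T c"
      proof -
        have "(c n - z c)\<^sup>2 * Q ?e = Q ?e / (l0 n)\<^sup>2 * (?S l0 c)\<^sup>2" unfolding cz by (simp add: power_divide)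
        also have "\<dots> \<le> Q ?e / (l0 n)\<^sup>2 * ?T c" using T1 pos by (intro mult_left_mono) auto
        finally show ?thesis .
      qed
      have "Q c \<le> 2 * (Q (?x c) + (c n - z c)\<^sup>2 * Q ?e)" by (rule split)
      also have "\<dots> \<le> 2 * (B * ((2 + 2 * (\<Sum>l\<in>L2. (l n / l0 n)\<^sup>2)) * ?T c) + Q ?e / (l0 n)\<^sup>2 * ?T c)"
        by (intro mult_left_mono add_mono A E) simp
      also have "\<dots> = B' * ?T c" unfolding B'_def by (simp only: distrib_right mult.assoc)
      finally show ?thesis .
    qed
    moreover have "0 \<le> B'" unfolding B'_def using L1(3) pos by (intro mult_nonneg_nonneg add_nonneg_nonneg sum_nonneg) auto
    moreover have "insert l0 L2 \<subseteq> L" "finite (insert l0 L2)" using L2 l0 by auto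
    ultimately show ?thesis by blast
  qed
qed

lemma L2_norm_zero_AE:
  assumes "f \<in> L2_space \<Omega> X" "L2_norm \<Omega> f = 0"
  shows "AE x in lebesgue_on \<Omega>. f x = 0"
proof -
  have i: "integrable (lebesgue_on \<Omega>) (\<lambda>x. (norm (f x))\<^sup>2)" using assms(1) by (simp add: L2_space_def)
  have "(\<integral>x. (norm (f x))\<^sup>2 \<partial>lebesgue_on \<Omega>) = 0" using assms(2) by (simp add: L2_norm_def)
  then have "AE x in lebesgue_on \<Omega>. (norm (f x))\<^sup>2 = 0"
    using integral_nonneg_eq_0_iff_AE[OF i] by simp
  then show ?thesis by simp
qed

section \<open>Pairing the test fields with discrete functions\<close>

context mesh_domain
begin

abbreviation test_field :: "((real^3) set \<Rightarrow> real^3 \<Rightarrow> real) \<Rightarrow> ((real^3) set \<Rightarrow> real^3^3) \<Rightarrow> real^3 \<Rightarrow> real^3^3" where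
  "test_field w S \<equiv> piecewise (\<lambda>C x. w C x *\<^sub>R S C)"

lemma admissible_weak_div:
  assumes adm: "admissible w S"
  shows "test_field w S \<in> Sigma_h elements \<Omega>"
    and "weak_div \<Omega> (test_field w S) \<in> L2_space \<Omega> UNIV" and "has_weak_div \<Omega> (test_field w S) (weak_div \<Omega> (test_field w S))"
proof -
  have 1: "\<And>C. C \<in> M \<Longrightarrow> w C \<in> polys 3 UNIV" "\<And>C. C \<in> M \<Longrightarrow> transpose (S C) = S C" "\<And>C x. C \<in> M \<Longrightarrow> x \<in> C \<Longrightarrow> w C x = 0"
    using adm unfolding admissible_def by blast+
  have 2: "\<And>C C' F x. C \<in> M \<Longrightarrow> C' \<in> M \<Longrightarrow> C \<noteq> C' \<Longrightarrow> F \<in> faces C \<Longrightarrow> F \<in> faces C' \<Longrightarrow> x \<in> convex hull F \<Longrightarrow>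
      w C x *\<^sub>R (S C *v face_normal F) = w C' x *\<^sub>R (S C' *v face_normal F)"
    using adm unfolding admissible_def by blast
  show "(test_field w S) \<in> Sigma_h elements \<Omega>" by (rule field_Sigma_h[where w = w and S = S, OF 1 2])
  have "\<exists>g. g \<in> L2_space \<Omega> UNIV \<and> has_weak_div \<Omega> (test_field w S) g"
    using field_has_weak_div[where w = w and S = S, OF 1 2] field_div_L2[where w = w and S = S, OF 1 2] by blast
  from someI_ex[OF this] show "weak_div \<Omega> (test_field w S) \<in> L2_space \<Omega> UNIV" "has_weak_div \<Omega> (test_field w S) (weak_div \<Omega> (test_field w S))"
    unfolding weak_div_def by auto
qed

lemma admissible_pairing:
  assumes adm: "admissible w S"
    and p: "\<And>C i. C \<in> M \<Longrightarrow> smooth (\<lambda>x. p C x $ i)" and v: "v \<in> borel_measurable (lebesgue_on \<Omega>)" "AE x in lebesgue_on \<Omega>. v x = piecewise p x"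
  shows "(\<integral>x. weak_div \<Omega> (test_field w S) x \<bullet> v x \<partial>lebesgue_on \<Omega>)
    = (\<Sum>C\<in>M. integral (convex hull C) (\<lambda>x. (S C *v gradient (w C) x) \<bullet> p C x))"
proof -
  have 1: "\<And>C. C \<in> M \<Longrightarrow> w C \<in> polys 3 UNIV" "\<And>C. C \<in> M \<Longrightarrow> transpose (S C) = S C" "\<And>C x. C \<in> M \<Longrightarrow> x \<in> C \<Longrightarrow> w C x = 0"
    using adm unfolding admissible_def by blast+
  have 2: "\<And>C C' F x. C \<in> M \<Longrightarrow> C' \<in> M \<Longrightarrow> C \<noteq> C' \<Longrightarrow> F \<in> faces C \<Longrightarrow> F \<in> faces C' \<Longrightarrow> x \<in> convex hull F \<Longrightarrow>
      w C x *\<^sub>R (S C *v face_normal F) = w C' x *\<^sub>R (S C' *v face_normal F)"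
    using adm unfolding admissible_def by blast
  show ?thesis by (rule weak_div_field[where w = w and S = S, OF 1 2 p v])
qed

text \<open>If the field were zero almost everywhere, 0 would be another weak divergence of it, and
  by \<open>weak_div_unique_tested\<close> the pairing with \<open>v\<close> would vanish. For the
  norm, a divergence of zero norm vanishes almost everywhere.\<close>

lemma admissible_nonzero:
  assumes adm: "admissible w S" and v: "v \<in> L2_space \<Omega> UNIV" "AE x in lebesgue_on \<Omega>. v x = piecewise p x"
    and p: "\<And>C i. C \<in> M \<Longrightarrow> smooth (\<lambda>x. p C x $ i)"
    and nz: "(\<integral>x. weak_div \<Omega> (test_field w S) x \<bullet> v x \<partial>lebesgue_on \<Omega>) \<noteq> 0"
  shows "nonzero_on \<Omega> (test_field w S)" and "Hdiv_norm \<Omega> (test_field w S) > 0"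
proof -
  note d = admissible_weak_div(2,3)[OF adm]
  have dm: "weak_div \<Omega> (test_field w S) \<in> borel_measurable (lebesgue_on \<Omega>)" "v \<in> borel_measurable (lebesgue_on \<Omega>)"
    using d(1) v(1) unfolding L2_space_def by blast+
  have nz': "L2_norm \<Omega> (weak_div \<Omega> (test_field w S)) \<noteq> 0"
  proof
    assume "L2_norm \<Omega> (weak_div \<Omega> (test_field w S)) = 0"
    from L2_norm_zero_AE[OF d(1) this] have "AE x in lebesgue_on \<Omega>. weak_div \<Omega> (test_field w S) x \<bullet> v x = 0" by (rule eventually_mono) simp
    then have "(\<integral>x. weak_div \<Omega> (test_field w S) x \<bullet> v x \<partial>lebesgue_on \<Omega>) = 0" by (rule integral_eq_zero_AE)
    with nz show False by (rule notE)
  qed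
  then show "Hdiv_norm \<Omega> (test_field w S) > 0"
    unfolding Hdiv_norm_def by (simp add: add_nonneg_pos)
  show "nonzero_on \<Omega> (test_field w S)"
    unfolding nonzero_on_def
  proof
    assume ae: "AE x in lebesgue_on \<Omega>. (test_field w S) x = 0"
    have z: "has_weak_div \<Omega> (test_field w S) (\<lambda>_. 0)"
      unfolding has_weak_div_def
    proof
      fix \<phi>
      have "AE x in lebesgue_on \<Omega>. (test_field w S) x *v gradient \<phi> x = 0"
        using ae by (rule eventually_mono) simp
      then have "(\<integral>x. (test_field w S) x *v gradient \<phi> x \<partial>lebesgue_on \<Omega>) = 0" by (rule integral_eq_zero_AE)
      then show "(\<integral>x. (test_field w S) x *v gradient \<phi> x \<partial>lebesgue_on \<Omega>) = - (\<integral>x. \<phi> x *\<^sub>R 0 \<partial>lebesgue_on \<Omega>)" by simp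
    qed
    have z2: "(\<lambda>_. 0) \<in> L2_space \<Omega> (UNIV :: (real^3) set)" by (simp add: L2_space_def)
    have eq1: "(\<integral>x. weak_div \<Omega> (test_field w S) x \<bullet> piecewise p x \<partial>lebesgue_on \<Omega>) = (\<integral>x. 0 \<bullet> piecewise p x \<partial>lebesgue_on \<Omega>)"
      by (rule weak_div_unique_tested(1)[OF d(1) z2 d(2) z p])
    have eq2: "(\<integral>x. weak_div \<Omega> (test_field w S) x \<bullet> v x \<partial>lebesgue_on \<Omega>) = (\<integral>x. weak_div \<Omega> (test_field w S) x \<bullet> piecewise p x \<partial>lebesgue_on \<Omega>)"
    proof (rule integral_cong_AE)
      show "(\<lambda>x. weak_div \<Omega> (test_field w S) x \<bullet> v x) \<in> borel_measurable (lebesgue_on \<Omega>)" using dm by (intro borel_measurable_inner)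
      show "(\<lambda>x. weak_div \<Omega> (test_field w S) x \<bullet> piecewise p x) \<in> borel_measurable (lebesgue_on \<Omega>)"
        using weak_div_unique_tested(2)[OF d(1) d(1) d(2) d(2) p d(1)] by (rule borel_measurable_integrable)
      show "AE x in lebesgue_on \<Omega>. weak_div \<Omega> (test_field w S) x \<bullet> v x = weak_div \<Omega> (test_field w S) x \<bullet> piecewise p x"
        using v(2) by (rule eventually_mono) simp
    qed
    have "(\<integral>x. 0 \<bullet> piecewise p x \<partial>lebesgue_on \<Omega>) = 0" by simp
    from trans[OF eq2 trans[OF eq1 this]] nz show False by (rule notE[rotated])
  qed
qed

end

unbundle no cross3_syntax

section \<open>Discrete functions in monomial coordinates\<close>

type_synonym coefficient = "(real^3) set \<times> (3 \<Rightarrow> nat) \<times> 3"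

text \<open>Makes \<open>V_h\<close> accessible to \<open>functional_bound\<close>, which works with
  real families over a finite index set rather than with classes of functions.\<close>

definition coef_poly :: "(coefficient \<Rightarrow> real) \<Rightarrow> (real^3) set \<Rightarrow> real^3 \<Rightarrow> real^3" where
  "coef_poly c C x = (\<chi> i. \<Sum>\<alpha>\<in>exponents 2. monomial \<alpha> x * c (C, \<alpha>, i))"

lemma coef_poly_polys: "coef_poly c C \<in> polys 2 UNIV"
proof (rule polysI[where c = "\<lambda>\<alpha>. \<chi> i. c (C, \<alpha>, i)"])
  show "coef_poly c C x = (\<Sum>\<alpha>\<in>exponents 2. monomial \<alpha> x *\<^sub>R (\<chi> i. c (C, \<alpha>, i)))" for x
    unfolding vec_eq_iff coef_poly_def by (simp add: sum_component)
qed simp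

lemma coef_poly_smooth: "smooth (\<lambda>x. coef_poly c C x $ i)"
  by (rule polys_smooth[OF polys_nth[OF coef_poly_polys]])

lemma continuous_on_coef_poly: "continuous_on UNIV (coef_poly c C)"
  using smooth_continuous[OF coef_poly_smooth]
  by (subst continuous_on_componentwise) (auto simp: Basis_vec_def inner_axis)

lemma coef_poly_add: "coef_poly (\<lambda>i. c i + d i) C x = coef_poly c C x + coef_poly d C x"
  unfolding vec_eq_iff coef_poly_def by (simp add: distrib_left sum.distrib)

lemma coef_poly_scale: "coef_poly (\<lambda>i. a * c i) C x = a *\<^sub>R coef_poly c C x"
proof -
  have "(\<Sum>\<alpha>\<in>exponents 2. monomial \<alpha> x * (a * c (C, \<alpha>, i))) = a * (\<Sum>\<alpha>\<in>exponents 2. monomial \<alpha> x * c (C, \<alpha>, i))" for i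
    unfolding sum_distrib_left by (intro sum.cong refl) (rule mult.left_commute)
  then show ?thesis by (simp add: coef_poly_def vec_eq_iff)
qed

lemma coef_poly_exists:
  assumes "\<And>C. C \<in> M \<Longrightarrow> p C \<in> polys 2 (UNIV :: (real^3) set)"
  obtains c where "\<And>C. C \<in> M \<Longrightarrow> p C = coef_poly c C"
proof -
  have "\<forall>C\<in>M. \<exists>c. \<forall>x. p C x = (\<Sum>\<alpha>\<in>exponents 2. monomial \<alpha> x *\<^sub>R c \<alpha>)"
  proof
    fix C assume C: "C \<in> M"
    obtain c where "\<And>x. p C x = (\<Sum>\<alpha>\<in>exponents 2. monomial \<alpha> x *\<^sub>R c \<alpha>)"
      by (rule polysE[OF assms[OF C]]) blast
    then show "\<exists>c. \<forall>x. p C x = (\<Sum>\<alpha>\<in>exponents 2. monomial \<alpha> x *\<^sub>R c \<alpha>)" by blast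
  qed
  from bchoice[OF this] obtain c where c: "\<And>C x. C \<in> M \<Longrightarrow> p C x = (\<Sum>\<alpha>\<in>exponents 2. monomial \<alpha> x *\<^sub>R c C \<alpha>)"
    by blast
  have "p C = coef_poly (\<lambda>(C, \<alpha>, i). c C \<alpha> $ i) C" if C: "C \<in> M" for C
  proof
    fix x show "p C x = coef_poly (\<lambda>(C, \<alpha>, i). c C \<alpha> $ i) C x"
      unfolding vec_eq_iff coef_poly_def c[OF C] by (simp add: sum_component)
  qed
  then show ?thesis using that by blast
qed

context mesh_domain
begin

definition coefficients :: "coefficient set" where
  "coefficients = M \<times> (exponents 2 \<times> UNIV)"

definition sq_norm :: "(coefficient \<Rightarrow> real) \<Rightarrow> real" where
  "sq_norm c = (\<integral>x. (norm (piecewise (coef_poly c) x))\<^sup>2 \<partial>lebesgue_on \<Omega>)"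

text \<open>The row vector of the pairing with the divergence of \<open>w S\<close> in these
  coordinates; \<open>functional_apply\<close> is its meaning.\<close>

definition functional :: "((real^3) set \<Rightarrow> real^3 \<Rightarrow> real) \<Rightarrow> ((real^3) set \<Rightarrow> real^3^3) \<Rightarrow> coefficient \<Rightarrow> real" where
  "functional w S = (\<lambda>(C, \<alpha>, i). integral (convex hull C) (\<lambda>x. monomial \<alpha> x * (S C *v gradient (w C) x) $ i))"

lemma piecewise_add: "piecewise (\<lambda>C x. f C x + g C x) x = piecewise f x + piecewise g x"
  by (cases rule: piecewise_cases[of x]) (simp_all add: piecewise_eq piecewise_0)

lemma piecewise_scale: "piecewise (\<lambda>C x. a *\<^sub>R f C x) x = a *\<^sub>R piecewise f x"
  by (cases rule: piecewise_cases[of x]) (simp_all add: piecewise_eq piecewise_0)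

lemma sq_norm_integrable: "integrable (lebesgue_on \<Omega>) (\<lambda>x. (norm (piecewise (coef_poly c) x))\<^sup>2)"
  using piecewise_L2[of "coef_poly c" UNIV] continuous_on_coef_poly by (simp add: L2_space_def)

lemma sq_norm_add: "sq_norm (\<lambda>i. c i + d i) \<le> 2 * (sq_norm c + sq_norm d)"
proof -
  have "sq_norm (\<lambda>i. c i + d i) \<le> (\<integral>x. 2 * ((norm (piecewise (coef_poly c) x))\<^sup>2 + (norm (piecewise (coef_poly d) x))\<^sup>2) \<partial>lebesgue_on \<Omega>)"
    unfolding sq_norm_def
  proof (rule integral_mono[OF sq_norm_integrable])
    show "integrable (lebesgue_on \<Omega>) (\<lambda>x. 2 * ((norm (piecewise (coef_poly c) x))\<^sup>2 + (norm (piecewise (coef_poly d) x))\<^sup>2))"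
      by (intro integrable_mult_right Bochner_Integration.integrable_add sq_norm_integrable)
    fix x
    let ?u = "piecewise (coef_poly c) x" and ?v = "piecewise (coef_poly d) x"
    have e: "piecewise (coef_poly (\<lambda>i. c i + d i)) x = ?u + ?v"
      unfolding piecewise_add[symmetric] coef_poly_add[symmetric] ..
    have "(norm (?u + ?v))\<^sup>2 \<le> (norm ?u + norm ?v)\<^sup>2" by (intro power_mono norm_triangle_ineq norm_ge_zero)
    also have "\<dots> \<le> 2 * ((norm ?u)\<^sup>2 + (norm ?v)\<^sup>2)"
      using zero_le_power2[of "norm ?u - norm ?v"] by (simp add: power2_sum power2_diff)
    finally show "(norm (piecewise (coef_poly (\<lambda>i. c i + d i)) x))\<^sup>2 \<le> 2 * ((norm ?u)\<^sup>2 + (norm ?v)\<^sup>2)" unfolding e .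
  qed
  also have "\<dots> = 2 * (sq_norm c + sq_norm d)"
    unfolding sq_norm_def integral_mult_right_zero by (subst Bochner_Integration.integral_add[OF sq_norm_integrable sq_norm_integrable]) simp
  finally show ?thesis .
qed

lemma sq_norm_scale: "sq_norm (\<lambda>i. a * c i) = a\<^sup>2 * sq_norm c"
proof -
  have "piecewise (coef_poly (\<lambda>i. a * c i)) x = a *\<^sub>R piecewise (coef_poly c) x" for x
    unfolding piecewise_scale[symmetric] coef_poly_scale[symmetric] ..
  then show ?thesis unfolding sq_norm_def by (simp add: power_mult_distrib)
qed

lemma piecewise_cong: "(\<And>C. C \<in> M \<Longrightarrow> f C = g C) \<Longrightarrow> piecewise f = piecewise g"
  unfolding piecewise_def[abs_def] by (intro ext sum.cong) auto

lemma sq_norm_cong: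
  assumes "\<And>i. i \<in> coefficients \<Longrightarrow> c i = d i" shows "sq_norm c = sq_norm d"
proof -
  have "coef_poly c C = coef_poly d C" if "C \<in> M" for C
    unfolding coef_poly_def[abs_def] using assms that by (intro ext vec_eq_iff[THEN iffD2] allI) (simp add: coefficients_def)
  then show ?thesis unfolding sq_norm_def by (simp only: piecewise_cong[of "coef_poly c" "coef_poly d"])
qed

lemma functional_apply:
  assumes adm: "admissible w S"
  shows "(\<Sum>i\<in>coefficients. functional w S i * c i) = (\<Sum>C\<in>M. integral (convex hull C) (\<lambda>x. (S C *v gradient (w C) x) \<bullet> coef_poly c C x))"
proof -
  have "integral (convex hull C) (\<lambda>x. (S C *v gradient (w C) x) \<bullet> coef_poly c C x)
    = (\<Sum>q\<in>exponents 2 \<times> UNIV. functional w S (C, q) * c (C, q))" if C: "C \<in> M" for C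
  proof -
    interpret tetrahedron C using tet[OF C] .
    have "w C \<in> polys 3 UNIV" using adm C unfolding admissible_def by blast
    then have "continuous_on UNIV (gradient (w C))" by (intro smooth_gradient(2) polys_smooth)
    then have cg: "continuous_on UNIV (\<lambda>x. S C *v gradient (w C) x)" by (rule continuous_on_matrix_vector)
    have cgi: "continuous_on UNIV (\<lambda>x. (S C *v gradient (w C) x) $ i)" for i
      using continuous_on_inner[OF cg continuous_on_const[of _ "axis i 1"]] by (simp add: inner_axis)
    have cm: "continuous_on UNIV (monomial \<alpha>)" for \<alpha>
      by (rule smooth_continuous[OF smooth_prod[OF finite smooth_power[OF smooth_coord]]])
    have i: "(\<lambda>x. (monomial \<alpha> x * (S C *v gradient (w C) x) $ i) * c (C, \<alpha>, i)) integrable_on convex hull C" for \<alpha> i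
      by (intro set_lebesgue_integral_eq_integral(1) absolutely_integrable_continuous_compact compact_tet
          continuous_on_subset[OF continuous_on_mult[OF continuous_on_mult[OF cm cgi] continuous_on_const] subset_UNIV])
    have "(\<lambda>x. (S C *v gradient (w C) x) \<bullet> coef_poly c C x)
      = (\<lambda>x. \<Sum>q\<in>exponents 2 \<times> UNIV. (monomial (fst q) x * (S C *v gradient (w C) x) $ (snd q)) * c (C, fst q, snd q))"
    proof
      fix x
      have "(S C *v gradient (w C) x) \<bullet> coef_poly c C x = (\<Sum>i\<in>UNIV. \<Sum>\<alpha>\<in>exponents 2. (monomial \<alpha> x * (S C *v gradient (w C) x) $ i) * c (C, \<alpha>, i))"
        unfolding inner_vec_def coef_poly_def by (simp add: sum_distrib_left mult_ac)
      also have "\<dots> = (\<Sum>\<alpha>\<in>exponents 2. \<Sum>i\<in>UNIV. (monomial \<alpha> x * (S C *v gradient (w C) x) $ i) * c (C, \<alpha>, i))"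
        by (rule sum.swap)
      finally show "(S C *v gradient (w C) x) \<bullet> coef_poly c C x
        = (\<Sum>q\<in>exponents 2 \<times> UNIV. (monomial (fst q) x * (S C *v gradient (w C) x) $ (snd q)) * c (C, fst q, snd q))"
        unfolding sum.cartesian_product by (simp add: case_prod_beta)
    qed
    then have "integral (convex hull C) (\<lambda>x. (S C *v gradient (w C) x) \<bullet> coef_poly c C x)
      = (\<Sum>q\<in>exponents 2 \<times> UNIV. integral (convex hull C) (\<lambda>x. (monomial (fst q) x * (S C *v gradient (w C) x) $ (snd q)) * c (C, fst q, snd q)))"
      using Henstock_Kurzweil_Integration.integral_sum[of "exponents 2 \<times> UNIV" "\<lambda>q x. (monomial (fst q) x * (S C *v gradient (w C) x) $ (snd q)) * c (C, fst q, snd q)" "convex hull C", OF _ i]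
      by (simp only: finite_cartesian_product[OF finite_exponents finite])
    then show ?thesis by (simp add: functional_def case_prod_beta)
  qed
  note each = this
  have "(\<Sum>i\<in>coefficients. functional w S i * c i) = (\<Sum>C\<in>M. \<Sum>q\<in>exponents 2 \<times> UNIV. functional w S (C, q) * c (C, q))"
    unfolding coefficients_def sum.cartesian_product by (simp add: case_prod_beta)
  also have "\<dots> = (\<Sum>C\<in>M. integral (convex hull C) (\<lambda>x. (S C *v gradient (w C) x) \<bullet> coef_poly c C x))"
    by (rule sum.cong[OF refl each[symmetric]])
  finally show ?thesis .
qed

lemma V_h_piecewise:
  assumes "v \<in> V_h elements \<Omega>"
  obtains c where "AE x in lebesgue_on \<Omega>. v x = piecewise (coef_poly c) x"
proof -
  obtain p where p: "elementwise_poly 2 UNIV elements v p" using assms unfolding V_h_def by blast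
  obtain c where c: "\<And>C. C \<in> M \<Longrightarrow> p (convex hull C) = coef_poly c C"
  proof (rule coef_poly_exists[of M "\<lambda>C. p (convex hull C)"])
    show "C \<in> M \<Longrightarrow> p (convex hull C) \<in> polys 2 UNIV" for C using p unfolding elementwise_poly_def by blast
  qed blast
  have "AE x in lebesgue. x \<in> convex hull C \<longrightarrow> v x = coef_poly c C x" if C: "C \<in> M" for C
  proof -
    have "AE x in lebesgue_on (convex hull C). v x = coef_poly c C x"
      using p C c[OF C] unfolding elementwise_poly_def by fastforce
    then show ?thesis
      using tetrahedron.compact_tet[OF tet[OF C]]
      by (subst (asm) AE_restrict_space_iff) (auto simp: lmeasurable_compact fmeasurableD)
  qed
  then have "AE x in lebesgue. \<forall>C\<in>M. x \<in> convex hull C \<longrightarrow> v x = coef_poly c C x"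
    using finM by (subst AE_ball_countable) (auto intro: countable_finite)
  then have "AE x in lebesgue_on \<Omega>. \<forall>C\<in>M. x \<in> convex hull C \<longrightarrow> v x = coef_poly c C x"
    by (subst AE_restrict_space_iff) (use open_domain in \<open>auto simp: borel_open elim: eventually_mono\<close>)
  with AE_in_tet have "AE x in lebesgue_on \<Omega>. v x = piecewise (coef_poly c) x"
  proof eventually_elim
    case (elim x)
    then obtain C where C: "C \<in> M" "x \<in> open_tet C" by blast
    then have "x \<in> convex hull C" using tetrahedron.open_tet_interior[OF tet[OF C(1)]] interior_subset by blast
    then show ?case using elim(2) C by (simp add: piecewise_eq)
  qed
  then show ?thesis by (rule that)
qed

text \<open>Injectivity means that the pairings have no common kernel on nonzero discrete functions,
  so by \<open>functional_bound\<close> finitely many test fields control the norm. For each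
  \<open>v\<close> one of them is large enough, and being finitely many they have bounded
  norms.\<close>

lemma inf_sup_of_injectivity:
  assumes zero: "\<And>p C x. (\<And>C. C \<in> M \<Longrightarrow> p C \<in> polys 2 UNIV) \<Longrightarrow> orthogonal_to_div p \<Longrightarrow> C \<in> M \<Longrightarrow> p C x = 0"
  shows "\<exists>\<delta>>0. \<forall>v\<in>V_h elements \<Omega>. nonzero_on \<Omega> v \<longrightarrow> (\<exists>\<tau>\<in>Sigma_h elements \<Omega>. nonzero_on \<Omega> \<tau> \<and>
     \<delta> \<le> (\<integral>x. weak_div \<Omega> \<tau> x \<bullet> v x \<partial>lebesgue_on \<Omega>) / (L2_norm \<Omega> v * Hdiv_norm \<Omega> \<tau>))"
proof -
  let ?L = "{functional w S | w S. admissible w S}"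
  have "\<exists>L' B. finite L' \<and> L' \<subseteq> ?L \<and> 0 \<le> B \<and> (\<forall>c. sq_norm c \<le> B * (\<Sum>l\<in>L'. (\<Sum>i\<in>coefficients. l i * c i)\<^sup>2))"
  proof (rule functional_bound)
    show "finite coefficients" unfolding coefficients_def by (intro finite_cartesian_product finM finite_exponents finite)
    show "0 \<le> sq_norm c" for c unfolding sq_norm_def by (rule Bochner_Integration.integral_nonneg) simp
    show "sq_norm c = 0" if k: "\<And>l. l \<in> ?L \<Longrightarrow> (\<Sum>i\<in>coefficients. l i * c i) = 0" for c
    proof -
      have "orthogonal_to_div (coef_poly c)"
        unfolding orthogonal_to_div_def
      proof (intro allI impI)
        fix w S assume adm: "admissible w S"
        have "functional w S \<in> ?L" using adm by blast
        from k[OF this] show "(\<Sum>C\<in>M. integral (convex hull C) (\<lambda>x. (S C *v gradient (w C) x) \<bullet> coef_poly c C x)) = 0"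
          unfolding functional_apply[OF adm] .
      qed
      then have "coef_poly c C x = 0" if "C \<in> M" for C x
        using zero[of "coef_poly c"] coef_poly_polys that by blast
      then have "piecewise (coef_poly c) x = 0" for x
        by (cases rule: piecewise_cases[of x]) (simp_all add: piecewise_eq piecewise_0)
      then show ?thesis by (simp add: sq_norm_def)
    qed
  qed (rule sq_norm_add sq_norm_scale sq_norm_cong; assumption)+
  then obtain L' B where L': "finite L'" "L' \<subseteq> ?L" "0 \<le> B" and B: "\<And>c. sq_norm c \<le> B * (\<Sum>l\<in>L'. (\<Sum>i\<in>coefficients. l i * c i)\<^sup>2)"
    by blast
  have "\<forall>l\<in>L'. \<exists>w S. admissible w S \<and> l = functional w S" using L'(2) by blast
  then obtain w S where wS: "\<And>l. l \<in> L' \<Longrightarrow> admissible (w l) (S l)" "\<And>l. l \<in> L' \<Longrightarrow> l = functional (w l) (S l)"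
    by metis
  \<comment> \<open>The pairing selected for \<open>v\<close> may be negative; the opposite field
    corrects its sign.\<close>
  define S' where "S' l C = - S l C" for l C
  have wS': "admissible (w l) (S' l)" if "l \<in> L'" for l
  proof -
    have t: "transpose (- A) = - transpose A" for A :: "real^3^3" by (simp add: transpose_def vec_eq_iff)
    have a: "admissible (w l) (S l)" by (rule wS(1)[OF that])
    have "transpose (S l C) = S l C" if "C \<in> M" for C using a that unfolding admissible_def by blast
    then show ?thesis
      using a unfolding admissible_def S'_def matrix_vector_uminus t scaleR_minus_right neg_equal_iff_equal by blast
  qed
  \<comment> \<open>A common bound for the norms of the finitely many fields and their opposites,
    kept at least 1 so that it can be divided by.\<close>
  define H where "H = 1 + (\<Sum>l\<in>L'. \<bar>Hdiv_norm \<Omega> (test_field (w l) (S l))\<bar> + \<bar>Hdiv_norm \<Omega> (test_field (w l) (S' l))\<bar>)"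
  have H: "1 \<le> H" "Hdiv_norm \<Omega> (test_field (w l) (S l)) \<le> H" "Hdiv_norm \<Omega> (test_field (w l) (S' l)) \<le> H" if "l \<in> L'" for l
  proof -
    have "\<bar>Hdiv_norm \<Omega> (test_field (w l) (S l))\<bar> + \<bar>Hdiv_norm \<Omega> (test_field (w l) (S' l))\<bar>
      \<le> (\<Sum>l\<in>L'. \<bar>Hdiv_norm \<Omega> (test_field (w l) (S l))\<bar> + \<bar>Hdiv_norm \<Omega> (test_field (w l) (S' l))\<bar>)"
      using L'(1) that by (intro member_le_sum) auto
    then show "1 \<le> H" "Hdiv_norm \<Omega> (test_field (w l) (S l)) \<le> H" "Hdiv_norm \<Omega> (test_field (w l) (S' l)) \<le> H"
      unfolding H_def by linarith+
  qed
  have H1: "1 \<le> H" unfolding H_def by (simp add: sum_nonneg)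
  \<comment> \<open>Some squared pairing reaches \<open>sq_norm c / n\<close>: otherwise the bound
    \<open>B\<close> times the sum of \<open>card L'\<close> terms would fall below
    \<open>sq_norm c\<close>. The added ones keep \<open>n\<close> positive and the comparison
    strict.\<close>
  define n where "n = (B + 1) * (real (card L') + 1)"
  have n: "n > 0" unfolding n_def using L'(3) by simp
  define \<delta> where "\<delta> = 1 / (sqrt n * H)"
  have \<delta>: "\<delta> > 0" unfolding \<delta>_def using n H1 by simp
  have "\<exists>\<tau>\<in>Sigma_h elements \<Omega>. nonzero_on \<Omega> \<tau> \<and> \<delta> \<le> (\<integral>x. weak_div \<Omega> \<tau> x \<bullet> v x \<partial>lebesgue_on \<Omega>) / (L2_norm \<Omega> v * Hdiv_norm \<Omega> \<tau>)"
    if v: "v \<in> V_h elements \<Omega>" and nz: "nonzero_on \<Omega> v" for v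
  proof -
    obtain c where c: "AE x in lebesgue_on \<Omega>. v x = piecewise (coef_poly c) x" using V_h_piecewise[OF v] .
    have vL: "v \<in> L2_space \<Omega> UNIV" using v by (simp add: V_h_def)
    then have vm: "v \<in> borel_measurable (lebesgue_on \<Omega>)" by (simp add: L2_space_def)
    have vi: "integrable (lebesgue_on \<Omega>) (\<lambda>x. (norm (v x))\<^sup>2)" using vL by (simp add: L2_space_def)
    have "sq_norm c = (\<integral>x. (norm (v x))\<^sup>2 \<partial>lebesgue_on \<Omega>)"
      unfolding sq_norm_def
      by (rule integral_cong_AE[OF borel_measurable_integrable[OF sq_norm_integrable] borel_measurable_integrable[OF vi]])
         (use c in \<open>auto elim: eventually_mono\<close>)
    then have Lv: "L2_norm \<Omega> v = sqrt (sq_norm c)" by (simp add: L2_norm_def)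
    have Lnz: "L2_norm \<Omega> v \<noteq> 0" using L2_norm_zero_AE[OF vL] nz unfolding nonzero_on_def by blast
    have "sq_norm c \<ge> 0" unfolding sq_norm_def by (rule Bochner_Integration.integral_nonneg) simp
    then have Q: "sq_norm c > 0" using Lnz Lv by (cases "sq_norm c = 0") auto
    then have Lpos: "L2_norm \<Omega> v > 0" using Lv by simp
    let ?F = "\<lambda>l. (\<Sum>i\<in>coefficients. l i * c i)"
    have "\<exists>l\<in>L'. sq_norm c / n \<le> (?F l)\<^sup>2"
    proof (rule ccontr)
      assume "\<not> ?thesis"
      then have lt: "(?F l)\<^sup>2 \<le> sq_norm c / n" if "l \<in> L'" for l using that by force
      have "sq_norm c \<le> B * (\<Sum>l\<in>L'. (?F l)\<^sup>2)" by (rule B)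
      also have "\<dots> \<le> B * (real (card L') * (sq_norm c / n))"
        using sum_bounded_above[of L' "\<lambda>l. (?F l)\<^sup>2" "sq_norm c / n"] lt L'(3) by (intro mult_left_mono) auto
      also have "\<dots> = (B * real (card L') / n) * sq_norm c" by simp
      also have "\<dots> < 1 * sq_norm c"
      proof (rule mult_strict_right_mono[OF _ Q])
        have "B * real (card L') < n" unfolding n_def using L'(3) by (simp add: algebra_simps add_pos_nonneg)
        then show "B * real (card L') / n < 1" using n by simp
      qed
      finally show False by simp
    qed
    then obtain l where l: "l \<in> L'" "sq_norm c / n \<le> (?F l)\<^sup>2" by blast
    have "sqrt (sq_norm c / n) \<le> \<bar>?F l\<bar>" using l(2) by (metis real_sqrt_abs real_sqrt_le_mono)
    then have Fl: "L2_norm \<Omega> v / sqrt n \<le> \<bar>?F l\<bar>" unfolding Lv by (simp add: real_sqrt_divide)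
    have key: "\<exists>\<tau>\<in>Sigma_h elements \<Omega>. nonzero_on \<Omega> \<tau> \<and> \<delta> \<le> (\<integral>x. weak_div \<Omega> \<tau> x \<bullet> v x \<partial>lebesgue_on \<Omega>) / (L2_norm \<Omega> v * Hdiv_norm \<Omega> \<tau>)"
      if adm: "admissible w' T'" and I: "(\<integral>x. weak_div \<Omega> (test_field w' T') x \<bullet> v x \<partial>lebesgue_on \<Omega>) = \<bar>?F l\<bar>"
        and Hle: "Hdiv_norm \<Omega> (test_field w' T') \<le> H" for w' T'
    proof -
      have "\<bar>?F l\<bar> > 0" using Fl Lpos n by (meson divide_pos_pos less_le_trans real_sqrt_gt_zero)
      then have "(\<integral>x. weak_div \<Omega> (test_field w' T') x \<bullet> v x \<partial>lebesgue_on \<Omega>) \<noteq> 0" unfolding I by simp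
      note nzp = admissible_nonzero[OF adm vL c coef_poly_smooth this]
      have "\<delta> = (L2_norm \<Omega> v / sqrt n) / (L2_norm \<Omega> v * H)" unfolding \<delta>_def using Lpos by simp
      also have "\<dots> \<le> \<bar>?F l\<bar> / (L2_norm \<Omega> v * Hdiv_norm \<Omega> (test_field w' T'))"
        using Fl Lpos nzp(2) Hle by (intro frac_le mult_left_mono mult_pos_pos) auto
      finally show ?thesis using nzp(1) admissible_weak_div(1)[OF adm] unfolding I[symmetric] by blast
    qed
    have pair: "(\<integral>x. weak_div \<Omega> (test_field (w l) T') x \<bullet> v x \<partial>lebesgue_on \<Omega>) = (\<Sum>i\<in>coefficients. functional (w l) T' i * c i)"
      if "admissible (w l) T'" for T'
      unfolding functional_apply[OF that] by (rule admissible_pairing[OF that coef_poly_smooth vm c])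
    show ?thesis
    proof (cases "?F l \<ge> 0")
      case True
      show ?thesis
        by (rule key[OF wS(1)[OF l(1)] _ H(2)[OF l(1)]]) (use pair[OF wS(1)[OF l(1)]] wS(2)[OF l(1)] True in simp)
    next
      case False
      have "functional (w l) (S' l) i = - functional (w l) (S l) i" for i
        unfolding functional_def S'_def by (simp add: matrix_vector_uminus case_prod_beta)
      then have "(\<Sum>i\<in>coefficients. functional (w l) (S' l) i * c i) = - ?F l"
        using wS(2)[OF l(1)] by (simp add: sum_negf)
      then show ?thesis
        by (intro key[OF wS'[OF l(1)] _ H(3)[OF l(1)]]) (use pair[OF wS'[OF l(1)]] False in simp)
    qed
  qed
  then show ?thesis using \<delta> by blast
qed

end

section \<open>Edge patches of a triangulation\<close>

definition element_vertices :: "(real^3) set set \<Rightarrow> (real^3) set set" where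
  "element_vertices T = {C. card C = 4 \<and> \<not> affine_dependent C \<and> convex hull C \<in> T}"

lemma extreme_points_hull:
  fixes C :: "'a::euclidean_space set"
  shows "\<not> affine_dependent C \<Longrightarrow> {x. x extreme_point_of (convex hull C)} = C"
  by (simp add: extreme_point_of_convex_hull_affine_independent)

lemma hull_eq_imp_eq:
  fixes C D :: "'a::euclidean_space set"
  assumes "\<not> affine_dependent C" "\<not> affine_dependent D" "convex hull C = convex hull D" shows "C = D"
  by (rule trans[OF extreme_points_hull[OF assms(1), symmetric, unfolded assms(3)] extreme_points_hull[OF assms(2)]])

text \<open>The intersection of two elements is a face of each, thus the hull of a subset of either
  vertex set. Extreme points identify the two subsets, which therefore consist of common
  vertices.\<close>

lemma tet_mesh_elements:
  assumes "tet_mesh T \<Omega>"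
  shows "T = (\<lambda>C. convex hull C) ` element_vertices T" and "simplicial_mesh (element_vertices T)"
proof -
  have tri: "triangulation T" and s3: "\<And>K. K \<in> T \<Longrightarrow> 3 simplex K" using assms by (auto simp: tet_mesh_def)
  show T: "T = (\<lambda>C. convex hull C) ` element_vertices T"
  proof (intro set_eqI iffI)
    fix K assume K: "K \<in> T"
    obtain C where C: "\<not> affine_dependent C" "int (card C) = 3 + 1" "K = convex hull C"
      using s3[OF K] unfolding simplex_def by blast
    then have "C \<in> element_vertices T" using K by (simp add: element_vertices_def)
    then show "K \<in> (\<lambda>C. convex hull C) ` element_vertices T" using C(3) by blast
  qed (auto simp: element_vertices_def)
  have inj: "inj_on (\<lambda>C. convex hull C) (element_vertices T)"
    by (rule inj_onI) (rule hull_eq_imp_eq, simp_all add: element_vertices_def)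
  show "simplicial_mesh (element_vertices T)"
  proof
    show "finite (element_vertices T)"
      by (rule finite_imageD[OF _ inj]) (use tri T in \<open>simp add: triangulation_def\<close>)
    fix C C' assume C: "C \<in> element_vertices T" "C' \<in> element_vertices T"
    then have i: "\<not> affine_dependent C" "\<not> affine_dependent C'" and K: "convex hull C \<in> T" "convex hull C' \<in> T"
      by (auto simp: element_vertices_def)
    have f: "(convex hull C \<inter> convex hull C') face_of (convex hull C)" "(convex hull C \<inter> convex hull C') face_of (convex hull C')"
      using tri K unfolding triangulation_def by (simp, metis Int_commute)
    obtain c where c: "c \<subseteq> C" "convex hull C \<inter> convex hull C' = convex hull c"
      using f(1) unfolding face_of_convex_hull_affine_independent[OF i(1)] by blast
    obtain c' where c': "c' \<subseteq> C'" "convex hull C \<inter> convex hull C' = convex hull c'"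
      using f(2) unfolding face_of_convex_hull_affine_independent[OF i(2)] by blast
    have "c = c'"
    proof (rule hull_eq_imp_eq)
      show "\<not> affine_dependent c" by (rule affine_independent_subset[OF i(1) c(1)])
      show "\<not> affine_dependent c'" by (rule affine_independent_subset[OF i(2) c'(1)])
      show "convex hull c = convex hull c'" using c(2) c'(2) by (rule trans[OF sym])
    qed
    then have "c \<subseteq> C \<inter> C'" using c c' by blast
    then have "convex hull c \<subseteq> convex hull (C \<inter> C')" by (rule hull_mono)
    moreover have "convex hull (C \<inter> C') \<subseteq> convex hull C \<inter> convex hull C'" by (simp add: hull_mono)
    ultimately show "convex hull C \<inter> convex hull C' = convex hull (C \<inter> C')" using c(2) by blast
  qed (auto simp: element_vertices_def)
qed

text \<open>A point of the face inside \<Omega> can be moved slightly towards the centroid of the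
  face. Any other element containing the new point would have all of \<open>F\<close> as a face, so
  nearby only \<open>C\<close> is left. Crossing the face out of \<open>C\<close> then reaches a
  point of \<Omega> covered by no element.\<close>

lemma (in simplicial_mesh) exposed_face_outside:
  assumes \<Omega>: "open \<Omega>" "\<Omega> \<subseteq> (\<Union>C\<in>M. convex hull C)" and C: "C \<in> M" and F: "F \<in> faces C"
    and only: "\<And>C'. C' \<in> M \<Longrightarrow> F \<in> faces C' \<Longrightarrow> C' = C"
  shows "convex hull F \<inter> \<Omega> = {}"
proof (rule ccontr)
  assume "\<not> ?thesis"
  then obtain x where x: "x \<in> convex hull F" "x \<in> \<Omega>" by blast
  interpret tetrahedron C using tet[OF C] .
  obtain v where v: "v \<in> C" "F = C - {v}" using F unfolding faces_Diff[OF card4] by blast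
  have FC: "F \<subseteq> C" and finF: "finite F" and c3: "card F = 3" using v fin F by (auto simp: faces_def)
  define g where "g = (\<Sum>w\<in>F. (1/3) *\<^sub>R w)"
  have g: "bary C u g = (\<Sum>w\<in>F. 1/3 * bary C u w)" for u
    unfolding g_def by (rule bary_sum) (simp add: c3)
  have gF: "bary C w g = 1/3" if w: "w \<in> F" for w
  proof -
    have "(\<Sum>u\<in>F. 1/3 * bary C w u) = (\<Sum>u\<in>F. if u = w then 1/3 else 0)"
    proof (intro sum.cong refl)
      fix u assume "u \<in> F"
      then have "u \<in> C" "w \<in> C" using FC w by auto
      then show "1/3 * bary C w u = (if u = w then 1/3 else 0)" by (simp add: bary_vertex)
    qed
    then show ?thesis using g finF w by simp
  qed
  have gin: "g \<in> convex hull F"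
    unfolding g_def by (rule convex_sum[OF finF convex_convex_hull]) (auto simp: c3 hull_inc)
  obtain r where r: "r > 0" "ball x r \<subseteq> \<Omega>" using \<Omega>(1) x(2) openE by blast
  define e where "e = min 1 (r / (2 * (1 + norm (g - x))))"
  have e: "0 < e" "e \<le> 1" unfolding e_def using r(1) by (auto simp: add_pos_nonneg)
  define y where "y = (1 - e) *\<^sub>R x + e *\<^sub>R g"
  have "norm (y - x) < r"
  proof -
    have "y - x = e *\<^sub>R (g - x)" by (simp add: y_def algebra_simps)
    then have "norm (y - x) = e * norm (g - x)" using e(1) by simp
    also have "\<dots> \<le> r / (2 * (1 + norm (g - x))) * norm (g - x)" unfolding e_def by (intro mult_right_mono) auto
    also have "\<dots> \<le> r / 2"
    proof -
      have "norm (g - x) / (1 + norm (g - x)) \<le> 1" by (simp add: add_pos_nonneg)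
      then have "r / 2 * (norm (g - x) / (1 + norm (g - x))) \<le> r / 2 * 1" using r(1) by (intro mult_left_mono) auto
      then show ?thesis by simp
    qed
    also have "\<dots> < r" using r(1) by simp
    finally show ?thesis .
  qed
  then have y\<Omega>: "y \<in> \<Omega>" using r(2) by (auto simp: dist_norm norm_minus_commute)
  have yF: "bary C w y > 0" if w: "w \<in> F" for w
  proof -
    have "x \<in> convex hull C" using x(1) hull_mono[OF FC] by blast
    then have "0 \<le> bary C w x" using mem_tet w FC by blast
    then have "0 \<le> (1 - e) * bary C w x" using e by simp
    moreover have "0 < e * (1/3)" using e by simp
    ultimately have "0 < (1 - e) * bary C w x + e * (1/3)" by linarith
    then show ?thesis unfolding y_def bary_comb2 gF[OF w] .
  qed
  have yv: "bary C v y = 0"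
    unfolding y_def bary_comb2 using bary_on_face[OF FC _ x(1), of v] bary_on_face[OF FC _ gin, of v] v by simp
  have y_only: "y \<notin> convex hull C'" if C': "C' \<in> M" "C' \<noteq> C" for C'
  proof
    assume "y \<in> convex hull C'"
    have "y \<in> convex hull C" unfolding mem_tet
    proof
      fix w assume "w \<in> C"
      then show "0 \<le> bary C w y" using yF[of w] yv v by (cases "w = v") auto
    qed
    then have yi: "y \<in> convex hull (C \<inter> C')" using conf[OF C C'(1)] \<open>y \<in> convex hull C'\<close> by blast
    have "F \<subseteq> C'"
    proof
      fix w assume w: "w \<in> F"
      show "w \<in> C'"
      proof (rule ccontr)
        assume "w \<notin> C'"
        then have "bary C w y = 0" using w FC by (intro bary_on_face[OF _ _ yi]) auto
        then show False using yF[OF w] by simp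
      qed
    qed
    then have "F \<in> faces C'" using c3 by (simp add: faces_def)
    then show False using only C' by blast
  qed
  define U where "U = \<Omega> - (\<Union>C'\<in>M - {C}. convex hull C')"
  have "open U"
    unfolding U_def
  proof (intro open_Diff \<Omega>(1) closed_UN)
    show "finite (M - {C})" using finM by simp
    show "\<forall>C'\<in>M - {C}. closed (convex hull C')" using tetrahedron.compact_tet[OF tet] by (auto intro: compact_imp_closed)
  qed
  moreover have "y \<in> U" unfolding U_def using y\<Omega> y_only by blast
  ultimately obtain q where q: "q > 0" "ball y q \<subseteq> U" using openE by blast
  define h where "h = q / (2 * (1 + norm (g - v)))"
  have h: "0 < h" unfolding h_def using q(1) by (simp add: add_pos_nonneg)
  \<comment> \<open>A step away from the opposite vertex \<open>v\<close>: the
    \<open>v\<close>-coordinate falls from 0 to \<open>- h\<close>.\<close>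
  define z where "z = y + h *\<^sub>R (g - v)"
  have "norm (z - y) < q"
  proof -
    have "norm (z - y) = h * norm (g - v)" using h by (simp add: z_def)
    also have "\<dots> = q / 2 * (norm (g - v) / (1 + norm (g - v)))" by (simp add: h_def)
    also have "\<dots> \<le> q / 2 * 1" using q(1) by (intro mult_left_mono) (auto simp: add_pos_nonneg)
    also have "\<dots> < q" using q(1) by simp
    finally show ?thesis .
  qed
  then have zU: "z \<in> U" using q(2) by (auto simp: dist_norm norm_minus_commute)
  have "bary C v z = bary C v y + h * (bary C v g - bary C v v)"
    using bary_diff[of C v z y] bary_diff[of C v g v] by (simp add: z_def)
  also have "\<dots> = - h" using yv bary_on_face[OF FC _ gin, of v] v by simp
  finally have "z \<notin> convex hull C" using h mem_tet v(1) by force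
  moreover have "z \<in> \<Omega>" "\<forall>C'\<in>M - {C}. z \<notin> convex hull C'" using zU unfolding U_def by blast+
  ultimately show False using \<Omega>(2) by blast
qed

text \<open>Elements lie in the closure of \<Omega>, and \<Omega> is the interior of a closed union
  of polytopes. This puts the interiors of the elements into \<Omega>, which could fail for a slit
  domain.\<close>

lemma polyhedral_mesh_domain:
  assumes \<Omega>: "polyhedral_domain \<Omega>" and T: "tet_mesh T \<Omega>"
  shows "mesh_domain (element_vertices T) \<Omega>"
proof -
  interpret simplicial_mesh "element_vertices T" by (rule tet_mesh_elements(2)[OF T])
  obtain P where P: "finite P" "\<forall>p\<in>P. polytope p" "\<Omega> = interior (\<Union>P)" using \<Omega> unfolding polyhedral_domain_def by blast
  have o: "open \<Omega>" "bounded \<Omega>" using \<Omega> unfolding polyhedral_domain_def by blast+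
  have un: "(\<Union>C\<in>element_vertices T. convex hull C) = closure \<Omega>"
    using tet_mesh_elements(1)[OF T] T unfolding tet_mesh_def by metis
  have "closed (\<Union>P)" using P(1,2) polytope_imp_closed by (intro closed_Union) blast+
  then have cl: "closure \<Omega> \<subseteq> \<Union>P" unfolding P(3) by (meson closure_minimal interior_subset)
  show ?thesis
  proof
    show "open \<Omega>" "bounded \<Omega>" by (rule o)+
    show "interior (convex hull C) \<subseteq> \<Omega>" if "C \<in> element_vertices T" for C
    proof -
      have "convex hull C \<subseteq> \<Union>P" using that un cl by blast
      then show ?thesis unfolding P(3) by (rule interior_mono)
    qed
    show cov: "\<Omega> \<subseteq> (\<Union>C\<in>element_vertices T. convex hull C)" unfolding un by (rule closure_subset)
    show "convex hull F \<inter> \<Omega> = {}" if "C \<in> element_vertices T" "F \<in> faces C" "\<And>C'. C' \<in> element_vertices T \<Longrightarrow> F \<in> faces C' \<Longrightarrow> C' = C" for C F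
      by (rule exposed_face_outside[OF o(1) cov that])
  qed
qed

section \<open>Edges and faces as convex hulls\<close>

context simplicial_mesh
begin

lemma face_indep: "C \<in> M \<Longrightarrow> F \<subseteq> C \<Longrightarrow> \<not> affine_dependent F"
  using indepM affine_independent_subset by blast

lemma vertex_set_face: "C \<in> M \<Longrightarrow> F \<subseteq> C \<Longrightarrow> vertex_set (convex hull F) = F"
  unfolding vertex_set_def using extreme_points_hull[OF face_indep] by blast

lemma facet_iff: "C \<in> M \<Longrightarrow> G facet_of (convex hull C) \<longleftrightarrow> (\<exists>F\<in>faces C. G = convex hull F)"
proof -
  assume C: "C \<in> M"
  interpret tetrahedron C using tet[OF C] .
  have "C - {u} \<noteq> {}" if "u \<in> C" for u using card_face[OF that] by force
  then show ?thesis
    unfolding facet_of_convex_hull_affine_independent[OF indep] faces_Diff[OF card4] by auto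
qed

lemma vertex_in_face:
  assumes "C \<in> M" "F \<subseteq> C" "a \<in> C" "a \<in> convex hull F" shows "a \<in> F"
proof (rule ccontr)
  assume "a \<notin> F"
  interpret tetrahedron C using tet[OF assms(1)] .
  have "bary C a a = 0" using assms \<open>a \<notin> F\<close> by (intro bary_on_face[of F]) auto
  then show False using assms(3) by simp
qed

context
  fixes a b :: "real^3" assumes ab: "a \<noteq> b"
begin

abbreviation "seg \<equiv> convex hull {a, b}"

lemma seg_vertices: "{x. x extreme_point_of seg} = {a, b}"
  using ab by (intro extreme_points_hull) (rule affine_independent_2)

lemma seg_edge: "C \<in> M \<Longrightarrow> seg edge_of (convex hull C) \<longleftrightarrow> a \<in> C \<and> b \<in> C"
proof
  assume C: "C \<in> M" and "seg edge_of (convex hull C)"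
  then have "seg face_of (convex hull C)" by (simp add: edge_of_def)
  then obtain c where c: "c \<subseteq> C" "seg = convex hull c"
    unfolding face_of_convex_hull_affine_independent[OF indepM[OF C]] by blast
  have "c = {a, b}" using extreme_points_hull[OF face_indep[OF C c(1)]] seg_vertices unfolding c(2) by (rule trans[OF sym])
  then show "a \<in> C \<and> b \<in> C" using c(1) by simp
next
  assume C: "C \<in> M" and "a \<in> C \<and> b \<in> C"
  then have "seg face_of (convex hull C)"
    unfolding face_of_convex_hull_affine_independent[OF indepM[OF C]] by (intro exI[of _ "{a, b}"]) simp
  moreover have "aff_dim seg = 1" using ab by (simp add: aff_dim_convex_hull aff_dim_2)
  ultimately show "seg edge_of (convex hull C)" by (simp add: edge_of_def)
qed

lemma edge_elements_eq: "edge_elements elements seg = (\<lambda>C. convex hull C) ` {C\<in>M. a \<in> C \<and> b \<in> C}"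
  unfolding edge_elements_def using seg_edge by blast

lemma seg_subset_face:
  assumes "C \<in> M" "F \<subseteq> C" "a \<in> C" "b \<in> C" shows "seg \<subseteq> convex hull F \<longleftrightarrow> a \<in> F \<and> b \<in> F"
proof
  assume s: "seg \<subseteq> convex hull F"
  have "a \<in> seg" "b \<in> seg" by (simp_all add: hull_inc)
  then show "a \<in> F \<and> b \<in> F" using s vertex_in_face[OF assms(1,2)] assms(3,4) by blast
next
  assume "a \<in> F \<and> b \<in> F"
  then show "seg \<subseteq> convex hull F" by (intro hull_mono) auto
qed

lemma edge_faces_eq:
  assumes C0: "C0 \<in> M" "a \<in> C0" "b \<in> C0"
  shows "edge_faces elements seg = (\<lambda>F. convex hull F) ` {F\<in>all_faces. a \<in> F \<and> b \<in> F}"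
proof (intro set_eqI iffI)
  fix G assume "G \<in> edge_faces elements seg"
  then obtain C where C: "C \<in> M" "G facet_of (convex hull C)" "seg \<subseteq> G" by (auto simp: edge_faces_def mesh_faces_def)
  obtain F where F: "F \<in> faces C" "G = convex hull F" using C(2) unfolding facet_iff[OF C(1)] by blast
  have FC: "F \<subseteq> C" using F(1) by (simp add: faces_def)
  have "seg \<subseteq> convex hull C" using C(3) F(2) hull_mono[OF FC] by blast
  moreover have "a \<in> seg" "b \<in> seg" by (simp_all add: hull_inc)
  ultimately have "a \<in> C" "b \<in> C" using vertex_in_tet[OF C0(1) _ C(1)] C0 by blast+
  then have "a \<in> F \<and> b \<in> F" using seg_subset_face[OF C(1) FC] C(3) F(2) by blast
  then show "G \<in> (\<lambda>F. convex hull F) ` {F\<in>all_faces. a \<in> F \<and> b \<in> F}"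
    using F C(1) unfolding all_faces_def by blast
next
  fix G assume "G \<in> (\<lambda>F. convex hull F) ` {F\<in>all_faces. a \<in> F \<and> b \<in> F}"
  then obtain F C where F: "G = convex hull F" "a \<in> F" "b \<in> F" "C \<in> M" "F \<in> faces C" unfolding all_faces_def by blast
  have "seg \<subseteq> G" unfolding F(1) using F by (intro hull_mono) auto
  moreover have "G facet_of (convex hull C)" using facet_iff[OF F(4)] F by blast
  ultimately show "G \<in> edge_faces elements seg" using F(4) unfolding edge_faces_def mesh_faces_def by blast
qed

end

end

text \<open>Let d be the part of \<open>c - a\<close> orthogonal to the edge. The differences in the
  definition span the plane of the edge vector and d, where orthogonality and unit length leave two
  vectors and the sign condition selects d divided by its norm. So the definite description
  denotes.\<close>

lemma conormal_triangle:
  assumes ind: "\<not> affine_dependent {a, b, c}" and dist: "a \<noteq> b" "a \<noteq> c" "b \<noteq> c"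
  shows "norm (conormal (convex hull {a,b}) (convex hull {a,b,c})) = 1 \<and>
    conormal (convex hull {a,b}) (convex hull {a,b,c}) \<bullet> (b - a) = 0 \<and>
    (\<exists>\<alpha>>0. \<exists>\<beta>. c - a = \<alpha> *\<^sub>R conormal (convex hull {a,b}) (convex hull {a,b,c}) + \<beta> *\<^sub>R (b - a))"
proof -
  let ?e = "convex hull {a,b}" and ?F = "convex hull {a,b,c}"
  define t where "t = b - a"
  define \<beta> where "\<beta> = ((c - a) \<bullet> t) / (t \<bullet> t)"
  define d where "d = (c - a) - \<beta> *\<^sub>R t"
  define u where "u = (1 / norm d) *\<^sub>R d"
  have t0: "t \<bullet> t \<noteq> 0" using dist(1) by (simp add: t_def)
  have dt: "d \<bullet> t = 0" using t0 by (simp add: d_def \<beta>_def inner_diff_left)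
  have d0: "d \<noteq> 0"
  proof
    assume "d = 0"
    then have "c = (1 - \<beta>) *\<^sub>R a + \<beta> *\<^sub>R b" by (simp add: d_def t_def algebra_simps)
    then have "c \<in> affine hull {a, b}" unfolding affine_hull_2 mem_Collect_eq by (intro exI[of _ "1 - \<beta>"] exI[of _ \<beta>]) simp
    moreover have "{a,b,c} - {c} = {a,b}" using dist by auto
    ultimately show False using ind unfolding affine_dependent_def by auto
  qed
  have cd: "c - a = norm d *\<^sub>R u + \<beta> *\<^sub>R t" using d0 by (simp add: u_def d_def)
  have u1: "norm u = 1" using d0 by (simp add: u_def)
  have ut: "u \<bullet> t = 0" using dt by (simp add: u_def)
  have uc: "u \<bullet> (c - a) = norm d" unfolding cd using ut u1 by (simp add: inner_add_right dot_square_norm)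
  let ?S = "{x - y | x y. x \<in> ?F \<and> y \<in> ?e}"
  have "a \<in> ?e" "b \<in> ?F" "c \<in> ?F" by (simp_all add: hull_inc)
  then have inS: "b - a \<in> ?S" "c - a \<in> ?S" unfolding mem_Collect_eq by blast+
  have e_repr: "\<exists>l. y = a + l *\<^sub>R t" if y: "y \<in> ?e" for y
  proof -
    obtain p q where pq: "y = p *\<^sub>R a + q *\<^sub>R b" "p + q = 1" using y unfolding convex_hull_2 mem_Collect_eq by blast
    have p: "p = 1 - q" using pq(2) by simp
    have "y = a + q *\<^sub>R t" unfolding pq(1) p t_def by (simp add: algebra_simps)
    then show ?thesis by blast
  qed
  have F_repr: "\<exists>l r. 0 \<le> r \<and> x = a + l *\<^sub>R t + r *\<^sub>R (c - a)" if x: "x \<in> ?F" for x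
  proof -
    obtain p q r where pqr: "0 \<le> r" "p + q + r = 1" "x = p *\<^sub>R a + q *\<^sub>R b + r *\<^sub>R c"
      using x unfolding convex_hull_3 mem_Collect_eq by blast
    have p: "p = 1 - q - r" using pqr(2) by simp
    have "x = a + q *\<^sub>R t + r *\<^sub>R (c - a)" unfolding pqr(3) p t_def by (simp add: algebra_simps)
    then show ?thesis using pqr(1) by blast
  qed
  have span: "?S \<subseteq> span {t, d}"
  proof
    fix z assume "z \<in> ?S"
    then obtain x y where xy: "z = x - y" "x \<in> ?F" "y \<in> ?e" by blast
    obtain l where l: "y = a + l *\<^sub>R t" using e_repr[OF xy(3)] by blast
    obtain l' r where r: "x = a + l' *\<^sub>R t + r *\<^sub>R (c - a)" using F_repr[OF xy(2)] by blast
    have "c - a = d + \<beta> *\<^sub>R t" by (simp add: d_def)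
    then have "z = (l' - l + r * \<beta>) *\<^sub>R t + r *\<^sub>R d" unfolding xy(1) l r by (simp add: algebra_simps)
    then show "z \<in> span {t, d}" by (simp add: span_add span_scale span_base)
  qed
  have ok: "norm u = 1 \<and> u \<in> span ?S \<and> (\<forall>p\<in>?e. \<forall>q\<in>?e. u \<bullet> (q - p) = 0) \<and> (\<forall>p\<in>?e. \<forall>x\<in>?F. u \<bullet> (x - p) \<ge> 0)"
  proof (intro conjI ballI)
    have "d \<in> span ?S" unfolding d_def t_def by (intro span_diff span_scale span_base inS)
    then show "u \<in> span ?S" unfolding u_def by (rule span_scale)
    show "u \<bullet> (q - p) = 0" if pq: "p \<in> ?e" "q \<in> ?e" for p q
    proof -
      obtain l l' where "p = a + l *\<^sub>R t" "q = a + l' *\<^sub>R t" using e_repr[OF pq(1)] e_repr[OF pq(2)] by blast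
      then show ?thesis using ut by (simp add: inner_diff_right inner_add_right)
    qed
    show "u \<bullet> (x - p) \<ge> 0" if px: "p \<in> ?e" "x \<in> ?F" for p x
    proof -
      obtain l where l: "p = a + l *\<^sub>R t" using e_repr[OF px(1)] by blast
      obtain l' r where r: "0 \<le> r" "x = a + l' *\<^sub>R t + r *\<^sub>R (c - a)" using F_repr[OF px(2)] by blast
      have "u \<bullet> (x - p) = r * norm d" unfolding l r(2) using ut uc by (simp add: inner_diff_right inner_add_right)
      then show ?thesis using r(1) by simp
    qed
  qed (rule u1)
  have uniq: "w = u"
    if w: "norm w = 1 \<and> w \<in> span ?S \<and> (\<forall>p\<in>?e. \<forall>q\<in>?e. w \<bullet> (q - p) = 0) \<and> (\<forall>p\<in>?e. \<forall>x\<in>?F. w \<bullet> (x - p) \<ge> 0)" for w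
  proof -
    have ae: "a \<in> ?e" "b \<in> ?e" "c \<in> ?F" by (simp_all add: hull_inc)
    have wt: "w \<bullet> t = 0" and wc: "w \<bullet> (c - a) \<ge> 0" using w ae unfolding t_def by blast+
    have "w \<in> span {t, d}" using w span_mono[OF span] unfolding span_span by blast
    then obtain p q where pq: "w - p *\<^sub>R t = q *\<^sub>R d" unfolding span_insert span_singleton by auto
    then have wpq: "w = p *\<^sub>R t + q *\<^sub>R d" by (simp add: algebra_simps)
    have "p * (t \<bullet> t) = 0" using wt dt unfolding wpq by (simp add: inner_add_left)
    then have wq: "w = q *\<^sub>R d" using t0 wpq by simp
    have "w \<bullet> (c - a) = q * (norm d)\<^sup>2"
      unfolding cd wq using dt d0 by (simp add: inner_add_right u_def dot_square_norm power2_eq_square)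
    then have "q \<ge> 0" using wc d0 by (simp add: zero_le_mult_iff)
    moreover have "\<bar>q\<bar> * norm d = 1" using w wq by simp
    ultimately have "q = 1 / norm d" using d0 by (simp add: field_simps)
    then show ?thesis using wq by (simp add: u_def)
  qed
  have "conormal ?e ?F = u"
    unfolding conormal_def by (rule the_equality, rule ok, rule uniq)
  moreover have "norm d > 0" using d0 by simp
  ultimately show ?thesis using u1 ut cd unfolding t_def by blast
qed

context mesh_domain
begin

text \<open>The face misses the open set \<Omega> but lies in the closure of the interior of its
  element, so all its points are frontier points.\<close>

lemma exposed_edge:
  assumes C: "C \<in> M" and F: "F \<in> faces C" and only: "\<And>C'. C' \<in> M \<Longrightarrow> F \<in> faces C' \<Longrightarrow> C' = C"
    and ab: "a \<in> F" "b \<in> F"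
  shows "\<not> interior_edge \<Omega> (convex hull {a, b})"
proof -
  interpret tetrahedron C using tet[OF C] .
  have aff: "affine hull (convex hull C) = UNIV"
    using affine_independent_span_eq[OF indep] card4 by simp
  have FC: "F \<subseteq> C" using F by (simp add: faces_def)
  have "convex hull {a, b} \<subseteq> convex hull F" by (rule hull_mono) (use ab in blast)
  moreover have "convex hull F \<subseteq> convex hull C" by (rule hull_mono[OF FC])
  moreover have "convex hull C \<subseteq> closure (interior (convex hull C))"
    using convex_closure_rel_interior[OF convex_convex_hull[of C]] closure_subset[of "convex hull C"]
    unfolding rel_interior_interior[OF aff] by simp
  moreover have "closure (interior (convex hull C)) \<subseteq> closure \<Omega>" by (rule closure_mono[OF tet_subset[OF C]])
  moreover have "convex hull F \<inter> \<Omega> = {}" by (rule exposed[OF C F only])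
  ultimately have "convex hull {a, b} \<subseteq> closure \<Omega> - \<Omega>" by blast
  then show ?thesis using interior_open[OF open_domain] by (simp add: interior_edge_def frontier_def)
qed

end

section \<open>Labelled edge patches of the triangulation\<close>

context rigid_mesh
begin

lemma fan_conormal:
  assumes ab: "a \<noteq> b" and f: "f \<in> edge_fan a b"
  defines "s \<equiv> conormal (convex hull {a, b}) (convex hull f)"
  shows "norm s = 1 \<and> s \<bullet> (b - a) = 0 \<and> (\<exists>\<alpha>>0. \<exists>\<beta>. apex a b f - a = \<alpha> *\<^sub>R s + \<beta> *\<^sub>R (b - a))"
proof -
  obtain C where C: "C \<in> M" "f \<in> faces C" using f unfolding all_faces_def by blast
  define c where "c = apex a b f"
  have fe: "f = {a, b, c}" and ne: "a \<noteq> c" "b \<noteq> c" unfolding c_def by (rule fan_face[OF ab f])+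
  have "\<not> affine_dependent f" using face_indep[OF C(1)] C(2) by (simp add: faces_def)
  then have "\<not> affine_dependent {a, b, c}" unfolding fe .
  from conormal_triangle[OF this ab ne] show ?thesis unfolding s_def c_def[symmetric] unfolding fe .
qed

text \<open>The labelling starts at 1 and speaks of convex hulls, whereas \<open>edge_patch\<close>
  starts at 0 and speaks of vertex sets: everything is shifted by one and pulled back along
  \<open>vertex_set\<close>. Both conclusions come from the same patch.\<close>

lemma edge_good:
  assumes ab: "a \<noteq> b" and F0: "F0 \<in> edge_fan a b" and G: "G \<in> edge_fan a b"
    and lab: "edge_patch_labelling elements \<Omega> (convex hull {a, b}) Kl Fl"
    and angles: "interior_edge \<Omega> (convex hull {a, b}) \<Longrightarrow> even (edge_number elements (convex hull {a, b})) \<Longrightarrow>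
      (\<forall>j\<in>{1..edge_number elements (convex hull {a, b})}. patch_angle elements (convex hull {a, b}) Fl j +
         patch_angle elements (convex hull {a, b}) Fl (j + 1) < pi) \<or>
      singular_edge elements \<Omega> (convex hull {a, b}) Fl"
  shows "\<not> interior_edge \<Omega> (convex hull {a, b}) \<Longrightarrow> good G" and "good F0 \<Longrightarrow> good G"
proof -
  define e where "e = convex hull {a, b}"
  define m where "m = edge_number elements e"
  define K where "K i = vertex_set (Kl (Suc i))" for i
  define F where "F i = vertex_set (Fl (Suc i))" for i
  define s where "s f = conormal e (convex hull f)" for f
  have lab_m: "bij_betw Kl {1..m} (edge_elements elements e)"
    "\<And>i. i \<in> {1..m} \<Longrightarrow> Fl i facet_of Kl i" "\<And>i. i \<in> {1..m} \<Longrightarrow> Fl (i + 1) facet_of Kl i"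
    and lab_int: "interior_edge \<Omega> e \<Longrightarrow> bij_betw Fl {1..m} (edge_faces elements e) \<and> Fl (m + 1) = Fl 1"
    and lab_bd: "\<not> interior_edge \<Omega> e \<Longrightarrow> bij_betw Fl {1..m + 1} (edge_faces elements e)"
    using lab unfolding edge_patch_labelling_def Let_def e_def[symmetric] m_def[symmetric] by (simp_all split: if_splits)
  obtain C0 where C0: "C0 \<in> M" "F0 \<in> faces C0" using F0 unfolding all_faces_def by blast
  have F0C: "F0 \<subseteq> C0" and a0: "a \<in> C0" and b0: "b \<in> C0" using C0(2) F0 by (auto simp: faces_def)
  have EK: "edge_elements elements e = (\<lambda>C. convex hull C) ` {C\<in>M. a \<in> C \<and> b \<in> C}"
    unfolding e_def by (rule edge_elements_eq[OF ab])
  have EF: "edge_faces elements e = (\<lambda>F. convex hull F) ` edge_fan a b"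
    unfolding e_def by (rule edge_faces_eq[OF ab C0(1) a0 b0])
  have vs: "vertex_set (convex hull f) = f" if f: "f \<in> edge_fan a b" for f
  proof -
    obtain C where C: "C \<in> M" "f \<in> faces C" using f unfolding all_faces_def by blast
    show ?thesis by (rule vertex_set_face[OF C(1)]) (use C(2) in \<open>simp add: faces_def\<close>)
  qed
  have K: "K i \<in> M \<and> a \<in> K i \<and> b \<in> K i \<and> Kl (Suc i) = convex hull (K i)" if i: "i < m" for i
  proof -
    have "Kl (Suc i) \<in> edge_elements elements e" using bij_betw_apply[OF lab_m(1), of "Suc i"] i by simp
    then obtain C where C: "C \<in> M" "a \<in> C" "b \<in> C" "Kl (Suc i) = convex hull C" unfolding EK by blast
    have "K i = C" unfolding K_def C(4) by (rule vertex_set_hull[OF C(1)])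
    then show ?thesis using C by simp
  qed
  have K_all: "\<exists>i<m. C = K i" if C: "C \<in> M" "a \<in> C" "b \<in> C" for C
  proof -
    have "convex hull C \<in> edge_elements elements e" unfolding EK using C by blast
    then have "convex hull C \<in> Kl ` {1..m}" unfolding bij_betw_imp_surj_on[OF lab_m(1)] .
    then obtain j where j: "j \<in> {1..m}" "convex hull C = Kl j" by (rule imageE)
    then have "C = K (j - 1)" using vertex_set_hull[OF C(1)] by (simp add: K_def)
    moreover have "j - 1 < m" using j(1) by auto
    ultimately show ?thesis by blast
  qed
  have m_pos: "m > 0" using K_all[OF C0(1) a0 b0] by auto
  have K_inj: "inj_on K {..<m}"
  proof (rule inj_onI)
    fix i j assume ij: "i \<in> {..<m}" "j \<in> {..<m}" "K i = K j"
    then have "Kl (Suc i) = Kl (Suc j)" using K[of i] K[of j] by simp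
    then show "i = j" using inj_onD[OF bij_betw_imp_inj_on[OF lab_m(1)], of "Suc i" "Suc j"] ij(1,2) by simp
  qed
  have gen: "edge_fan a b = F ` {..<n}" "inj_on F {..<n}" "\<And>i. i < n \<Longrightarrow> F i \<in> edge_fan a b \<and> Fl (Suc i) = convex hull (F i)"
    if bij: "bij_betw Fl {1..n} (edge_faces elements e)" for n
  proof -
    show fi: "F i \<in> edge_fan a b \<and> Fl (Suc i) = convex hull (F i)" if i: "i < n" for i
    proof -
      have "Fl (Suc i) \<in> edge_faces elements e" using bij_betw_apply[OF bij, of "Suc i"] i by simp
      then obtain f where f: "f \<in> edge_fan a b" "Fl (Suc i) = convex hull f" unfolding EF by (rule imageE)
      have "F i = f" unfolding F_def f(2) by (rule vs[OF f(1)])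
      then show ?thesis using f by simp
    qed
    show "inj_on F {..<n}"
    proof (rule inj_onI)
      fix i j assume ij: "i \<in> {..<n}" "j \<in> {..<n}" "F i = F j"
      then have "Fl (Suc i) = Fl (Suc j)" using fi[of i] fi[of j] by simp
      then show "i = j" using inj_onD[OF bij_betw_imp_inj_on[OF bij], of "Suc i" "Suc j"] ij(1,2) by simp
    qed
    have "f \<in> F ` {..<n}" if f: "f \<in> edge_fan a b" for f
    proof -
      have "convex hull f \<in> edge_faces elements e" unfolding EF by (rule imageI[OF f])
      then have "convex hull f \<in> Fl ` {1..n}" unfolding bij_betw_imp_surj_on[OF bij] .
      then obtain j where j: "j \<in> {1..n}" "convex hull f = Fl j" by (rule imageE)
      then have "f = F (j - 1)" using vs[OF f] by (simp add: F_def)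
      moreover have "j - 1 < n" using j(1) by auto
      ultimately show ?thesis by blast
    qed
    then show "edge_fan a b = F ` {..<n}" using fi by blast
  qed
  \<comment> \<open>An element has two faces at the edge. This rules out m = 1 at an interior edge,
    where consecutive faces would coincide.\<close>
  have fan2: "\<exists>f g. f \<in> edge_fan a b \<and> g \<in> edge_fan a b \<and> f \<noteq> g"
  proof -
    have c4: "card C0 = 4" by (rule card4M[OF C0(1)])
    then have "finite C0" by (metis card.infinite zero_neq_numeral)
    then have "card (C0 - {a, b}) = 2" using c4 a0 b0 ab by (simp add: card_Diff_subset)
    then obtain c d where cd: "C0 - {a, b} = {c, d}" "c \<noteq> d" by (auto simp: card_2_iff)
    then have mem: "c \<in> C0" "d \<in> C0" "c \<noteq> a" "c \<noteq> b" "d \<noteq> a" "d \<noteq> b" by blast+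
    have "{a, b, c} \<in> faces C0" "{a, b, d} \<in> faces C0" using mem a0 b0 ab by (simp_all add: faces_def)
    then have "{a, b, c} \<in> edge_fan a b" "{a, b, d} \<in> edge_fan a b" unfolding all_faces_def using C0(1) by blast+
    moreover have "{a, b, c} \<noteq> {a, b, d}" using cd(2) mem by blast
    ultimately show ?thesis by blast
  qed
  have F: "F i \<in> edge_fan a b \<and> Fl (Suc i) = convex hull (F i)" if i: "i \<le> m" for i
  proof (cases "interior_edge \<Omega> e")
    case True
    note bij = conjunct1[OF lab_int[OF True]] and closed = conjunct2[OF lab_int[OF True]]
    show ?thesis
    proof (cases "i < m")
      case False
      then have "Fl (Suc i) = Fl (Suc 0)" "F i = F 0" using i closed by (simp_all add: F_def)
      then show ?thesis using gen(3)[OF bij m_pos] by simp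
    qed (rule gen(3)[OF bij])
  qed (rule gen(3)[OF lab_bd], use i in simp_all)
  have F_ne: "F i \<noteq> F (Suc i)" if i: "i < m" for i
  proof (cases "interior_edge \<Omega> e")
    case True
    note bij = conjunct1[OF lab_int[OF True]] and closed = conjunct2[OF lab_int[OF True]]
    have inj: "F x \<noteq> F y" if "x < m" "y < m" "x \<noteq> y" for x y using inj_onD[OF gen(2)[OF bij], of x y] that by auto
    have "m \<noteq> 1"
    proof
      assume "m = 1"
      have one: "f = F 0" if "f \<in> edge_fan a b" for f
        using that unfolding gen(1)[OF bij] \<open>m = 1\<close> by auto
      obtain f g where "f \<in> edge_fan a b" "g \<in> edge_fan a b" "f \<noteq> g" using fan2 by blast
      then show False using one[of f] one[of g] by (simp del: mem_Collect_eq)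
    qed
    then have m2: "1 < m" using m_pos by simp
    show ?thesis
    proof (cases "Suc i < m")
      case True
      then show ?thesis using inj i by simp
    next
      case False
      then have "F (Suc i) = F 0" and "i \<noteq> 0" using i m2 closed by (auto simp: F_def dest: less_antisym)
      then show ?thesis using inj[of i 0] i m_pos by simp
    qed
  next
    case False
    then show ?thesis using inj_onD[OF gen(2)[OF lab_bd[OF False]], of i "Suc i"] i by auto
  qed
  have facet: "F j \<in> faces (K i)" if i: "i < m" "j \<le> m" "Fl (Suc j) facet_of Kl (Suc i)" for i j
  proof -
    have "K i \<in> M" "Kl (Suc i) = convex hull (K i)" using K[OF i(1)] by blast+
    then obtain f where f: "f \<in> faces (K i)" "Fl (Suc j) = convex hull f" using i(3) facet_iff by metis
    have "F j = f" unfolding F_def f(2) by (rule vertex_set_face[OF \<open>K i \<in> M\<close>]) (use f(1) in \<open>simp add: faces_def\<close>)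
    then show ?thesis using f(1) by simp
  qed
  interpret P: edge_patch M \<Omega> k W a b m K F s
  proof
    show "a \<noteq> b" "0 < m" "inj_on K {..<m}" by (rule ab m_pos K_inj)+
    show "K i \<in> M" if "i < m" for i using K[OF that] by blast
    show "\<exists>i<m. C = K i" if "C \<in> M" "a \<in> C" "b \<in> C" for C by (rule K_all[OF that])
    show "F i \<in> faces (K i)" if "i < m" for i using facet[of i i] lab_m(2)[of "Suc i"] that by simp
    show "F (Suc i) \<in> faces (K i)" if "i < m" for i using facet[of i "Suc i"] lab_m(3)[of "Suc i"] that by simp
    show "F i \<noteq> F (Suc i)" if "i < m" for i by (rule F_ne[OF that])
    show "a \<in> F i" "b \<in> F i" if "i \<le> m" for i using F[OF that] by blast+
    show "norm (s f) = 1 \<and> s f \<bullet> (b - a) = 0 \<and> (\<exists>\<alpha>>0. \<exists>\<beta>. apex a b f - a = \<alpha> *\<^sub>R s f + \<beta> *\<^sub>R (b - a))"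
      if "f \<in> edge_fan a b" for f unfolding s_def e_def by (rule fan_conormal[OF ab that])
  qed
  have pa: "patch_angle elements e Fl (Suc i) = P.\<theta> i" if i: "i < m" for i
    using F[of i] F[of "Suc i"] i
    unfolding patch_angle_def Let_def m_def[symmetric] dihedral_angle_def P.\<gamma>_def s_def by simp
  \<comment> \<open>\<open>patch_angle\<close> reduces the index m + 1 to 1. The sum at j in (M2) is
    therefore the sum at the 0-based position j and its cyclic predecessor, with j = m standing for
    position 0.\<close>
  have pam: "patch_angle elements e Fl (Suc m) = P.\<theta> 0"
    using pa[OF m_pos] m_pos unfolding patch_angle_def Let_def m_def[symmetric] by simp
  show bd: "good G" if "\<not> interior_edge \<Omega> (convex hull {a, b})"
  proof (rule P.boundary_good)
    have bij: "bij_betw Fl {1..Suc m} (edge_faces elements e)" using lab_bd that by (simp add: e_def)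
    show "edge_fan a b = F ` {..m}" "inj_on F {..m}" using gen(1,2)[OF bij] by (simp_all only: lessThan_Suc_atMost)
  qed (rule G)
  show "good G" if F0g: "good F0"
  proof (cases "interior_edge \<Omega> e")
    case True
    note bij = conjunct1[OF lab_int[OF True]] and closed = conjunct2[OF lab_int[OF True]]
    have ang: "(\<forall>i<m. P.\<theta> (cyclic_pred m i) + P.\<theta> i < pi) \<or> (m = 4 \<and> P.\<theta> 0 + P.\<theta> 1 = pi \<and> P.\<theta> 1 + P.\<theta> 2 = pi)"
      if ev: "even m"
    proof (cases "singular_edge elements \<Omega> e Fl")
      case True
      then have "m = 4" "patch_angle elements e Fl 1 + patch_angle elements e Fl 2 = pi"
        "patch_angle elements e Fl 2 + patch_angle elements e Fl 3 = pi"
        unfolding singular_edge_def m_def by blast+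
      then show ?thesis using pa[of 0] pa[of 1] pa[of 2] by (simp add: eval_nat_numeral)
    next
      case False
      have sum: "patch_angle elements e Fl j + patch_angle elements e Fl (Suc j) < pi" if "j \<in> {1..m}" for j
        using angles[folded e_def, folded m_def, OF True ev] False that by simp
      have "P.\<theta> (cyclic_pred m i) + P.\<theta> i < pi" if i: "i < m" for i
      proof (cases i)
        case 0
        then show ?thesis using sum[of m] pa[of "m - 1"] pam m_pos by (simp add: cyclic_pred_def)
      next
        case (Suc j)
        then show ?thesis using sum[of i] pa[of j] pa[of i] i by (simp add: cyclic_pred_def)
      qed
      then show ?thesis by blast
    qed
    have "F m = F 0" using closed by (simp add: F_def)
    from P.interior_good[OF gen(1,2)[OF bij] this ang F0 F0g G] show ?thesis .
  next
    case False
    then show ?thesis using bd by (simp add: e_def)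
  qed
qed

end

context mesh_domain
begin

lemma orthogonal_zero:
  assumes lab: "\<And>e. e \<in> mesh_edges elements \<Longrightarrow> edge_patch_labelling elements \<Omega> e (Kl e) (Fl e)"
    and angles: "\<And>e. e \<in> mesh_edges elements \<Longrightarrow> interior_edge \<Omega> e \<Longrightarrow> even (edge_number elements e) \<Longrightarrow>
      (\<forall>j\<in>{1..edge_number elements e}. patch_angle elements e (Fl e) j + patch_angle elements e (Fl e) (j + 1) < pi) \<or>
      singular_edge elements \<Omega> e (Fl e)"
    and p: "\<And>C. C \<in> M \<Longrightarrow> p C \<in> polys 2 UNIV" and orth: "orthogonal_to_div p" and C: "C \<in> M"
  shows "p C x = 0"
proof -
  have "\<forall>C. \<exists>k W. C \<in> M \<longrightarrow> transpose W = - W \<and> p C = (\<lambda>x. k + W *v x)"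
    using orthogonal_rigid[OF orth p] by metis
  then obtain k W where kW: "\<And>C. C \<in> M \<Longrightarrow> transpose (W C) = - W C" "\<And>C. C \<in> M \<Longrightarrow> p C = (\<lambda>x. k C + W C *v x)"
    by metis
  have "orthogonal_to_div (\<lambda>C x. k C + W C *v x)"
    using orth unfolding orthogonal_to_div_def by (simp add: kW(2) cong: sum.cong)
  then interpret R: rigid_mesh M \<Omega> k W by unfold_locales (rule kW(1))
  have edge: "convex hull {a, b} \<in> mesh_edges elements" if ab: "a \<noteq> b" and F: "F \<in> R.edge_fan a b" for a b F
  proof -
    obtain C where C: "C \<in> M" "F \<in> faces C" using F unfolding all_faces_def by blast
    then have "(convex hull {a, b}) edge_of (convex hull C)"
      using F seg_edge[OF ab C(1)] by (auto simp: faces_def)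
    then show ?thesis unfolding mesh_edges_def using C(1) by blast
  qed
  have "k C + W C *v x = 0"
  proof (rule R.all_zero[OF _ _ C])
    fix a b F G assume ab: "a \<noteq> b" and FG: "F \<in> R.edge_fan a b" "G \<in> R.edge_fan a b" and g: "R.good F"
    note e = edge[OF ab FG(1)]
    show "R.good G" by (rule R.edge_good(2)[OF ab FG lab[OF e] angles[OF e] g])
  next
    fix C F assume CF: "C \<in> M" "F \<in> faces C" and only: "\<And>C'. C' \<in> M \<Longrightarrow> F \<in> faces C' \<Longrightarrow> C' = C"
    have "card F = 3" using CF(2) by (simp add: faces_def)
    then obtain a b c where abc: "F = {a, b, c}" "a \<noteq> b" unfolding card_3_iff by blast
    have mem: "a \<in> F" "b \<in> F" unfolding abc(1) by simp_all
    have fan: "F \<in> R.edge_fan a b" using mem CF unfolding all_faces_def by blast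
    note e = edge[OF abc(2) fan]
    show "R.good F"
      by (rule R.edge_good(1)[OF abc(2) fan fan lab[OF e] angles[OF e] exposed_edge[OF CF only mem]])
  qed
  then show ?thesis by (simp add: kW(2)[OF C])
qed

end

theorem theorem3p5:
  fixes \<Omega> :: "(real^3) set" and T :: "(real^3) set set" and \<sigma> \<kappa> :: real
    and Kl Fl :: "(real^3) set \<Rightarrow> nat \<Rightarrow> (real^3) set"
  assumes "polyhedral_domain \<Omega>" and "simply_connected \<Omega>"
    and "tet_mesh T \<Omega>" and "shape_regular \<sigma> T"
    and "\<And>e. e \<in> mesh_edges T \<Longrightarrow> edge_patch_labelling T \<Omega> e (Kl e) (Fl e)"
    and "\<kappa> > 0"
    and "mesh_condition_M1 \<kappa> T Fl"
    and "mesh_condition_M2 \<kappa> T \<Omega> Fl"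
  shows "(INF v\<in>{v\<in>V_h T \<Omega>. nonzero_on \<Omega> v}.
           SUP \<tau>\<in>{\<tau>\<in>Sigma_h T \<Omega>. nonzero_on \<Omega> \<tau>}.
             ereal ((\<integral>x. weak_div \<Omega> \<tau> x \<bullet> v x \<partial>lebesgue_on \<Omega>) / (L2_norm \<Omega> v * Hdiv_norm \<Omega> \<tau>))) > 0"
proof -
  interpret mesh_domain "element_vertices T" \<Omega> by (rule polyhedral_mesh_domain[OF assms(1,3)])
  have T: "elements = T" by (rule tet_mesh_elements(1)[OF assms(3), symmetric])
  \<comment> \<open>Dropping the margin \<kappa> > 0 leaves the strict bound by \<open>pi\<close>,
    which is what makes the sine in \<open>cot_sum\<close> positive.\<close>
  have "(\<forall>j\<in>{1..edge_number T e}. patch_angle T e (Fl e) j + patch_angle T e (Fl e) (j + 1) < pi) \<or> singular_edge T \<Omega> e (Fl e)"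
    if e: "e \<in> mesh_edges T" "interior_edge \<Omega> e" "even (edge_number T e)" for e
  proof (cases "singular_edge T \<Omega> e (Fl e)")
    case False
    then have "\<forall>j\<in>{1..edge_number T e}. patch_angle T e (Fl e) j + patch_angle T e (Fl e) (j + 1) < pi - \<kappa>"
      using assms(8) e unfolding mesh_condition_M2_def by blast
    then show ?thesis using assms(6) by fastforce
  qed blast
  then have "\<exists>\<delta>>0. \<forall>v\<in>V_h elements \<Omega>. nonzero_on \<Omega> v \<longrightarrow> (\<exists>\<tau>\<in>Sigma_h elements \<Omega>. nonzero_on \<Omega> \<tau> \<and>
      \<delta> \<le> (\<integral>x. weak_div \<Omega> \<tau> x \<bullet> v x \<partial>lebesgue_on \<Omega>) / (L2_norm \<Omega> v * Hdiv_norm \<Omega> \<tau>))"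
    using assms(5) by (intro inf_sup_of_injectivity orthogonal_zero[of Kl Fl]) (simp_all only: T)
  then obtain \<delta> where \<delta>: "\<delta> > 0" "\<And>v. v \<in> V_h T \<Omega> \<Longrightarrow> nonzero_on \<Omega> v \<Longrightarrow> \<exists>\<tau>\<in>Sigma_h T \<Omega>. nonzero_on \<Omega> \<tau> \<and>
      \<delta> \<le> (\<integral>x. weak_div \<Omega> \<tau> x \<bullet> v x \<partial>lebesgue_on \<Omega>) / (L2_norm \<Omega> v * Hdiv_norm \<Omega> \<tau>)"
    unfolding T by blast
  have "ereal \<delta> \<le> (INF v\<in>{v\<in>V_h T \<Omega>. nonzero_on \<Omega> v}. SUP \<tau>\<in>{\<tau>\<in>Sigma_h T \<Omega>. nonzero_on \<Omega> \<tau>}.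
      ereal ((\<integral>x. weak_div \<Omega> \<tau> x \<bullet> v x \<partial>lebesgue_on \<Omega>) / (L2_norm \<Omega> v * Hdiv_norm \<Omega> \<tau>)))"
  proof (rule INF_greatest)
    fix v assume "v \<in> {v\<in>V_h T \<Omega>. nonzero_on \<Omega> v}"
    then obtain \<tau> where \<tau>: "\<tau> \<in> {\<tau>\<in>Sigma_h T \<Omega>. nonzero_on \<Omega> \<tau>}"
      "\<delta> \<le> (\<integral>x. weak_div \<Omega> \<tau> x \<bullet> v x \<partial>lebesgue_on \<Omega>) / (L2_norm \<Omega> v * Hdiv_norm \<Omega> \<tau>)"
      using \<delta>(2) by blast
    show "ereal \<delta> \<le> (SUP \<tau>\<in>{\<tau>\<in>Sigma_h T \<Omega>. nonzero_on \<Omega> \<tau>}.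
        ereal ((\<integral>x. weak_div \<Omega> \<tau> x \<bullet> v x \<partial>lebesgue_on \<Omega>) / (L2_norm \<Omega> v * Hdiv_norm \<Omega> \<tau>)))"
      by (rule SUP_upper2[OF \<tau>(1)]) (use \<tau>(2) in simp)
  qed
  then show ?thesis using \<delta>(1) by (simp add: less_le_trans[of 0 "ereal \<delta>"])
qed

end
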